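(* Let $\lambda\in\mathfrak h^*$. For all $f_1,f_2\in F[0]^{K_\lambda+\widetilde K_\lambda}$ we have $$f_1\star_\lambda f_2=\mu\left(\overrightarrow{J^{\mathrm{red}}(\lambda)}(f_1\otimes f_2)\right),$$ where $\mu$ is the multiplication of $F$, $\star_\lambda$ is the product transported by $\Theta$ from $\operatorname{Hom}_U(L(\lambda),L(\lambda)\otimes F)$, and $J^{\mathrm{red}}(\lambda)$ is the reduced fusion element (both defined in the context).
   Context: Let $\Bbbk$ be the field obtained from $\mathbb C(q)$ by adjoining all fractional powers $q^{1/n}$, $n\in\mathbb N=\{1,2,3,\dots\}$. Let $(a_{ij})$ be an $r\times r$ Cartan matrix of finite type with realization $(\mathfrak h,\Pi,\Pi^\vee)$ over $\mathbb Q$: $\Pi=\{\alpha_1,\dots,\alpha_r\}\subset\mathfrak h^*$ are the simple roots, $\Pi^\vee=\{\alpha_1^\vee,\dots,\alpha_r^\vee\}\subset\mathfrak h$ the simple coroots, $a_{ij}=\langle\alpha_j,\alpha_i^\vee\rangle$; $u_1,\dots,u_r\in\mathfrak h$ are the simple coweights, $\langle\alpha_i,u_j\rangle=\delta_{ij}$. Let $(\cdot|\cdot)$ be the invariant scalar product on $\mathfrak h^*$ with $(\alpha|\alpha)=2$ for short roots, $d_i=(\alpha_i|\alpha_i)/2$ (so $d_ia_{ij}=d_ja_{ji}$), $[k]_i=\frac{q^{kd_i}-q^{-kd_i}}{q^{d_i}-q^{-d_i}}$, $[k]_i!=[1]_i\cdots[k]_i$. Let $Q_+=\sum_i\mathbb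 Z_{\ge0}\alpha_i$, and $\lambda\ge\mu$ iff $\lambda-\mu\in Q_+$. $U=\check U_q\mathfrak g$ is the $\Bbbk$-algebra generated by $t_i^{\pm1},e_i,f_i$ ($1\le i\le r$) with the $t_i$ commuting and: $t_ie_jt_i^{-1}=q^{d_i\delta_{ij}}e_j$, $t_if_jt_i^{-1}=q^{-d_i\delta_{ij}}f_j$, $e_if_j-f_je_i=\delta_{ij}\frac{k_i-k_i^{-1}}{q^{d_i}-q^{-d_i}}$ with $k_i=\prod_jt_j^{a_{ji}}$, and for $i\ne j$ the Serre relations $\sum_{m=0}^{1-a_{ij}}\frac{(-1)^m}{[m]_i!\,[1-a_{ij}-m]_i!}e_i^me_je_i^{1-a_{ij}-m}=0$ and the same with $f$ in place of $e$. It is a Hopf algebra: $\Delta(t_i)=t_i\otimes t_i$, $\Delta(e_i)=e_i\otimes1+k_i\otimes e_i$, $\Delta(f_i)=f_i\otimes k_i^{-1}+1\otimes f_i$; $\varepsilon(t_i)=1$, $\varepsilon(e_i)=\varepsilon(f_i)=0$; antipode $\sigma(t_i)=t_i^{-1}$, $\sigma(e_i)=-k_i^{-1}e_i$, $\sigma(f_i)=-f_ik_i$. $U^0,U^+,U^-$ are the subalgebras generated by the $t_i^{\pm1}$, the $e_i$, the $f_i$; $U=U^-U^0U^+$. $T$ is the group generated by the $t_i$. $\theta$ is the involutive algebra automorphism with $\theta(e_i)=-f_i$, $\theta(f_i)=-e_i$, $\theta(t_i)=t_i^{-1}$, and $\omega=\sigma\theta$. Each $\lambda\in\mathfrak h^*$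 defines the character $q^\lambda:U^0\to\Bbbk$, $t_i\mapsto q^{d_i\langle\lambda,u_i\rangle}$. For a $U$-module $V$, $V[\mu]=\{v: tv=q^\mu(t)v\ \forall t\in T\}$; $U^-[-\beta]$ is the span of $y\in U^-$ with $tyt^{-1}=q^{-\beta}(t)y$. $M(\lambda)$ is the Verma module with highest weight vector $\mathbf 1_\lambda$ ($e_i\mathbf 1_\lambda=0$, $t\mathbf 1_\lambda=q^\lambda(t)\mathbf 1_\lambda$), free over $U^-$ on $\mathbf 1_\lambda$. With $U^\pm_+=\ker\varepsilon|_{U^\pm}$, let $x\mapsto(x)_0$ be the projection $U\to U^0$ along $U^-_+U+UU^+_+$. Put $\pi_\lambda(x\otimes y)=q^\lambda((\sigma(x)y)_0)$ for $x\in U^+$, $y\in U^-$, and $\mathbb S_\lambda(x\otimes y)=\pi_\lambda(\theta(x)\otimes y)=q^\lambda((\omega(x)y)_0)$ for $x,y\in U^-$ (Shapovalov form). $K_\lambda=\{y\in U^-:\pi_\lambda(x\otimes y)=0\ \forall x\in U^+\}$ (the kernel of $\mathbb S_\lambda$), $\widetilde K_\lambda=\{x\in U^+:\pi_\lambda(x\otimes y)=0\ \forall y\in U^-\}=\theta(K_\lambda)$. $L(\lambda)=M(\lambda)/K_\lambda\mathbf 1_\lambda$ is the irreducible module of highest weight $\lambda$, and $\overline{\mathbf 1}_\lambda$ is the image of $\mathbf 1_\lambda$. $\mathbb S_\lambda$, viewed on $M(\lambda)\cong U^-$, induces a nondegenerate form $\overline{\mathbb S}_\lambda$ on $L(\lambda)$;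 $\overline{\mathbb S}_\lambda^\beta$ is its restriction to $L(\lambda)[\lambda-\beta]$. $F=\Bbbk[G]_q$ is the quantized algebra of regular functions on the connected simply connected group $G$ with Cartan matrix $(a_{ij})$: the Hopf subalgebra of the dual Hopf algebra of $U$ spanned by matrix elements of the finite-dimensional modules $L(\mu)$, $\mu$ dominant integral. Left regular action: $(\overrightarrow{a}f)(x)=f(xa)$. $F[0]$ is the zero weight space for it, and $F[0]^{K_\lambda+\widetilde K_\lambda}$ is the set of $f\in F[0]$ annihilated (via $\overrightarrow{\ \cdot\ }$) by both $K_\lambda$ and $\widetilde K_\lambda$. With $F$ carrying the left regular action, $\operatorname{Hom}_U(L(\lambda),L(\lambda)\otimes F)$ is a unital associative algebra under $\varphi*\psi=(\mathrm{id}\otimes\mu)\circ(\varphi\otimes\mathrm{id})\circ\psi$. The map $\Theta:\operatorname{Hom}_U(L(\lambda),L(\lambda)\otimes F)\to F[0]^{K_\lambda+\widetilde K_\lambda}$, $\varphi\mapsto f_\varphi$, where $\varphi(\overline{\mathbf 1}_\lambda)\in\overline{\mathbf 1}_\lambda\otimes f_\varphi+\bigoplus_{\mu<\lambda}L(\lambda)[\mu]\otimes F$, is a linear isomorphism, and $f_1\star_\lambda f_2:=\Theta(\Theta^{-1}(f_1)*\Theta^{-1}(f_2))$. For each $\beta\in Q_+$ choose $y_\beta^i\in U^-[-\beta]$ such that the $y_\beta^i\overline{\mathbf 1}_\lambda$ form a basis of $L(\lambda)[\lambda-\beta]$ (with $y_0=1$). Put $J^{\mathrm{red}}(\lambda)=\sum_{\beta\in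 Q_+}\sum_{i,j}\bigl(\overline{\mathbb S}_\lambda^\beta\bigr)^{-1}_{ij}\,y_\beta^i\otimes\theta(y_\beta^j)$, an element of a completion of $U^-\otimes U^+$, where $(\overline{\mathbb S}_\lambda^\beta)_{ij}=\overline{\mathbb S}_\lambda(y_\beta^i\overline{\mathbf 1}_\lambda,y_\beta^j\overline{\mathbf 1}_\lambda)$. It depends on the choices, but the claim holds for any choice. $\overrightarrow{J^{\mathrm{red}}(\lambda)}$ denotes its action on $F\otimes F$ by the left regular action in each factor (only finitely many terms act nontrivially on a given element). *)

theory Defs
  imports
    Complex_Main
    "HOL-Library.Poly_Mapping"
    "HOL-Computational_Algebra.Fraction_Field"
    "HOL-Analysis.Finite_Cartesian_Product"
begin

section \<open>The ground field\<close>

text \<open>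
  The group algebra of the additive group of rational numbers over the complex numbers is the
  union of the Laurent polynomial rings in \<open>q\<^bsup>1/n\<^esup>\<close>; its fraction field is the field obtained
  from \<open>\<complex>(q)\<close> by adjoining all \<open>q\<^bsup>1/n\<^esup>\<close>.
\<close>

type_synonym qfield = "(rat \<Rightarrow>\<^sub>0 complex) fract"

definition qpow :: "rat \<Rightarrow> qfield" where
  "qpow s = Fraction_Field.Fract (Poly_Mapping.single s 1) 1"

class qspace = ab_group_add +
  fixes scaleq :: "qfield \<Rightarrow> 'a \<Rightarrow> 'a"  (infixr \<open>*\<^sub>q\<close> 75)
  assumes scaleq_add_right: "c *\<^sub>q (x + y) = c *\<^sub>q x + c *\<^sub>q y"
    and scaleq_add_left: "(c + d) *\<^sub>q x = c *\<^sub>q x + d *\<^sub>q x"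
    and scaleq_scaleq: "c *\<^sub>q (d *\<^sub>q x) = (c * d) *\<^sub>q x"
    and scaleq_one: "1 *\<^sub>q x = x"

class qalgebra = qspace + ring_1 +
  assumes scaleq_mult_left: "(c *\<^sub>q x) * y = c *\<^sub>q (x * y)"
    and scaleq_mult_right: "x * (c *\<^sub>q y) = c *\<^sub>q (x * y)"

global_interpretation qs: vector_space "scaleq :: qfield \<Rightarrow> 'a \<Rightarrow> 'a::qspace"
  by unfold_locales (fact scaleq_add_right scaleq_add_left scaleq_scaleq scaleq_one)+

abbreviation qlinear :: "('a::qspace \<Rightarrow> 'b::qspace) \<Rightarrow> bool" where
  "qlinear \<equiv> Vector_Spaces.linear scaleq scaleq"

abbreviation qfunctional :: "('a::qspace \<Rightarrow> qfield) \<Rightarrow> bool" where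
  "qfunctional \<equiv> Vector_Spaces.linear scaleq (*)"

lemma vector_space_qfield: "vector_space ((*) :: qfield \<Rightarrow> qfield \<Rightarrow> qfield)"
  by unfold_locales (simp_all add: algebra_simps)


text \<open>Lifting should treat \<^typ>\<open>qfield\<close> and \<^typ>\<open>'x \<Rightarrow>\<^sub>0 qfield\<close> as opaque.\<close>

lifting_forget fract.lifting
lifting_forget poly_mapping.lifting


section \<open>Dual spaces\<close>

typedef (overloaded) 'a dual = "{f :: 'a::qspace \<Rightarrow> qfield. qfunctional f}"
  morphisms eval_dual Dual
proof
  show "(\<lambda>_. 0) \<in> {f :: 'a \<Rightarrow> qfield. qfunctional f}"
    using qs.vector_space_axioms[where 'a = 'a] vector_space_qfield
    by (auto simp: Vector_Spaces.linear_iff)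
qed

setup_lifting type_definition_dual

instantiation dual :: (qspace) qspace
begin

lift_definition zero_dual :: "'a dual" is "\<lambda>_. 0"
  by (auto simp: Vector_Spaces.linear_iff qs.vector_space_axioms vector_space_qfield)
lift_definition plus_dual :: "'a dual \<Rightarrow> 'a dual \<Rightarrow> 'a dual" is "\<lambda>f g x. f x + g x"
  by (auto simp: Vector_Spaces.linear_iff algebra_simps)
lift_definition minus_dual :: "'a dual \<Rightarrow> 'a dual \<Rightarrow> 'a dual" is "\<lambda>f g x. f x - g x"
  by (auto simp: Vector_Spaces.linear_iff algebra_simps)
lift_definition uminus_dual :: "'a dual \<Rightarrow> 'a dual" is "\<lambda>f x. - f x"
  by (auto simp: Vector_Spaces.linear_iff algebra_simps)
lift_definition scaleq_dual :: "qfield \<Rightarrow> 'a dual \<Rightarrow> 'a dual" is "\<lambda>c f x. c * f x"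
  by (auto simp: Vector_Spaces.linear_iff algebra_simps)

instance
  by standard (transfer; force simp: algebra_simps)+

end


section \<open>Tensor products\<close>

abbreviation pm_scale :: "qfield \<Rightarrow> ('x \<Rightarrow>\<^sub>0 qfield) \<Rightarrow> 'x \<Rightarrow>\<^sub>0 qfield" where
  "pm_scale c \<equiv> Poly_Mapping.map ((*) c)"

lemma lookup_pm_scale: "Poly_Mapping.lookup (pm_scale c p) x = c * Poly_Mapping.lookup p x"
  by (simp add: Poly_Mapping.map.rep_eq when_def)

global_interpretation pms: vector_space "pm_scale :: qfield \<Rightarrow> ('x \<Rightarrow>\<^sub>0 qfield) \<Rightarrow> _"
  by unfold_locales
    (rule poly_mapping_eqI; simp add: lookup_add lookup_pm_scale algebra_simps del: lookup_not_eq_zero_eq_in_keys)+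

definition tensor_relations :: "('a::qspace \<times> 'b::qspace \<Rightarrow>\<^sub>0 qfield) set" where
  "tensor_relations =
     (let T = (\<lambda>a b. Poly_Mapping.single (a, b) (1::qfield)) in
       {T (a + a') b - T a b - T a' b | a a' b. True}
       \<union> {T a (b + b') - T a b - T a b' | a b b'. True}
       \<union> {T (c *\<^sub>q a) b - pm_scale c (T a b) | c a b. True}
       \<union> {T a (c *\<^sub>q b) - pm_scale c (T a b) | c a b. True})"

quotient_type (overloaded) ('a, 'b) tensor = "('a::qspace \<times> 'b::qspace) \<Rightarrow>\<^sub>0 qfield" /
  "\<lambda>p r. p - r \<in> pms.span tensor_relations"
proof (rule equivpI)
  let ?S = "pms.span (tensor_relations :: ('a \<times> 'b \<Rightarrow>\<^sub>0 qfield) set)"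
  show "reflp (\<lambda>p r. p - r \<in> ?S)"
    by (rule reflpI) (simp add: pms.span_zero)
  show "symp (\<lambda>p r. p - r \<in> ?S)"
    using pms.span_neg by (intro sympI) fastforce
  show "transp (\<lambda>p r. p - r \<in> ?S)"
  proof (rule transpI)
    fix x y z assume "x - y \<in> ?S" "y - z \<in> ?S"
    from pms.span_add[OF this] show "x - z \<in> ?S" by simp
  qed
qed

instantiation tensor :: (qspace, qspace) qspace
begin

lift_definition zero_tensor :: "('a, 'b) tensor" is 0 .
lift_definition plus_tensor :: "('a, 'b) tensor \<Rightarrow> ('a, 'b) tensor \<Rightarrow> ('a, 'b) tensor" is "(+)"
  subgoal for p r p' r' using pms.span_add[of "p - r" _ "p' - r'"] by (simp add: algebra_simps)
  done
lift_definition minus_tensor :: "('a, 'b) tensor \<Rightarrow> ('a, 'b) tensor \<Rightarrow> ('a, 'b) tensor" is "(-)"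
  subgoal for p r p' r' using pms.span_diff[of "p - r" _ "p' - r'"] by (simp add: algebra_simps)
  done
lift_definition uminus_tensor :: "('a, 'b) tensor \<Rightarrow> ('a, 'b) tensor" is uminus
  subgoal for p r using pms.span_neg[of "p - r"] by simp
  done
lift_definition scaleq_tensor :: "qfield \<Rightarrow> ('a, 'b) tensor \<Rightarrow> ('a, 'b) tensor" is pm_scale
  subgoal for c p r using pms.span_scale[of "p - r" _ c] by (simp add: pms.scale_right_diff_distrib)
  done

instance
  by standard
    (transfer; simp add: algebra_simps pms.scale_right_distrib pms.scale_left_distrib pms.span_zero)+

end

lift_definition tensor :: "'a::qspace \<Rightarrow> 'b::qspace \<Rightarrow> ('a, 'b) tensor"  (infixl \<open>\<otimes>\<^sub>q\<close> 76)
  is "\<lambda>a b. Poly_Mapping.single (a, b) 1" .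

text \<open>
  The linear map on a tensor product that is induced by a bilinear map \<open>h\<close> into a vector space
  with scalar multiplication \<open>s\<close>; \<open>s\<close> is a parameter so that the ground field can be the target.
\<close>

definition tensor_ext ::
  "(qfield \<Rightarrow> 'c::ab_group_add \<Rightarrow> 'c) \<Rightarrow> ('a::qspace \<Rightarrow> 'b::qspace \<Rightarrow> 'c)
    \<Rightarrow> ('a, 'b) tensor \<Rightarrow> 'c" where
  "tensor_ext s h =
     (THE g. Vector_Spaces.linear scaleq s g \<and> (\<forall>a b. g (a \<otimes>\<^sub>q b) = h a b))"


lemma tensor_add_left: "(a + a') \<otimes>\<^sub>q b = a \<otimes>\<^sub>q b + a' \<otimes>\<^sub>q b"
  by transfer (rule pms.span_base, unfold tensor_relations_def Let_def diff_diff_eq[symmetric], blast)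

lemma tensor_add_right: "a \<otimes>\<^sub>q (b + b') = a \<otimes>\<^sub>q b + a \<otimes>\<^sub>q b'"
  by transfer (rule pms.span_base, unfold tensor_relations_def Let_def diff_diff_eq[symmetric], blast)

lemma tensor_scale_left: "(c *\<^sub>q a) \<otimes>\<^sub>q b = c *\<^sub>q (a \<otimes>\<^sub>q b)"
  by transfer (rule pms.span_base, unfold tensor_relations_def Let_def, blast)

lemma tensor_scale_right: "a \<otimes>\<^sub>q (c *\<^sub>q b) = c *\<^sub>q (a \<otimes>\<^sub>q b)"
  by transfer (rule pms.span_base, unfold tensor_relations_def Let_def, blast)

lemma pm_span_single: "p \<in> pms.span (range (\<lambda>x. Poly_Mapping.single x (1::qfield)))"
proof -
  have "p = (\<Sum>x\<in>Poly_Mapping.keys p. pm_scale (Poly_Mapping.lookup p x) (Poly_Mapping.single x 1))"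
    by (rule poly_mapping_eqI)
      (simp add: lookup_sum lookup_pm_scale lookup_single when_def in_keys_iff sum.delta'
         if_distrib[where f = "(*) _"] cong: if_cong)
  also have "\<dots> \<in> pms.span (range (\<lambda>x. Poly_Mapping.single x (1::qfield)))"
    by (intro pms.span_sum pms.span_scale pms.span_base rangeI)
  finally show ?thesis .
qed

lemma tensor_span: "x \<in> qs.span {a \<otimes>\<^sub>q b | a b. True}"
proof (induction x rule: tensor.abs_induct)
  case (1 p)
  have "p \<in> pms.span (range (\<lambda>x. Poly_Mapping.single x (1::qfield)))"
    by (rule pm_span_single)
  then show ?case
  proof (induction rule: pms.span_induct_alt)
    case base
    then show ?case by (simp add: zero_tensor.abs_eq[symmetric] qs.span_zero)
  next
    case (step c x p)
    then obtain a b where x: "x = Poly_Mapping.single (a, b) 1" by force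
    have "abs_tensor (pm_scale c x + p) = c *\<^sub>q (a \<otimes>\<^sub>q b) + abs_tensor p"
      by (simp add: x plus_tensor.abs_eq scaleq_tensor.abs_eq tensor.abs_eq)
    moreover have "a \<otimes>\<^sub>q b \<in> qs.span {a \<otimes>\<^sub>q b | a b. True}"
      by (rule qs.span_base) blast
    ultimately show ?case
      using step by (simp add: qs.span_add qs.span_scale)
  qed
qed

lemma tensor_ext:
  fixes h :: "'a::qspace \<Rightarrow> 'b::qspace \<Rightarrow> 'c::ab_group_add"
  assumes "\<And>b. Vector_Spaces.linear scaleq s (\<lambda>a. h a b)"
    and "\<And>a. Vector_Spaces.linear scaleq s (h a)"
  shows "Vector_Spaces.linear scaleq s (tensor_ext s h)"
    and "tensor_ext s h (a \<otimes>\<^sub>q b) = h a b"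
proof -
  interpret s: vector_space s
    using assms(1) by (simp add: Vector_Spaces.linear_iff)
  let ?l = Poly_Mapping.lookup and ?k = Poly_Mapping.keys
  define H where "H p = (\<Sum>x\<in>?k p. s (?l p x) (h (fst x) (snd x)))" for p :: "'a \<times> 'b \<Rightarrow>\<^sub>0 qfield"
  have H: "H p = (\<Sum>x\<in>X. s (?l p x) (h (fst x) (snd x)))" if "finite X" "?k p \<subseteq> X" for p X
    unfolding H_def using that by (intro sum.mono_neutral_left) (auto simp: in_keys_iff)
  have H_add: "H (p + r) = H p + H r" for p r
    using H[of "?k p \<union> ?k r"] keys_add[of p r]
    by (simp add: lookup_add s.scale_left_distrib sum.distrib)
  have "?k (pm_scale c p) \<subseteq> ?k p" for c and p :: "'a \<times> 'b \<Rightarrow>\<^sub>0 qfield"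
    by (metis in_keys_iff lookup_pm_scale mult_zero_right subsetI)
  then have H_scale: "H (pm_scale c p) = s c (H p)" for c p
    using H[of "?k p" "pm_scale c p"]
    by (simp add: lookup_pm_scale s.scale_sum_right s.scale_scale H_def[of p])
  have H_uminus: "H (- p) = - H p" for p
    using H_add[of p "- p"] by (simp add: H_def[of 0] add_eq_0_iff)
  have H_diff: "H (p - r) = H p - H r" for p r
    using H_add[of p "- r"] H_uminus[of r] by simp
  have H_single: "H (Poly_Mapping.single (a, b) c) = s c (h a b)" for a b c
    by (cases "c = 0") (simp_all add: H_def)
  have rel: "H p = 0" if "p \<in> pms.span tensor_relations" for p
    using that
  proof (induction rule: pms.span_induct_alt)
    case base
    then show ?case by (simp add: H_def)
  next
    case (step c x y)
    have "H x = 0"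
      using step(1) assms
      by (auto simp: tensor_relations_def Let_def H_diff H_scale H_single Vector_Spaces.linear_iff)
    with step show ?case by (simp add: H_add H_scale)
  qed
  define g where "g t = H (rep_tensor t)" for t
  have g_abs: "g (abs_tensor p) = H p" for p
  proof -
    have "rep_tensor (abs_tensor p) - p \<in> pms.span tensor_relations"
      by (rule Quotient3_rep_abs[OF Quotient3_tensor]) (simp add: pms.span_zero)
    from rel[OF this] show ?thesis by (simp add: g_def H_diff)
  qed
  have g: "Vector_Spaces.linear scaleq s g" "g (a \<otimes>\<^sub>q b) = h a b" for a b
  proof -
    have "g (x + y) = g x + g y" for x y
      by (induction x rule: tensor.abs_induct, induction y rule: tensor.abs_induct) (simp add: plus_tensor.abs_eq g_abs H_add)
    moreover have "g (c *\<^sub>q x) = s c (g x)" for c x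
      by (induction x rule: tensor.abs_induct) (simp add: scaleq_tensor.abs_eq g_abs H_scale)
    ultimately show "Vector_Spaces.linear scaleq s g"
      by (simp add: Vector_Spaces.linear_iff qs.vector_space_axioms s.vector_space_axioms)
    show "g (a \<otimes>\<^sub>q b) = h a b"
      by (simp add: tensor.abs_eq g_abs H_single)
  qed
  have unique: "g' = g"
    if g': "Vector_Spaces.linear scaleq s g' \<and> (\<forall>a b. g' (a \<otimes>\<^sub>q b) = h a b)" for g'
  proof
    fix x :: "('a, 'b) tensor"
    have "x \<in> qs.span {a \<otimes>\<^sub>q b | a b. True}" by (rule tensor_span)
    then show "g' x = g x"
    proof (induction rule: qs.span_induct_alt)
      case base
      show ?case using g g' Vector_Spaces.linear_iff
        by (metis add_cancel_right_right)
    next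
      case (step c x y)
      then show ?case using g g' by (auto simp: Vector_Spaces.linear_iff)
    qed
  qed
  have "tensor_ext s h = g"
    unfolding tensor_ext_def using g unique by (intro the_equality) blast+
  with g show "Vector_Spaces.linear scaleq s (tensor_ext s h)"
    and "tensor_ext s h (a \<otimes>\<^sub>q b) = h a b" by simp_all
qed

text \<open>\<open>(a \<otimes> b) (v \<otimes> w) = a v \<otimes> b w\<close>.\<close>

definition tensor_act ::
  "('u::qspace \<Rightarrow> 'v::qspace \<Rightarrow> 'v) \<Rightarrow> ('u \<Rightarrow> 'w::qspace \<Rightarrow> 'w)
    \<Rightarrow> ('u, 'u) tensor \<Rightarrow> ('v, 'w) tensor \<Rightarrow> ('v, 'w) tensor" where
  "tensor_act act1 act2 s x =
     tensor_ext scaleq (\<lambda>a b. tensor_ext scaleq (\<lambda>v w. act1 a v \<otimes>\<^sub>q act2 b w) x) s"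

definition tensor_map ::
  "('a::qspace \<Rightarrow> 'c::qspace) \<Rightarrow> ('b::qspace \<Rightarrow> 'd::qspace) \<Rightarrow> ('a, 'b) tensor \<Rightarrow> ('c, 'd) tensor"
  where
  "tensor_map g h = tensor_ext scaleq (\<lambda>a b. g a \<otimes>\<^sub>q h b)"


section \<open>Cartan matrices of finite type\<close>

text \<open>
  As the Cartan matrix is invertible, the simple roots form a basis of \<open>\<hh>\<^sup>*\<close>. A weight is given by
  its coordinates in this basis: \<open>l $ i = \<langle>l, u\<^sub>i\<rangle>\<close>.
\<close>

type_synonym 'r weight = "rat ^ 'r"

definition simple_root :: "'r::finite \<Rightarrow> 'r weight" where
  "simple_root i = axis i 1"

definition finite_type_cartan :: "int ^ 'r ^ 'r::finite \<Rightarrow> bool" where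
  "finite_type_cartan A \<longleftrightarrow>
     (\<forall>i. A $ i $ i = 2) \<and>
     (\<forall>i j. i \<noteq> j \<longrightarrow> A $ i $ j \<le> 0) \<and>
     (\<forall>i j. A $ i $ j = 0 \<longrightarrow> A $ j $ i = 0) \<and>
     (\<exists>D :: 'r \<Rightarrow> rat. (\<forall>i. D i > 0) \<and>
        (\<forall>i j. D i * of_int (A $ i $ j) = D j * of_int (A $ j $ i)) \<and>
        (\<forall>x :: rat ^ 'r. x \<noteq> 0 \<longrightarrow>
           (\<Sum>i\<in>UNIV. \<Sum>j\<in>UNIV. x $ i * D i * of_int (A $ i $ j) * x $ j) > 0))"

text \<open>\<open>\<langle>l, \<alpha>\<^sub>i\<^sup>\<or>\<rangle>\<close>, using \<open>\<langle>\<alpha>\<^sub>j, \<alpha>\<^sub>i\<^sup>\<or>\<rangle> = a\<^sub>i\<^sub>j\<close>.\<close>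

definition coroot_pairing :: "int ^ 'r ^ 'r::finite \<Rightarrow> 'r weight \<Rightarrow> 'r \<Rightarrow> rat" where
  "coroot_pairing A l i = (\<Sum>j\<in>UNIV. l $ j * of_int (A $ i $ j))"

definition simple_reflection :: "int ^ 'r ^ 'r::finite \<Rightarrow> 'r \<Rightarrow> 'r weight \<Rightarrow> 'r weight" where
  "simple_reflection A i l = l - coroot_pairing A l i *s simple_root i"

inductive_set roots :: "int ^ 'r ^ 'r::finite \<Rightarrow> 'r weight set" for A where
  simple: "simple_root i \<in> roots A"
| reflect: "\<alpha> \<in> roots A \<Longrightarrow> simple_reflection A i \<alpha> \<in> roots A"

definition invariant_scalar_product ::
  "int ^ 'r ^ 'r::finite \<Rightarrow> ('r weight \<Rightarrow> 'r weight \<Rightarrow> rat) \<Rightarrow> bool" where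
  "invariant_scalar_product A B \<longleftrightarrow>
     (\<forall>x y z. B (x + y) z = B x z + B y z) \<and>
     (\<forall>c x y. B (c *s x) y = c * B x y) \<and>
     (\<forall>x y. B x y = B y x) \<and>
     (\<forall>x. x \<noteq> 0 \<longrightarrow> B x x > 0) \<and>
     (\<forall>i x y. B (simple_reflection A i x) (simple_reflection A i y) = B x y)"

text \<open>
  The matrix may be decomposable. A root is short if no root of the same irreducible component is
  shorter, so in a simply laced component all roots are short.
\<close>

definition same_component ::
  "int ^ 'r ^ 'r::finite \<Rightarrow> ('r weight \<Rightarrow> 'r weight \<Rightarrow> rat) \<Rightarrow> 'r weight \<Rightarrow> 'r weight \<Rightarrow> bool" where
  "same_component A B = (\<lambda>\<alpha> \<beta>. \<alpha> \<in> roots A \<and> \<beta> \<in> roots A \<and> B \<alpha> \<beta> \<noteq> 0)\<^sup>*\<^sup>*"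

definition short_root ::
  "int ^ 'r ^ 'r::finite \<Rightarrow> ('r weight \<Rightarrow> 'r weight \<Rightarrow> rat) \<Rightarrow> 'r weight \<Rightarrow> bool" where
  "short_root A B \<alpha> \<longleftrightarrow>
     \<alpha> \<in> roots A \<and> (\<forall>\<beta>. same_component A B \<alpha> \<beta> \<longrightarrow> B \<alpha> \<alpha> \<le> B \<beta> \<beta>)"

definition normalized_scalar_product ::
  "int ^ 'r ^ 'r::finite \<Rightarrow> ('r weight \<Rightarrow> 'r weight \<Rightarrow> rat) \<Rightarrow> bool" where
  "normalized_scalar_product A B \<longleftrightarrow>
     invariant_scalar_product A B \<and> (\<forall>\<alpha>. short_root A B \<alpha> \<longrightarrow> B \<alpha> \<alpha> = 2)"

definition Q_plus :: "('r::finite) weight set" where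
  "Q_plus = {\<beta>. \<forall>i. \<beta> $ i \<in> \<nat>}"

definition weight_less :: "('r::finite) weight \<Rightarrow> 'r weight \<Rightarrow> bool" where
  "weight_less m l \<longleftrightarrow> l - m \<in> Q_plus \<and> m \<noteq> l"

definition dominant_integral :: "int ^ 'r ^ 'r::finite \<Rightarrow> 'r weight \<Rightarrow> bool" where
  "dominant_integral A m \<longleftrightarrow> (\<forall>i. coroot_pairing A m i \<in> \<nat>)"


section \<open>The quantized enveloping algebra\<close>

datatype 'g word = Word (letters: "'g list")

instantiation word :: (type) monoid_add
begin

definition "0 = Word []"
definition "v + w = Word (letters v @ letters w)"

instance
  by standard (simp_all add: zero_word_def plus_word_def)

end

text \<open>The free associative unital algebra on \<open>'g\<close> is the monoid algebra of the free monoid.\<close>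

type_synonym 'g free_algebra = "'g word \<Rightarrow>\<^sub>0 qfield"

definition free_gen :: "'g \<Rightarrow> 'g free_algebra" where
  "free_gen g = Poly_Mapping.single (Word [g]) 1"

definition free_const :: "qfield \<Rightarrow> 'g free_algebra" where
  "free_const c = Poly_Mapping.single 0 c"

definition free_eval :: "('g \<Rightarrow> 'u::qalgebra) \<Rightarrow> 'g free_algebra \<Rightarrow> 'u" where
  "free_eval x p =
     (\<Sum>w\<in>Poly_Mapping.keys p. Poly_Mapping.lookup p w *\<^sub>q prod_list (map x (letters w)))"

inductive_set generated_ideal :: "'a::ring_1 set \<Rightarrow> 'a set" for S where
  zero: "0 \<in> generated_ideal S"
| gen: "s \<in> S \<Longrightarrow> x * s * y \<in> generated_ideal S"
| add: "x \<in> generated_ideal S \<Longrightarrow> y \<in> generated_ideal S \<Longrightarrow> x + y \<in> generated_ideal S"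

definition presented_by :: "('g \<Rightarrow> 'u::qalgebra) \<Rightarrow> 'g free_algebra set \<Rightarrow> bool" where
  "presented_by x R \<longleftrightarrow>
     surj (free_eval x) \<and> (\<forall>p. free_eval x p = 0 \<longleftrightarrow> p \<in> generated_ideal R)"

datatype 'r gen = T 'r | T_inv 'r | E 'r | F 'r

definition index_list :: "'r::finite list" where
  "index_list = (SOME is. distinct is \<and> set is = UNIV)"

text \<open>
  \<open>\<Prod>\<^sub>j t\<^sub>j\<^bsup>a\<^sub>j\<^sub>i\<^esup>\<close> for commuting \<open>t\<^sub>j\<close> with inverses \<open>t'\<^sub>j\<close>; as the factors commute, the order of the
  list is irrelevant. Exchanging \<open>t\<close> and \<open>t'\<close> gives the inverse.
\<close>

definition k_product ::
  "int ^ 'r ^ 'r::finite \<Rightarrow> ('r \<Rightarrow> 'a::monoid_mult) \<Rightarrow> ('r \<Rightarrow> 'a) \<Rightarrow> 'r \<Rightarrow> 'a" where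
  "k_product A t t' i =
     prod_list (map (\<lambda>j. if A $ j $ i \<ge> 0 then t j ^ nat (A $ j $ i) else t' j ^ nat (- A $ j $ i))
       index_list)"

definition half_norm :: "('r weight \<Rightarrow> 'r weight \<Rightarrow> rat) \<Rightarrow> 'r::finite \<Rightarrow> rat" where
  "half_norm B i = B (simple_root i) (simple_root i) / 2"

definition q_int :: "rat \<Rightarrow> nat \<Rightarrow> qfield" where
  "q_int d k = (qpow (of_nat k * d) - qpow (- of_nat k * d)) / (qpow d - qpow (- d))"

definition q_fact :: "rat \<Rightarrow> nat \<Rightarrow> qfield" where
  "q_fact d k = (\<Prod>m = 1..k. q_int d m)"

definition serre_element ::
  "int ^ 'r ^ 'r::finite \<Rightarrow> ('r \<Rightarrow> rat) \<Rightarrow> ('r \<Rightarrow> 'r gen) \<Rightarrow> 'r \<Rightarrow> 'r \<Rightarrow> 'r gen free_algebra" where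
  "serre_element A d X i j =
     (let N = nat (1 - A $ i $ j); x = (\<lambda>l. free_gen (X l)) in
      \<Sum>m = 0..N. free_const ((- 1) ^ m / (q_fact (d i) m * q_fact (d i) (N - m)))
                   * x i ^ m * x j * x i ^ (N - m))"

definition uq_relations ::
  "int ^ 'r ^ 'r::finite \<Rightarrow> ('r \<Rightarrow> rat) \<Rightarrow> 'r gen free_algebra set" where
  "uq_relations A d =
     (let t = (\<lambda>i. free_gen (T i)); t' = (\<lambda>i. free_gen (T_inv i));
          e = (\<lambda>i. free_gen (E i)); f = (\<lambda>i. free_gen (F i));
          k = k_product A t t'; k' = k_product A t' t;
          \<delta> = (\<lambda>i j :: 'r. if i = j then 1 else 0)
      in {t i * t' i - 1 | i. True} \<union> {t' i * t i - 1 | i. True}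
       \<union> {t i * t j - t j * t i | i j. True}
       \<union> {t i * e j * t' i - free_const (qpow (d i * \<delta> i j)) * e j | i j. True}
       \<union> {t i * f j * t' i - free_const (qpow (- d i * \<delta> i j)) * f j | i j. True}
       \<union> {e i * f j - f j * e i | i j. i \<noteq> j}
       \<union> {e i * f i - f i * e i - free_const (1 / (qpow (d i) - qpow (- d i))) * (k i - k' i) | i. True}
       \<union> {serre_element A d E i j | i j. i \<noteq> j}
       \<union> {serre_element A d F i j | i j. i \<noteq> j})"

record ('r, 'u) qgroup =
  cartan :: "int ^ 'r ^ 'r"
  sform :: "'r weight \<Rightarrow> 'r weight \<Rightarrow> rat"
  generator :: "'r gen \<Rightarrow> 'u"

definition dd :: "('r::finite, 'u) qgroup \<Rightarrow> 'r \<Rightarrow> rat" where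
  "dd G = half_norm (sform G)"

definition quantized_enveloping_algebra :: "('r::finite, 'u::qalgebra) qgroup \<Rightarrow> bool" where
  "quantized_enveloping_algebra G \<longleftrightarrow>
     finite_type_cartan (cartan G) \<and>
     normalized_scalar_product (cartan G) (sform G) \<and>
     presented_by (generator G) (uq_relations (cartan G) (dd G))"

definition t_gen :: "('r::finite, 'u) qgroup \<Rightarrow> 'r \<Rightarrow> 'u" where "t_gen G i = generator G (T i)"
definition t_inv :: "('r::finite, 'u) qgroup \<Rightarrow> 'r \<Rightarrow> 'u" where "t_inv G i = generator G (T_inv i)"
definition e_gen :: "('r::finite, 'u) qgroup \<Rightarrow> 'r \<Rightarrow> 'u" where "e_gen G i = generator G (E i)"
definition f_gen :: "('r::finite, 'u) qgroup \<Rightarrow> 'r \<Rightarrow> 'u" where "f_gen G i = generator G (F i)"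

definition k_gen :: "('r::finite, 'u::qalgebra) qgroup \<Rightarrow> 'r \<Rightarrow> 'u" where
  "k_gen G = k_product (cartan G) (t_gen G) (t_inv G)"
definition k_inv :: "('r::finite, 'u::qalgebra) qgroup \<Rightarrow> 'r \<Rightarrow> 'u" where
  "k_inv G = k_product (cartan G) (t_inv G) (t_gen G)"


subsection \<open>Hopf algebra structure and the automorphism \<open>\<theta>\<close>\<close>

definition tensor_times :: "('u::qalgebra, 'u) tensor \<Rightarrow> ('u, 'u) tensor \<Rightarrow> ('u, 'u) tensor" where
  "tensor_times = tensor_act (*) (*)"

text \<open>
  The structure maps are determined by multiplicativity (antimultiplicativity for the antipode) and
  their values on the generators \<open>t\<^sub>i, e\<^sub>i, f\<^sub>i\<close>; the values on \<open>t\<^sub>i\<^sup>-\<^sup>1\<close> are forced.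
\<close>

definition coproduct :: "('r::finite, 'u::qalgebra) qgroup \<Rightarrow> 'u \<Rightarrow> ('u, 'u) tensor" where
  "coproduct G = (THE D. qlinear D \<and> D 1 = 1 \<otimes>\<^sub>q 1 \<and>
     (\<forall>x y. D (x * y) = tensor_times (D x) (D y)) \<and>
     (\<forall>i. D (t_gen G i) = t_gen G i \<otimes>\<^sub>q t_gen G i) \<and>
     (\<forall>i. D (e_gen G i) = e_gen G i \<otimes>\<^sub>q 1 + k_gen G i \<otimes>\<^sub>q e_gen G i) \<and>
     (\<forall>i. D (f_gen G i) = f_gen G i \<otimes>\<^sub>q k_inv G i + 1 \<otimes>\<^sub>q f_gen G i))"

definition counit :: "('r::finite, 'u::qalgebra) qgroup \<Rightarrow> 'u \<Rightarrow> qfield" where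
  "counit G = (THE \<epsilon>. qfunctional \<epsilon> \<and> \<epsilon> 1 = 1 \<and> (\<forall>x y. \<epsilon> (x * y) = \<epsilon> x * \<epsilon> y) \<and>
     (\<forall>i. \<epsilon> (t_gen G i) = 1 \<and> \<epsilon> (e_gen G i) = 0 \<and> \<epsilon> (f_gen G i) = 0))"

definition antipode :: "('r::finite, 'u::qalgebra) qgroup \<Rightarrow> 'u \<Rightarrow> 'u" where
  "antipode G = (THE S. qlinear S \<and> S 1 = 1 \<and> (\<forall>x y. S (x * y) = S y * S x) \<and>
     (\<forall>i. S (t_gen G i) = t_inv G i \<and> S (e_gen G i) = - (k_inv G i * e_gen G i)
        \<and> S (f_gen G i) = - (f_gen G i * k_gen G i)))"

definition theta :: "('r::finite, 'u::qalgebra) qgroup \<Rightarrow> 'u \<Rightarrow> 'u" where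
  "theta G = (THE h. qlinear h \<and> h 1 = 1 \<and> (\<forall>x y. h (x * y) = h x * h y) \<and>
     (\<forall>i. h (t_gen G i) = t_inv G i \<and> h (e_gen G i) = - f_gen G i
        \<and> h (f_gen G i) = - e_gen G i))"


subsection \<open>Triangular decomposition and characters\<close>

inductive_set generated_subalgebra :: "'u::qalgebra set \<Rightarrow> 'u set" for S where
  one: "1 \<in> generated_subalgebra S"
| gen: "s \<in> S \<Longrightarrow> s \<in> generated_subalgebra S"
| add: "x \<in> generated_subalgebra S \<Longrightarrow> y \<in> generated_subalgebra S \<Longrightarrow> x + y \<in> generated_subalgebra S"
| mult: "x \<in> generated_subalgebra S \<Longrightarrow> y \<in> generated_subalgebra S \<Longrightarrow> x * y \<in> generated_subalgebra S"
| scale: "x \<in> generated_subalgebra S \<Longrightarrow> c *\<^sub>q x \<in> generated_subalgebra S"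

definition U_zero :: "('r::finite, 'u::qalgebra) qgroup \<Rightarrow> 'u set" where
  "U_zero G = generated_subalgebra (range (t_gen G) \<union> range (t_inv G))"
definition U_plus :: "('r::finite, 'u::qalgebra) qgroup \<Rightarrow> 'u set" where
  "U_plus G = generated_subalgebra (range (e_gen G))"
definition U_minus :: "('r::finite, 'u::qalgebra) qgroup \<Rightarrow> 'u set" where
  "U_minus G = generated_subalgebra (range (f_gen G))"

inductive_set torus :: "('r::finite, 'u::qalgebra) qgroup \<Rightarrow> 'u set" for G where
  one: "1 \<in> torus G"
| t: "x \<in> torus G \<Longrightarrow> x * t_gen G i \<in> torus G"
| t_inv: "x \<in> torus G \<Longrightarrow> x * t_inv G i \<in> torus G"

text \<open>The projection \<open>x \<mapsto> (x)\<^sub>0\<close> onto \<open>U\<^sup>0\<close> along \<open>U\<^sup>-\<^sub>+ U + U U\<^sup>+\<^sub>+\<close>.\<close>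

definition proj_zero :: "('r::finite, 'u::qalgebra) qgroup \<Rightarrow> 'u \<Rightarrow> 'u" where
  "proj_zero G x = (THE z. z \<in> U_zero G \<and>
     x - z \<in> qs.span ({a * b | a b. a \<in> U_minus G \<and> counit G a = 0}
                    \<union> {a * b | a b. b \<in> U_plus G \<and> counit G b = 0}))"

text \<open>The character \<open>q\<^sup>l\<close> of \<open>U\<^sup>0\<close>, extended by \<open>0\<close> to a function on \<open>U\<close>.\<close>

definition q_char :: "('r::finite, 'u::qalgebra) qgroup \<Rightarrow> 'r weight \<Rightarrow> 'u \<Rightarrow> qfield" where
  "q_char G l = (THE \<kappa>. (\<forall>x. x \<notin> U_zero G \<longrightarrow> \<kappa> x = 0) \<and> \<kappa> 1 = 1 \<and>
     (\<forall>x\<in>U_zero G. \<forall>y\<in>U_zero G. \<kappa> (x + y) = \<kappa> x + \<kappa> y \<and> \<kappa> (x * y) = \<kappa> x * \<kappa> y) \<and>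
     (\<forall>c. \<forall>x\<in>U_zero G. \<kappa> (c *\<^sub>q x) = c * \<kappa> x) \<and>
     (\<forall>i. \<kappa> (t_gen G i) = qpow (dd G i * l $ i)))"

definition weight_space ::
  "('r::finite, 'u::qalgebra) qgroup \<Rightarrow> ('u \<Rightarrow> 'v::qspace \<Rightarrow> 'v) \<Rightarrow> 'r weight \<Rightarrow> 'v set" where
  "weight_space G act m = {v. \<forall>t\<in>torus G. act t v = q_char G m t *\<^sub>q v}"

text \<open>\<open>U\<^sup>-[-\<beta>]\<close>; \<open>s\<close> is \<open>t\<^sup>-\<^sup>1\<close>.\<close>

definition U_minus_weight :: "('r::finite, 'u::qalgebra) qgroup \<Rightarrow> 'r weight \<Rightarrow> 'u set" where
  "U_minus_weight G \<beta> =
     qs.span {y \<in> U_minus G. \<forall>t\<in>torus G. \<forall>s\<in>torus G. t * s = 1 \<longrightarrow>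
       t * y * s = q_char G (- \<beta>) t *\<^sub>q y}"


section \<open>The Shapovalov form and irreducible highest weight modules\<close>

definition pi_form ::
  "('r::finite, 'u::qalgebra) qgroup \<Rightarrow> 'r weight \<Rightarrow> 'u \<Rightarrow> 'u \<Rightarrow> qfield" where
  "pi_form G l x y = q_char G l (proj_zero G (antipode G x * y))"

definition shapovalov ::
  "('r::finite, 'u::qalgebra) qgroup \<Rightarrow> 'r weight \<Rightarrow> 'u \<Rightarrow> 'u \<Rightarrow> qfield" where
  "shapovalov G l x y = pi_form G l (theta G x) y"

definition K_minus :: "('r::finite, 'u::qalgebra) qgroup \<Rightarrow> 'r weight \<Rightarrow> 'u set" where
  "K_minus G l = {y \<in> U_minus G. \<forall>x\<in>U_plus G. pi_form G l x y = 0}"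

definition K_plus :: "('r::finite, 'u::qalgebra) qgroup \<Rightarrow> 'r weight \<Rightarrow> 'u set" where
  "K_plus G l = {x \<in> U_plus G. \<forall>y\<in>U_minus G. pi_form G l x y = 0}"

text \<open>
  The Verma module \<open>M(l)\<close>, with \<open>e\<^sub>i 1\<^sub>l = 0\<close> and \<open>t 1\<^sub>l = q\<^sup>l(t) 1\<^sub>l\<close>, is \<open>U\<close> modulo this left ideal, and \<open>1\<^sub>l\<close> is the class of \<open>1\<close>.
\<close>

definition verma_ideal :: "('r::finite, 'u::qalgebra) qgroup \<Rightarrow> 'r weight \<Rightarrow> 'u set" where
  "verma_ideal G l =
     qs.span ({x * e_gen G i | x i. True}
            \<union> {x * (t - q_char G l t *\<^sub>q 1) | x t. t \<in> torus G})"

text \<open>The preimage of \<open>K\<^sub>l 1\<^sub>l \<subseteq> M(l)\<close> in \<open>U\<close>, so that \<open>L(l) = M(l) / K\<^sub>l 1\<^sub>l\<close> is \<open>U\<close> modulo it.\<close>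

definition L_ideal :: "('r::finite, 'u::qalgebra) qgroup \<Rightarrow> 'r weight \<Rightarrow> 'u set" where
  "L_ideal G l = {y + z | y z. y \<in> K_minus G l \<and> z \<in> verma_ideal G l}"

definition is_module :: "('u::qalgebra \<Rightarrow> 'v::qspace \<Rightarrow> 'v) \<Rightarrow> bool" where
  "is_module act \<longleftrightarrow>
     (\<forall>v. act 1 v = v) \<and> (\<forall>x y v. act (x * y) v = act x (act y v)) \<and>
     (\<forall>x. qlinear (act x)) \<and> (\<forall>v. qlinear (\<lambda>x. act x v))"

text \<open>
  \<open>act\<close> makes \<open>'l\<close> a copy of \<open>L(l)\<close>, with \<open>one\<close> the image of \<open>1\<^sub>l\<close>: \<open>x \<mapsto> act x one\<close> induces an
  isomorphism from \<open>U\<close> modulo \<open>L_ideal G l\<close>.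
\<close>

definition irreducible_highest_weight_module ::
  "('r::finite, 'u::qalgebra) qgroup \<Rightarrow> 'r weight \<Rightarrow> ('u \<Rightarrow> 'l::qspace \<Rightarrow> 'l) \<Rightarrow> 'l \<Rightarrow> bool" where
  "irreducible_highest_weight_module G l act one \<longleftrightarrow>
     is_module act \<and> surj (\<lambda>x. act x one) \<and> (\<forall>x. act x one = 0 \<longleftrightarrow> x \<in> L_ideal G l)"

definition induced_form ::
  "('r::finite, 'u::qalgebra) qgroup \<Rightarrow> 'r weight \<Rightarrow> ('u \<Rightarrow> 'l \<Rightarrow> 'l) \<Rightarrow> 'l \<Rightarrow> 'l \<Rightarrow> 'l \<Rightarrow> qfield" where
  "induced_form G l act one v w =
     (THE c. \<exists>x\<in>U_minus G. \<exists>y\<in>U_minus G.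
        v = act x one \<and> w = act y one \<and> c = shapovalov G l x y)"


section \<open>The quantized algebra of regular functions\<close>

definition left_regular :: "'u::qalgebra \<Rightarrow> 'u dual \<Rightarrow> 'u dual" where
  "left_regular a f = Dual (\<lambda>x. eval_dual f (x * a))"

text \<open>
  Matrix elements \<open>x \<mapsto> \<xi> (x v)\<close> of \<open>L(m)\<close>: a functional \<open>\<xi>\<close> on \<open>L(m)\<close> is a functional \<open>g\<close> on \<open>U\<close>
  that vanishes on \<open>L_ideal G m\<close>, and \<open>v\<close> is the class of some \<open>y\<close>.
\<close>

definition matrix_elements :: "('r::finite, 'u::qalgebra) qgroup \<Rightarrow> 'r weight \<Rightarrow> 'u dual set" where
  "matrix_elements G m =
     {c. \<exists>g y. (\<forall>z\<in>L_ideal G m. eval_dual g z = 0) \<and> (\<forall>x. eval_dual c x = eval_dual g (x * y))}"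

definition regular_functions :: "('r::finite, 'u::qalgebra) qgroup \<Rightarrow> 'u dual set" where
  "regular_functions G = qs.span (\<Union>m\<in>Collect (dominant_integral (cartan G)). matrix_elements G m)"

text \<open>The multiplication of the dual Hopf algebra: \<open>(f g)(x) = (f \<otimes> g)(\<Delta>(x))\<close>.\<close>

definition dual_times :: "('r::finite, 'u::qalgebra) qgroup \<Rightarrow> 'u dual \<Rightarrow> 'u dual \<Rightarrow> 'u dual" where
  "dual_times G f g =
     Dual (\<lambda>x. tensor_ext (*) (\<lambda>a b. eval_dual f a * eval_dual g b) (coproduct G x))"

definition mu :: "('r::finite, 'u::qalgebra) qgroup \<Rightarrow> ('u dual, 'u dual) tensor \<Rightarrow> 'u dual" where
  "mu G = tensor_ext scaleq (dual_times G)"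

definition invariant_functions :: "('r::finite, 'u::qalgebra) qgroup \<Rightarrow> 'r weight \<Rightarrow> 'u dual set" where
  "invariant_functions G l =
     {f \<in> regular_functions G \<inter> weight_space G left_regular 0.
        (\<forall>x\<in>K_minus G l. left_regular x f = 0) \<and> (\<forall>x\<in>K_plus G l. left_regular x f = 0)}"


section \<open>The star product\<close>

text \<open>
  \<open>F\<close> is a subspace of the full dual space, so for a subspace \<open>W\<close> of \<open>V\<close> the space \<open>W \<otimes> F\<close> is
  identified with its (injective) image in the tensor product of \<open>V\<close> with the full dual space.
\<close>

definition tensor_F :: "('r::finite, 'u::qalgebra) qgroup \<Rightarrow> 'l::qspace set \<Rightarrow> ('l, 'u dual) tensor set" where
  "tensor_F G W = qs.span {v \<otimes>\<^sub>q f | v f. v \<in> W \<and> f \<in> regular_functions G}"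

definition intertwiners ::
  "('r::finite, 'u::qalgebra) qgroup \<Rightarrow> ('u \<Rightarrow> 'l::qspace \<Rightarrow> 'l) \<Rightarrow> ('l \<Rightarrow> ('l, 'u dual) tensor) set" where
  "intertwiners G act =
     {\<phi>. qlinear \<phi> \<and> range \<phi> \<subseteq> tensor_F G UNIV \<and>
        (\<forall>x v. \<phi> (act x v) = tensor_act act left_regular (coproduct G x) (\<phi> v))}"

text \<open>\<open>id \<otimes> \<mu>\<close>, with \<open>(V \<otimes> F) \<otimes> F\<close> identified with \<open>V \<otimes> (F \<otimes> F)\<close>.\<close>

definition id_tensor_mu ::
  "('r::finite, 'u::qalgebra) qgroup \<Rightarrow>
     (('l::qspace, 'u dual) tensor, 'u dual) tensor \<Rightarrow> ('l, 'u dual) tensor" where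
  "id_tensor_mu G =
     tensor_ext scaleq (\<lambda>s g. tensor_ext scaleq (\<lambda>v f. v \<otimes>\<^sub>q dual_times G f g) s)"

definition intertwiner_times ::
  "('r::finite, 'u::qalgebra) qgroup \<Rightarrow> ('l::qspace \<Rightarrow> ('l, 'u dual) tensor) \<Rightarrow>
     ('l \<Rightarrow> ('l, 'u dual) tensor) \<Rightarrow> 'l \<Rightarrow> ('l, 'u dual) tensor" where
  "intertwiner_times G \<phi> \<psi> = id_tensor_mu G \<circ> tensor_map \<phi> id \<circ> \<psi>"

definition Theta ::
  "('r::finite, 'u::qalgebra) qgroup \<Rightarrow> 'r weight \<Rightarrow> ('u \<Rightarrow> 'l::qspace \<Rightarrow> 'l) \<Rightarrow> 'l \<Rightarrow>
     ('l \<Rightarrow> ('l, 'u dual) tensor) \<Rightarrow> 'u dual" where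
  "Theta G l act one \<phi> =
     (THE f. f \<in> regular_functions G \<and>
        \<phi> one - one \<otimes>\<^sub>q f \<in> tensor_F G (\<Union>m\<in>{m. weight_less m l}. weight_space G act m))"

definition star ::
  "('r::finite, 'u::qalgebra) qgroup \<Rightarrow> 'r weight \<Rightarrow> ('u \<Rightarrow> 'l::qspace \<Rightarrow> 'l) \<Rightarrow> 'l \<Rightarrow>
     'u dual \<Rightarrow> 'u dual \<Rightarrow> 'u dual" where
  "star G l act one f1 f2 =
     (let \<Theta> = Theta G l act one; \<Theta>' = inv_into (intertwiners G act) \<Theta>
      in \<Theta> (intertwiner_times G (\<Theta>' f1) (\<Theta>' f2)))"


section \<open>The reduced fusion element\<close>

text \<open>\<open>(y \<beta> i)\<close> for \<open>i < n \<beta>\<close> are the chosen elements of \<open>U\<^sup>-[-\<beta>]\<close>.\<close>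

definition adapted_basis ::
  "('r::finite, 'u::qalgebra) qgroup \<Rightarrow> 'r weight \<Rightarrow> ('u \<Rightarrow> 'l::qspace \<Rightarrow> 'l) \<Rightarrow> 'l \<Rightarrow>
     ('r weight \<Rightarrow> nat) \<Rightarrow> ('r weight \<Rightarrow> nat \<Rightarrow> 'u) \<Rightarrow> bool" where
  "adapted_basis G l act one n y \<longleftrightarrow>
     (\<forall>\<beta>\<in>Q_plus. (\<forall>i<n \<beta>. y \<beta> i \<in> U_minus_weight G \<beta>) \<and>
        (let b = (\<lambda>i. act (y \<beta> i) one) in
          inj_on b {..<n \<beta>} \<and> qs.independent (b ` {..<n \<beta>}) \<and>
          qs.span (b ` {..<n \<beta>}) = weight_space G act (l - \<beta>))) \<and>
     n 0 = 1 \<and> y 0 0 = 1"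

definition inverse_matrix :: "nat \<Rightarrow> (nat \<Rightarrow> nat \<Rightarrow> qfield) \<Rightarrow> nat \<Rightarrow> nat \<Rightarrow> qfield" where
  "inverse_matrix n M = (THE C. (\<forall>i j. \<not> (i < n \<and> j < n) \<longrightarrow> C i j = 0) \<and>
     (\<forall>i<n. \<forall>j<n. (\<Sum>k<n. M i k * C k j) = (if i = j then 1 else 0) \<and>
                     (\<Sum>k<n. C i k * M k j) = (if i = j then 1 else 0)))"

text \<open>
  An element of the completed tensor product \<open>U\<^sup>- \<otimes> U\<^sup>+\<close> is given as the family of its components
  indexed by \<open>\<beta> \<in> Q\<^sub>+\<close>.
\<close>

definition J_red ::
  "('r::finite, 'u::qalgebra) qgroup \<Rightarrow> 'r weight \<Rightarrow> ('u \<Rightarrow> 'l::qspace \<Rightarrow> 'l) \<Rightarrow> 'l \<Rightarrow>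
     ('r weight \<Rightarrow> nat) \<Rightarrow> ('r weight \<Rightarrow> nat \<Rightarrow> 'u) \<Rightarrow> 'r weight \<Rightarrow> ('u, 'u) tensor" where
  "J_red G l act one n y \<beta> =
     (let S = (\<lambda>i j. induced_form G l act one (act (y \<beta> i) one) (act (y \<beta> j) one)) in
      \<Sum>i<n \<beta>. \<Sum>j<n \<beta>. inverse_matrix (n \<beta>) S i j *\<^sub>q (y \<beta> i \<otimes>\<^sub>q theta G (y \<beta> j)))"

definition completed_act ::
  "(('r::finite) weight \<Rightarrow> ('u::qalgebra, 'u) tensor) \<Rightarrow>
     ('u dual, 'u dual) tensor \<Rightarrow> ('u dual, 'u dual) tensor" where
  "completed_act J s =
     (let A = (\<lambda>\<beta>. tensor_act left_regular left_regular (J \<beta>) s) in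
      \<Sum>\<beta> | \<beta> \<in> Q_plus \<and> A \<beta> \<noteq> 0. A \<beta>)"

end

theory Submission
  imports Defs
begin

text \<open>
  Let \<open>v\<^sup>*\<close> be the functional on \<open>L(\<lambda>)\<close> that reads off the coefficient of the highest weight vector. Then
  \<open>\<Theta>(\<phi>) = (v\<^sup>* \<otimes> id) \<phi>(1)\<close>. If all \<open>e\<^sub>i\<close> kill \<open>z \<in> L(\<lambda>) \<otimes> F\<close>, then
  \<open>(v\<^sup>* \<omega>(y) \<otimes> id) z = \<theta>(y) (v\<^sup>* \<otimes> id) z\<close> for \<open>y \<in> U\<^sup>-\<close>, so \<open>z\<close> is determined by \<open>f = (v\<^sup>* \<otimes> id) z\<close>; expanding in the
  given bases, \<open>z\<close> is the sum of the \<open>S\<^sup>-\<^sup>1\<^sub>i\<^sub>j y\<^sub>i 1 \<otimes> \<theta>(y\<^sub>j) f\<close>. If \<open>f\<close> is invariant, this sum has weight \<open>\<lambda>\<close> and is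
  killed by the \<open>e\<^sub>i\<close> and by \<open>K\<^sub>\<lambda>\<close>, the latter because a submodule of \<open>L(\<lambda>) \<otimes> F\<close> on which \<open>v\<^sup>* \<otimes> id\<close> vanishes is zero;
  hence it is \<open>\<phi>(1)\<close> for an intertwiner \<open>\<phi>\<close>. As \<open>v\<^sup>* \<otimes> id\<close> commutes with \<open>U\<^sup>-\<close>, it maps \<open>\<phi>\<^sub>1(y 1)\<close> to \<open>y f\<^sub>1\<close>, and the
  formula follows by applying it to the composition of the intertwiners of \<open>f\<^sub>1\<close> and \<open>f\<^sub>2\<close>.

  \<open>\<Theta>\<close> is defined on this composition because \<open>F\<close> is closed under products: the span of all products is a module on
  which the \<open>e\<^sub>i\<close> and \<open>f\<^sub>i\<close> act locally nilpotently, and such a module is a sum of irreducible modules \<open>L(\<mu>)\<close>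
  with \<open>\<mu>\<close> dominant integral, since the quantum Casimir operator separates the weights \<open>\<mu>\<close> and \<open>\<mu> + \<beta>\<close> of singular
  vectors.
\<close>

section \<open>The ground field and linear maps\<close>

text \<open>\<open>U\<close> is given only by a presentation, with no basis at hand. The basic tool
  is therefore one functional \<open>Lam l\<close> for each weight, the coefficient of the highest
  weight vector in the Verma module. It exists because the generators act on functions on words: all
  relations except the Serre relations in the f_i hold there identically, and those hold on a stable
  subspace. The ideal of L(l), the Shapovalov form and the characters are read off from
  \<open>Lam\<close>, and the functional v^* of the overview is \<open>Lam\<close> carried over to
  L(lambda). As elements of the dual of \<open>U\<close> the same functionals generate copies of all
  L(m), so facts about highest weight modules transfer to matrix elements. The obstacle for the
  Casimir operator is that the form on words is degenerate. Its components are canonical elements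
  built from a generalized inverse of the Gram matrix; they behave as usual on modules where the
  radical of the form acts by zero. This condition passes to products because the coproduct of words
  is adjoint to concatenation.\<close>

lemma qpow_0 [simp]: "qpow 0 = 1"
  by (simp add: qpow_def One_fract_def)

lemma qpow_add: "qpow (s + t) = qpow s * qpow t"
  by (simp add: qpow_def mult_single)

lemma qpow_eq_iff [simp]: "qpow s = qpow t \<longleftrightarrow> s = t"
proof
  assume "qpow s = qpow t"
  then have "Poly_Mapping.single s (1::complex) = Poly_Mapping.single t 1"
    by (simp add: qpow_def eq_fract)
  then have "Poly_Mapping.lookup (Poly_Mapping.single s (1::complex)) s
      = Poly_Mapping.lookup (Poly_Mapping.single t 1) s" by simp
  then show "s = t" by (simp add: lookup_single when_def split: if_splits)
qed simp

lemma qpow_minus_mult [simp]: "qpow (- s) * qpow s = 1" "qpow s * qpow (- s) = 1"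
  by (simp_all add: qpow_add[symmetric])

lemma qpow_minus_mult_left [simp]: "qpow (- s) * (qpow s * x) = x" "qpow s * (qpow (- s) * x) = x"
  by (simp_all add: mult.assoc[symmetric])

lemma qpow_nonzero [simp]: "qpow s \<noteq> 0"
  by (metis qpow_minus_mult(1) mult_zero_right zero_neq_one)

lemma qpow_minus: "qpow (- s) = inverse (qpow s)"
  by (metis inverse_unique qpow_minus_mult(2))

lemma qpow_eq_1_iff [simp]: "qpow s = 1 \<longleftrightarrow> s = 0"
  by (metis qpow_0 qpow_eq_iff)

lemma qpow_power: "qpow s ^ n = qpow (of_nat n * s)"
  by (induction n) (simp_all add: qpow_add algebra_simps)

lemma q_int_nonzero: "d \<noteq> 0 \<Longrightarrow> n > 0 \<Longrightarrow> q_int d n \<noteq> 0"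
  by (auto simp: q_int_def)

lemma q_fact_nonzero: "d \<noteq> 0 \<Longrightarrow> q_fact d n \<noteq> 0"
  by (simp add: q_fact_def q_int_nonzero)

text \<open>Quantum integers do not change under q -> 1/q. A Serre element can therefore be expanded
  with \<open>d\<close> or with \<open>- d\<close>, which reverses the order of the q-commutators
  producing it.\<close>

lemma q_int_uminus: "q_int (- d) n = q_int d n"
proof -
  have "q_int (- d) n = (- (qpow (of_nat n * d) - qpow (- of_nat n * d))) / (- (qpow d - qpow (- d)))"
    by (simp add: q_int_def)
  then show ?thesis unfolding q_int_def by (simp only: minus_divide_divide)
qed

lemma q_fact_uminus: "q_fact (- d) n = q_fact d n"
  by (simp add: q_fact_def q_int_uminus)

lemma vs_qfield [simp]: "vector_space ((*) :: qfield \<Rightarrow> qfield \<Rightarrow> qfield)"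
  by (rule vector_space_qfield)

lemma vs_scaleq [simp]: "vector_space (scaleq :: qfield \<Rightarrow> 'a \<Rightarrow> 'a::qspace)"
  by unfold_locales

lemma linearI:
  assumes "vector_space s1" "vector_space s2" "\<And>x y. f (x + y) = f x + f y" "\<And>c x. f (s1 c x) = s2 c (f x)"
  shows "Vector_Spaces.linear s1 s2 f"
  using assms by (simp add: Vector_Spaces.linear_iff)

lemma qlinearI: "(\<And>x y. f (x + y) = f x + f y) \<Longrightarrow> (\<And>c x. f (c *\<^sub>q x) = c *\<^sub>q f x) \<Longrightarrow> qlinear f"
  by (simp add: linearI)

lemma qfunctionalI: "(\<And>x y. f (x + y) = f x + f y) \<Longrightarrow> (\<And>c x. f (c *\<^sub>q x) = c * f x) \<Longrightarrow> qfunctional f"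
  by (simp add: linearI)

lemma
  assumes "Vector_Spaces.linear s1 s2 f"
  shows lin_add: "f (x + y) = f x + f y" and lin_scale: "f (s1 c x) = s2 c (f x)"
    and lin_zero: "f 0 = 0" and lin_neg: "f (- x) = - f x" and lin_diff: "f (x - y) = f x - f y"
    and lin_sum: "f (sum g I) = (\<Sum>i\<in>I. f (g i))"
proof -
  interpret l: Vector_Spaces.linear s1 s2 f by fact
  show "f (x + y) = f x + f y" "f (s1 c x) = s2 c (f x)" "f 0 = 0" "f (- x) = - f x" "f (x - y) = f x - f y"
    "f (sum g I) = (\<Sum>i\<in>I. f (g i))"
    by (simp_all add: l.add l.scale l.zero l.neg l.diff l.sum)
qed

lemmas lin_simps = lin_add lin_scale lin_zero lin_neg lin_diff lin_sum

lemma qlinear_compose: "qlinear f \<Longrightarrow> qlinear g \<Longrightarrow> qlinear (\<lambda>x. f (g x))"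
  by (intro qlinearI) (simp_all add: lin_simps)

lemma qlinear_ident: "qlinear (\<lambda>x. x)"
  by (intro qlinearI) simp_all

lemma linear_span_eq:
  assumes "Vector_Spaces.linear scaleq s f" "Vector_Spaces.linear scaleq s g"
    and "\<And>x. x \<in> S \<Longrightarrow> f x = g x" "x \<in> qs.span S"
  shows "f x = g x"
proof -
  interpret s: vector_space s using assms(1) by (simp add: Vector_Spaces.linear_iff)
  show ?thesis
    using assms(4)
    by (induction rule: qs.span_induct_alt)
      (simp_all add: assms(3) lin_simps[OF assms(1)] lin_simps[OF assms(2)])
qed

lemma linear_span_mem:
  assumes "qlinear f" "qs.subspace Y" "\<And>x. x \<in> S \<Longrightarrow> f x \<in> Y" "x \<in> qs.span S"
  shows "f x \<in> Y"
  using assms(4)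
  by (induction rule: qs.span_induct_alt)
    (simp_all add: assms lin_simps[OF assms(1)] qs.subspace_0 qs.subspace_add qs.subspace_scale)

lemma linear_tensor_eq:
  assumes "Vector_Spaces.linear scaleq s f" "Vector_Spaces.linear scaleq s g"
    and "\<And>a b. f (a \<otimes>\<^sub>q b) = g (a \<otimes>\<^sub>q b)"
  shows "f x = g x"
  by (rule linear_span_eq[OF assms(1,2) _ tensor_span]) (use assms(3) in auto)

lemma tensor_zero_left [simp]: "0 \<otimes>\<^sub>q b = 0"
  by (metis tensor_scale_left qs.scale_zero_left)

lemma tensor_zero_right [simp]: "a \<otimes>\<^sub>q 0 = 0"
  by (metis tensor_scale_right qs.scale_zero_left)

lemma qlinear_tensor_left: "qlinear (\<lambda>a. a \<otimes>\<^sub>q b)"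
  by (intro qlinearI) (simp_all add: tensor_add_left tensor_scale_left)

lemma qlinear_tensor_right: "qlinear (\<lambda>b. a \<otimes>\<^sub>q b)"
  by (intro qlinearI) (simp_all add: tensor_add_right tensor_scale_right)

lemmas tensor_simps = lin_simps[OF qlinear_tensor_left] lin_simps[OF qlinear_tensor_right]

lemma qfunctional_exists:
  fixes v :: "'a::qspace"
  assumes "v \<noteq> 0"
  shows "\<exists>\<xi>. qfunctional \<xi> \<and> \<xi> v = 1"
proof -
  interpret vp: vector_space_pair "scaleq :: qfield \<Rightarrow> 'a \<Rightarrow> 'a" "(*) :: qfield \<Rightarrow> qfield \<Rightarrow> qfield"
    by (intro vector_space_pair.intro vs_scaleq vs_qfield)
  have "qs.independent {v}" using assms by simp
  from vp.linear_independent_extend[OF this, of "\<lambda>_. 1"] show ?thesis by auto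
qed

lemma tensor_map_linear:
  assumes "qlinear g" "qlinear h"
  shows "qlinear (tensor_map g h)" "tensor_map g h (a \<otimes>\<^sub>q b) = g a \<otimes>\<^sub>q h b"
  unfolding tensor_map_def
  by (rule tensor_ext; intro qlinearI; simp add: lin_simps[OF assms(1)] lin_simps[OF assms(2)] tensor_simps)+

lemma scaleq_1_inj:
  assumes "c *\<^sub>q (1::'a::qalgebra) = d *\<^sub>q 1"
  shows "c = d"
proof -
  have "(c - d) *\<^sub>q (1::'a) = 0" using assms by (simp add: qs.scale_left_diff_distrib)
  then show ?thesis by simp
qed

lemma qlinear_mult_left: "qlinear (\<lambda>x. a * x)" for a :: "'a::qalgebra"
  by (intro qlinearI) (simp_all add: algebra_simps scaleq_mult_right)

lemma qlinear_mult_right: "qlinear (\<lambda>x. x * a)" for a :: "'a::qalgebra"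
  by (intro qlinearI) (simp_all add: algebra_simps scaleq_mult_left)

section \<open>Algebras given by generators and relations\<close>

lemma free_eval_superset:
  assumes "finite X" "Poly_Mapping.keys p \<subseteq> X"
  shows "free_eval x p = (\<Sum>w\<in>X. Poly_Mapping.lookup p w *\<^sub>q prod_list (map x (letters w)))"
  unfolding free_eval_def using assms by (intro sum.mono_neutral_left) (auto simp: in_keys_iff)

lemma free_eval_add: "free_eval x (p + r) = free_eval x p + free_eval x r"
  using keys_add[of p r] free_eval_superset[of "Poly_Mapping.keys p \<union> Poly_Mapping.keys r" _ x]
  by (simp add: lookup_add qs.scale_left_distrib sum.distrib)

lemma free_eval_zero [simp]: "free_eval x 0 = 0"
  by (simp add: free_eval_def)

lemma free_eval_uminus: "free_eval x (- p) = - free_eval x p"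
  using free_eval_add[of x p "- p"] by (simp add: eq_neg_iff_add_eq_0 add.commute)

lemma free_eval_diff: "free_eval x (p - r) = free_eval x p - free_eval x r"
  using free_eval_add[of x p "- r"] by (simp add: free_eval_uminus)

lemma free_eval_sum: "free_eval x (sum g I) = (\<Sum>i\<in>I. free_eval x (g i))"
  by (induction I rule: infinite_finite_induct) (simp_all add: free_eval_add)

lemma free_eval_single: "free_eval x (Poly_Mapping.single w c) = c *\<^sub>q prod_list (map x (letters w))"
  by (cases "c = 0") (simp_all add: free_eval_def)

lemma free_eval_one [simp]: "free_eval x 1 = 1"
  by (simp add: free_eval_single zero_word_def flip: single_one)

lemma poly_mapping_sum_single: "p = (\<Sum>w\<in>Poly_Mapping.keys p. Poly_Mapping.single w (Poly_Mapping.lookup p w))"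
  by (rule poly_mapping_eqI)
    (simp add: lookup_sum lookup_single when_def in_keys_iff sum.delta' cong: if_cong)

lemma free_eval_mult: "free_eval x (p * r) = free_eval x p * free_eval x r"
proof -
  have single: "free_eval x (Poly_Mapping.single v c * Poly_Mapping.single w d)
      = free_eval x (Poly_Mapping.single v c) * free_eval x (Poly_Mapping.single w d)" for v w c d
    by (simp add: mult_single free_eval_single plus_word_def scaleq_mult_left scaleq_mult_right scaleq_scaleq)
  have "free_eval x ((\<Sum>v\<in>V. Poly_Mapping.single v (f v)) * (\<Sum>w\<in>W. Poly_Mapping.single w (g w)))
      = free_eval x (\<Sum>v\<in>V. Poly_Mapping.single v (f v)) * free_eval x (\<Sum>w\<in>W. Poly_Mapping.single w (g w))"
    for V W f g
    by (simp only: sum_product free_eval_sum single)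
  from this[where V = "Poly_Mapping.keys p" and W = "Poly_Mapping.keys r"
      and f = "Poly_Mapping.lookup p" and g = "Poly_Mapping.lookup r"]
  show ?thesis by (simp only: poly_mapping_sum_single[symmetric])
qed

lemma free_eval_power: "free_eval x (p ^ n) = free_eval x p ^ n"
  by (induction n) (simp_all add: free_eval_mult)

lemma free_eval_prod_list: "free_eval x (prod_list ps) = prod_list (map (free_eval x) ps)"
  by (induction ps) (simp_all add: free_eval_mult)

lemma free_eval_gen [simp]: "free_eval x (free_gen g) = x g"
  by (simp add: free_gen_def free_eval_single)

lemma free_eval_const [simp]: "free_eval x (free_const c) = c *\<^sub>q 1"
  by (simp add: free_const_def free_eval_single zero_word_def)

lemmas free_eval_simps = free_eval_add free_eval_diff free_eval_uminus free_eval_mult free_eval_sum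
  free_eval_power free_eval_prod_list

lemma free_eval_const_mult: "free_eval x (free_const c * p) = c *\<^sub>q free_eval x p"
  by (simp add: free_eval_mult scaleq_mult_left)

lemma free_eval_ideal:
  assumes "\<And>r. r \<in> R \<Longrightarrow> free_eval y r = 0" "p \<in> generated_ideal R"
  shows "free_eval y p = 0"
  using assms(2) by induction (simp_all add: assms(1) free_eval_simps)

lemma presented_relation:
  assumes "presented_by x R" "r \<in> R"
  shows "free_eval x r = 0"
  using assms generated_ideal.gen[of r R 1 1] by (auto simp: presented_by_def)

text \<open>Only additivity of \<open>\<phi>\<close> is asked for, because descent to the quotient
  is used twice: for homomorphisms and for the Verma functional, which is not
  multiplicative.\<close>

lemma free_eval_unique:
  assumes "presented_by x R" "\<And>p. p \<in> generated_ideal R \<Longrightarrow> \<phi> p = 0"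
    and "\<And>p r. \<phi> (p + r) = \<phi> p + \<phi> r"
  shows "\<exists>h. \<forall>p. h (free_eval x p) = (\<phi> p :: 'c::ab_group_add)"
proof -
  have minus: "\<phi> (- p) = - \<phi> p" for p
  proof -
    have "\<phi> 0 = 0" using assms(3)[of 0 0] by simp
    then show ?thesis using assms(3)[of p "- p"] by (simp add: eq_neg_iff_add_eq_0 add.commute)
  qed
  have eq: "\<phi> p = \<phi> r" if "free_eval x p = free_eval x r" for p r
  proof -
    have "free_eval x (p - r) = 0" using that by (simp add: free_eval_diff)
    then have "\<phi> (p - r) = 0" using assms by (simp add: presented_by_def)
    then show ?thesis using assms(3)[of p "- r"] by (simp add: minus)
  qed
  have "\<forall>p. \<phi> (inv (free_eval x) (free_eval x p)) = \<phi> p"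
    by (intro allI eq) (simp add: f_inv_into_f)
  then show ?thesis by (intro exI[of _ "\<lambda>u. \<phi> (inv (free_eval x) u)"])
qed

lemma presented_hom:
  fixes x :: "'g \<Rightarrow> 'u::qalgebra" and y :: "'g \<Rightarrow> 'v::qalgebra"
  assumes "presented_by x R" "\<And>r. r \<in> R \<Longrightarrow> free_eval y r = 0"
  shows "\<exists>h. qlinear h \<and> h 1 = 1 \<and> (\<forall>a b. h (a * b) = h a * h b) \<and> (\<forall>g. h (x g) = y g)"
proof -
  obtain h where h: "h (free_eval x p) = free_eval y p" for p
    using free_eval_unique[OF assms(1), of "free_eval y"] free_eval_ideal[OF assms(2)] free_eval_add
    by metis
  have surj: "\<exists>p. u = free_eval x p" for u
    using assms(1) by (metis presented_by_def surjD)
  have add: "h (a + b) = h a + h b" for a b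
    using surj[of a] surj[of b] h by (metis free_eval_add)
  have mult: "h (a * b) = h a * h b" for a b
    using surj[of a] surj[of b] h by (metis free_eval_mult)
  have scale: "h (c *\<^sub>q a) = c *\<^sub>q h a" for c a
    using surj[of a] h by (metis free_eval_const_mult)
  have one: "h 1 = 1" using h[of 1] by simp
  have gen: "h (x g) = y g" for g using h[of "free_gen g"] by simp
  show ?thesis
    by (intro exI[of _ h] conjI allI qlinearI add scale one mult gen)
qed

lemma presented_span:
  assumes "presented_by x R"
  shows "u \<in> qs.span (range (\<lambda>w. prod_list (map x w)))"
proof -
  obtain p where u: "u = free_eval x p" using assms by (metis presented_by_def surjD)
  show ?thesis unfolding u free_eval_def
    by (intro qs.span_sum qs.span_scale qs.span_base) blast
qed

text \<open>Words grow by letters added on the left. This is the induction principle by which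
  identities between linear maps on \<open>U\<close> are reduced to the generators.\<close>

lemma presented_left_closed:
  assumes "presented_by x R" "qs.subspace S" "1 \<in> S" "\<And>g u. u \<in> S \<Longrightarrow> x g * u \<in> S"
  shows "u \<in> S"
proof -
  have "prod_list (map x w) \<in> S" for w by (induction w) (simp_all add: assms)
  then have "qs.span (range (\<lambda>w. prod_list (map x w))) \<subseteq> S"
    by (intro qs.span_minimal assms(2)) auto
  then show ?thesis using presented_span[OF assms(1)] by blast
qed

lemma generated_subalgebra_subspace: "qs.subspace (generated_subalgebra S)"
  using generated_subalgebra.scale[OF generated_subalgebra.one, of 0 S]
  by (auto simp: qs.subspace_def intro: generated_subalgebra.intros)

lemma generated_subalgebra_eq_span:
  "generated_subalgebra S = qs.span {prod_list xs | xs. set xs \<subseteq> S}" (is "?A = qs.span ?P")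
proof
  have mult: "x * y \<in> qs.span ?P" if x: "x \<in> qs.span ?P" and y: "y \<in> qs.span ?P" for x y
  proof -
    have *: "a * y \<in> qs.span ?P" if "a \<in> ?P" for a
    proof (rule linear_span_mem[OF qlinear_mult_left _ _ y])
      fix b assume "b \<in> ?P"
      with that obtain xs ys where "a = prod_list xs" "b = prod_list ys" "set xs \<subseteq> S" "set ys \<subseteq> S" by blast
      then have "a * b = prod_list (xs @ ys)" "set (xs @ ys) \<subseteq> S" by simp_all
      then have "a * b \<in> ?P" by blast
      then show "a * b \<in> qs.span ?P" by (rule qs.span_base)
    qed (rule qs.subspace_span)
    show ?thesis
      by (rule linear_span_mem[OF qlinear_mult_right _ _ x]) (use * in \<open>auto\<close>)
  qed
  show "?A \<subseteq> qs.span ?P"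
  proof
    fix x assume "x \<in> ?A"
    then show "x \<in> qs.span ?P"
    proof induction
      case one
      show ?case by (rule qs.span_base) (auto intro!: exI[of _ "[]"])
    next
      case (gen s)
      then show ?case by (intro qs.span_base) (auto intro!: exI[of _ "[s]"])
    qed (simp_all add: qs.span_add qs.span_scale mult)
  qed
  have "prod_list xs \<in> ?A" if "set xs \<subseteq> S" for xs
    using that by (induction xs) (auto intro: generated_subalgebra.intros)
  then show "qs.span ?P \<subseteq> ?A"
    by (intro qs.span_minimal generated_subalgebra_subspace) auto
qed

lemma generated_subalgebra_range:
  "generated_subalgebra (range g) = qs.span (range (\<lambda>w. prod_list (map g w)))"
proof -
  have "\<exists>w. prod_list xs = prod_list (map g w)" if "set xs \<subseteq> range g" for xs
    using that ex_map_conv[of xs g] by (metis rangeE subsetD)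
  then have "{prod_list xs | xs. set xs \<subseteq> range g} = range (\<lambda>w. prod_list (map g w))"
    by (fastforce intro: exI[of _ "map g w" for w])
  then show ?thesis by (simp add: generated_subalgebra_eq_span)
qed

section \<open>Tensor product algebras and opposite algebras\<close>

definition qbilinear :: "('a::qspace \<Rightarrow> 'v::qspace \<Rightarrow> 'w::qspace) \<Rightarrow> bool" where
  "qbilinear h \<longleftrightarrow> (\<forall>a. qlinear (h a)) \<and> (\<forall>v. qlinear (\<lambda>a. h a v))"

lemma qbilinearD: "qbilinear h \<Longrightarrow> qlinear (h a)" "qbilinear h \<Longrightarrow> qlinear (\<lambda>a. h a v)"
  by (simp_all add: qbilinear_def)

lemma qbilinear_simps:
  assumes "qbilinear h"
  shows "h (a + a') v = h a v + h a' v" "h (c *\<^sub>q a) v = c *\<^sub>q h a v" "h 0 v = 0" "h (- a) v = - h a v"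
    "h (a - a') v = h a v - h a' v" "h a (v + v') = h a v + h a v'" "h a (c *\<^sub>q v) = c *\<^sub>q h a v"
    "h a 0 = 0" "h a (- v) = - h a v" "h a (v - v') = h a v - h a v'"
    "h (sum g I) v = (\<Sum>i\<in>I. h (g i) v)" "h a (sum g' I') = (\<Sum>i\<in>I'. h a (g' i))"
  by (rule lin_simps[OF qbilinearD(1)[OF assms]] lin_simps[OF qbilinearD(2)[OF assms]])+

lemma qbilinear_mult: "qbilinear ((*) :: 'a::qalgebra \<Rightarrow> 'a \<Rightarrow> 'a)"
  by (simp add: qbilinear_def qlinear_mult_left qlinear_mult_right)

text \<open>\<open>tensor_act\<close> with two possibly different algebras, so that one construction
  gives both the multiplication of a tensor product of algebras and the action on a tensor product
  of modules.\<close>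

definition tensor_bilinear ::
  "('a::qspace \<Rightarrow> 'v::qspace \<Rightarrow> 'v) \<Rightarrow> ('b::qspace \<Rightarrow> 'w::qspace \<Rightarrow> 'w)
    \<Rightarrow> ('a, 'b) tensor \<Rightarrow> ('v, 'w) tensor \<Rightarrow> ('v, 'w) tensor" where
  "tensor_bilinear act1 act2 s x =
     tensor_ext scaleq (\<lambda>a b. tensor_ext scaleq (\<lambda>v w. act1 a v \<otimes>\<^sub>q act2 b w) x) s"

lemma tensor_act_eq_bilinear: "tensor_act = tensor_bilinear"
  by (intro ext) (simp add: tensor_act_def tensor_bilinear_def)

context
  fixes act1 :: "'a::qspace \<Rightarrow> 'v::qspace \<Rightarrow> 'v" and act2 :: "'b::qspace \<Rightarrow> 'w::qspace \<Rightarrow> 'w"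
  assumes bil: "qbilinear act1" "qbilinear act2"
begin

private definition pext :: "'a \<Rightarrow> 'b \<Rightarrow> ('v, 'w) tensor \<Rightarrow> ('v, 'w) tensor" where
  "pext a b = tensor_ext scaleq (\<lambda>v w. act1 a v \<otimes>\<^sub>q act2 b w)"

private lemma pext_linear0: "qlinear (pext a b)"
  and pext_pure: "pext a b (v \<otimes>\<^sub>q w) = act1 a v \<otimes>\<^sub>q act2 b w"
  unfolding pext_def
  by (rule tensor_ext;
      intro qlinearI; simp add: qbilinear_simps[OF bil(1)] qbilinear_simps[OF bil(2)] tensor_simps)+

private lemma pext_linear: "qlinear (\<lambda>a. pext a b x)" "qlinear (\<lambda>b. pext a b x)"
proof -
  note simps = pext_pure lin_simps[OF pext_linear0] tensor_add_left tensor_add_right tensor_scale_left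
    tensor_scale_right qbilinear_simps[OF bil(1)] qbilinear_simps[OF bil(2)]
    qs.scale_right_distrib qs.scale_left_commute
  have *: "qlinear (\<lambda>x. pext a b x + pext a' b' x)" "qlinear (\<lambda>x. c *\<^sub>q pext a b x)" for a a' b b' c
    by (intro qlinearI; simp add: simps)+
  have "pext (a + a') b x = pext a b x + pext a' b x" for a a' b
    by (rule linear_tensor_eq[OF pext_linear0 *(1)]) (simp add: simps)
  moreover have "pext a (b + b') x = pext a b x + pext a b' x" for a b b'
    by (rule linear_tensor_eq[OF pext_linear0 *(1)]) (simp add: simps)
  moreover have "pext (c *\<^sub>q a) b x = c *\<^sub>q pext a b x" for a b c
    by (rule linear_tensor_eq[OF pext_linear0 *(2)]) (simp add: simps)
  moreover have "pext a (c *\<^sub>q b) x = c *\<^sub>q pext a b x" for a b c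
    by (rule linear_tensor_eq[OF pext_linear0 *(2)]) (simp add: simps)
  ultimately show "qlinear (\<lambda>a. pext a b x)" "qlinear (\<lambda>b. pext a b x)"
    by (intro qlinearI; simp)+
qed

lemma tensor_bilinear_left: "qlinear (\<lambda>s. tensor_bilinear act1 act2 s x)"
  and tensor_bilinear_eq_pext: "tensor_bilinear act1 act2 (a \<otimes>\<^sub>q b) x = pext a b x"
  unfolding tensor_bilinear_def pext_def[symmetric] by (rule tensor_ext; rule pext_linear)+

lemma tensor_bilinear_pure [simp]:
  "tensor_bilinear act1 act2 (a \<otimes>\<^sub>q b) (v \<otimes>\<^sub>q w) = act1 a v \<otimes>\<^sub>q act2 b w"
  by (simp add: tensor_bilinear_eq_pext pext_pure)

lemma qbilinear_tensor_bilinear: "qbilinear (tensor_bilinear act1 act2)"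
proof -
  note simps = tensor_bilinear_eq_pext lin_simps[OF tensor_bilinear_left] lin_simps[OF pext_linear0]
    qs.scale_right_distrib qs.scale_left_commute
  have *: "qlinear (\<lambda>s. tensor_bilinear act1 act2 s x + tensor_bilinear act1 act2 s y)"
    "qlinear (\<lambda>s. c *\<^sub>q tensor_bilinear act1 act2 s x)" for x y c
    by (intro qlinearI; simp add: simps)+
  have "tensor_bilinear act1 act2 s (x + y) = tensor_bilinear act1 act2 s x + tensor_bilinear act1 act2 s y" for s x y
    by (rule linear_tensor_eq[OF tensor_bilinear_left *(1)]) (simp add: simps)
  moreover have "tensor_bilinear act1 act2 s (c *\<^sub>q x) = c *\<^sub>q tensor_bilinear act1 act2 s x" for s x c
    by (rule linear_tensor_eq[OF tensor_bilinear_left *(2)]) (simp add: simps)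
  ultimately show ?thesis
    unfolding qbilinear_def by (auto intro: tensor_bilinear_left qlinearI)
qed

end

text \<open>Linearity in each argument reduces the claim to pure tensors. The four bilinear maps are
  kept general to cover associativity of the tensor algebra and the module law for tensor products
  at once.\<close>

lemma tensor_bilinear_mult:
  assumes "qbilinear act1" "qbilinear act2" "qbilinear m1" "qbilinear m2"
    and "\<And>a a' v. act1 (m1 a a') v = act1 a (act1 a' v)"
    and "\<And>b b' w. act2 (m2 b b') w = act2 b (act2 b' w)"
  shows "tensor_bilinear act1 act2 (tensor_bilinear m1 m2 s s') x
    = tensor_bilinear act1 act2 s (tensor_bilinear act1 act2 s' x)"
proof -
  let ?A = "tensor_bilinear act1 act2" and ?M = "tensor_bilinear m1 m2"
  note A = qbilinear_tensor_bilinear[OF assms(1,2)] and M = qbilinear_tensor_bilinear[OF assms(3,4)]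
  have 1: "?A (?M (a \<otimes>\<^sub>q b) (a' \<otimes>\<^sub>q b')) x = ?A (a \<otimes>\<^sub>q b) (?A (a' \<otimes>\<^sub>q b') x)" for a b a' b'
  proof (rule linear_tensor_eq[of scaleq "?A (?M (a \<otimes>\<^sub>q b) (a' \<otimes>\<^sub>q b'))" "\<lambda>x. ?A (a \<otimes>\<^sub>q b) (?A (a' \<otimes>\<^sub>q b') x)"])
    show "qlinear (?A (?M (a \<otimes>\<^sub>q b) (a' \<otimes>\<^sub>q b')))" by (rule qbilinearD[OF A])
    show "qlinear (\<lambda>x. ?A (a \<otimes>\<^sub>q b) (?A (a' \<otimes>\<^sub>q b') x))"
      by (rule qlinear_compose[OF qbilinearD(1)[OF A] qbilinearD(1)[OF A]])
  qed (simp add: assms)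
  have 2: "?A (?M (a \<otimes>\<^sub>q b) s') x = ?A (a \<otimes>\<^sub>q b) (?A s' x)" for a b
  proof (rule linear_tensor_eq[of scaleq "\<lambda>s'. ?A (?M (a \<otimes>\<^sub>q b) s') x" "\<lambda>s'. ?A (a \<otimes>\<^sub>q b) (?A s' x)"])
    show "qlinear (\<lambda>s'. ?A (?M (a \<otimes>\<^sub>q b) s') x)"
      by (rule qlinear_compose[OF qbilinearD(2)[OF A] qbilinearD(1)[OF M]])
    show "qlinear (\<lambda>s'. ?A (a \<otimes>\<^sub>q b) (?A s' x))"
      by (rule qlinear_compose[OF qbilinearD(1)[OF A] qbilinearD(2)[OF A]])
  qed (rule 1)
  show ?thesis
  proof (rule linear_tensor_eq[of scaleq "\<lambda>s. ?A (?M s s') x" "\<lambda>s. ?A s (?A s' x)"])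
    show "qlinear (\<lambda>s. ?A (?M s s') x)" by (rule qlinear_compose[OF qbilinearD(2)[OF A] qbilinearD(2)[OF M]])
    show "qlinear (\<lambda>s. ?A s (?A s' x))" by (rule qbilinearD(2)[OF A])
  qed (rule 2)
qed

lemma tensor_bilinear_1:
  assumes "qbilinear act1" "qbilinear act2" "\<And>v. act1 a v = v" "\<And>w. act2 b w = w"
  shows "tensor_bilinear act1 act2 (a \<otimes>\<^sub>q b) x = x"
  by (rule linear_tensor_eq[of scaleq "tensor_bilinear act1 act2 (a \<otimes>\<^sub>q b)" "\<lambda>x. x"])
    (simp_all add: assms qlinear_ident qbilinearD[OF qbilinear_tensor_bilinear[OF assms(1,2)]])

lemma tensor_1_nonzero: "(1::'a::qalgebra) \<otimes>\<^sub>q (1::'b::qalgebra) \<noteq> 0"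
proof
  assume 0: "(1::'a) \<otimes>\<^sub>q (1::'b) = 0"
  obtain \<xi> :: "'a \<Rightarrow> qfield" and \<eta> :: "'b \<Rightarrow> qfield"
    where \<xi>: "qfunctional \<xi>" "\<xi> 1 = 1" and \<eta>: "qfunctional \<eta>" "\<eta> 1 = 1"
    using qfunctional_exists[of "1::'a"] qfunctional_exists[of "1::'b"] by auto
  have bil: "Vector_Spaces.linear scaleq (*) (\<lambda>a. \<xi> a * \<eta> b)" "Vector_Spaces.linear scaleq (*) (\<lambda>b. \<xi> a * \<eta> b)" for a b
    by (intro qfunctionalI; simp add: lin_simps[OF \<xi>(1)] lin_simps[OF \<eta>(1)] algebra_simps)+
  note * = tensor_ext[OF bil]
  have "tensor_ext (*) (\<lambda>a b. \<xi> a * \<eta> b) (1 \<otimes>\<^sub>q 1) = 1" by (simp add: * \<xi> \<eta>)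
  moreover have "tensor_ext (*) (\<lambda>a b. \<xi> a * \<eta> b) (1 \<otimes>\<^sub>q 1) = 0" by (simp add: 0 lin_zero[OF *(1)])
  ultimately show False by simp
qed

instantiation tensor :: (qalgebra, qalgebra) qalgebra
begin

definition "1 = (1 :: 'a) \<otimes>\<^sub>q (1 :: 'b)"
definition "s * s' = tensor_bilinear ((*) :: 'a \<Rightarrow> 'a \<Rightarrow> 'a) ((*) :: 'b \<Rightarrow> 'b \<Rightarrow> 'b) s s'"

instance
proof
  fix a b c :: "('a, 'b) tensor" and r :: qfield
  note simps = qbilinear_simps[OF qbilinear_tensor_bilinear[OF qbilinear_mult[where 'a = 'a] qbilinear_mult[where 'a = 'b]]]
  show "a * b * c = a * (b * c)"
    unfolding times_tensor_def by (rule tensor_bilinear_mult) (simp_all add: qbilinear_mult mult.assoc)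
  show "1 * a = a"
    unfolding times_tensor_def one_tensor_def by (rule tensor_bilinear_1) (simp_all add: qbilinear_mult)
  show "a * 1 = a"
    unfolding times_tensor_def one_tensor_def
    by (rule linear_tensor_eq[of scaleq "\<lambda>a. tensor_bilinear (*) (*) a (1 \<otimes>\<^sub>q 1)" "\<lambda>a. a"])
      (simp_all add: qbilinear_mult qlinear_ident qbilinearD qbilinear_tensor_bilinear)
  show "(0::('a, 'b) tensor) \<noteq> 1"
    by (metis one_tensor_def tensor_1_nonzero)
qed (simp_all add: times_tensor_def qbilinear_simps[OF qbilinear_tensor_bilinear[OF qbilinear_mult qbilinear_mult]])

end

lemma tensor_times_pure [simp]: "(a \<otimes>\<^sub>q b) * (a' \<otimes>\<^sub>q b') = (a * a') \<otimes>\<^sub>q (b * b')"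
  by (simp add: times_tensor_def qbilinear_mult)

lemma tensor_times_eq: "tensor_times s s' = s * s'"
  by (simp add: tensor_times_def times_tensor_def tensor_act_eq_bilinear)

text \<open>The antipode reverses products. With the opposite algebra as target it becomes a
  homomorphism, which the presentation can produce from values on generators.\<close>

typedef 'a opp = "UNIV :: 'a set" morphisms unopp Opp ..

setup_lifting type_definition_opp

instantiation opp :: (qalgebra) qalgebra
begin

lift_definition zero_opp :: "'a opp" is 0 .
lift_definition one_opp :: "'a opp" is 1 .
lift_definition plus_opp :: "'a opp \<Rightarrow> 'a opp \<Rightarrow> 'a opp" is "(+)" .
lift_definition minus_opp :: "'a opp \<Rightarrow> 'a opp \<Rightarrow> 'a opp" is "(-)" .
lift_definition uminus_opp :: "'a opp \<Rightarrow> 'a opp" is uminus .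
lift_definition scaleq_opp :: "qfield \<Rightarrow> 'a opp \<Rightarrow> 'a opp" is scaleq .
lift_definition times_opp :: "'a opp \<Rightarrow> 'a opp \<Rightarrow> 'a opp" is "\<lambda>x y. y * x" .

instance
  by standard (transfer; simp add: distrib_left distrib_right mult.assoc scaleq_mult_left scaleq_mult_right
      qs.scale_right_distrib qs.scale_left_distrib)+

end

section \<open>Quantum Serre elements as iterated q-commutators\<close>

definition qad :: "'a::qalgebra \<Rightarrow> qfield \<Rightarrow> 'a \<Rightarrow> 'a" where
  "qad x p y = x * y - p *\<^sub>q (y * x)"

primrec qads :: "'a::qalgebra \<Rightarrow> qfield \<Rightarrow> qfield \<Rightarrow> nat \<Rightarrow> 'a \<Rightarrow> 'a" where
  "qads x u r 0 y = y"
| "qads x u r (Suc m) y = qad x (u * r ^ m) (qads x u r m y)"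

definition serre_in :: "int \<Rightarrow> rat \<Rightarrow> 'a::qalgebra \<Rightarrow> 'a \<Rightarrow> 'a" where
  "serre_in a d x y = (let N = nat (1 - a) in
     \<Sum>m = 0..N. ((- 1) ^ m / (q_fact d m * q_fact d (N - m))) *\<^sub>q (x ^ m * y * x ^ (N - m)))"

lemma free_eval_serre: "free_eval g (serre_element A d X i j) = serre_in (A $ i $ j) (d i) (g (X i)) (g (X j))"
  by (simp add: serre_element_def serre_in_def Let_def free_eval_simps scaleq_mult_left)

lemma qlinear_qad: "qlinear (qad x p)"
  by (intro qlinearI)
    (simp_all add: qad_def algebra_simps scaleq_mult_left scaleq_mult_right qs.scale_right_distrib
      qs.scale_right_diff_distrib qs.scale_left_commute)

lemmas qad_simps = lin_simps[OF qlinear_qad]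

lemma qlinear_qads: "qlinear (qads x u r m)"
  by (induction m) (simp_all add: qlinear_ident qlinear_compose[OF qlinear_qad])

lemmas qads_simps = lin_simps[OF qlinear_qads]

section \<open>Gaussian binomials and the expansion of iterated q-commutators\<close>

lemma q_int_add: "q_int d (k + l) = qpow (of_nat k * d) * q_int d l + qpow (- of_nat l * d) * q_int d k"
proof -
  have "qpow (of_nat k * d) * (qpow (of_nat l * d) - qpow (- of_nat l * d))
      + qpow (- of_nat l * d) * (qpow (of_nat k * d) - qpow (- of_nat k * d))
    = qpow (of_nat (k + l) * d) - qpow (- of_nat (k + l) * d)"
    by (simp add: right_diff_distrib qpow_add[symmetric] distrib_right) (simp add: algebra_simps)
  then show ?thesis by (simp only: q_int_def times_divide_eq_right add_divide_distrib[symmetric])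
qed

definition q_binomial :: "rat \<Rightarrow> nat \<Rightarrow> nat \<Rightarrow> qfield" where
  "q_binomial d m k = (if k \<le> m then q_fact d m / (q_fact d k * q_fact d (m - k)) else 0)"

lemma q_fact_Suc: "q_fact d (Suc n) = q_fact d n * q_int d (Suc n)"
  by (simp add: q_fact_def mult.commute)

lemma q_fact_0 [simp]: "q_fact d 0 = 1"
  by (simp add: q_fact_def)

lemma q_binomial_0 [simp]: "d \<noteq> 0 \<Longrightarrow> q_binomial d m 0 = 1"
  by (simp add: q_binomial_def q_fact_nonzero)

text \<open>The addition rule for quantum integers with m + 1 split as (k + 1) + (m - k), divided by
  the factorials.\<close>

lemma q_binomial_pascal:
  assumes "d \<noteq> 0"
  shows "q_binomial d (Suc m) (Suc k)
    = qpow (of_nat (Suc k) * d) * q_binomial d m (Suc k) + qpow (- of_nat (Suc m - Suc k) * d) * q_binomial d m k"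
proof -
  consider "k > m" | "k = m" | l where "m = Suc (k + l)"
    by (metis less_imp_Suc_add linorder_less_linear)
  then show ?thesis
  proof cases
    case 3
    note nz = q_fact_nonzero[OF assms] q_int_nonzero[OF assms]
    have "q_int d (Suc m) = qpow (of_nat (Suc k) * d) * q_int d (Suc l) + qpow (- of_nat (Suc l) * d) * q_int d (Suc k)"
      using q_int_add[of d "Suc k" "Suc l"] 3 by simp
    then show ?thesis
      using 3 by (simp add: q_binomial_def q_fact_Suc nz Suc_diff_le field_simps)
  qed (use assms in \<open>simp_all add: q_binomial_def q_fact_nonzero\<close>)
qed

text \<open>Left and right multiplication by \<open>x\<close> commute, and
  \<open>qads x u (qpow (2 * d)) m\<close> is the product over s < m of (left - u q^(2 d s) right).
  These are the coefficients of that product in the q-binomial theorem.\<close>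

definition gauss_coeff :: "rat \<Rightarrow> qfield \<Rightarrow> nat \<Rightarrow> nat \<Rightarrow> qfield" where
  "gauss_coeff d u m k = (- u) ^ (m - k) * qpow (d * of_nat (m - k) * (of_nat m - 1)) * q_binomial d m k"

lemma qads_expand:
  assumes "d \<noteq> 0"
  shows "qads x u (qpow (2 * d)) m y = (\<Sum>k\<le>m. gauss_coeff d u m k *\<^sub>q (x ^ k * y * x ^ (m - k)))"
proof (induction m)
  case 0
  show ?case using assms by (simp add: gauss_coeff_def)
next
  case (Suc m)
  let ?c = "gauss_coeff d u"
  note c_def = gauss_coeff_def
  define X where "X k = x ^ k * y * x ^ (Suc m - k)" for k
  have left: "x * (x ^ k * y * x ^ (m - k)) = X (Suc k)" for k
    by (simp add: X_def mult.assoc)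
  have right: "x ^ k * y * x ^ (m - k) * x = X k" if "k \<le> m" for k
    using that by (simp add: X_def mult.assoc power_Suc2[symmetric] Suc_diff_le del: power_Suc)
  have step: "?c (Suc m) (Suc k) = ?c m k - u * qpow (2 * d) ^ m * ?c m (Suc k)" for k
  proof (cases "Suc k \<le> m")
    case True
    then obtain l where m: "m = Suc (k + l)" by (metis add_Suc less_eqE)
    have e1: "qpow (d * of_nat (Suc l) * of_nat m) * qpow (- of_nat (Suc l) * d) = qpow (d * of_nat (Suc l) * (of_nat m - 1))"
      unfolding qpow_add[symmetric] by (simp add: algebra_simps)
    have e2: "qpow (2 * d) ^ m * qpow (d * of_nat l * (of_nat m - 1)) = qpow (d * of_nat (Suc l) * of_nat m) * qpow (of_nat (Suc k) * d)"
      unfolding qpow_add[symmetric] qpow_power by (simp add: m algebra_simps)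
    have "?c (Suc m) (Suc k) = (- u) ^ Suc l * (qpow (d * of_nat (Suc l) * of_nat m) * q_binomial d (Suc m) (Suc k))"
      by (simp add: c_def m)
    also have "\<dots> = (- u) ^ Suc l * ((qpow (d * of_nat (Suc l) * of_nat m) * qpow (of_nat (Suc k) * d)) * q_binomial d m (Suc k)
        + (qpow (d * of_nat (Suc l) * of_nat m) * qpow (- of_nat (Suc l) * d)) * q_binomial d m k)"
      using q_binomial_pascal[OF assms, of m k] by (simp add: m algebra_simps)
    also have "\<dots> = ?c m k - u * qpow (2 * d) ^ m * ?c m (Suc k)"
      unfolding e1 e2[symmetric] by (simp add: c_def m algebra_simps)
    finally show ?thesis .
  qed (auto simp: c_def q_binomial_def q_fact_nonzero assms not_less_eq_eq)
  have step0: "?c (Suc m) 0 = - u * qpow (2 * d) ^ m * ?c m 0"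
  proof -
    have "qpow (d * of_nat (Suc m) * of_nat m) = qpow (2 * d) ^ m * qpow (d * of_nat m * (of_nat m - 1))"
      unfolding qpow_add[symmetric] qpow_power by (simp add: algebra_simps)
    then show ?thesis using assms by (simp add: c_def)
  qed
  have top: "?c m (Suc m) = 0" by (simp add: c_def q_binomial_def)
  have "qads x u (qpow (2 * d)) (Suc m) y
      = (\<Sum>k\<le>m. ?c m k *\<^sub>q X (Suc k)) - (u * qpow (2 * d) ^ m) *\<^sub>q (\<Sum>k\<le>m. ?c m k *\<^sub>q X k)"
    using Suc.IH
    by (simp add: qad_def sum_distrib_left sum_distrib_right scaleq_mult_left scaleq_mult_right left right)
  also have "(\<Sum>k\<le>m. ?c m k *\<^sub>q X k) = ?c m 0 *\<^sub>q X 0 + (\<Sum>k\<le>m. ?c m (Suc k) *\<^sub>q X (Suc k))"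
    using sum.atMost_Suc_shift[of "\<lambda>k. ?c m k *\<^sub>q X k" m] top by simp
  finally have "qads x u (qpow (2 * d)) (Suc m) y
      = (- u * qpow (2 * d) ^ m * ?c m 0) *\<^sub>q X 0 + (\<Sum>k\<le>m. (?c m k - u * qpow (2 * d) ^ m * ?c m (Suc k)) *\<^sub>q X (Suc k))"
    by (simp add: qs.scale_right_distrib qs.scale_sum_right qs.scale_left_diff_distrib sum_subtractf algebra_simps)
  also have "\<dots> = (\<Sum>k\<le>Suc m. ?c (Suc m) k *\<^sub>q X k)"
    unfolding sum.atMost_Suc_shift by (simp add: step step0)
  finally show ?case by (simp only: X_def)
qed

text \<open>For u = q^(d a) and N = 1 - a the power of u in each Gauss coefficient cancels the
  remaining power of q, because N - 1 = - a. Sign and binomial survive, and these are the Serre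
  coefficients up to a common factor.\<close>

lemma qads_eq_serre:
  assumes "d \<noteq> 0" "a \<le> 0"
  shows "qads x (qpow (d * of_int a)) (qpow (2 * d)) (nat (1 - a)) y
    = ((- 1) ^ nat (1 - a) * q_fact d (nat (1 - a))) *\<^sub>q serre_in a d x y"
proof -
  define N where "N = nat (1 - a)"
  have a: "of_int a = 1 - (of_nat N :: rat)" using assms(2) by (simp add: N_def of_nat_nat)
  have *: "gauss_coeff d (qpow (d * of_int a)) N k = (- 1) ^ N * q_fact d N * ((- 1) ^ k / (q_fact d k * q_fact d (N - k)))" if "k \<le> N" for k
  proof -
    have "(- qpow (d * of_int a)) ^ (N - k) = (- 1) ^ (N - k) * qpow (of_nat (N - k) * (d * of_int a))"
      by (subst power_minus) (simp add: qpow_power)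
    moreover have "qpow (of_nat (N - k) * (d * of_int a)) * qpow (d * of_nat (N - k) * (of_nat N - 1)) = 1"
      unfolding qpow_add[symmetric] a by (simp add: algebra_simps)
    moreover have "(- 1) ^ (N - k) = (- 1) ^ N * (- 1 :: qfield) ^ k"
      using that by (simp add: power_add[symmetric] minus_one_power_iff)
    ultimately show ?thesis using that by (simp add: gauss_coeff_def q_binomial_def mult.assoc)
  qed
  show ?thesis
    unfolding qads_expand[OF assms(1)] serre_in_def Let_def N_def[symmetric] qs.scale_sum_right atMost_atLeast0
    by (rule sum.cong) (simp_all add: *)
qed

lemma serre_in_uminus: "serre_in a (- d) x y = serre_in a d x y"
  by (simp add: serre_in_def q_fact_uminus)

lemma serre_in_eq_0_iff:
  assumes "d \<noteq> 0" "a \<le> 0"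
  shows "serre_in a d x y = 0 \<longleftrightarrow> qads x (qpow (d * of_int a)) (qpow (2 * d)) (nat (1 - a)) y = 0"
  using assms by (simp add: qads_eq_serre q_fact_nonzero)

lemma qcomm_mult:
  fixes k :: "'a::qalgebra"
  assumes "k * x = a *\<^sub>q (x * k)" "k * y = b *\<^sub>q (y * k)"
  shows "k * (x * y) = (a * b) *\<^sub>q (x * y * k)"
proof -
  have "k * (x * y) = (k * x) * y" by (simp add: mult.assoc)
  also have "\<dots> = a *\<^sub>q (x * (k * y))" by (simp add: assms(1) scaleq_mult_left mult.assoc)
  also have "\<dots> = (a * b) *\<^sub>q (x * y * k)" by (simp add: assms(2) scaleq_mult_right mult.assoc)
  finally show ?thesis .
qed

lemma qcomm_qad:
  assumes "k * x = a *\<^sub>q (x * k)" "k * y = b *\<^sub>q (y * k)"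
  shows "k * qad x p y = (a * b) *\<^sub>q (qad x p y * k)"
  using qcomm_mult[OF assms] qcomm_mult[OF assms(2,1)]
  by (simp add: qad_def right_diff_distrib left_diff_distrib scaleq_mult_left scaleq_mult_right
      qs.scale_right_diff_distrib mult.left_commute mult.commute)

lemma qads_qcomm:
  assumes "k * x = a *\<^sub>q (x * k)" "k * y = b *\<^sub>q (y * k)"
  shows "k * qads x u r m y = (a ^ m * b) *\<^sub>q (qads x u r m y * k)"
  by (induction m) (simp_all add: assms qcomm_qad[OF assms(1)] mult.assoc)

text \<open>Moving \<open>b\<close> across the m-th iterated commutator costs exactly p \<rho>^m,
  which is the parameter of the next q-commutator; so \<open>b\<close> contributes nothing at any
  step.\<close>

lemma qads_sum_fst:
  assumes "b * a = \<rho> *\<^sub>q (a * b)" "b * c = p *\<^sub>q (c * b)"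
  shows "qads (a + b) p \<rho> m c = qads a p \<rho> m c"
proof -
  have comm: "b * qads a p \<rho> m c = (p * \<rho> ^ m) *\<^sub>q (qads a p \<rho> m c * b)" for m
    using qads_qcomm[OF assms, of p \<rho> m] by (simp add: mult.commute)
  show ?thesis
  proof (induction m)
    case (Suc m)
    have "b * qads a p \<rho> m c = (p * \<rho> ^ m) *\<^sub>q (qads a p \<rho> m c * b)" by (rule comm)
    then show ?case
      by (simp add: Suc.IH qad_def algebra_simps qs.scale_right_distrib)
  qed simp
qed

text \<open>The factors \<^term>\<open>qad x (u * r ^ m)\<close> commute, so each half of a sum may use the order of the
  factors that suits it; the two orders correspond to \<^term>\<open>d\<close> and \<^term>\<open>- d\<close>.\<close>

lemma serre_in_sum:
  assumes "d \<noteq> 0" "n \<le> 0"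
    and "b * a = qpow (2 * d) *\<^sub>q (a * b)" "b * c = qpow (d * of_int n) *\<^sub>q (c * b)"
    and "a * w = qpow (- d * of_int n) *\<^sub>q (w * a)"
    and "serre_in n d a c = 0" "serre_in n d b w = 0"
  shows "serre_in n d (a + b) (c + w) = 0"
proof -
  let ?N = "nat (1 - n)"
  have "qads (a + b) (qpow (d * of_int n)) (qpow (2 * d)) ?N c = 0"
    using assms by (simp add: qads_sum_fst serre_in_eq_0_iff)
  then have c: "serre_in n d (a + b) c = 0" using assms by (simp add: serre_in_eq_0_iff)
  have ab: "a * b = qpow (2 * - d) *\<^sub>q (b * a)" using assms(3) by (simp add: scaleq_scaleq)
  have "qads (b + a) (qpow (- d * of_int n)) (qpow (2 * - d)) ?N w = qads b (qpow (- d * of_int n)) (qpow (2 * - d)) ?N w"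
    by (rule qads_sum_fst[OF ab assms(5)])
  also have "\<dots> = 0"
    using assms serre_in_eq_0_iff[of "- d" n b w] by (simp add: serre_in_uminus)
  finally have w: "serre_in n d (a + b) w = 0"
    using assms serre_in_eq_0_iff[of "- d" n "a + b" w] by (simp add: serre_in_uminus add.commute)
  have "qads (a + b) (qpow (d * of_int n)) (qpow (2 * d)) ?N (c + w) = 0"
    unfolding qads_simps using c w assms by (simp add: serre_in_eq_0_iff)
  then show ?thesis using assms by (simp add: serre_in_eq_0_iff)
qed

text \<open>Each q-commutator turns \<open>x ^ s * k\<close> into a multiple of
  \<open>x ^ Suc s * k\<close>. The result is zero as soon as one of the factors is.\<close>

lemma qads_torus:
  assumes "k * x = p *\<^sub>q (x * k)"
  shows "qads x u r m k = (\<Prod>s<m. 1 - u * r ^ s * p) *\<^sub>q (x ^ m * k)"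
proof (induction m)
  case (Suc m)
  have "x ^ m * k * x = p *\<^sub>q (x ^ Suc m * k)"
    using assms by (metis mult.assoc power_Suc power_commutes scaleq_mult_right)
  then show ?case
    by (simp add: Suc.IH qad_simps)
      (simp add: qad_def mult.assoc qs.scale_left_diff_distrib qs.scale_right_diff_distrib left_diff_distrib
        right_diff_distrib mult.commute mult.left_commute[where 'a = qfield])
qed simp

lemma qads_commute:
  assumes "e * x = x * e"
  shows "e * qads x u r m y - qads x u r m y * e = qads x u r m (e * y - y * e)"
proof (induction m)
  case (Suc m)
  let ?z = "qads x u r m y"
  have "e * qad x p z - qad x p z * e = qad x p (e * z - z * e)" for p z
  proof -
    have "e * (x * z) = x * (e * z)" "z * x * e = z * e * x"
      using assms by (simp_all only: mult.assoc[symmetric]) (simp add: mult.assoc)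
    then show ?thesis
      by (simp add: qad_def algebra_simps scaleq_mult_left scaleq_mult_right qs.scale_right_diff_distrib)
  qed
  with Suc show ?case by simp
qed simp

section \<open>The defining relations\<close>

definition torus_monomial ::
  "('r::finite \<Rightarrow> 'a::monoid_mult) \<Rightarrow> ('r \<Rightarrow> 'a) \<Rightarrow> ('r \<Rightarrow> int) \<Rightarrow> 'a" where
  "torus_monomial t t' m =
     prod_list (map (\<lambda>j. if m j \<ge> 0 then t j ^ nat (m j) else t' j ^ nat (- m j)) index_list)"

lemma k_product_eq: "k_product A t t' i = torus_monomial t t' (\<lambda>j. A $ j $ i)"
  by (simp add: k_product_def torus_monomial_def)

lemma k_product_swap: "k_product A t' t i = torus_monomial t t' (\<lambda>j. - A $ j $ i)"
  unfolding k_product_def torus_monomial_def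
  by (intro arg_cong[of _ _ prod_list] map_cong refl) (auto simp: order.order_iff_strict)

lemma index_list: "distinct (index_list :: 'r::finite list)" "set (index_list :: 'r list) = UNIV"
proof -
  have "\<exists>is :: 'r list. distinct is \<and> set is = UNIV"
    using finite_distinct_list[of "UNIV :: 'r set"] by auto
  then show "distinct (index_list :: 'r list)" "set (index_list :: 'r list) = UNIV"
    unfolding index_list_def by (metis (mono_tags, lifting) someI_ex)+
qed

text \<open>\<open>P x s\<close> is read as a statement about a torus element \<open>x\<close> and
  an exponent \<open>s\<close> that adds up in products, typically the power of q by which
  \<open>x\<close> acts. With all exponents 0 it becomes plain closure of the torus under a
  property.\<close>

lemma torus_monomial_induct:
  fixes s :: "'r::finite \<Rightarrow> rat"
  assumes "P 1 0" "\<And>x y r s. P x r \<Longrightarrow> P y s \<Longrightarrow> P (x * y) (r + s)"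
    and "\<And>j. P (t j) (s j)" "\<And>j. P (t' j) (- s j)"
  shows "P (torus_monomial t t' m) (\<Sum>j\<in>UNIV. of_int (m j) * s j)"
proof -
  have pow: "P (x ^ n) (of_nat n * r)" if "P x r" for x r n
  proof (induction n)
    case (Suc n)
    from assms(2)[OF that Suc] show ?case by (simp add: distrib_right)
  qed (simp add: assms(1))
  have "P (prod_list (map (\<lambda>j. if m j \<ge> 0 then t j ^ nat (m j) else t' j ^ nat (- m j)) L))
      (sum_list (map (\<lambda>j. of_int (m j) * s j) L))" for L
  proof (induction L)
    case (Cons j L)
    have "P (if m j \<ge> 0 then t j ^ nat (m j) else t' j ^ nat (- m j)) (of_int (m j) * s j)"
      using pow[OF assms(3)[of j], of "nat (m j)"] pow[OF assms(4)[of j], of "nat (- m j)"] by (auto simp: of_nat_nat)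
    from assms(2)[OF this Cons.IH] show ?case by simp
  qed (simp add: assms(1))
  from this[of index_list] show ?thesis
    by (simp only: torus_monomial_def sum_list_distinct_conv_sum_set index_list)
qed

lemma torus_monomial_hom:
  fixes m :: "'r::finite \<Rightarrow> int"
  assumes "h 1 = 1" "\<And>x y. h (x * y) = h x * h y"
  shows "h (torus_monomial t t' m) = torus_monomial (\<lambda>i. h (t i)) (\<lambda>i. h (t' i)) m"
proof -
  have pow: "h (x ^ n) = h x ^ n" for x n by (induction n) (simp_all add: assms)
  have "h (prod_list (map g L)) = prod_list (map (\<lambda>j. h (g j)) L)" for g and L :: "'r list"
    by (induction L) (simp_all add: assms)
  then show ?thesis unfolding torus_monomial_def by (simp add: if_distrib[of h] pow cong: if_cong)
qed

locale quantum_cartan =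
  fixes A :: "int ^ 'r ^ 'r::finite" and d :: "'r \<Rightarrow> rat"
  assumes d_pos: "d i > 0"
    and A_diag: "A $ i $ i = 2" and A_offdiag: "i \<noteq> j \<Longrightarrow> A $ i $ j \<le> 0"
    and A_sym: "d i * of_int (A $ i $ j) = d j * of_int (A $ j $ i)"
begin

definition nu :: "'r \<Rightarrow> qfield" where "nu i = 1 / (qpow (d i) - qpow (- d i))"

lemma d_nonzero [simp]: "d i \<noteq> 0"
  using d_pos[of i] by simp

lemma nu_denominator [simp]: "qpow (d i) - qpow (- d i) \<noteq> 0"
  by simp

lemma nu_nonzero [simp]: "nu i \<noteq> 0"
  by (simp add: nu_def)

end

text \<open>The relations without the Serre relations. They are kept apart because the operators on
  words satisfy them while the Serre elements in \<open>f\<close> vanish only on a subspace, and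
  because they alone imply that the Serre elements in \<open>f\<close> commute with every
  \<open>e\<close>, and conversely.\<close>

locale uq_rel = quantum_cartan A d
  for A :: "int ^ 'r ^ 'r::finite" and d :: "'r \<Rightarrow> rat" +
  fixes t t' e f :: "'r \<Rightarrow> 'b::qalgebra"
  assumes tt' [simp]: "t i * t' i = 1" and t't [simp]: "t' i * t i = 1"
    and t_comm: "t i * t j = t j * t i"
    and tet: "t i * e j * t' i = qpow (d i * (if i = j then 1 else 0)) *\<^sub>q e j"
    and tft: "t i * f j * t' i = qpow (- d i * (if i = j then 1 else 0)) *\<^sub>q f j"
    and ef: "e i * f j - f j * e i
      = (if i = j then nu i *\<^sub>q (torus_monomial t t' (\<lambda>j. A $ j $ i) - torus_monomial t t' (\<lambda>j. - A $ j $ i)) else 0)"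

locale uq = uq_rel A d t t' e f
  for A :: "int ^ 'r ^ 'r::finite" and d :: "'r \<Rightarrow> rat" and t t' e f :: "'r \<Rightarrow> 'b::qalgebra" +
  assumes serre_e: "i \<noteq> j \<Longrightarrow> serre_in (A $ i $ j) (d i) (e i) (e j) = 0"
    and serre_f: "i \<noteq> j \<Longrightarrow> serre_in (A $ i $ j) (d i) (f i) (f j) = 0"

lemma (in quantum_cartan) uq_rel_iff:
  fixes y :: "'r gen \<Rightarrow> 'b::qalgebra"
  defines "R \<equiv> uq_relations A d" and "t \<equiv> \<lambda>i. y (T i)" and "t' \<equiv> \<lambda>i. y (T_inv i)"
    and "e \<equiv> \<lambda>i. y (E i)" and "f \<equiv> \<lambda>i. y (F i)"
  shows "(\<forall>r\<in>R. free_eval y r = 0) \<longleftrightarrow>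
     uq_rel A d t t' e f \<and> (\<forall>i j. i \<noteq> j \<longrightarrow> serre_in (A $ i $ j) (d i) (e i) (e j) = 0)
      \<and> (\<forall>i j. i \<noteq> j \<longrightarrow> serre_in (A $ i $ j) (d i) (f i) (f j) = 0)"
proof -
  have k1: "free_eval y (k_product A (\<lambda>i. free_gen (T i)) (\<lambda>i. free_gen (T_inv i)) i) = torus_monomial t t' (\<lambda>j. A $ j $ i)" for i
    unfolding k_product_eq
    by (simp add: torus_monomial_hom[of "free_eval y"] free_eval_mult t_def t'_def)
  have k2: "free_eval y (k_product A (\<lambda>i. free_gen (T_inv i)) (\<lambda>i. free_gen (T i)) i) = torus_monomial t t' (\<lambda>j. - A $ j $ i)" for i
    unfolding k_product_swap
    by (simp add: torus_monomial_hom[of "free_eval y"] free_eval_mult t_def t'_def)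
  have R: "(\<forall>r\<in>R. free_eval y r = 0) \<longleftrightarrow>
      (\<forall>i. t i * t' i = 1) \<and> (\<forall>i. t' i * t i = 1) \<and> (\<forall>i j. t i * t j = t j * t i)
      \<and> (\<forall>i j. t i * e j * t' i = qpow (d i * (if i = j then 1 else 0)) *\<^sub>q e j)
      \<and> (\<forall>i j. t i * f j * t' i = qpow (- d i * (if i = j then 1 else 0)) *\<^sub>q f j)
      \<and> (\<forall>i j. i \<noteq> j \<longrightarrow> e i * f j - f j * e i = 0)
      \<and> (\<forall>i. e i * f i - f i * e i
          = nu i *\<^sub>q (torus_monomial t t' (\<lambda>j. A $ j $ i) - torus_monomial t t' (\<lambda>j. - A $ j $ i)))
      \<and> (\<forall>i j. i \<noteq> j \<longrightarrow> serre_in (A $ i $ j) (d i) (e i) (e j) = 0)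
      \<and> (\<forall>i j. i \<noteq> j \<longrightarrow> serre_in (A $ i $ j) (d i) (f i) (f j) = 0)"
    unfolding R_def uq_relations_def Let_def ball_Un
    by (simp add: imp_ex all_conj_distrib free_eval_serre Ball_def imp_conjL free_eval_simps k1 k2 nu_def
        t_def t'_def e_def f_def scaleq_mult_left)
  show ?thesis unfolding R
    by (auto simp: uq_rel_def uq_rel_axioms_def quantum_cartan_axioms)
qed

context quantum_cartan
begin

definition cc :: "'r \<Rightarrow> 'r \<Rightarrow> rat" where "cc i j = d i * of_int (A $ i $ j)"

lemma cc_commute: "cc i j = cc j i"
  by (simp add: cc_def A_sym)

lemma cc_diag [simp]: "cc i i = 2 * d i"
  by (simp add: cc_def A_diag)

end

context uq_rel
begin

definition kk :: "'r \<Rightarrow> 'b" where "kk i = torus_monomial t t' (\<lambda>j. A $ j $ i)"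
definition kk' :: "'r \<Rightarrow> 'b" where "kk' i = torus_monomial t t' (\<lambda>j. - A $ j $ i)"

abbreviation "tm \<equiv> torus_monomial t t'"

lemma ef_commutator: "e i * f j = f j * e i + (if i = j then nu i *\<^sub>q (kk i - kk' i) else 0)"
  using ef[of i j] by (simp add: kk_def kk'_def algebra_simps)

lemma t_e: "t i * e j = qpow (d i * (if i = j then 1 else 0)) *\<^sub>q (e j * t i)"
proof -
  have "t i * e j = t i * e j * t' i * t i" by (simp add: mult.assoc)
  then show ?thesis by (simp add: tet scaleq_mult_left)
qed

lemma t_f: "t i * f j = qpow (- d i * (if i = j then 1 else 0)) *\<^sub>q (f j * t i)"
proof -
  have "t i * f j = t i * f j * t' i * t i" by (simp add: mult.assoc)
  then show ?thesis by (simp add: tft scaleq_mult_left)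
qed

lemma t'_commute:
  assumes "t i * x = qpow s *\<^sub>q (x * t i)"
  shows "t' i * x = qpow (- s) *\<^sub>q (x * t' i)"
proof -
  have "x * t' i = t' i * (t i * x) * t' i"
    by (simp only: mult.assoc[symmetric] t't mult_1_left)
  also have "\<dots> = qpow s *\<^sub>q (t' i * x)" unfolding assms
    by (simp add: mult.assoc scaleq_mult_left scaleq_mult_right)
  finally show ?thesis by (simp add: scaleq_scaleq)
qed

lemma mult_commute_scaled:
  fixes x :: "'b"
  assumes "y * x = a *\<^sub>q (x * y)" "z * x = b *\<^sub>q (x * z)"
  shows "y * z * x = (a * b) *\<^sub>q (x * (y * z))"
proof -
  have "y * z * x = b *\<^sub>q (y * x * z)" by (simp add: mult.assoc assms(2) scaleq_mult_right)
  also have "\<dots> = (a * b) *\<^sub>q (x * (y * z))" by (simp add: assms(1) scaleq_mult_left mult.assoc mult.commute)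
  finally show ?thesis .
qed

lemma tm_commute:
  assumes "\<And>i. t i * x = qpow (s i) *\<^sub>q (x * t i)"
  shows "tm m * x = qpow (\<Sum>j\<in>UNIV. of_int (m j) * s j) *\<^sub>q (x * tm m)"
  by (rule torus_monomial_induct[of "\<lambda>y r. y * x = qpow r *\<^sub>q (x * y)"])
    (simp_all add: assms t'_commute[OF assms] qpow_add mult_commute_scaled)

lemma tm_commute':
  assumes "\<And>i. t i * x = x * t i"
  shows "tm m * x = x * tm m"
  using tm_commute[of x "\<lambda>_. 0" m] assms by simp

lemma cc_eq: "(\<Sum>l\<in>UNIV. of_int (A $ l $ i) * (d l * (if l = j then 1 else 0))) = cc i j"
  using A_sym[of i j] unfolding cc_def
  by (simp add: if_distrib[of "\<lambda>x. _ * x"] sum.delta mult.commute cong: if_cong)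

lemma kk_e: "kk i * e j = qpow (cc i j) *\<^sub>q (e j * kk i)"
  and kk'_e: "kk' i * e j = qpow (- cc i j) *\<^sub>q (e j * kk' i)"
  unfolding kk_def kk'_def cc_eq[symmetric] by (subst tm_commute[OF t_e]; simp add: sum_negf)+

lemma kk_f: "kk i * f j = qpow (- cc i j) *\<^sub>q (f j * kk i)"
  and kk'_f: "kk' i * f j = qpow (cc i j) *\<^sub>q (f j * kk' i)"
  unfolding kk_def kk'_def cc_eq[symmetric] by (subst tm_commute[OF t_f]; simp add: sum_negf)+

lemma t_t': "t i * t' j = t' j * t i"
  using t'_commute[of j "t i" 0] by (simp add: t_comm)

lemma t'_t': "t' i * t' j = t' j * t' i"
  using t'_commute[of i "t' j" 0] by (simp add: t_t')

lemma t_tm: "t i * tm m = tm m * t i"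
  using tm_commute'[of "t i" m] by (simp add: t_comm)

lemma t'_tm: "t' i * tm m = tm m * t' i"
  using tm_commute'[of "t' i" m] by (simp add: t_t')

lemma tm_tm: "tm m * tm n = tm n * tm m"
  using tm_commute'[of "tm n" m] by (simp add: t_tm)

lemma tm_0: "tm (\<lambda>j. 0) = 1"
proof -
  have "prod_list (map (\<lambda>j. 1 :: 'b) L) = 1" for L :: "'r list" by (induction L) simp_all
  then show ?thesis by (simp add: torus_monomial_def)
qed

lemma tm_add: "tm m * tm n = tm (\<lambda>j. m j + n j)"
proof -
  define pw where "pw j k = (if k \<ge> 0 then t j ^ nat k else t' j ^ nat (- k))" for j k
  have inv: "t j ^ a * t' j ^ a = 1" "t' j ^ a * t j ^ a = 1" for j a
    by (simp_all add: left_right_inverse_power)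
  have add_pos: "pw j (int a) * pw j k = pw j (int a + k)" "pw j (- int a) * pw j k = pw j (- int a + k)" for j a k
  proof -
    have 1: "t j ^ a * pw j k = pw j (int a + k)"
    proof (cases k rule: int_cases4)
      case (neg b)
      then consider "a \<le> b" | "a > b" by linarith
      then show ?thesis
      proof cases
        case 1
        then have "t' j ^ b = t' j ^ a * t' j ^ (b - a)" by (simp flip: power_add)
        with neg 1 show ?thesis by (simp add: pw_def inv nat_minus_as_int of_nat_diff flip: mult.assoc)
      next
        case 2
        then have "t j ^ a = t j ^ (a - b) * t j ^ b" by (simp flip: power_add)
        with neg 2 show ?thesis by (simp add: pw_def inv mult.assoc nat_diff_distrib)
      qed
    qed (simp add: pw_def power_add nat_add_distrib)
    have 2: "t' j ^ a * pw j k = pw j (- int a + k)"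
    proof (cases k rule: int_cases4)
      case (nonneg b)
      then consider "a \<le> b" | "a > b" by linarith
      then show ?thesis
      proof cases
        case 1
        then have "t j ^ b = t j ^ a * t j ^ (b - a)" by (simp flip: power_add)
        with nonneg 1 show ?thesis by (simp add: pw_def inv nat_minus_as_int of_nat_diff flip: mult.assoc)
      next
        case 2
        then have "t' j ^ a = t' j ^ (a - b) * t' j ^ b" by (simp flip: power_add)
        with nonneg 2 show ?thesis by (simp add: pw_def inv mult.assoc nat_diff_distrib)
      qed
    next
      case (neg b)
      then have "t' j ^ a * t' j ^ b = t' j ^ nat (int b + int a)"
        by (simp add: nat_add_distrib add.commute flip: power_add)
      with neg show ?thesis by (simp add: pw_def)
    qed
    show "pw j (int a) * pw j k = pw j (int a + k)" using 1 by (simp add: pw_def)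
    show "pw j (- int a) * pw j k = pw j (- int a + k)" using 2 by (cases "a = 0") (simp_all add: pw_def)
  qed
  have pw_add: "pw j k * pw j l = pw j (k + l)" for j k l
    by (cases k rule: int_cases4) (simp_all add: add_pos)
  have comm: "pw i k * x = x * pw i k" if "t i * x = x * t i" for i k x
  proof -
    have "t i ^ a * x = x * t i ^ a" for a
      using that by (simp add: power_commuting_commutes)
    moreover have "t' i * x = x * t' i" using t'_commute[of i x 0] that by simp
    then have "t' i ^ a * x = x * t' i ^ a" for a
      by (simp add: power_commuting_commutes)
    ultimately show ?thesis by (simp add: pw_def)
  qed
  have t_pw: "t i * pw j k = pw j k * t i" for i j k
    using comm[of j "t i" k] by (simp add: t_comm)
  have tm: "tm m = prod_list (map (\<lambda>j. pw j (m j)) index_list)" for m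
    by (simp add: torus_monomial_def pw_def)
  have "prod_list (map (\<lambda>j. pw j (m j)) L) * prod_list (map (\<lambda>j. pw j (n j)) L)
      = prod_list (map (\<lambda>j. pw j (m j + n j)) L)" for L
  proof (induction L)
    case (Cons i L)
    let ?P = "prod_list (map (\<lambda>j. pw j (m j)) L)" and ?Q = "prod_list (map (\<lambda>j. pw j (n j)) L)"
    have "t i * ?P = ?P * t i" by (induction L) (simp_all add: mult.assoc[symmetric] t_pw, simp add: mult.assoc)
    then have "?P * pw i (n i) = pw i (n i) * ?P" by (rule comm[symmetric])
    moreover have "pw i (m i) * ?P * (pw i (n i) * ?Q) = pw i (m i) * (?P * pw i (n i)) * ?Q"
      by (simp add: mult.assoc)
    moreover have "pw i (m i) * (pw i (n i) * ?P) * ?Q = pw i (m i) * pw i (n i) * (?P * ?Q)"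
      by (simp add: mult.assoc)
    ultimately have "pw i (m i) * ?P * (pw i (n i) * ?Q) = pw i (m i) * pw i (n i) * (?P * ?Q)" by simp
    then show ?case by (simp add: Cons.IH pw_add)
  qed simp
  then show ?thesis by (simp add: tm)
qed

lemma tm_axis: "tm (\<lambda>j. if j = i then 1 else 0) = t i" "tm (\<lambda>j. if j = i then - 1 else 0) = t' i"
proof -
  have "distinct L \<Longrightarrow> prod_list (map (\<lambda>j. if j = i then a else 1) L) = (if i \<in> set L then a else 1)"
    for L and a :: 'b
    by (induction L) auto
  from this[OF index_list(1)] have *: "prod_list (map (\<lambda>j. if j = i then a else 1) index_list) = a" for a :: 'b
    by (simp add: index_list)
  show "tm (\<lambda>j. if j = i then 1 else 0) = t i"
    unfolding torus_monomial_def using *[of "t i"] by (simp add: if_distrib cong: if_cong)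
  show "tm (\<lambda>j. if j = i then - 1 else 0) = t' i"
    unfolding torus_monomial_def using *[of "t' i"] by (simp add: if_distrib cong: if_cong)
qed

lemma kk_kk' [simp]: "kk i * kk' i = 1" "kk' i * kk i = 1"
  by (simp_all add: kk_def kk'_def tm_add tm_0)

lemma kk_comm: "kk i * kk j = kk j * kk i" "kk' i * kk' j = kk' j * kk' i" "kk i * kk' j = kk' j * kk i"
  by (simp_all add: kk_def kk'_def tm_tm)

text \<open>If l differs from i, commuting with \<open>e l\<close> passes to the innermost argument
  \<open>f j\<close>, where it leaves torus elements that the iterated q-commutator annihilates. If
  l = i, the commutators satisfy a recursion whose coefficient vanishes exactly at length 1 -
  a_ij.\<close>

lemma e_commutes_serre_f:
  assumes "i \<noteq> j"
  shows "e l * serre_in (A $ i $ j) (d i) (f i) (f j) = serre_in (A $ i $ j) (d i) (f i) (f j) * e l"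
proof -
  let ?a = "A $ i $ j" and ?N = "nat (1 - A $ i $ j)"
  define z where "z m = qads (f i) (qpow (cc i j)) (qpow (2 * d i)) m (f j)" for m
  have zN: "z ?N = ((- 1) ^ ?N * q_fact (d i) ?N) *\<^sub>q serre_in ?a (d i) (f i) (f j)"
    using qads_eq_serre[of "d i" ?a] A_offdiag[OF assms] by (simp add: z_def cc_def)
  have nz: "(- 1) ^ ?N * q_fact (d i) ?N \<noteq> 0" by (simp add: q_fact_nonzero)
  have N: "of_nat ?N = 1 - (of_int ?a :: rat)" using A_offdiag[OF assms] by (simp add: of_nat_nat)
  have "e l * z ?N = z ?N * e l"
  proof (cases "l = i")
    case False
    then have "e l * f i = f i * e l" by (simp add: ef_commutator)
    from qads_commute[OF this] have comm: "e l * z ?N - z ?N * e l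
        = qads (f i) (qpow (cc i j)) (qpow (2 * d i)) ?N (if l = j then nu l *\<^sub>q (kk l - kk' l) else 0)"
      unfolding z_def by (simp add: ef_commutator)
    have "kk j * f i = qpow (- cc i j) *\<^sub>q (f i * kk j)" by (simp add: kk_f cc_commute)
    \<comment> \<open>For \<open>kk j\<close> it is the factor at s = 0 that vanishes.\<close>
    moreover have "(\<Prod>s<?N. 1 - qpow (cc i j) * qpow (2 * d i) ^ s * qpow (- cc i j)) = 0"
      using A_offdiag[OF assms] by (auto intro!: bexI[of _ 0])
    ultimately have k: "qads (f i) (qpow (cc i j)) (qpow (2 * d i)) ?N (kk j) = 0"
      by (simp only: qads_torus qs.scale_zero_left)
    have "kk' j * f i = qpow (cc i j) *\<^sub>q (f i * kk' j)" by (simp add: kk'_f cc_commute)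
    moreover have "(\<Prod>s<?N. 1 - qpow (cc i j) * qpow (2 * d i) ^ s * qpow (cc i j)) = 0"
    proof -
      \<comment> \<open>For \<open>kk' j\<close> it is the last factor, s = - a_ij, since
        \<open>cc i j\<close> is d_i a_ij.\<close>
      have "cc i j + of_nat (nat (- ?a)) * (2 * d i) + cc i j = 0"
        using A_offdiag[OF assms] by (simp add: cc_def of_nat_nat)
      then have "qpow (cc i j) * qpow (2 * d i) ^ nat (- ?a) * qpow (cc i j) = 1"
        unfolding qpow_power qpow_add[symmetric] by simp
      then show ?thesis using A_offdiag[OF assms] by (auto intro!: bexI[of _ "nat (- ?a)"])
    qed
    ultimately have "qads (f i) (qpow (cc i j)) (qpow (2 * d i)) ?N (kk' j) = 0"
      by (simp only: qads_torus qs.scale_zero_left)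
    with comm k show ?thesis by (simp add: qads_simps split: if_splits)
  next
    case True
    define P where "P m = qpow (cc i j) * qpow (2 * d i) ^ m" for m
    define Q where "Q = qpow (2 * d i)"
    have Q: "Q - 1 \<noteq> 0" "Q \<noteq> 0" by (simp_all add: Q_def)
    \<comment> \<open>The closed solution of C_(m+1) = Q C_m + nu_i (1 - P_m^2) with C_0 = 0, the
      recursion that the commutators of \<open>e i\<close> with the \<open>z m\<close> obey.\<close>
    define C where "C m = nu i * (Q ^ m - 1) * (1 - P 0 ^ 2 * Q ^ m / Q) / (Q - 1)" for m
    have z_Suc: "z (Suc m) = f i * z m - P m *\<^sub>q (z m * f i)" for m
      by (simp add: z_def qad_def P_def)
    have P_eq: "P m = qpow (cc i j + of_nat m * (2 * d i))" for m
      by (simp add: P_def qpow_power qpow_add)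
    have P_Suc: "P (Suc m) = Q * P m" for m by (simp add: P_def Q_def)
    have k: "kk i * z m = inverse (P m) *\<^sub>q (z m * kk i)" and k': "kk' i * z m = P m *\<^sub>q (z m * kk' i)" for m
      using qads_qcomm[OF kk_f[of i i] kk_f[of i j], of _ _ m] qads_qcomm[OF kk'_f[of i i] kk'_f[of i j], of _ _ m]
      by (simp_all add: z_def P_eq qpow_power qpow_minus[symmetric] qpow_add[symmetric] algebra_simps)
    have zk: "z m * kk i = P m *\<^sub>q (kk i * z m)" and zk': "z m * kk' i = inverse (P m) *\<^sub>q (kk' i * z m)" for m
      by (simp_all add: k k' P_eq)
    have kf: "f i * kk i = Q *\<^sub>q (kk i * f i)"
      by (simp add: kk_f scaleq_scaleq Q_def)
    have comm: "e i * z (Suc m) - z (Suc m) * e i = e0" if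
      "e0 = (f i * w - P m *\<^sub>q (w * f i)) + (nu i * (1 - P m ^ 2)) *\<^sub>q (kk i * z m)"
      "e i * z m = z m * e i + w" for m w e0
    proof -
      define X where "X = (kk i - kk' i) * z m"
      define Y where "Y = z m * (kk i - kk' i)"
      have 1: "e i * (f i * z m) = f i * (z m * e i + w) + nu i *\<^sub>q X"
        by (simp only: mult.assoc[symmetric] ef_commutator) (simp add: distrib_right mult.assoc that(2) scaleq_mult_left X_def)
      have 2: "e i * (z m * f i) = z m * f i * e i + nu i *\<^sub>q Y + w * f i"
        by (simp only: mult.assoc[symmetric] that(2))
          (simp add: distrib_right mult.assoc ef_commutator distrib_left scaleq_mult_right Y_def)
      have 3: "nu i *\<^sub>q X - P m *\<^sub>q (nu i *\<^sub>q Y) = (nu i * (1 - P m ^ 2)) *\<^sub>q (kk i * z m)"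
        by (simp add: X_def Y_def right_diff_distrib left_diff_distrib zk zk' scaleq_scaleq qs.scale_right_diff_distrib
            qs.scale_left_diff_distrib power2_eq_square P_eq mult_ac)
      have "e i * z (Suc m) = e i * (f i * z m) - P m *\<^sub>q (e i * (z m * f i))"
        by (simp add: z_Suc right_diff_distrib scaleq_mult_right)
      then show ?thesis
        unfolding that(1) 1 2 3[symmetric]
        by (simp add: z_Suc left_diff_distrib distrib_left scaleq_mult_left qs.scale_right_distrib mult.assoc)
    qed
    have C_Suc: "C (Suc m) = Q * C m + nu i * (1 - P m ^ 2)" for m
    proof -
      have "P m = P 0 * Q ^ m" by (simp add: P_def Q_def)
      then show ?thesis using Q by (simp add: C_def field_simps power2_eq_square)
    qed
    have main: "e i * z (Suc m) - z (Suc m) * e i = C (Suc m) *\<^sub>q (kk i * z m)" for m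
    proof (induction m)
      case 0
      have "e i * z 0 = z 0 * e i + 0" using assms by (simp add: z_def ef_commutator)
      then show ?case by (intro comm[where w = 0]) (simp_all add: C_Suc, simp add: C_def)
    next
      case (Suc m)
      let ?w = "C (Suc m) *\<^sub>q (kk i * z m)"
      have w: "e i * z (Suc m) = z (Suc m) * e i + ?w" using Suc by (simp add: algebra_simps)
      have "f i * (kk i * z m) = Q *\<^sub>q (kk i * (f i * z m))"
        by (simp only: mult.assoc[symmetric] kf scaleq_mult_left)
      then have "f i * ?w - P (Suc m) *\<^sub>q (?w * f i) = (Q * C (Suc m)) *\<^sub>q (kk i * z (Suc m))"
        by (simp add: z_Suc P_Suc right_diff_distrib scaleq_mult_left scaleq_mult_right scaleq_scaleq
            qs.scale_right_diff_distrib mult.assoc) (simp add: mult_ac)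
      then show ?case
        by (intro comm[OF _ w]) (simp add: C_Suc[of "Suc m"] qs.scale_left_distrib)
    qed
    \<comment> \<open>The exponent is 2 d_i a_ij + 2 d_i (N - 1), and N - 1 = - a_ij. This is what
      makes the coefficient \<open>C ?N\<close> vanish.\<close>
    have "P 0 ^ 2 * Q ^ ?N / Q = 1"
    proof -
      have "P 0 ^ 2 * Q ^ ?N = qpow (cc i j + (cc i j + of_nat ?N * (2 * d i)))"
        unfolding P_def Q_def power2_eq_square qpow_add qpow_power by simp
      also have "cc i j + (cc i j + of_nat ?N * (2 * d i)) = 2 * d i"
        unfolding N by (simp add: cc_def algebra_simps)
      finally show ?thesis by (simp add: Q_def)
    qed
    then have "C ?N = 0" by (simp add: C_def)
    moreover have "?N = Suc (?N - 1)" using A_offdiag[OF assms] by simp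
    ultimately have "e i * z ?N - z ?N * e i = 0" using main[of "?N - 1"] by simp
    then show ?thesis using True by simp
  qed
  then have "((- 1) ^ ?N * q_fact (d i) ?N) *\<^sub>q (e l * serre_in ?a (d i) (f i) (f j)
      - serre_in ?a (d i) (f i) (f j) * e l) = 0"
    unfolding zN by (simp add: scaleq_mult_left scaleq_mult_right qs.scale_right_diff_distrib)
  then show ?thesis using nz by simp
qed

text \<open>Exchanging \<open>e\<close> with \<open>f\<close> and \<open>t\<close> with
  \<open>t'\<close> turns the relations into each other. It yields the statements about Serre
  elements in \<open>e\<close> from those in \<open>f\<close>, and it underlies the automorphism
  theta.\<close>

lemma uq_rel_dual: "uq_rel A d t' t f e"
proof
  fix i j
  have swap: "torus_monomial t' t m = tm (\<lambda>j. - m j)" for m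
    unfolding torus_monomial_def
    by (intro arg_cong[of _ _ prod_list] map_cong refl) (auto simp: order.order_iff_strict)
  show "t' i * t' j = t' j * t' i" by (rule t'_t')
  show "t' i * f j * t i = qpow (d i * (if i = j then 1 else 0)) *\<^sub>q f j"
    using t'_commute[OF t_f[of i j]] by (simp add: scaleq_mult_left mult.assoc)
  show "t' i * e j * t i = qpow (- d i * (if i = j then 1 else 0)) *\<^sub>q e j"
    using t'_commute[OF t_e[of i j]] by (simp add: scaleq_mult_left mult.assoc)
  show "f i * e j - e j * f i = (if i = j then nu i *\<^sub>q (torus_monomial t' t (\<lambda>j. A $ j $ i) -
      torus_monomial t' t (\<lambda>j. - A $ j $ i)) else 0)"
    unfolding swap using ef_commutator[of j i] by (simp add: kk_def kk'_def algebra_simps qs.scale_right_diff_distrib)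
qed simp_all

end

lemma (in uq_rel) f_commutes_serre_e:
  assumes "i \<noteq> j"
  shows "f l * serre_in (A $ i $ j) (d i) (e i) (e j) = serre_in (A $ i $ j) (d i) (e i) (e j) * f l"
proof -
  interpret dual: uq_rel A d t' t f e by (rule uq_rel_dual)
  show ?thesis by (rule dual.e_commutes_serre_f[OF assms])
qed

section \<open>The Hopf algebra structure\<close>

lemma serre_in_hom:
  assumes "qlinear h" "h 1 = 1" "\<And>x y. h (x * y) = h x * h y"
  shows "h (serre_in a d x y) = serre_in a d (h x) (h y)"
proof -
  have pow: "h (x ^ n) = h x ^ n" for x n by (induction n) (simp_all add: assms)
  show ?thesis by (simp add: serre_in_def Let_def lin_simps[OF assms(1)] assms pow)
qed

lemma serre_in_scale:
  "serre_in a d (c *\<^sub>q x) (c' *\<^sub>q y) = (c ^ nat (1 - a) * c') *\<^sub>q serre_in a d x y"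
proof -
  have pow: "(c *\<^sub>q x) ^ n = c ^ n *\<^sub>q x ^ n" for n
    by (induction n) (simp_all add: scaleq_mult_left scaleq_mult_right mult.commute)
  have "c ^ nat (1 - a) = c ^ m * c ^ (nat (1 - a) - m)" if "m \<le> nat (1 - a)" for m
    using that by (simp flip: power_add)
  then show ?thesis
    by (auto simp: serre_in_def Let_def pow scaleq_mult_left scaleq_mult_right qs.scale_sum_right
        intro!: sum.cong)
qed

lemma tensor_power: "(x \<otimes>\<^sub>q y) ^ n = x ^ n \<otimes>\<^sub>q y ^ n"
  by (induction n) (simp_all add: one_tensor_def)

text \<open>Commuting first legs can be collected in any order, so all monomials of the Serre sum
  share the same first leg. This treats the summands of a coproduct that have a torus element or 1
  in one leg.\<close>

lemma serre_in_tensor_left: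
  assumes "x * x' = x' * x"
  shows "serre_in a d (x \<otimes>\<^sub>q y) (x' \<otimes>\<^sub>q y') = (x ^ nat (1 - a) * x') \<otimes>\<^sub>q serre_in a d y y'"
proof -
  have "x ^ m * x' * x ^ (n - m) = x ^ n * x'" if "m \<le> n" for m n
    using that assms by (metis le_add_diff_inverse mult.assoc power_add power_commuting_commutes)
  then show ?thesis
    by (simp add: serre_in_def Let_def tensor_power tensor_simps)
qed

lemma serre_in_tensor_right:
  assumes "y * y' = y' * y"
  shows "serre_in a d (x \<otimes>\<^sub>q y) (x' \<otimes>\<^sub>q y') = serre_in a d x x' \<otimes>\<^sub>q (y ^ nat (1 - a) * y')"
proof -
  have "y ^ m * y' * y ^ (n - m) = y ^ n * y'" if "m \<le> n" for m n
    using that assms by (metis le_add_diff_inverse mult.assoc power_add power_commuting_commutes)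
  then show ?thesis
    by (simp add: serre_in_def Let_def tensor_power tensor_simps)
qed

lemma torus_monomial_tensor:
  "torus_monomial (\<lambda>i. t i \<otimes>\<^sub>q s i) (\<lambda>i. t' i \<otimes>\<^sub>q s' i) m = torus_monomial t t' m \<otimes>\<^sub>q torus_monomial s s' m"
proof -
  have "prod_list (map (\<lambda>j. g j \<otimes>\<^sub>q h j) L) = prod_list (map g L) \<otimes>\<^sub>q prod_list (map h L)" for g h L
    by (induction L) (simp_all add: one_tensor_def)
  note * = this[symmetric]
  show ?thesis
    unfolding torus_monomial_def * by (rule arg_cong[of _ _ prod_list]) (auto simp: tensor_power)
qed

lemma prod_list_antihom:
  assumes "h 1 = 1" "\<And>x y. h (x * y) = h y * h x" "\<And>i j. g i * g j = g j * g i"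
  shows "h (prod_list (map g L)) = prod_list (map (\<lambda>i. h (g i)) L)"
proof (induction L)
  case (Cons i L)
  have "prod_list (map g L) * g i = g i * prod_list (map g L)"
    by (induction L) (simp_all add: mult.assoc assms(3)[of _ i], simp add: assms(3) flip: mult.assoc)
  then have "h (g i * prod_list (map g L)) = h (g i) * h (prod_list (map g L))"
    using assms(2) by metis
  then show ?case by (simp add: Cons.IH)
qed (simp add: assms)

text \<open>Torus factors can be moved to the left at the cost of scalars. The same scalar
  \<open>b\<close> for \<open>x\<close> past \<open>\<mu>\<close> and for \<open>y\<close> past
  \<open>\<kappa>\<close> reflects the symmetry of d_i a_ij; it makes both terms of each
  q-commutator acquire the same factor.\<close>

lemma qads_twist:
  assumes "\<kappa> * \<mu> = \<mu> * \<kappa>" "x * \<kappa> = a *\<^sub>q (\<kappa> * x)" "x * \<mu> = b *\<^sub>q (\<mu> * x)" "y * \<kappa> = b *\<^sub>q (\<kappa> * y)"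
  shows "\<exists>s. qads (\<kappa> * x) u r m (\<mu> * y) = s *\<^sub>q (\<kappa> ^ m * \<mu> * qads x u r m y)"
proof -
  have xk: "x * (\<kappa> ^ m * \<mu>) = (a ^ m * b) *\<^sub>q (\<kappa> ^ m * \<mu> * x)" for m
  proof (induction m)
    case (Suc m)
    from qcomm_mult[OF assms(2) Suc] show ?case by (simp add: mult.assoc)
  qed (simp add: assms)
  have zk: "qads x u r m y * \<kappa> = (a ^ m * b) *\<^sub>q (\<kappa> * qads x u r m y)" for m
  proof (induction m)
    case (Suc m)
    let ?z = "qads x u r m y"
    have "x * ?z * \<kappa> = x * (?z * \<kappa>)" "?z * x * \<kappa> = ?z * (x * \<kappa>)" by (simp_all add: mult.assoc)
    moreover have "x * (\<kappa> * ?z) = a *\<^sub>q (\<kappa> * (x * ?z))" "?z * (\<kappa> * x) = (a ^ m * b) *\<^sub>q (\<kappa> * (?z * x))"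
      by (simp_all only: mult.assoc[symmetric] assms Suc scaleq_mult_left)
    ultimately show ?case
      by (simp add: qad_def right_diff_distrib left_diff_distrib scaleq_mult_left scaleq_mult_right Suc assms
          qs.scale_right_diff_distrib mult_ac)
  qed (simp add: assms)
  have "\<kappa> ^ m * \<mu> * \<kappa> = \<kappa> ^ m * \<kappa> * \<mu>" for m
    by (simp add: mult.assoc assms(1))
  then have comm: "\<kappa> * (\<kappa> ^ m * \<mu>) = \<kappa> ^ Suc m * \<mu>" "\<kappa> ^ m * \<mu> * \<kappa> = \<kappa> ^ Suc m * \<mu>" for m
    by (simp_all add: mult.assoc[symmetric] power_commutes)
  show ?thesis
  proof (induction m)
    case (Suc m)
    define z where "z = qads x u r m y"
    define k where "k = \<kappa> ^ m * \<mu>"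
    obtain s where s: "qads (\<kappa> * x) u r m (\<mu> * y) = s *\<^sub>q (k * z)" using Suc unfolding k_def z_def by blast
    have xk: "x * k = (a ^ m * b) *\<^sub>q (k * x)" and zk: "z * \<kappa> = (a ^ m * b) *\<^sub>q (\<kappa> * z)"
      and comm: "\<kappa> * k = \<kappa> ^ Suc m * \<mu>" "k * \<kappa> = \<kappa> ^ Suc m * \<mu>"
      unfolding k_def z_def by (rule xk zk comm)+
    have "\<kappa> * x * (k * z) = \<kappa> * (x * k) * z" by (simp only: mult.assoc)
    also have "\<dots> = (a ^ m * b) *\<^sub>q ((\<kappa> * k) * (x * z))"
      by (simp only: xk scaleq_mult_right scaleq_mult_left) (simp only: mult.assoc)
    finally have 1: "\<kappa> * x * (k * z) = (a ^ m * b) *\<^sub>q (\<kappa> ^ Suc m * \<mu> * (x * z))" unfolding comm .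
    have "k * z * (\<kappa> * x) = k * (z * \<kappa>) * x" by (simp only: mult.assoc)
    also have "\<dots> = (a ^ m * b) *\<^sub>q ((k * \<kappa>) * (z * x))"
      by (simp only: zk scaleq_mult_right scaleq_mult_left) (simp only: mult.assoc)
    finally have 2: "k * z * (\<kappa> * x) = (a ^ m * b) *\<^sub>q (\<kappa> ^ Suc m * \<mu> * (z * x))" unfolding comm .
    have "qad (\<kappa> * x) p (k * z) = (a ^ m * b) *\<^sub>q (\<kappa> ^ Suc m * \<mu> * qad x p z)" for p
      by (simp only: qad_def 1 2 right_diff_distrib scaleq_mult_right qs.scale_right_diff_distrib qs.scale_left_commute)
    then have "qads (\<kappa> * x) u r (Suc m) (\<mu> * y) = (s * (a ^ m * b)) *\<^sub>q (\<kappa> ^ Suc m * \<mu> * qads x u r (Suc m) y)"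
      by (simp only: qads.simps s qad_simps z_def[symmetric] qs.scale_scale)
    then show ?case by blast
  qed (auto intro!: exI[of _ 1])
qed

lemma serre_in_twist:
  assumes "d \<noteq> 0" "n \<le> 0" "serre_in n d x y = 0"
    and "\<kappa> * \<mu> = \<mu> * \<kappa>" "x * \<kappa> = a *\<^sub>q (\<kappa> * x)" "x * \<mu> = b *\<^sub>q (\<mu> * x)" "y * \<kappa> = b *\<^sub>q (\<kappa> * y)"
  shows "serre_in n d (\<kappa> * x) (\<mu> * y) = 0"
  using qads_twist[OF assms(4-7), of "qpow (d * of_int n)" "qpow (2 * d)" "nat (1 - n)"] assms(1-3)
  by (auto simp: serre_in_eq_0_iff)

text \<open>Reversing all products exchanges m and N - m, and the Serre coefficients are symmetric
  under this exchange up to (-1)^N.\<close>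

lemma serre_in_Opp: "serre_in a d (Opp x) (Opp y) = (- 1) ^ nat (1 - a) *\<^sub>q Opp (serre_in a d x y)"
proof -
  define N where "N = nat (1 - a)"
  have lin: "qlinear Opp" by (intro qlinearI) (simp_all add: plus_opp.abs_eq scaleq_opp.abs_eq)
  have mult: "Opp u * Opp v = Opp (v * u)" for u v :: 'a by (simp add: times_opp.abs_eq)
  have pow: "Opp x ^ n = Opp (x ^ n)" for n
    by (induction n) (simp_all add: one_opp_def mult power_commutes)
  have "serre_in a d (Opp x) (Opp y)
      = (\<Sum>m = 0..N. ((- 1) ^ m / (q_fact d m * q_fact d (N - m))) *\<^sub>q Opp (x ^ (N - m) * y * x ^ m))"
    by (simp add: serre_in_def Let_def N_def[symmetric] mult pow mult.assoc)
  also have "\<dots> = (\<Sum>m = 0..N. ((- 1) ^ (N - m) / (q_fact d (N - m) * q_fact d m)) *\<^sub>q Opp (x ^ m * y * x ^ (N - m)))"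
    by (rule sum.reindex_bij_witness[of _ "\<lambda>m. N - m" "\<lambda>m. N - m"]) auto
  also have "\<dots> = (\<Sum>m = 0..N. (- 1) ^ N *\<^sub>q (((- 1) ^ m / (q_fact d m * q_fact d (N - m))) *\<^sub>q Opp (x ^ m * y * x ^ (N - m))))"
  proof (rule sum.cong)
    fix m assume "m \<in> {0..N}"
    then have "(- 1) ^ (N - m) = (- 1) ^ N * (- 1 :: qfield) ^ m"
      by (simp add: power_add[symmetric] minus_one_power_iff)
    then show "((- 1) ^ (N - m) / (q_fact d (N - m) * q_fact d m)) *\<^sub>q Opp (x ^ m * y * x ^ (N - m))
        = (- 1) ^ N *\<^sub>q (((- 1) ^ m / (q_fact d m * q_fact d (N - m))) *\<^sub>q Opp (x ^ m * y * x ^ (N - m)))"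
      by (simp add: scaleq_scaleq mult.commute)
  qed simp
  finally show ?thesis
    by (simp add: serre_in_def Let_def N_def[symmetric] lin_simps[OF lin] qs.scale_sum_right)
qed

section \<open>The structure maps of the quantized enveloping algebra\<close>

locale qea =
  fixes G :: "('r::finite, 'u::qalgebra) qgroup"
  assumes qea: "quantized_enveloping_algebra G"
begin

abbreviation "A \<equiv> cartan G"
abbreviation "B \<equiv> sform G"
abbreviation "d \<equiv> dd G"

lemma presented: "presented_by (generator G) (uq_relations A d)"
  using qea by (simp add: quantized_enveloping_algebra_def)

lemma sform: "B (x + y) z = B x z + B y z" "B (c *s x) z = c * B x z" "B x y = B y x" "x \<noteq> 0 \<Longrightarrow> B x x > 0"
  and sform_invariant: "B (simple_reflection A i x) (simple_reflection A i y) = B x y"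
  using qea by (auto simp: quantized_enveloping_algebra_def normalized_scalar_product_def invariant_scalar_product_def)

lemma sform_zero [simp]: "B 0 z = 0" "B z 0 = 0"
  using sform(2)[of 0 0 z] by (simp_all add: sform(3)[of z])

lemma sform_right: "B z (x + y) = B z x + B z y" "B z (c *s x) = c * B z x"
  by (simp_all add: sform(1,2) sform(3)[of z])

lemma sform_minus: "B (- x) z = - B x z" "B z (- x) = - B z x" "B (x - y) z = B x z - B y z" "B z (x - y) = B z x - B z y"
proof -
  show 1: "B (- x) z = - B x z" for x z using sform(1)[of x "- x" z] by simp
  then show 2: "B z (- x) = - B z x" for x z by (simp add: sform(3)[of z])
  show "B (x - y) z = B x z - B y z" using sform(1)[of x "- y" z] 1 by simp
  show "B z (x - y) = B z x - B z y" using sform_right(1)[of z x "- y"] 2 by simp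
qed

text \<open>The i-th reflection negates alpha_i and subtracts a_ij alpha_i from alpha_j. Invariance
  of the scalar product under it is a linear equation for the value.\<close>

lemma sform_simple: "B (simple_root i) (simple_root j) = d i * of_int (A $ i $ j)"
proof -
  have pairing: "coroot_pairing A (simple_root j) i = of_int (A $ i $ j)" for i j
    by (simp add: coroot_pairing_def simple_root_def axis_def if_distrib[of "\<lambda>x. x * _"] cong: if_cong)
  have diag: "A $ i $ i = 2"
    using qea by (auto simp: quantized_enveloping_algebra_def finite_type_cartan_def)
  have "B (simple_root i) (simple_root j)
      = B (simple_reflection A i (simple_root i)) (simple_reflection A i (simple_root j))"
    by (simp add: sform_invariant)
  also have "simple_reflection A i (simple_root i) = - simple_root i"
    by (simp add: simple_reflection_def pairing diag vec_eq_iff)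
  also have "simple_reflection A i (simple_root j) = simple_root j - of_int (A $ i $ j) *s simple_root i"
    by (simp add: simple_reflection_def pairing)
  finally show ?thesis
    by (simp add: sform_minus sform_right dd_def half_norm_def field_simps)
qed

lemma simple_root_nonzero: "simple_root i \<noteq> (0 :: 'r weight)"
  by (simp add: simple_root_def axis_eq_0_iff)

sublocale quantum_cartan A d
proof
  show "d i > 0" for i using sform(4)[OF simple_root_nonzero[of i]] by (simp add: dd_def half_norm_def)
  show "A $ i $ i = 2" for i
    using qea by (auto simp: quantized_enveloping_algebra_def finite_type_cartan_def)
  show "i \<noteq> j \<Longrightarrow> A $ i $ j \<le> 0" for i j
    using qea by (auto simp: quantized_enveloping_algebra_def finite_type_cartan_def)
  show "d i * of_int (A $ i $ j) = d j * of_int (A $ j $ i)" for i j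
    using sform_simple[of i j] sform_simple[of j i] sform(3) by metis
qed

sublocale uq A d "t_gen G" "t_inv G" "e_gen G" "f_gen G"
proof -
  have "\<forall>r\<in>uq_relations A d. free_eval (generator G) r = 0"
    using presented_relation[OF presented] by blast
  then show "uq A d (t_gen G) (t_inv G) (e_gen G) (f_gen G)"
    unfolding uq_rel_iff t_gen_def[symmetric] t_inv_def[symmetric] e_gen_def[symmetric] f_gen_def[symmetric]
    by (auto simp: uq_def uq_axioms_def)
qed

abbreviation "t \<equiv> t_gen G"
abbreviation "t' \<equiv> t_inv G"
abbreviation "e \<equiv> e_gen G"
abbreviation "f \<equiv> f_gen G"

lemma cc_sform: "cc i j = B (simple_root i) (simple_root j)"
  by (simp add: cc_def sform_simple)

lemma k_gen_eq [simp]: "k_gen G = kk" "k_inv G = kk'"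
  by (intro ext, simp add: k_gen_def k_product_eq kk_def, intro ext, simp add: k_inv_def k_product_swap kk'_def)

lemma left_closed:
  assumes "qs.subspace S" "1 \<in> S"
    and "\<And>i u. u \<in> S \<Longrightarrow> t i * u \<in> S" "\<And>i u. u \<in> S \<Longrightarrow> t' i * u \<in> S"
      "\<And>i u. u \<in> S \<Longrightarrow> e i * u \<in> S" "\<And>i u. u \<in> S \<Longrightarrow> f i * u \<in> S"
  shows "u \<in> S"
proof (rule presented_left_closed[OF presented assms(1,2)])
  show "generator G g * u \<in> S" if "u \<in> S" for g u
    using assms(3-6)[OF that] by (cases g) (auto simp: t_gen_def t_inv_def e_gen_def f_gen_def)
qed

lemma hom_exists:
  fixes s s' x y :: "'r \<Rightarrow> 'v::qalgebra"
  assumes "uq A d s s' x y"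
  shows "\<exists>h :: 'u \<Rightarrow> 'v. qlinear h \<and> h 1 = 1 \<and> (\<forall>a b. h (a * b) = h a * h b)
    \<and> (\<forall>i. h (t i) = s i) \<and> (\<forall>i. h (t' i) = s' i) \<and> (\<forall>i. h (e i) = x i) \<and> (\<forall>i. h (f i) = y i)"
proof -
  define g where "g = case_gen s s' x y"
  have "\<forall>r\<in>uq_relations A d. free_eval g r = 0"
    using assms unfolding uq_rel_iff g_def by (simp add: uq_def uq_axioms_def)
  then have R: "r \<in> uq_relations A d \<Longrightarrow> free_eval g r = 0" for r by blast
  obtain h :: "'u \<Rightarrow> 'v" where h: "qlinear h" "h 1 = 1" "\<forall>a b. h (a * b) = h a * h b" "\<forall>k. h (generator G k) = g k"
    using presented_hom[OF presented R] by metis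
  show ?thesis
    using h by (intro exI[of _ h]) (simp add: t_gen_def t_inv_def e_gen_def f_gen_def g_def)
qed

text \<open>The structure maps are specified on t_i, e_i, f_i only. Their values on the inverse of
  t_i are forced, for homomorphisms and antihomomorphisms alike.\<close>

lemma inverse_agree:
  assumes "h 1 = 1" "h' 1 = (1 :: 'a::monoid_mult)" "h (t i) = h' (t i)"
    and "(\<forall>a b. h (a * b) = h a * h b) \<and> (\<forall>a b. h' (a * b) = h' a * h' b)
      \<or> (\<forall>a b. h (a * b) = h b * h a) \<and> (\<forall>a b. h' (a * b) = h' b * h' a)"
  shows "h (t' i) = h' (t' i)"
proof -
  have "h (t' i) * h (t i) = 1" "h' (t i) * h' (t' i) = 1"
    using assms(1,2,4) tt'[of i] t't[of i] by metis+
  then show ?thesis using assms(3) by (metis mult.assoc mult_1_left mult_1_right)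
qed

end

lemma subspace_equalizer:
  assumes "Vector_Spaces.linear scaleq s f" "Vector_Spaces.linear scaleq s g"
  shows "qs.subspace {u. f u = g u}"
  using lin_simps[OF assms(1)] lin_simps[OF assms(2)] by (simp add: qs.subspace_def)

context qea
begin

lemma torus_monomial_swap: "torus_monomial t' t m = tm (\<lambda>j. - m j)"
  unfolding torus_monomial_def
  by (intro arg_cong[of _ _ prod_list] map_cong refl) (auto simp: order.order_iff_strict)

text \<open>The two summands in the coproduct of \<open>e i\<close> or \<open>f i\<close> satisfy
  the Serre relation separately and q-commute with each other; this is the situation of
  \<open>serre_in_sum\<close>.\<close>

lemma coproduct_uq:
  "uq A d (\<lambda>i. t i \<otimes>\<^sub>q t i) (\<lambda>i. t' i \<otimes>\<^sub>q t' i) (\<lambda>i. e i \<otimes>\<^sub>q 1 + kk i \<otimes>\<^sub>q e i) (\<lambda>i. f i \<otimes>\<^sub>q kk' i + 1 \<otimes>\<^sub>q f i)"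
proof
  fix i j
  show "t i \<otimes>\<^sub>q t i * (t' i \<otimes>\<^sub>q t' i) = 1" "t' i \<otimes>\<^sub>q t' i * (t i \<otimes>\<^sub>q t i) = 1"
    by (simp_all add: one_tensor_def)
  show "t i \<otimes>\<^sub>q t i * (t j \<otimes>\<^sub>q t j) = t j \<otimes>\<^sub>q t j * (t i \<otimes>\<^sub>q t i)"
    by (simp add: t_comm)
  have "t i * kk j * t' i = kk j" "t i * kk' j * t' i = kk' j"
    unfolding kk_def kk'_def t_tm by (simp_all add: mult.assoc)
  then show "t i \<otimes>\<^sub>q t i * (e j \<otimes>\<^sub>q 1 + kk j \<otimes>\<^sub>q e j) * (t' i \<otimes>\<^sub>q t' i)
      = qpow (d i * (if i = j then 1 else 0)) *\<^sub>q (e j \<otimes>\<^sub>q 1 + kk j \<otimes>\<^sub>q e j)"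
    and "t i \<otimes>\<^sub>q t i * (f j \<otimes>\<^sub>q kk' j + 1 \<otimes>\<^sub>q f j) * (t' i \<otimes>\<^sub>q t' i)
      = qpow (- d i * (if i = j then 1 else 0)) *\<^sub>q (f j \<otimes>\<^sub>q kk' j + 1 \<otimes>\<^sub>q f j)"
    unfolding distrib_left distrib_right tensor_times_pure
    by (simp_all only: tet tft tensor_scale_left tensor_scale_right qs.scale_right_distrib mult_1_right tt')
  show "(e i \<otimes>\<^sub>q 1 + kk i \<otimes>\<^sub>q e i) * (f j \<otimes>\<^sub>q kk' j + 1 \<otimes>\<^sub>q f j) - (f j \<otimes>\<^sub>q kk' j + 1 \<otimes>\<^sub>q f j) * (e i \<otimes>\<^sub>q 1 + kk i \<otimes>\<^sub>q e i)
      = (if i = j then nu i *\<^sub>q (torus_monomial (\<lambda>i. t i \<otimes>\<^sub>q t i) (\<lambda>i. t' i \<otimes>\<^sub>q t' i) (\<lambda>j. A $ j $ i)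
          - torus_monomial (\<lambda>i. t i \<otimes>\<^sub>q t i) (\<lambda>i. t' i \<otimes>\<^sub>q t' i) (\<lambda>j. - A $ j $ i)) else 0)"
  proof -
    \<comment> \<open>The power of q from \<open>kk i\<close> passing \<open>f j\<close> in the
      first leg cancels the one from \<open>e i\<close> passing \<open>kk' j\<close> in the
      second.\<close>
    have mixed: "(kk i * f j) \<otimes>\<^sub>q (e i * kk' j) = (f j * kk i) \<otimes>\<^sub>q (kk' j * e i)"
      by (simp add: kk_f kk'_e cc_commute[of j i] tensor_simps)
    have "(e i \<otimes>\<^sub>q 1 + kk i \<otimes>\<^sub>q e i) * (f j \<otimes>\<^sub>q kk' j + 1 \<otimes>\<^sub>q f j) - (f j \<otimes>\<^sub>q kk' j + 1 \<otimes>\<^sub>q f j) * (e i \<otimes>\<^sub>q 1 + kk i \<otimes>\<^sub>q e i)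
        = (e i * f j - f j * e i) \<otimes>\<^sub>q kk' j + kk i \<otimes>\<^sub>q (e i * f j - f j * e i)"
      by (simp add: distrib_left distrib_right mixed tensor_simps)
    then show ?thesis
      unfolding torus_monomial_tensor kk_def[symmetric] kk'_def[symmetric]
      by (simp add: ef_commutator tensor_simps qs.scale_right_diff_distrib)
  qed
next
  fix i j :: 'r assume ij: "i \<noteq> j"
  have lin: "qlinear (\<lambda>x. x \<otimes>\<^sub>q (1::'u))" "qlinear (\<lambda>x. (1::'u) \<otimes>\<^sub>q x)"
    by (rule qlinear_tensor_left qlinear_tensor_right)+
  have pure: "serre_in (A $ i $ j) (d i) (x \<otimes>\<^sub>q (1::'u)) (y \<otimes>\<^sub>q 1) = serre_in (A $ i $ j) (d i) x y \<otimes>\<^sub>q 1"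
    "serre_in (A $ i $ j) (d i) ((1::'u) \<otimes>\<^sub>q x) (1 \<otimes>\<^sub>q y) = 1 \<otimes>\<^sub>q serre_in (A $ i $ j) (d i) x y" for x y :: 'u
    using serre_in_hom[OF lin(1), of "A $ i $ j" "d i" x y] serre_in_hom[OF lin(2), of "A $ i $ j" "d i" x y]
    by (simp_all add: one_tensor_def)
  note simps = kk_e kk_f kk'_e kk'_f tensor_simps pure kk_comm serre_in_tensor_left serre_in_tensor_right
    serre_e[OF ij] serre_f[OF ij] A_offdiag[OF ij] cc_commute[of j i]
  show "serre_in (A $ i $ j) (d i) (e i \<otimes>\<^sub>q 1 + kk i \<otimes>\<^sub>q e i) (e j \<otimes>\<^sub>q 1 + kk j \<otimes>\<^sub>q e j) = 0"
    by (rule serre_in_sum) (simp_all add: simps, simp_all add: cc_def)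
  \<comment> \<open>The summand with 1 in the first leg comes first here, because
    \<open>serre_in_sum\<close> wants the second summand to pass the first with a positive power,
    and \<open>kk' i\<close> passes \<open>f i\<close> in this way.\<close>
  have "serre_in (A $ i $ j) (d i) (1 \<otimes>\<^sub>q f i + f i \<otimes>\<^sub>q kk' i) (1 \<otimes>\<^sub>q f j + f j \<otimes>\<^sub>q kk' j) = 0"
    by (rule serre_in_sum) (simp_all add: simps, simp_all add: cc_def)
  then show "serre_in (A $ i $ j) (d i) (f i \<otimes>\<^sub>q kk' i + 1 \<otimes>\<^sub>q f i) (f j \<otimes>\<^sub>q kk' j + 1 \<otimes>\<^sub>q f j) = 0"
    by (simp add: add.commute)
qed

lemma coproduct:
  shows coproduct_linear: "qlinear (coproduct G)" and coproduct_1: "coproduct G 1 = 1"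
    and coproduct_mult: "coproduct G (x * y) = coproduct G x * coproduct G y"
    and coproduct_t: "coproduct G (t i) = t i \<otimes>\<^sub>q t i"
    and coproduct_e: "coproduct G (e i) = e i \<otimes>\<^sub>q 1 + kk i \<otimes>\<^sub>q e i"
    and coproduct_f: "coproduct G (f i) = f i \<otimes>\<^sub>q kk' i + 1 \<otimes>\<^sub>q f i"
    and coproduct_t': "coproduct G (t' i) = t' i \<otimes>\<^sub>q t' i"
proof -
  let ?P = "\<lambda>D. qlinear D \<and> D 1 = 1 \<otimes>\<^sub>q 1 \<and> (\<forall>x y. D (x * y) = tensor_times (D x) (D y)) \<and>
     (\<forall>i. D (t i) = t i \<otimes>\<^sub>q t i) \<and> (\<forall>i. D (e i) = e i \<otimes>\<^sub>q 1 + kk i \<otimes>\<^sub>q e i) \<and>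
     (\<forall>i. D (f i) = f i \<otimes>\<^sub>q kk' i + 1 \<otimes>\<^sub>q f i)"
  obtain h where h: "?P h" and ht': "\<forall>i. h (t' i) = t' i \<otimes>\<^sub>q t' i"
    using hom_exists[OF coproduct_uq] unfolding tensor_times_eq one_tensor_def by blast
  have unique: "D = h" if D: "?P D" for D
  proof
    fix u
    have "D (t' i) = h (t' i)" for i
      by (rule inverse_agree) (use D h in \<open>auto simp: tensor_times_eq one_tensor_def\<close>)
    moreover have "qs.subspace {u. D u = h u}"
      using conjunct1[OF D] conjunct1[OF h] by (rule subspace_equalizer)
    ultimately have "u \<in> {u. D u = h u}"
      by - (rule left_closed, use D h in auto)
    then show "D u = h u" by simp
  qed
  have "coproduct G = h"
    unfolding coproduct_def k_gen_eq using h unique by (intro the_equality) blast+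
  then show "qlinear (coproduct G)" "coproduct G 1 = 1" "coproduct G (x * y) = coproduct G x * coproduct G y"
    "coproduct G (t i) = t i \<otimes>\<^sub>q t i" "coproduct G (e i) = e i \<otimes>\<^sub>q 1 + kk i \<otimes>\<^sub>q e i"
    "coproduct G (f i) = f i \<otimes>\<^sub>q kk' i + 1 \<otimes>\<^sub>q f i" "coproduct G (t' i) = t' i \<otimes>\<^sub>q t' i"
    using h ht' by (auto simp: tensor_times_eq one_tensor_def)
qed

lemma coproduct_kk': "coproduct G (kk' i) = kk' i \<otimes>\<^sub>q kk' i"
  unfolding kk'_def
  by (subst torus_monomial_hom[of "coproduct G"])
    (simp_all add: coproduct_1 coproduct_mult coproduct_t coproduct_t' torus_monomial_tensor)

text \<open>The exchange of \<open>uq_rel_dual\<close> with signs added. The signs cancel in the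
  commutator of \<open>e\<close> and \<open>f\<close> and only rescale Serre elements.\<close>

lemma theta_uq: "uq A d t' t (\<lambda>i. - f i) (\<lambda>i. - e i)"
proof -
  interpret dual: uq_rel A d t' t f e by (rule uq_rel_dual)
  have scale: "serre_in a b (- x) (- y) = ((- 1) ^ nat (1 - a) * - 1) *\<^sub>q serre_in a b x y" for a b and x y :: 'u
    using serre_in_scale[of a b "- 1" x "- 1" y] by simp
  show ?thesis
    by unfold_locales
      (use dual.t_comm dual.tet dual.tft dual.ef in \<open>simp_all add: scale serre_e serre_f\<close>)
qed

lemma theta:
  shows theta_linear: "qlinear (theta G)" and theta_1: "theta G 1 = 1"
    and theta_mult: "theta G (x * y) = theta G x * theta G y"
    and theta_t: "theta G (t i) = t' i" and theta_e: "theta G (e i) = - f i"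
    and theta_f: "theta G (f i) = - e i" and theta_t': "theta G (t' i) = t i"
proof -
  let ?P = "\<lambda>h. qlinear h \<and> h 1 = 1 \<and> (\<forall>x y. h (x * y) = h x * h y) \<and>
     (\<forall>i. h (t i) = t' i \<and> h (e i) = - f i \<and> h (f i) = - e i)"
  obtain h where h: "?P h" and ht': "\<forall>i. h (t' i) = t i"
    using hom_exists[OF theta_uq] by blast
  have unique: "D = h" if D: "?P D" for D
  proof
    fix u
    have "D (t' i) = h (t' i)" for i
      by (rule inverse_agree) (use D h in auto)
    moreover have "qs.subspace {u. D u = h u}"
      using conjunct1[OF D] conjunct1[OF h] by (rule subspace_equalizer)
    ultimately have "u \<in> {u. D u = h u}"
      by - (rule left_closed, use D h in auto)
    then show "D u = h u" by simp
  qed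
  have "theta G = h"
    unfolding theta_def using h unique by (intro the_equality) blast+
  then show "qlinear (theta G)" "theta G 1 = 1" "theta G (x * y) = theta G x * theta G y"
    "theta G (t i) = t' i" "theta G (e i) = - f i" "theta G (f i) = - e i" "theta G (t' i) = t i"
    using h ht' by auto
qed

lemma prod_list_Opp_torus: "torus_monomial (\<lambda>i. Opp (t' i)) (\<lambda>i. Opp (t i)) m = Opp (tm (\<lambda>j. - m j))"
proof -
  have pow: "Opp x ^ n = Opp (x ^ n)" for x :: 'u and n
    by (induction n) (simp_all add: one_opp_def times_opp.abs_eq power_commutes)
  define g where "g j = (if m j \<ge> 0 then t' j ^ nat (m j) else t j ^ nat (- m j))" for j
  have "g i * g j = g j * g i" for i j
    by (auto simp: g_def t_comm t'_t' t_t'[symmetric] intro!: power_commuting_commutes[symmetric])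
  then have "Opp (prod_list (map g L)) = prod_list (map (\<lambda>i. Opp (g i)) L)" for L
    by (intro prod_list_antihom) (simp_all add: one_opp_def times_opp.abs_eq)
  from this[of index_list] have "Opp (torus_monomial t' t m) = torus_monomial (\<lambda>i. Opp (t' i)) (\<lambda>i. Opp (t i)) m"
    unfolding torus_monomial_def g_def by (simp add: pow if_distrib cong: if_cong)
  then show ?thesis by (simp add: torus_monomial_swap)
qed

text \<open>The prescribed values of the antipode are checked in the opposite algebra. For the Serre
  relations the torus factors are absorbed by \<open>serre_in_twist\<close>, and reversal of
  products by \<open>serre_in_Opp\<close>.\<close>

lemma antipode_uq: "uq A d (\<lambda>i. Opp (t' i)) (\<lambda>i. Opp (t i)) (\<lambda>i. Opp (- (kk' i * e i))) (\<lambda>i. Opp (- (f i * kk i)))"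
proof
  have lin: "qlinear (Opp :: 'u \<Rightarrow> 'u opp)" by (intro qlinearI) (simp_all add: plus_opp.abs_eq scaleq_opp.abs_eq)
  note Opp = lin_simps[OF lin] times_opp.abs_eq[symmetric]
  have mult: "Opp x * Opp y = Opp (y * x)" for x y :: 'u by (simp add: times_opp.abs_eq)
  fix i j
  show "Opp (t' i) * Opp (t i) = 1" "Opp (t i) * Opp (t' i) = 1" "Opp (t' i) * Opp (t' j) = Opp (t' j) * Opp (t' i)"
    by (simp_all add: mult one_opp_def t'_t')
  have k: "t i * kk j = kk j * t i" "t i * kk' j = kk' j * t i" by (simp_all add: kk_def kk'_def t_tm)
  have "t i * (kk' j * e j) * t' i = kk' j * (t i * e j * t' i)" by (simp add: mult.assoc[symmetric] k)
  then show "Opp (t' i) * Opp (- (kk' j * e j)) * Opp (t i) = qpow (d i * (if i = j then 1 else 0)) *\<^sub>q Opp (- (kk' j * e j))"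
    by (simp only: mult) (simp add: mult.assoc[symmetric] tet scaleq_mult_right scaleq_opp.abs_eq uminus_opp.abs_eq[symmetric])
  have "t i * (f j * kk j) * t' i = (t i * f j * t' i) * kk j"
    by (simp add: mult.assoc) (metis k(1) mult.assoc mult_1_right tt' t't t'_tm kk_def)
  then show "Opp (t' i) * Opp (- (f j * kk j)) * Opp (t i) = qpow (- d i * (if i = j then 1 else 0)) *\<^sub>q Opp (- (f j * kk j))"
    by (simp only: mult) (simp add: mult.assoc[symmetric] tft scaleq_mult_left scaleq_opp.abs_eq uminus_opp.abs_eq[symmetric])
  \<comment> \<open>Both products are brought to a common power of q and a common torus element on
    the right, so that the commutator reduces to that of \<open>e i\<close> and
    \<open>f j\<close>.\<close>
  have "f j * kk j * (kk' i * e i) = qpow (cc i j - 2 * d i) *\<^sub>q (f j * e i * (kk j * kk' i))"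
  proof -
    have "f j * kk j * (kk' i * e i) = f j * (kk j * (kk' i * e i))" by (simp add: mult.assoc)
    also have "kk j * (kk' i * e i) = qpow (- cc i i) *\<^sub>q (kk j * e i * kk' i)"
      by (simp add: kk'_e scaleq_mult_right mult.assoc)
    also have "\<dots> = qpow (cc i j - 2 * d i) *\<^sub>q (e i * (kk j * kk' i))"
      by (simp add: kk_e scaleq_mult_left scaleq_scaleq qpow_add[symmetric] cc_commute[of j i] mult.assoc)
    finally show ?thesis by (simp add: scaleq_mult_right mult.assoc)
  qed
  moreover have "kk' i * e i * (f j * kk j) = qpow (cc i j - 2 * d i) *\<^sub>q (e i * f j * (kk j * kk' i))"
  proof -
    have "kk' i * e i * (f j * kk j) = qpow (- cc i i) *\<^sub>q (e i * (kk' i * f j) * kk j)"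
      by (simp add: kk'_e scaleq_mult_left mult.assoc)
    also have "\<dots> = qpow (cc i j - 2 * d i) *\<^sub>q (e i * f j * (kk' i * kk j))"
      by (simp add: kk'_f scaleq_mult_left scaleq_mult_right scaleq_scaleq qpow_add[symmetric] mult.assoc)
    finally show ?thesis by (simp add: kk_comm)
  qed
  ultimately have "f j * kk j * (kk' i * e i) - kk' i * e i * (f j * kk j)
      = - (qpow (cc i j - 2 * d i) *\<^sub>q ((e i * f j - f j * e i) * (kk j * kk' i)))"
    by (simp add: left_diff_distrib qs.scale_right_diff_distrib)
  also have "\<dots> = (if i = j then nu i *\<^sub>q (kk' i - kk i) else 0)"
    by (simp add: ef_commutator qs.scale_right_diff_distrib)
  finally show "Opp (- (kk' i * e i)) * Opp (- (f j * kk j)) - Opp (- (f j * kk j)) * Opp (- (kk' i * e i))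
      = (if i = j then nu i *\<^sub>q (torus_monomial (\<lambda>i. Opp (t' i)) (\<lambda>i. Opp (t i)) (\<lambda>j. A $ j $ i)
          - torus_monomial (\<lambda>i. Opp (t' i)) (\<lambda>i. Opp (t i)) (\<lambda>j. - A $ j $ i)) else 0)"
    unfolding prod_list_Opp_torus minus_minus kk_def[symmetric] kk'_def[symmetric]
    by (simp add: mult minus_opp.abs_eq scaleq_opp.abs_eq lin_simps(3)[OF lin])
next
  fix i j :: 'r assume ij: "i \<noteq> j"
  have neg: "serre_in a b (- x) (- y) = ((- 1) ^ nat (1 - a) * - 1) *\<^sub>q serre_in a b x y" for a b and x y :: 'u
    using serre_in_scale[of a b "- 1" x "- 1" y] by simp
  have Opp_0: "Opp (0::'u) = 0" by (simp add: zero_opp_def)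
  have "serre_in (A $ i $ j) (d i) (kk' i * e i) (kk' j * e j) = 0"
  proof (rule serre_in_twist)
    show "kk' i * kk' j = kk' j * kk' i" by (rule kk_comm)
    show "e i * kk' i = qpow (cc i i) *\<^sub>q (kk' i * e i)" "e i * kk' j = qpow (cc i j) *\<^sub>q (kk' j * e i)"
      "e j * kk' i = qpow (cc i j) *\<^sub>q (kk' i * e j)"
      by (simp_all add: kk'_e scaleq_scaleq cc_commute[of j i])
  qed (use ij in \<open>simp_all add: serre_e A_offdiag\<close>)
  then show "serre_in (A $ i $ j) (d i) (Opp (- (kk' i * e i))) (Opp (- (kk' j * e j))) = 0"
    by (simp add: serre_in_Opp neg Opp_0)
  have "serre_in (A $ i $ j) (d i) (kk i * f i) (kk j * f j) = 0"
  proof (rule serre_in_twist)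
    show "kk i * kk j = kk j * kk i" by (rule kk_comm)
    show "f i * kk i = qpow (cc i i) *\<^sub>q (kk i * f i)" "f i * kk j = qpow (cc i j) *\<^sub>q (kk j * f i)"
      "f j * kk i = qpow (cc i j) *\<^sub>q (kk i * f j)"
      by (simp_all add: kk_f scaleq_scaleq cc_commute[of j i])
  qed (use ij in \<open>simp_all add: serre_f A_offdiag\<close>)
  moreover have "f i * kk i = qpow (cc i i) *\<^sub>q (kk i * f i)" for i
    by (simp add: kk_f scaleq_scaleq)
  ultimately have "serre_in (A $ i $ j) (d i) (f i * kk i) (f j * kk j) = 0"
    by (simp add: serre_in_scale)
  then show "serre_in (A $ i $ j) (d i) (Opp (- (f i * kk i))) (Opp (- (f j * kk j))) = 0"
    by (simp add: serre_in_Opp neg Opp_0)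
qed

lemma antipode:
  shows antipode_linear: "qlinear (antipode G)" and antipode_1: "antipode G 1 = 1"
    and antipode_mult: "antipode G (x * y) = antipode G y * antipode G x"
    and antipode_t: "antipode G (t i) = t' i" and antipode_e: "antipode G (e i) = - (kk' i * e i)"
    and antipode_f: "antipode G (f i) = - (f i * kk i)" and antipode_t': "antipode G (t' i) = t i"
proof -
  let ?P = "\<lambda>h. qlinear h \<and> h 1 = 1 \<and> (\<forall>x y. h (x * y) = h y * h x) \<and>
     (\<forall>i. h (t i) = t' i \<and> h (e i) = - (kk' i * e i) \<and> h (f i) = - (f i * kk i))"
  obtain k where k: "qlinear k" "k 1 = 1" "\<forall>a b. k (a * b) = k a * k b" "\<forall>i. k (t i) = Opp (t' i)"
    "\<forall>i. k (t' i) = Opp (t i)" "\<forall>i. k (e i) = Opp (- (kk' i * e i))" "\<forall>i. k (f i) = Opp (- (f i * kk i))"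
    using hom_exists[OF antipode_uq] by blast
  define h where "h x = unopp (k x)" for x
  have h: "?P h" and ht': "\<forall>i. h (t' i) = t i"
    using k by (auto simp: h_def Opp_inverse plus_opp.rep_eq scaleq_opp.rep_eq times_opp.rep_eq one_opp.rep_eq
        lin_simps[OF k(1)] intro!: qlinearI)
  have unique: "D = h" if D: "?P D" for D
  proof
    fix u
    have "D (t' i) = h (t' i)" for i
      by (rule inverse_agree) (use D h in auto)
    moreover have "qs.subspace {u. D u = h u}"
      using conjunct1[OF D] conjunct1[OF h] by (rule subspace_equalizer)
    ultimately have "u \<in> {u. D u = h u}"
      by - (rule left_closed, use D h in auto)
    then show "D u = h u" by simp
  qed
  have "antipode G = h"
    unfolding antipode_def k_gen_eq using h unique by (intro the_equality) blast+
  then show "qlinear (antipode G)" "antipode G 1 = 1" "antipode G (x * y) = antipode G y * antipode G x"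
    "antipode G (t i) = t' i" "antipode G (e i) = - (kk' i * e i)" "antipode G (f i) = - (f i * kk i)"
    "antipode G (t' i) = t i"
    using h ht' by auto
qed

lemma counit:
  shows counit_linear: "qfunctional (counit G)" and counit_1: "counit G 1 = 1"
    and counit_mult: "counit G (x * y) = counit G x * counit G y"
    and counit_t: "counit G (t i) = 1" and counit_e: "counit G (e i) = 0" and counit_f: "counit G (f i) = 0"
proof -
  let ?P = "\<lambda>\<epsilon>. qfunctional \<epsilon> \<and> \<epsilon> 1 = 1 \<and> (\<forall>x y. \<epsilon> (x * y) = \<epsilon> x * \<epsilon> y) \<and>
     (\<forall>i. \<epsilon> (t i) = 1 \<and> \<epsilon> (e i) = 0 \<and> \<epsilon> (f i) = 0)"
  \<comment> \<open>The trivial representation is realized inside \<open>'u\<close>: a homomorphism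
    into \<open>'u\<close> with values in the multiples of 1, whose scalar is the counit.\<close>
  have "uq A d (\<lambda>i. 1) (\<lambda>i. 1) (\<lambda>i. 0 :: 'u) (\<lambda>i. 0)"
  proof
    have "torus_monomial (\<lambda>i. 1) (\<lambda>i. 1 :: 'u) m = 1" for m :: "'r \<Rightarrow> int"
      by (rule torus_monomial_induct[of "\<lambda>x _. x = 1" _ "\<lambda>_. 0"]) simp_all
    then show "0 * 0 - 0 * 0 = (if i = j then nu i *\<^sub>q (torus_monomial (\<lambda>i. 1) (\<lambda>i. 1) (\<lambda>j. A $ j $ i)
        - torus_monomial (\<lambda>i. 1) (\<lambda>i. 1 :: 'u) (\<lambda>j. - A $ j $ i)) else 0)" for i j by simp
  qed (simp_all add: serre_in_def)
  from hom_exists[OF this] obtain k :: "'u \<Rightarrow> 'u" where k: "qlinear k" "k 1 = 1" "\<forall>a b. k (a * b) = k a * k b"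
    "\<forall>i. k (t i) = 1" "\<forall>i. k (t' i) = 1" "\<forall>i. k (e i) = 0" "\<forall>i. k (f i) = 0"
    by blast
  have "u \<in> {u. \<exists>c. k u = c *\<^sub>q 1}" for u
  proof (rule left_closed)
    show "qs.subspace {u. \<exists>c. k u = c *\<^sub>q 1}"
      by (auto simp: qs.subspace_def lin_simps[OF k(1)] scaleq_scaleq intro: exI[of _ 0]
          simp flip: scaleq_add_left)
  qed (use k in \<open>auto intro: exI[of _ 1] exI[of _ 0]\<close>)
  then obtain \<epsilon> where \<epsilon>: "k u = \<epsilon> u *\<^sub>q 1" for u
    by (auto, metis)
  have val: "\<epsilon> u = c" if "k u = c *\<^sub>q 1" for u c
    using that \<epsilon> by (intro scaleq_1_inj[where 'a = 'u]) metis
  have h: "?P \<epsilon>"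
  proof (intro conjI allI qfunctionalI val)
    fix x y c
    show "k (x + y) = (\<epsilon> x + \<epsilon> y) *\<^sub>q 1" by (simp add: lin_simps[OF k(1)] scaleq_add_left flip: \<epsilon>)
    show "k (c *\<^sub>q x) = (c * \<epsilon> x) *\<^sub>q 1" by (simp only: lin_simps[OF k(1)] scaleq_scaleq[symmetric] \<epsilon>[of x])
    have "k (x * y) = \<epsilon> x *\<^sub>q 1 * \<epsilon> y *\<^sub>q 1" using k(3) \<epsilon> by metis
    then show "k (x * y) = (\<epsilon> x * \<epsilon> y) *\<^sub>q 1" by (simp add: scaleq_mult_left scaleq_scaleq)
  qed (simp_all add: k)
  have unique: "D = \<epsilon>" if D: "?P D" for D
  proof
    fix u
    have "D (t' i) = \<epsilon> (t' i)" for i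
      by (rule inverse_agree) (use D h in auto)
    moreover have "qs.subspace {u. D u = \<epsilon> u}"
      using conjunct1[OF D] conjunct1[OF h] by (rule subspace_equalizer)
    ultimately have "u \<in> {u. D u = \<epsilon> u}"
      by - (rule left_closed, use D h in auto)
    then show "D u = \<epsilon> u" by simp
  qed
  have "counit G = \<epsilon>"
    unfolding counit_def using h unique by (intro the_equality) blast+
  then show "qfunctional (counit G)" "counit G 1 = 1" "counit G (x * y) = counit G x * counit G y"
    "counit G (t i) = 1" "counit G (e i) = 0" "counit G (f i) = 0"
    using h by auto
qed

end

section \<open>Verma functionals\<close>

text \<open>Operators on functions, composed from left to right: the algebra acts on functions on words
  from the right, dually to its action on a Verma module.\<close>

typedef 'x wop = "{h :: ('x \<Rightarrow> qfield) \<Rightarrow> ('x \<Rightarrow> qfield).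
    (\<forall>g g'. h (\<lambda>w. g w + g' w) = (\<lambda>w. h g w + h g' w)) \<and> (\<forall>c g. h (\<lambda>w. c * g w) = (\<lambda>w. c * h g w))}"
  morphisms wop_fun Wop
  by (rule exI[of _ id]) simp

setup_lifting type_definition_wop

instantiation wop :: (type) qalgebra
begin

lift_definition zero_wop :: "'a wop" is "\<lambda>g w. 0" by simp
lift_definition one_wop :: "'a wop" is "\<lambda>g. g" by simp
lift_definition plus_wop :: "'a wop \<Rightarrow> 'a wop \<Rightarrow> 'a wop" is "\<lambda>h k g w. h g w + k g w"
  by (simp add: algebra_simps)
lift_definition minus_wop :: "'a wop \<Rightarrow> 'a wop \<Rightarrow> 'a wop" is "\<lambda>h k g w. h g w - k g w"
  by (simp add: algebra_simps)
lift_definition uminus_wop :: "'a wop \<Rightarrow> 'a wop" is "\<lambda>h g w. - h g w"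
  by (simp add: algebra_simps)
lift_definition scaleq_wop :: "qfield \<Rightarrow> 'a wop \<Rightarrow> 'a wop" is "\<lambda>c h g w. c * h g w"
  by (simp add: algebra_simps)
lift_definition times_wop :: "'a wop \<Rightarrow> 'a wop \<Rightarrow> 'a wop" is "\<lambda>h k g. k (h g)"
  by simp

instance
proof
  show "(0 :: 'a wop) \<noteq> 1"
    by transfer (metis zero_neq_one)
qed (transfer; simp add: algebra_simps)+

end

lemmas wop_simps = zero_wop.rep_eq one_wop.rep_eq plus_wop.rep_eq minus_wop.rep_eq uminus_wop.rep_eq
  scaleq_wop.rep_eq times_wop.rep_eq

lemma wop_fun_add: "wop_fun a (\<lambda>w. g w + g' w) = (\<lambda>w. wop_fun a g w + wop_fun a g' w)"
  and wop_fun_scale: "wop_fun a (\<lambda>w. c * g w) = (\<lambda>w. c * wop_fun a g w)"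
  using wop_fun[of a] by simp_all

lemma wop_fun_zero: "wop_fun a (\<lambda>w. 0) = (\<lambda>w. 0)"
  using wop_fun_scale[of a 0 "\<lambda>w. 0"] by simp

primrec wt :: "'r list \<Rightarrow> ('r::finite) weight" where
  "wt [] = 0"
| "wt (j # w) = simple_root j + wt w"

lemma wt_append: "wt (v @ w) = wt v + wt w"
  by (induction v) (simp_all add: add.assoc)

lemma simple_root_nth: "(simple_root i :: ('r::finite) weight) $ j = (if i = j then 1 else 0)"
  by (simp add: simple_root_def axis_def)

lemma serre_in_qcomm:
  assumes "d \<noteq> 0" "n \<le> 0" "k * x = a *\<^sub>q (x * k)" "k * y = b *\<^sub>q (y * k)"
  shows "k * serre_in n d x y = (a ^ nat (1 - n) * b) *\<^sub>q (serre_in n d x y * k)"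
proof -
  let ?c = "(- 1) ^ nat (1 - n) * q_fact d (nat (1 - n))" and ?s = "serre_in n d x y"
  have "k * ?c *\<^sub>q ?s = (a ^ nat (1 - n) * b) *\<^sub>q (?c *\<^sub>q ?s * k)"
    unfolding qads_eq_serre[OF assms(1,2), symmetric] by (rule qads_qcomm[OF assms(3,4)])
  then have "?c *\<^sub>q (k * ?s) = ?c *\<^sub>q ((a ^ nat (1 - n) * b) *\<^sub>q (?s * k))"
    by (simp add: scaleq_mult_left scaleq_mult_right scaleq_scaleq mult_ac)
  moreover have "?c \<noteq> 0" using assms(1) by (simp add: q_fact_nonzero)
  ultimately show ?thesis by (metis qs.scale_left_imp_eq)
qed

text \<open>Every monomial of a Serre element ends in \<open>x\<close> or \<open>y\<close>, hence
  lies in the left ideal that they generate.\<close>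

lemma serre_in_mult_ideal:
  assumes "\<And>z z'. P z \<Longrightarrow> P z' \<Longrightarrow> P (z + z')" "\<And>c z. P z \<Longrightarrow> P (c *\<^sub>q z)"
    and "\<And>z. P (z * x)" "\<And>z. P (z * y)"
  shows "P (serre_in a d x y)"
proof -
  have 0: "P 0" using assms(2)[OF assms(3), of 0] by simp
  have "P (x ^ m * y * x ^ l)" for m l
    by (cases l) (simp_all add: assms(4) power_Suc2 mult.assoc[symmetric] assms(3) del: power_Suc)
  moreover have "P (sum g I)" if "\<And>i. P (g i)" for g and I :: "nat set"
    by (induction I rule: infinite_finite_induct) (simp_all add: 0 assms(1) that)
  ultimately show ?thesis unfolding serre_in_def Let_def by (simp add: assms(2))
qed

lemma serre_in_mult_ideal_left:
  assumes "\<And>z z'. P z \<Longrightarrow> P z' \<Longrightarrow> P (z + z')" "\<And>c z. P z \<Longrightarrow> P (c *\<^sub>q z)"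
    and "\<And>z. P (x * z)" "\<And>z. P (y * z)"
  shows "P (serre_in a d x y)"
proof -
  have 0: "P 0" using assms(2)[OF assms(3), of 0] by simp
  have "P (x ^ m * y * x ^ l)" for m l
    by (cases m) (simp_all add: assms(4) mult.assoc assms(3))
  moreover have "P (sum g I)" if "\<And>i. P (g i)" for g and I :: "nat set"
    by (induction I rule: infinite_finite_induct) (simp_all add: 0 assms(1) that)
  ultimately show ?thesis unfolding serre_in_def Let_def by (simp add: assms(2))
qed

context quantum_cartan
begin

section \<open>The Verma action on functions on words\<close>

definition kval :: "'r \<Rightarrow> 'r weight \<Rightarrow> rat" where
  "kval j m = (\<Sum>l\<in>UNIV. of_int (A $ l $ j) * (d l * m $ l))"

text \<open>A word stands for the corresponding product of f_i applied to the highest weight vector,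
  before Serre relations are imposed. The value is that of \<open>g\<close>, extended linearly, at
  e_j applied to this vector; the second summand comes from the commutator of e_j and f_j on the
  weight lam - wt w.\<close>

primrec word_e :: "'r weight \<Rightarrow> 'r \<Rightarrow> 'r list \<Rightarrow> ('r list \<Rightarrow> qfield) \<Rightarrow> qfield" where
  "word_e lam j [] g = 0"
| "word_e lam j (i # w) g = word_e lam j w (\<lambda>u. g (i # u))
    + (if i = j then nu j * (qpow (kval j (lam - wt w)) - qpow (- kval j (lam - wt w))) * g w else 0)"

definition op_e where "op_e lam j = Wop (\<lambda>g w. word_e lam j w g)"
definition op_f :: "'r \<Rightarrow> 'r list wop" where "op_f j = Wop (\<lambda>g w. g (j # w))"
definition op_t :: "'r weight \<Rightarrow> rat \<Rightarrow> 'r \<Rightarrow> 'r list wop" where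
  "op_t lam s j = Wop (\<lambda>g w. qpow (s * d j * (lam - wt w) $ j) * g w)"

lemma word_e_add: "word_e lam j w (\<lambda>u. g u + g' u) = word_e lam j w g + word_e lam j w g'"
  by (induction w arbitrary: g g') (simp_all add: algebra_simps)

lemma word_e_scale: "word_e lam j w (\<lambda>u. c * g u) = c * word_e lam j w g"
  by (induction w arbitrary: g) (simp_all add: algebra_simps)

lemma op_rep:
  "wop_fun (op_e lam j) g = (\<lambda>w. word_e lam j w g)"
  "wop_fun (op_f j) g = (\<lambda>w. g (j # w))"
  "wop_fun (op_t lam s j) g = (\<lambda>w. qpow (s * d j * (lam - wt w) $ j) * g w)"
  unfolding op_e_def op_f_def op_t_def
  by (subst Wop_inverse; simp add: word_e_add word_e_scale algebra_simps)+

text \<open>\<open>word_e lam j w\<close> evaluates its argument only at words obtained from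
  \<open>w\<close> by deleting one letter j, and there \<open>\<phi>\<close> has dropped by exactly
  \<open>s j\<close>.\<close>

lemma word_e_twist:
  assumes "\<And>i w. \<phi> (i # w) = s i + \<phi> w"
  shows "word_e lam j w (\<lambda>u. qpow (c - \<phi> u) * g u) = qpow (c + s j - \<phi> w) * word_e lam j w g"
proof (induction w arbitrary: g c)
  case (Cons i w)
  have IH: "word_e lam j w (\<lambda>u. qpow (c - \<phi> (i # u)) * g (i # u)) = qpow (c - s i + s j - \<phi> w) * word_e lam j w (\<lambda>u. g (i # u))"
    using Cons[of "c - s i" "\<lambda>u. g (i # u)"] by (simp add: assms algebra_simps)
  have eq: "c + s j - \<phi> (i # w) = c - s i + s j - \<phi> w" by (simp add: assms)
  show ?case
    by (simp only: word_e.simps IH eq) (auto simp: distrib_left mult_ac)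
qed simp

lemma op_torus_monomial:
  "wop_fun (torus_monomial (op_t lam 1) (op_t lam (- 1)) m) g w
    = qpow (\<Sum>j\<in>UNIV. of_int (m j) * (d j * (lam - wt w) $ j)) * g w"
proof -
  have "\<forall>g. wop_fun (torus_monomial (op_t lam 1) (op_t lam (- 1)) m) g w
      = qpow (\<Sum>j\<in>UNIV. of_int (m j) * (d j * (lam - wt w) $ j)) * g w"
    by (rule torus_monomial_induct[of "\<lambda>x s. \<forall>g. wop_fun x g w = qpow s * g w"])
      (simp_all add: wop_simps op_rep qpow_add)
  then show ?thesis by blast
qed

lemma op_uq_rel: "uq_rel A d (op_t lam 1) (op_t lam (- 1)) (op_e lam) op_f"
proof
  fix i j
  have ext: "a = b" if "\<And>g w. wop_fun a g w = wop_fun b g w" for a b :: "'r list wop"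
    using that wop_fun_inject by blast
  note simps = wop_simps op_rep
  show "op_t lam 1 i * op_t lam (- 1) i = 1" "op_t lam (- 1) i * op_t lam 1 i = 1"
    by (rule ext, simp add: simps)+
  show "op_t lam 1 i * op_t lam 1 j = op_t lam 1 j * op_t lam 1 i"
    by (rule ext) (simp add: simps mult_ac)
  show "op_t lam 1 i * op_e lam j * op_t lam (- 1) i = qpow (d i * (if i = j then 1 else 0)) *\<^sub>q op_e lam j"
  proof (rule ext)
    fix g w
    let ?\<phi> = "\<lambda>w. d i * wt w $ i"
    have "word_e lam j w (\<lambda>u. qpow (d i * (lam - wt u) $ i) * g u)
        = qpow (d i * lam $ i + d i * (if j = i then 1 else 0) - ?\<phi> w) * word_e lam j w g"
      using word_e_twist[of ?\<phi> "\<lambda>j. d i * (if j = i then 1 else 0)" lam j w "d i * lam $ i" g]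
      by (simp add: simple_root_nth algebra_simps)
    then show "wop_fun (op_t lam 1 i * op_e lam j * op_t lam (- 1) i) g w
        = wop_fun (qpow (d i * (if i = j then 1 else 0)) *\<^sub>q op_e lam j) g w"
      by (simp add: simps qpow_add[symmetric] algebra_simps flip: mult.assoc)
  qed
  show "op_t lam 1 i * op_f j * op_t lam (- 1) i = qpow (- d i * (if i = j then 1 else 0)) *\<^sub>q op_f j"
    by (rule ext) (simp add: simps simple_root_nth algebra_simps qpow_add[symmetric] flip: mult.assoc)
  show "op_e lam i * op_f j - op_f j * op_e lam i
      = (if i = j then nu i *\<^sub>q (torus_monomial (op_t lam 1) (op_t lam (- 1)) (\<lambda>j. A $ j $ i)
        - torus_monomial (op_t lam 1) (op_t lam (- 1)) (\<lambda>j. - A $ j $ i)) else 0)"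
  proof (rule ext)
    fix g w
    have "wop_fun (torus_monomial (op_t lam 1) (op_t lam (- 1)) (\<lambda>j. A $ j $ i)) g w = qpow (kval i (lam - wt w)) * g w"
      "wop_fun (torus_monomial (op_t lam 1) (op_t lam (- 1)) (\<lambda>j. - A $ j $ i)) g w = qpow (- kval i (lam - wt w)) * g w"
      by (simp_all add: op_torus_monomial kval_def sum_negf)
    then show "wop_fun (op_e lam i * op_f j - op_f j * op_e lam i) g w
      = wop_fun (if i = j then nu i *\<^sub>q (torus_monomial (op_t lam 1) (op_t lam (- 1)) (\<lambda>j. A $ j $ i)
        - torus_monomial (op_t lam 1) (op_t lam (- 1)) (\<lambda>j. - A $ j $ i)) else 0) g w"
      by (simp add: simps algebra_simps)
  qed
qed

text \<open>At the empty word the value is zero, since every monomial ends in some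
  \<open>op_e\<close>. Longer words reduce to it, because the Serre element commutes with each
  \<open>op_f\<close>.\<close>

lemma op_serre_e:
  assumes "i \<noteq> j"
  shows "serre_in (A $ i $ j) (d i) (op_e lam i) (op_e lam j) = 0"
proof -
  interpret op: uq_rel A d "op_t lam 1" "op_t lam (- 1)" "op_e lam" op_f by (rule op_uq_rel)
  let ?S = "serre_in (A $ i $ j) (d i) (op_e lam i) (op_e lam j)"
  have "wop_fun ?S g w = 0" for g w
  proof (induction w arbitrary: g)
    case Nil
    have "\<forall>g. wop_fun ?S g [] = 0"
      by (rule serre_in_mult_ideal) (simp_all add: wop_simps op_rep)
    then show ?case by blast
  next
    case (Cons l w)
    have "wop_fun ?S g (l # w) = wop_fun (?S * op_f l) g w" by (simp add: wop_simps op_rep)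
    also have "\<dots> = wop_fun ?S (\<lambda>w. g (l # w)) w"
      by (simp add: op.f_commutes_serre_e[OF assms, symmetric]) (simp add: wop_simps op_rep)
    finally show ?case by (simp add: Cons)
  qed
  then have "wop_fun ?S = wop_fun 0" by (intro ext) (simp add: wop_simps)
  then show ?thesis by (simp add: wop_fun_inject)
qed

text \<open>The functions that vanish on the two-sided ideal of the Serre elements in the free
  algebra on the f_i: \<open>u\<close> provides the factors to the left, the argument of the
  resulting function those to the right.\<close>

definition serre_killed :: "'r weight \<Rightarrow> ('r list \<Rightarrow> qfield) set" where
  "serre_killed lam = {g. \<forall>u i j. i \<noteq> j \<longrightarrow>
     wop_fun (prod_list (map op_f u) * serre_in (A $ i $ j) (d i) (op_f i) (op_f j)) g = (\<lambda>w. 0)}"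

definition word_unit :: "'r list \<Rightarrow> qfield" where "word_unit w = (if w = [] then 1 else 0)"

lemma op_f_word_unit: "wop_fun (op_f l) word_unit = (\<lambda>w. 0)"
  by (simp add: op_rep word_unit_def)

lemma word_unit_serre_killed: "word_unit \<in> serre_killed lam"
  unfolding serre_killed_def
proof (intro CollectI allI impI)
  fix u and i j :: 'r
  let ?S = "serre_in (A $ i $ j) (d i) (op_f i) (op_f j)"
  have "wop_fun ?S word_unit = (\<lambda>w. 0)"
    by (rule serre_in_mult_ideal_left)
      (simp_all add: wop_simps op_f_word_unit wop_fun_zero)
  then show "wop_fun (prod_list (map op_f u) * ?S) word_unit = (\<lambda>w. 0)"
    by (cases u) (simp_all add: wop_simps op_f_word_unit wop_fun_zero)
qed

lemma serre_killed_add: "g \<in> serre_killed lam \<Longrightarrow> g' \<in> serre_killed lam \<Longrightarrow> (\<lambda>w. g w + g' w) \<in> serre_killed lam"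
  by (simp add: serre_killed_def wop_fun_add)

lemma serre_killed_scale: "g \<in> serre_killed lam \<Longrightarrow> (\<lambda>w. c * g w) \<in> serre_killed lam"
  by (simp add: serre_killed_def wop_fun_scale)

lemma serre_killed_f: "g \<in> serre_killed lam \<Longrightarrow> wop_fun (op_f l) g \<in> serre_killed lam"
  unfolding serre_killed_def
proof (intro CollectI allI impI)
  fix u and i j :: 'r
  assume "g \<in> {g. \<forall>u i j. i \<noteq> j \<longrightarrow>
     wop_fun (prod_list (map op_f u) * serre_in (A $ i $ j) (d i) (op_f i) (op_f j)) g = (\<lambda>w. 0)}" and "i \<noteq> j"
  then have "wop_fun (prod_list (map op_f (l # u)) * serre_in (A $ i $ j) (d i) (op_f i) (op_f j)) g = (\<lambda>w. 0)"
    by blast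
  then show "wop_fun (prod_list (map op_f u) * serre_in (A $ i $ j) (d i) (op_f i) (op_f j)) (wop_fun (op_f l) g) = (\<lambda>w. 0)"
    by (simp add: wop_simps)
qed

lemma serre_killed_torus:
  assumes "g \<in> serre_killed lam" "\<And>l. x * op_f l = c l *\<^sub>q (op_f l * x)"
  shows "wop_fun x g \<in> serre_killed lam"
  unfolding serre_killed_def
proof (intro CollectI allI impI)
  fix u and i j :: 'r assume ij: "i \<noteq> j"
  let ?S = "serre_in (A $ i $ j) (d i) (op_f i) (op_f j)" and ?u = "prod_list (map op_f u)"
  have "\<exists>a. x * ?u = a *\<^sub>q (?u * x)"
  proof (induction u)
    case (Cons l u)
    then obtain a where "x * prod_list (map op_f u) = a *\<^sub>q (prod_list (map op_f u) * x)" by blast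
    from qcomm_mult[OF assms(2) this] show ?case by auto
  qed (auto intro: exI[of _ 1])
  then obtain a where a: "x * ?u = a *\<^sub>q (?u * x)" by blast
  have S: "x * ?S = (c i ^ nat (1 - A $ i $ j) * c j) *\<^sub>q (?S * x)"
    by (rule serre_in_qcomm[OF d_nonzero A_offdiag[OF ij] assms(2) assms(2)])
  obtain b where "x * (?u * ?S) = b *\<^sub>q (?u * ?S * x)"
    using qcomm_mult[OF a S] by blast
  moreover have "wop_fun (?u * ?S) g = (\<lambda>w. 0)"
    using assms(1) ij by (simp add: serre_killed_def)
  ultimately have "wop_fun (x * (?u * ?S)) g = (\<lambda>w. 0)"
    by (simp add: scaleq_wop.rep_eq times_wop.rep_eq[of _ x] wop_fun_zero)
  then show "wop_fun (?u * ?S) (wop_fun x g) = (\<lambda>w. 0)"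
    by (simp add: wop_simps)
qed

text \<open>\<open>op_e\<close> is pushed through the letters of \<open>u\<close> until it meets the
  Serre element, with which it commutes. The torus terms left behind preserve the subspace.\<close>

lemma serre_killed_e:
  assumes "g \<in> serre_killed lam"
  shows "wop_fun (op_e lam l) g \<in> serre_killed lam"
  unfolding serre_killed_def
proof (intro CollectI allI impI)
  fix u and i j :: 'r assume ij: "i \<noteq> j"
  interpret op: uq_rel A d "op_t lam 1" "op_t lam (- 1)" "op_e lam" op_f by (rule op_uq_rel)
  let ?S = "serre_in (A $ i $ j) (d i) (op_f i) (op_f j)"
  have "wop_fun (op_e lam l * (prod_list (map op_f u) * ?S)) g = (\<lambda>w. 0)"
    using assms
  proof (induction u arbitrary: g)
    case Nil
    then have "wop_fun ?S g = (\<lambda>w. 0)"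
      using ij unfolding serre_killed_def by (auto dest: spec[of _ "[]"])
    then show ?case
      by (simp add: op.e_commutes_serre_f[OF ij]) (simp add: wop_simps wop_fun_zero)
  next
    case (Cons p u)
    let ?u = "prod_list (map op_f u) * ?S"
    have kk: "wop_fun ?u (wop_fun (op.kk p) g) = (\<lambda>w. 0)" "wop_fun ?u (wop_fun (op.kk' p) g) = (\<lambda>w. 0)"
      using serre_killed_torus[OF Cons.prems op.kk_f] serre_killed_torus[OF Cons.prems op.kk'_f] ij
      by (simp_all add: serre_killed_def)
    have "op_e lam l * (prod_list (map op_f (p # u)) * ?S)
        = op_f p * (op_e lam l * ?u) + (if l = p then nu l *\<^sub>q (op.kk l * ?u - op.kk' l * ?u) else 0)"
      by (simp add: mult.assoc[symmetric] op.ef_commutator)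
        (simp add: distrib_right left_diff_distrib scaleq_mult_left mult.assoc)
    then show ?case
      using Cons.IH[OF serre_killed_f[OF Cons.prems]] kk by (simp add: wop_simps)
  qed
  then show "wop_fun (prod_list (map op_f u) * ?S) (wop_fun (op_e lam l) g) = (\<lambda>w. 0)"
    by (simp add: wop_simps)
qed

end

context qea
begin

text \<open>The functional takes the coefficient of the highest weight vector in x applied to it.
  The orbit of \<open>word_unit\<close> under the operators stays in \<open>serre_killed\<close>, so
  all defining relations act as zero along it and the coefficient is well defined on
  \<open>U\<close>.\<close>

lemma verma_functional_exists:
  "\<exists>\<Lambda>. qfunctional \<Lambda> \<and> \<Lambda> 1 = 1 \<and> (\<forall>i x. \<Lambda> (f i * x) = 0) \<and> (\<forall>i x. \<Lambda> (x * e i) = 0)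
    \<and> (\<forall>i x. \<Lambda> (x * t i) = qpow (d i * lam $ i) * \<Lambda> x) \<and> (\<forall>i x. \<Lambda> (t i * x) = qpow (d i * lam $ i) * \<Lambda> x)"
proof -
  interpret op: uq_rel A d "op_t lam 1" "op_t lam (- 1)" "op_e lam" op_f by (rule op_uq_rel)
  define y where "y = case_gen (op_t lam 1) (op_t lam (- 1)) (op_e lam) op_f"
  have y: "y (T i) = op_t lam 1 i" "y (T_inv i) = op_t lam (- 1) i" "y (E i) = op_e lam i" "y (F i) = op_f i" for i
    by (simp_all add: y_def)
  \<comment> \<open>\<open>word_unit\<close> is the functional dual to the empty word and the
    evaluation at \<open>[]\<close> inserts the highest weight vector.\<close>
  define \<phi> where "\<phi> p = wop_fun (free_eval y p) word_unit []" for p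
  have killed: "wop_fun (free_eval y p) word_unit \<in> serre_killed lam" for p
  proof -
    have gen: "wop_fun (y g) h \<in> serre_killed lam" if h: "h \<in> serre_killed lam" for g h
    proof (cases g)
      case (T_inv i)
      show ?thesis
        unfolding T_inv y_def gen.case by (rule serre_killed_torus[OF h op.t'_commute[OF op.t_f]])
    next
      case (T i)
      show ?thesis
        unfolding T y_def gen.case by (rule serre_killed_torus[OF h op.t_f])
    qed (simp_all add: y_def serre_killed_e serre_killed_f h)
    have word: "wop_fun (prod_list (map y w)) h \<in> serre_killed lam" if "h \<in> serre_killed lam" for w h
      using that by (induction w arbitrary: h) (simp_all add: wop_simps gen)
    have 0: "(\<lambda>w. 0) \<in> serre_killed lam"
      using serre_killed_scale[OF word_unit_serre_killed, of 0] by simp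
    have sum: "wop_fun (\<Sum>i\<in>I. c i *\<^sub>q prod_list (map y (v i))) word_unit \<in> serre_killed lam" for I and c :: "'a \<Rightarrow> qfield" and v
    proof (induction I rule: infinite_finite_induct)
      case (insert i I)
      have "wop_fun (c i *\<^sub>q prod_list (map y (v i))) word_unit \<in> serre_killed lam"
        by (simp add: wop_simps serre_killed_scale word word_unit_serre_killed)
      from serre_killed_add[OF this insert.IH] insert.hyps show ?case by (simp add: wop_simps)
    qed (simp_all add: wop_simps 0)
    show ?thesis unfolding free_eval_def by (rule sum)
  qed
  \<comment> \<open>Of all relations only the Serre relations in the f_i need \<open>g\<close> in
    \<open>serre_killed\<close>; the others are zero as operators.\<close>
  have rel: "wop_fun (free_eval y r) g = (\<lambda>w. 0)" if "r \<in> uq_relations A d" "g \<in> serre_killed lam" for r g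
  proof (cases "\<exists>i j. r = serre_element A d F i j \<and> i \<noteq> j")
    case True
    then obtain i j where r: "r = serre_element A d F i j" "i \<noteq> j" by blast
    then have "free_eval y r = serre_in (A $ i $ j) (d i) (op_f i) (op_f j)"
      by (simp add: free_eval_serre y_def)
    then show ?thesis
      using that(2) r(2) unfolding serre_killed_def by (auto dest: spec[of _ "[]"])
  next
    case False
    have k1: "free_eval y (k_product A (\<lambda>i. free_gen (T i)) (\<lambda>i. free_gen (T_inv i)) i) = op.kk i" for i
      unfolding k_product_eq op.kk_def
      by (simp add: torus_monomial_hom[of "free_eval y"] free_eval_mult y)
    have k2: "free_eval y (k_product A (\<lambda>i. free_gen (T_inv i)) (\<lambda>i. free_gen (T i)) i) = op.kk' i" for i
      unfolding k_product_swap op.kk'_def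
      by (simp add: torus_monomial_hom[of "free_eval y"] free_eval_mult y)
    have "free_eval y r = 0"
    proof -
      have no: "r = serre_element A d F i j \<Longrightarrow> i \<noteq> j \<Longrightarrow> False" for i j
        using False by blast
      show ?thesis
        using that(1) unfolding uq_relations_def Let_def
        apply (elim UnE CollectE exE conjE)
        apply (simp_all add: free_eval_simps free_eval_serre k1 k2 y op.t_comm op.tet op.tft op.ef_commutator
            nu_def[symmetric] scaleq_mult_left op_serre_e)
        apply (drule (1) no)
        apply simp
        done
    qed
    then show ?thesis by (simp add: wop_simps)
  qed
  have ideal: "\<phi> p = 0" if "p \<in> generated_ideal (uq_relations A d)" for p
    using that
  proof induction
    case (gen s x z)
    \<comment> \<open>Operators compose from left to right, so \<open>x\<close> acts first and stays
      in the orbit, where the relation \<open>s\<close> gives zero.\<close>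
    have "wop_fun (free_eval y (x * s * z)) word_unit = wop_fun (free_eval y z) (wop_fun (free_eval y s) (wop_fun (free_eval y x) word_unit))"
      by (simp add: free_eval_mult wop_simps)
    also have "\<dots> = (\<lambda>w. 0)" by (simp add: rel[OF gen killed] wop_fun_zero)
    finally show ?case by (simp add: \<phi>_def)
  qed (simp_all add: \<phi>_def wop_simps free_eval_add)
  have add: "\<phi> (p + r) = \<phi> p + \<phi> r" for p r by (simp add: \<phi>_def free_eval_add wop_simps)
  obtain \<Lambda> where \<Lambda>: "\<Lambda> (free_eval (generator G) p) = \<phi> p" for p
    using free_eval_unique[OF presented, of \<phi>] ideal add by metis
  have surj: "\<exists>p. u = free_eval (generator G) p" for u
    using presented by (metis presented_by_def surjD)
  have "\<Lambda> (a + b) = \<Lambda> a + \<Lambda> b" for a b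
    using surj[of a] surj[of b] \<Lambda> add by (metis free_eval_add)
  moreover have "\<Lambda> (c *\<^sub>q a) = c * \<Lambda> a" for c a
  proof -
    obtain p where p: "a = free_eval (generator G) p" using surj by blast
    have "\<Lambda> (c *\<^sub>q a) = \<phi> (free_const c * p)" unfolding p free_eval_const_mult[symmetric] by (rule \<Lambda>)
    then show ?thesis by (simp add: p \<Lambda> \<phi>_def free_eval_const_mult wop_simps)
  qed
  moreover have "\<Lambda> 1 = 1" using \<Lambda>[of 1] by (simp add: \<phi>_def wop_simps word_unit_def)
  moreover have left: "\<Lambda> (generator G g * x) = 0" if "g = F i" for g x i
  proof -
    obtain p where p: "x = free_eval (generator G) p" using surj by blast
    have "\<Lambda> (generator G g * x) = \<phi> (free_gen g * p)" unfolding \<Lambda>[symmetric] by (simp add: p free_eval_mult)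
    then show ?thesis by (simp add: \<phi>_def free_eval_mult wop_simps y_def that op_f_word_unit wop_fun_zero)
  qed
  moreover have "\<Lambda> (generator G (T i) * x) = qpow (d i * lam $ i) * \<Lambda> x" for x i
  proof -
    obtain p where p: "x = free_eval (generator G) p" using surj by blast
    have "\<Lambda> (generator G (T i) * x) = \<phi> (free_gen (T i) * p)" unfolding \<Lambda>[symmetric] by (simp add: p free_eval_mult)
    moreover have "wop_fun (op_t lam 1 i) word_unit = (\<lambda>w. qpow (d i * lam $ i) * word_unit w)"
      by (auto simp: op_rep word_unit_def)
    ultimately show ?thesis
      by (simp add: \<phi>_def free_eval_mult wop_simps y_def p \<Lambda> wop_fun_scale)
  qed
  moreover have "\<Lambda> (x * generator G (T i)) = qpow (d i * lam $ i) * \<Lambda> x" for x i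
  proof -
    obtain p where p: "x = free_eval (generator G) p" using surj by blast
    have "\<Lambda> (x * generator G (T i)) = \<phi> (p * free_gen (T i))" unfolding \<Lambda>[symmetric] by (simp add: p free_eval_mult)
    then show ?thesis
      by (simp add: \<phi>_def free_eval_mult wop_simps y_def p \<Lambda> op_rep)
  qed
  moreover have "\<Lambda> (x * generator G (E i)) = 0" for x i
  proof -
    obtain p where p: "x = free_eval (generator G) p" using surj by blast
    have "\<Lambda> (x * generator G (E i)) = \<phi> (p * free_gen (E i))" unfolding \<Lambda>[symmetric] by (simp add: p free_eval_mult)
    then show ?thesis
      by (simp add: \<phi>_def free_eval_mult wop_simps y_def op_rep)
  qed
  ultimately show ?thesis
    by (intro exI[of _ \<Lambda>]) (auto simp: t_gen_def e_gen_def f_gen_def intro!: qfunctionalI)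
qed

end

section \<open>Triangular decomposition and the Shapovalov form\<close>

text \<open>Artin's argument for the independence of characters: shift by an \<open>l0\<close> at
  which a and b differ, and subtract a multiple of the original relation to eliminate b.\<close>

lemma qpow_characters_independent:
  fixes \<phi> :: "'a \<Rightarrow> 'b::ab_group_add \<Rightarrow> rat"
  assumes "finite X" "\<And>a l l'. \<phi> a (l + l') = \<phi> a l + \<phi> a l'"
    and "\<And>a b. a \<in> X \<Longrightarrow> b \<in> X \<Longrightarrow> a \<noteq> b \<Longrightarrow> \<exists>l. \<phi> a l \<noteq> \<phi> b l"
    and "\<And>l. (\<Sum>a\<in>X. r a * qpow (\<phi> a l)) = 0" "a \<in> X"
  shows "r a = 0"
  using assms(1,3-5)
proof (induction X arbitrary: a r rule: finite_induct)
  case (insert b X)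
  have X: "r a = 0" if a: "a \<in> X" for a
  proof -
    obtain l0 where l0: "\<phi> a l0 \<noteq> \<phi> b l0" using insert.prems(1)[of a b] insert.hyps a by auto
    have "r a * (qpow (\<phi> a l0) - qpow (\<phi> b l0)) = 0"
    proof (rule insert.IH[of "\<lambda>a. r a * (qpow (\<phi> a l0) - qpow (\<phi> b l0))", OF _ _ a])
      fix l
      have "0 = (\<Sum>a\<in>insert b X. r a * qpow (\<phi> a (l + l0))) - qpow (\<phi> b l0) * (\<Sum>a\<in>insert b X. r a * qpow (\<phi> a l))"
        by (simp only: insert.prems(2)) simp
      also have "\<dots> = (\<Sum>a\<in>insert b X. r a * (qpow (\<phi> a l0) - qpow (\<phi> b l0)) * qpow (\<phi> a l))"
        unfolding sum_distrib_left sum_subtractf[symmetric]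
        by (rule sum.cong) (simp_all add: assms(2) qpow_add algebra_simps)
      finally show "(\<Sum>a\<in>X. r a * (qpow (\<phi> a l0) - qpow (\<phi> b l0)) * qpow (\<phi> a l)) = 0"
        using insert.hyps by simp
    qed (use insert.prems(1) in auto)
    then show ?thesis using l0 by simp
  qed
  moreover have "r b = 0"
    using insert.prems(2)[of 0] insert.hyps X by simp
  ultimately show ?case using insert.prems(3) by blast
qed simp

lemma subspace_decomposable:
  assumes P: "qs.subspace P" and N: "qs.subspace N"
  shows "qs.subspace {x. \<exists>z\<in>P. x - z \<in> N}"
proof (rule qs.subspaceI)
  show "0 \<in> {x. \<exists>z\<in>P. x - z \<in> N}"
    using qs.subspace_0[OF P] qs.subspace_0[OF N] by (intro CollectI bexI[of _ 0]) simp_all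
next
  fix x y assume "x \<in> {x. \<exists>z\<in>P. x - z \<in> N}" "y \<in> {x. \<exists>z\<in>P. x - z \<in> N}"
  then obtain z z' where *: "z \<in> P" "x - z \<in> N" "z' \<in> P" "y - z' \<in> N" by blast
  have "x + y - (z + z') = (x - z) + (y - z')" by simp
  also have "\<dots> \<in> N" by (rule qs.subspace_add[OF N *(2,4)])
  finally show "x + y \<in> {x. \<exists>z\<in>P. x - z \<in> N}" using qs.subspace_add[OF P *(1,3)] by blast
next
  fix x c assume "x \<in> {x. \<exists>z\<in>P. x - z \<in> N}"
  then obtain z where *: "z \<in> P" "x - z \<in> N" by blast
  have "c *\<^sub>q x - c *\<^sub>q z = c *\<^sub>q (x - z)" by (simp add: qs.scale_right_diff_distrib)
  also have "\<dots> \<in> N" by (rule qs.subspace_scale[OF N *(2)])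
  finally show "c *\<^sub>q x \<in> {x. \<exists>z\<in>P. x - z \<in> N}" using qs.subspace_scale[OF P *(1)] by blast
qed

context qea
begin

text \<open>The coefficient of the highest weight vector of the Verma module in x applied to it,
  which is q^l of the projection of x to \<open>U_zero\<close>. Everything below about Verma modules
  and the Shapovalov form goes through this functional.\<close>

definition Lam :: "'r weight \<Rightarrow> 'u \<Rightarrow> qfield" where
  "Lam l = (SOME \<Lambda>. qfunctional \<Lambda> \<and> \<Lambda> 1 = 1 \<and> (\<forall>i x. \<Lambda> (f i * x) = 0) \<and> (\<forall>i x. \<Lambda> (x * e i) = 0)
    \<and> (\<forall>i x. \<Lambda> (x * t i) = qpow (d i * l $ i) * \<Lambda> x) \<and> (\<forall>i x. \<Lambda> (t i * x) = qpow (d i * l $ i) * \<Lambda> x))"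

lemma Lam:
  shows Lam_linear: "qfunctional (Lam l)" and Lam_1 [simp]: "Lam l 1 = 1"
    and Lam_f [simp]: "Lam l (f i * x) = 0" and Lam_e [simp]: "Lam l (x * e i) = 0"
    and Lam_t_right: "Lam l (x * t i) = qpow (d i * l $ i) * Lam l x"
    and Lam_t_left: "Lam l (t i * x) = qpow (d i * l $ i) * Lam l x"
  using someI_ex[OF verma_functional_exists[of l]] unfolding Lam_def[symmetric] by blast+

lemmas Lam_simps = lin_simps[OF Lam_linear]

lemma Lam_t'_right: "Lam l (x * t' i) = qpow (- (d i * l $ i)) * Lam l x"
  using Lam_t_right[of l "x * t' i" i] by (simp add: mult.assoc)

lemma Lam_t'_left: "Lam l (t' i * x) = qpow (- (d i * l $ i)) * Lam l x"
  using Lam_t_left[of l i "t' i * x"] by (simp add: mult.assoc[symmetric])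

definition tv :: "'r weight \<Rightarrow> ('r \<Rightarrow> int) \<Rightarrow> rat" where
  "tv l m = (\<Sum>j\<in>UNIV. of_int (m j) * (d j * l $ j))"

lemma Lam_tm_left: "Lam l (tm m * x) = qpow (tv l m) * Lam l x"
  and Lam_tm_right: "Lam l (x * tm m) = qpow (tv l m) * Lam l x"
proof -
  have "\<forall>x. Lam l (tm m * x) = qpow (tv l m) * Lam l x"
    unfolding tv_def by (rule torus_monomial_induct[of "\<lambda>y s. \<forall>x. Lam l (y * x) = qpow s * Lam l x"])
      (simp_all add: Lam_t_left Lam_t'_left mult.assoc qpow_add)
  moreover have "\<forall>x. Lam l (x * tm m) = qpow (tv l m) * Lam l x"
    unfolding tv_def
  proof (rule torus_monomial_induct[of "\<lambda>y s. \<forall>x. Lam l (x * y) = qpow s * Lam l x"])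
    fix y z r s assume "\<forall>x. Lam l (x * y) = qpow r * Lam l x" "\<forall>x. Lam l (x * z) = qpow s * Lam l x"
    then have "Lam l (x * y * z) = qpow (r + s) * Lam l x" for x by (simp add: qpow_add)
    then show "\<forall>x. Lam l (x * (y * z)) = qpow (r + s) * Lam l x" by (simp add: mult.assoc)
  qed (simp_all add: Lam_t_right Lam_t'_right)
  ultimately show "Lam l (tm m * x) = qpow (tv l m) * Lam l x" "Lam l (x * tm m) = qpow (tv l m) * Lam l x"
    by blast+
qed

lemma Lam_tm: "Lam l (tm m) = qpow (tv l m)"
  using Lam_tm_left[of l m 1] by simp

definition fw :: "'r list \<Rightarrow> 'u" where "fw w = prod_list (map f w)"
definition ew :: "'r list \<Rightarrow> 'u" where "ew w = prod_list (map e w)"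

lemma fw_simps [simp]: "fw [] = 1" "fw (i # w) = f i * fw w"
  and fw_append: "fw (v @ w) = fw v * fw w"
  by (simp_all add: fw_def)

lemma ew_simps [simp]: "ew [] = 1" "ew (i # w) = e i * ew w"
  and ew_append: "ew (v @ w) = ew v * ew w"
  by (simp_all add: ew_def)

lemma U_minus_eq: "U_minus G = qs.span (range fw)"
  by (simp add: U_minus_def generated_subalgebra_range fw_def)

lemma U_plus_eq: "U_plus G = qs.span (range ew)"
  by (simp add: U_plus_def generated_subalgebra_range ew_def)

lemma fw_U_minus [simp]: "fw w \<in> U_minus G" and ew_U_plus [simp]: "ew w \<in> U_plus G"
  by (simp_all add: U_minus_eq U_plus_eq qs.span_base)

lemma torus_mult:
  assumes "x \<in> torus G" "y \<in> torus G"
  shows "x * y \<in> torus G"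
  using assms(2) by induction (simp_all add: assms(1) torus.intros flip: mult.assoc)

lemma t_torus [simp]: "t i \<in> torus G" "t' i \<in> torus G"
  using torus.t[OF torus.one, of G i] torus.t_inv[OF torus.one, of G i] by simp_all

lemma tm_torus [simp]: "tm m \<in> torus G"
  by (rule torus_monomial_induct[of "\<lambda>x _. x \<in> torus G" _ "\<lambda>_. 0"]) (auto intro: torus_mult torus.one)

lemma torusE:
  assumes "x \<in> torus G"
  obtains m where "x = tm m"
proof -
  from assms have "\<exists>m. x = tm m"
  proof induction
    case one
    show ?case by (metis tm_0)
  next
    case (t x i)
    then show ?case by (metis tm_add tm_axis(1))
  next
    case (t_inv x i)
    then show ?case by (metis tm_add tm_axis(2))
  qed
  then show ?thesis using that by blast
qed

lemma U_zero_eq: "U_zero G = qs.span (range tm)"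
proof
  show "U_zero G \<subseteq> qs.span (range tm)"
  proof -
    have "prod_list xs \<in> range tm" if "set xs \<subseteq> range t \<union> range t'" for xs
      using that
    proof (induction xs)
      case Nil
      then show ?case by simp (metis rangeI tm_0)
    next
      case (Cons x xs)
      then obtain m where "prod_list xs = tm m" by auto
      moreover obtain n where "x = tm n" using Cons.prems by (auto intro: torusE[OF t_torus(1)] torusE[OF t_torus(2)])
      ultimately show ?case by (simp add: tm_add)
    qed
    then show ?thesis unfolding U_zero_def generated_subalgebra_eq_span by (intro qs.span_mono) auto
  qed
  have "tm m \<in> U_zero G" for m
    unfolding U_zero_def
    by (rule torus_monomial_induct[of "\<lambda>x _. x \<in> generated_subalgebra (range t \<union> range t')" _ "\<lambda>_. 0"])
      (auto intro: generated_subalgebra.intros)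
  then show "qs.span (range tm) \<subseteq> U_zero G"
    unfolding U_zero_def by (intro qs.span_minimal generated_subalgebra_subspace) auto
qed

lemma tm_U_zero [simp]: "tm m \<in> U_zero G"
  by (simp add: U_zero_eq qs.span_base)

lemma torus_U_zero: "x \<in> torus G \<Longrightarrow> x \<in> U_zero G"
  by (auto elim: torusE)

lemma Lam_U_zero:
  assumes "x \<in> U_zero G"
  shows "Lam l (x * y) = Lam l x * Lam l y"
proof -
  have "qfunctional (\<lambda>x. Lam l (x * y))" "qfunctional (\<lambda>x. Lam l x * Lam l y)"
    by (intro qfunctionalI; simp add: Lam_simps distrib_right scaleq_mult_left mult.assoc)+
  then show ?thesis
    by (rule linear_span_eq) (use assms in \<open>auto simp: U_zero_eq Lam_tm_left Lam_tm\<close>)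
qed

lemma U_zero_subspace: "qs.subspace (U_zero G)"
  by (simp add: U_zero_def generated_subalgebra_subspace)

text \<open>\<open>Lam l\<close> supplies existence, being multiplicative on \<open>U_zero\<close>.
  Uniqueness holds because torus monomials span \<open>U_zero\<close> and the values at the inverses
  of the t_i are forced.\<close>

lemma q_char_eq: "q_char G l = (\<lambda>x. if x \<in> U_zero G then Lam l x else 0)"
  unfolding q_char_def
proof (rule the_equality)
  show "(\<forall>x. x \<notin> U_zero G \<longrightarrow> (if x \<in> U_zero G then Lam l x else 0) = 0) \<and> (if 1 \<in> U_zero G then Lam l 1 else 0) = 1 \<and>
     (\<forall>x\<in>U_zero G. \<forall>y\<in>U_zero G. (if x + y \<in> U_zero G then Lam l (x + y) else 0)
         = (if x \<in> U_zero G then Lam l x else 0) + (if y \<in> U_zero G then Lam l y else 0) \<and>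
       (if x * y \<in> U_zero G then Lam l (x * y) else 0)
         = (if x \<in> U_zero G then Lam l x else 0) * (if y \<in> U_zero G then Lam l y else 0)) \<and>
     (\<forall>c. \<forall>x\<in>U_zero G. (if c *\<^sub>q x \<in> U_zero G then Lam l (c *\<^sub>q x) else 0) = c * (if x \<in> U_zero G then Lam l x else 0)) \<and>
     (\<forall>i. (if t i \<in> U_zero G then Lam l (t i) else 0) = qpow (d i * l $ i))"
    using Lam_t_right[of l 1] torus_U_zero[OF t_torus(1)] torus_U_zero[OF torus.one]
    by (auto simp: Lam_simps Lam_U_zero) (auto simp: U_zero_def intro: generated_subalgebra.intros)
next
  fix \<kappa> :: "'u \<Rightarrow> qfield"
  assume "(\<forall>x. x \<notin> U_zero G \<longrightarrow> \<kappa> x = 0) \<and> \<kappa> 1 = 1 \<and>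
     (\<forall>x\<in>U_zero G. \<forall>y\<in>U_zero G. \<kappa> (x + y) = \<kappa> x + \<kappa> y \<and> \<kappa> (x * y) = \<kappa> x * \<kappa> y) \<and>
     (\<forall>c. \<forall>x\<in>U_zero G. \<kappa> (c *\<^sub>q x) = c * \<kappa> x) \<and> (\<forall>i. \<kappa> (t i) = qpow (d i * l $ i))"
  then have \<kappa>: "\<And>x. x \<notin> U_zero G \<Longrightarrow> \<kappa> x = 0" "\<kappa> 1 = 1"
    "\<And>x y. x \<in> U_zero G \<Longrightarrow> y \<in> U_zero G \<Longrightarrow> \<kappa> (x + y) = \<kappa> x + \<kappa> y"
    "\<And>x y. x \<in> U_zero G \<Longrightarrow> y \<in> U_zero G \<Longrightarrow> \<kappa> (x * y) = \<kappa> x * \<kappa> y"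
    "\<And>c x. x \<in> U_zero G \<Longrightarrow> \<kappa> (c *\<^sub>q x) = c * \<kappa> x" "\<And>i. \<kappa> (t i) = qpow (d i * l $ i)"
    by blast+
  have t': "\<kappa> (t' i) = qpow (- (d i * l $ i))" for i
  proof -
    have "\<kappa> (t i * t' i) = qpow (d i * l $ i) * \<kappa> (t' i)"
      by (simp only: \<kappa>(4,6) torus_U_zero[OF t_torus(1)] torus_U_zero[OF t_torus(2)])
    then have "qpow (- (d i * l $ i)) * (qpow (d i * l $ i) * \<kappa> (t' i)) = qpow (- (d i * l $ i))"
      by (simp add: \<kappa>(2))
    then show ?thesis by simp
  qed
  have tm: "\<kappa> (tm m) = qpow (tv l m)" for m
  proof -
    have "tm m \<in> U_zero G \<and> \<kappa> (tm m) = qpow (tv l m)"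
      unfolding tv_def
      by (rule torus_monomial_induct[of "\<lambda>x s. x \<in> U_zero G \<and> \<kappa> x = qpow s"])
        (auto simp: \<kappa> t' torus_U_zero[OF t_torus(1)] torus_U_zero[OF t_torus(2)] torus_U_zero[OF torus.one] qpow_add
          U_zero_def intro: generated_subalgebra.intros)
    then show ?thesis by blast
  qed
  have "\<kappa> x = Lam l x" if "x \<in> U_zero G" for x
  proof -
    from that have "x \<in> qs.span (range tm)" by (simp add: U_zero_eq)
    then have "x \<in> U_zero G \<and> \<kappa> x = Lam l x"
    proof (induction rule: qs.span_induct_alt)
      case base
      have "\<kappa> 0 = 0" using \<kappa>(5)[of 1 0] torus_U_zero[OF torus.one] by simp
      then show ?case by (simp add: Lam_simps qs.subspace_0[OF U_zero_subspace])
    next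
      case (step c x y)
      then obtain m where x: "x = tm m" by blast
      then have "x \<in> U_zero G" "\<kappa> x = Lam l x" by (simp_all add: tm Lam_tm)
      with step show ?case
        by (simp add: \<kappa> Lam_simps qs.subspace_add[OF U_zero_subspace] qs.subspace_scale[OF U_zero_subspace])
    qed
    then show ?thesis by blast
  qed
  then show "\<kappa> = (\<lambda>x. if x \<in> U_zero G then Lam l x else 0)" using \<kappa>(1) by auto
qed

lemma q_char_tm [simp]: "q_char G l (tm m) = qpow (tv l m)"
  by (simp add: q_char_eq Lam_tm)

lemma q_char_t [simp]: "q_char G l (t i) = qpow (d i * l $ i)"
  using torus_U_zero[OF t_torus(1)[of i]] Lam_t_right[of l 1 i] by (simp add: q_char_eq)

lemma tv_add: "tv (l + l') m = tv l m + tv l' m"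
  by (simp add: tv_def algebra_simps sum.distrib)

text \<open>Distinct torus monomials give distinct characters of the weights, since an exponent at j
  is seen by the weight \<open>axis j 1\<close>; independence of characters then removes every
  coefficient.\<close>

lemma U_zero_separated:
  assumes "z \<in> U_zero G" "\<And>l. Lam l z = 0"
  shows "z = 0"
proof -
  obtain X r where X: "finite X" "X \<subseteq> range tm" and z: "z = (\<Sum>a\<in>X. r a *\<^sub>q a)"
    using assms(1) unfolding U_zero_eq qs.span_explicit by blast
  define m where "m a = (SOME m. a = tm m)" for a
  have m: "a = tm (m a)" if "a \<in> X" for a
  proof -
    have "\<exists>m. a = tm m" using X(2) that by blast
    then show ?thesis unfolding m_def by (rule someI_ex)
  qed
  have "r a = 0" if "a \<in> X" for a
  proof (rule qpow_characters_independent[of X "\<lambda>a l. tv l (m a)", OF X(1) _ _ _ that])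
    fix a b assume ab: "a \<in> X" "b \<in> X" "a \<noteq> b"
    have "m a \<noteq> m b" using m[OF ab(1)] m[OF ab(2)] ab(3) by metis
    then obtain j where j: "m a j \<noteq> m b j" by blast
    have "tv (axis j 1) n = of_int (n j) * d j" for n
      by (simp add: tv_def axis_def if_distrib[of "\<lambda>x. _ * x"] sum.delta cong: if_cong)
    then have "tv (axis j 1) (m a) \<noteq> tv (axis j 1) (m b)" using j by simp
    then show "\<exists>l. tv l (m a) \<noteq> tv l (m b)" by blast
  next
    fix l
    have "Lam l z = (\<Sum>a\<in>X. r a * Lam l (tm (m a)))"
      unfolding z using m by (simp add: Lam_simps)
    then show "(\<Sum>a\<in>X. r a * qpow (tv l (m a))) = 0" by (simp add: Lam_tm assms(2))
  qed (simp add: tv_add)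
  then show ?thesis by (simp add: z)
qed

lemma tm_f: "\<exists>c. tm m * f i = qpow c *\<^sub>q (f i * tm m)"
  using tm_commute[OF t_f] by blast

lemma e_tm: "\<exists>c. e i * tm m = qpow c *\<^sub>q (tm m * e i)"
proof -
  obtain c where "tm m * e i = qpow c *\<^sub>q (e i * tm m)" using tm_commute[OF t_e] by blast
  then have "e i * tm m = qpow (- c) *\<^sub>q (tm m * e i)" by (simp add: scaleq_scaleq)
  then show ?thesis by blast
qed

lemma tm_fw: "\<exists>c. tm m * fw w = qpow c *\<^sub>q (fw w * tm m)"
proof (induction w)
  case (Cons i w)
  then obtain c where c: "tm m * fw w = qpow c *\<^sub>q (fw w * tm m)" by blast
  obtain b where b: "tm m * f i = qpow b *\<^sub>q (f i * tm m)" using tm_f by blast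
  have "tm m * fw (i # w) = qpow (b + c) *\<^sub>q (fw (i # w) * tm m)"
    using qcomm_mult[OF b c] by (simp add: qpow_add)
  then show ?case by blast
qed (auto intro: exI[of _ 0])

section \<open>Spanning by triangular monomials\<close>

definition monomial :: "'r list \<Rightarrow> ('r \<Rightarrow> int) \<Rightarrow> 'r list \<Rightarrow> 'u" where
  "monomial w m v = fw w * tm m * ew v"

text \<open>The span contains 1 and is stable under left multiplication by generators. The one case
  with content is \<open>e i\<close>, moved to the right through the f_j by induction on the word;
  it leaves torus terms, which the earlier cases absorb.\<close>

lemma U_span: "u \<in> qs.span {monomial w m v | w m v. True}"
proof (rule left_closed)
  let ?S = "qs.span {monomial w m v | w m v. True}"
  show sub: "qs.subspace ?S" by (rule qs.subspace_span)
  have mono: "monomial w m v \<in> ?S" for w m v by (rule qs.span_base) blast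
  have scale: "c *\<^sub>q x \<in> ?S" if "x \<in> ?S" for c x using that by (rule qs.span_scale)
  show "1 \<in> ?S" using mono[of "[]" "\<lambda>_. 0" "[]"] by (simp add: monomial_def tm_0)
  have left: "a * u \<in> ?S" if "\<And>w m v. a * monomial w m v \<in> ?S" "u \<in> ?S" for a u
    by (rule linear_span_mem[OF qlinear_mult_left sub _ that(2)]) (use that(1) in blast)
  have tm: "tm n * monomial w m v \<in> ?S" for n w m v
  proof -
    obtain c where "tm n * fw w = qpow c *\<^sub>q (fw w * tm n)" using tm_fw by blast
    then have "tm n * monomial w m v = qpow c *\<^sub>q (fw w * (tm n * tm m) * ew v)"
      by (simp add: monomial_def mult.assoc[symmetric] scaleq_mult_left)
    then show ?thesis using scale[OF mono] by (simp add: tm_add monomial_def)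
  qed
  show "t i * u \<in> ?S" "t' i * u \<in> ?S" if "u \<in> ?S" for i u
    using left[OF tm[of "\<lambda>j. if j = i then 1 else 0"] that] left[OF tm[of "\<lambda>j. if j = i then - 1 else 0"] that]
    by (simp_all only: tm_axis)
  have f: "f i * monomial w m v \<in> ?S" for i w m v
    using mono[of "i # w" m v] by (simp add: monomial_def mult.assoc)
  show "f i * u \<in> ?S" if "u \<in> ?S" for i u using left[OF f that] .
  have "e i * monomial w m v \<in> ?S" for i w m v
  proof (induction w)
    case Nil
    obtain c where "e i * tm m = qpow c *\<^sub>q (tm m * e i)" using e_tm by blast
    then have "e i * monomial [] m v = qpow c *\<^sub>q monomial [] m (i # v)"
      by (simp add: monomial_def mult.assoc[symmetric] scaleq_mult_left)
    then show ?case using scale[OF mono] by simp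
  next
    case (Cons j w)
    have "e i * monomial (j # w) m v = e i * f j * monomial w m v"
      by (simp add: monomial_def mult.assoc)
    also have "\<dots> = f j * (e i * monomial w m v)
        + (if i = j then nu i *\<^sub>q (kk i * monomial w m v - kk' i * monomial w m v) else 0)"
      by (simp add: ef_commutator distrib_right left_diff_distrib scaleq_mult_left mult.assoc)
    also have "\<dots> \<in> ?S"
    proof -
      have "kk i * monomial w m v \<in> ?S" "kk' i * monomial w m v \<in> ?S"
        unfolding kk_def kk'_def by (rule tm)+
      then have "nu i *\<^sub>q (kk i * monomial w m v - kk' i * monomial w m v) \<in> ?S"
        by (intro scale qs.span_diff)
      then have "(if i = j then nu i *\<^sub>q (kk i * monomial w m v - kk' i * monomial w m v) else 0) \<in> ?S"
        by (cases "i = j") (simp_all only: if_True if_False simp_thms qs.span_zero)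
      then show ?thesis by (rule qs.span_add[OF left[OF f Cons.IH]])
    qed
    finally show ?case .
  qed
  then show "e i * u \<in> ?S" if "u \<in> ?S" for i u using left that by blast
qed

lemma linear_eqI:
  assumes "Vector_Spaces.linear scaleq s h" "Vector_Spaces.linear scaleq s h'"
    and "\<And>w m v. h (monomial w m v) = h' (monomial w m v)"
  shows "h x = h' x"
  by (rule linear_span_eq[OF assms(1,2) _ U_span]) (use assms(3) in blast)

lemma subspace_monomialI:
  assumes "qs.subspace S" "\<And>w m v. monomial w m v \<in> S"
  shows "x \<in> S"
  using qs.span_minimal[of "{monomial w m v | w m v. True}" S] U_span[of x] assms by blast

lemma Lam_U_minus:
  assumes "a \<in> U_minus G"
  shows "Lam l (a * b) = counit G a * Lam l b"
proof -
  have L: "qfunctional (\<lambda>x. Lam l (x * b))" "qfunctional (\<lambda>x. counit G x * Lam l b)"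
    by (intro qfunctionalI; simp add: Lam_simps lin_simps[OF counit_linear] distrib_right scaleq_mult_left mult.assoc)+
  have W: "Lam l (fw w * b) = counit G (fw w) * Lam l b" for w
    by (cases w) (simp_all add: counit_1 counit_mult counit_f mult.assoc)
  show ?thesis by (rule linear_span_eq[OF L, of "range fw"]) (use assms W in \<open>auto simp: U_minus_eq\<close>)
qed

lemma Lam_U_plus:
  assumes "b \<in> U_plus G"
  shows "Lam l (a * b) = counit G b * Lam l a"
proof -
  have L: "qfunctional (\<lambda>x. Lam l (a * x))" "qfunctional (\<lambda>x. counit G x * Lam l a)"
    by (intro qfunctionalI; simp add: Lam_simps lin_simps[OF counit_linear] distrib_left distrib_right scaleq_mult_right mult.assoc)+
  have W: "Lam l (a * ew w) = counit G (ew w) * Lam l a" for w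
    by (cases w rule: rev_cases) (simp_all add: counit_1 counit_mult counit_e mult.assoc[symmetric] ew_append)
  show ?thesis by (rule linear_span_eq[OF L, of "range ew"]) (use assms W in \<open>auto simp: U_plus_eq\<close>)
qed

text \<open>A projection exists because triangular monomials span. It is unique because every
  \<open>Lam l\<close> kills the subspace projected away, while all \<open>Lam l\<close> together
  separate \<open>U_zero\<close>.\<close>

lemma q_char_proj_zero: "q_char G l (proj_zero G x) = Lam l x"
proof -
  let ?N = "qs.span ({a * b | a b. a \<in> U_minus G \<and> counit G a = 0}
                    \<union> {a * b | a b. b \<in> U_plus G \<and> counit G b = 0})"
  have ex: "\<exists>z\<in>U_zero G. x - z \<in> ?N" for x
  proof -
    have sub: "qs.subspace {x. \<exists>z\<in>U_zero G. x - z \<in> ?N}"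
      by (rule subspace_decomposable[OF U_zero_subspace qs.subspace_span])
    have mono: "monomial w m v \<in> {x. \<exists>z\<in>U_zero G. x - z \<in> ?N}" for w m v
    proof (cases "w = [] \<and> v = []")
      case True
      then show ?thesis by (auto simp: monomial_def qs.span_zero intro!: bexI[of _ "tm m"])
    next
      case False
      have "monomial w m v \<in> ?N"
      proof (cases w)
        case Nil
        with False have "counit G (ew v) = 0"
          by (cases v) (simp_all add: counit_mult counit_e)
        then show ?thesis by (intro qs.span_base) (auto simp: monomial_def)
      next
        case (Cons i w')
        then have "counit G (fw w) = 0" by (simp add: counit_mult counit_f)
        moreover have "monomial w m v = fw w * (tm m * ew v)" by (simp add: monomial_def mult.assoc)
        ultimately show ?thesis by (intro qs.span_base) auto
      qed
      then show ?thesis by (auto intro!: bexI[of _ 0] simp: qs.subspace_0[OF U_zero_subspace])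
    qed
    show ?thesis using subspace_monomialI[OF sub mono] by blast
  qed
  have kill: "Lam l z = 0" if "z \<in> ?N" for z l
  proof -
    have "Lam l z = (\<lambda>_. 0) z"
    proof (rule linear_span_eq[OF Lam_linear _ _ that])
      show "qfunctional (\<lambda>_. 0)" by (intro qfunctionalI) simp_all
    qed (auto simp: Lam_U_minus Lam_U_plus)
    then show ?thesis by simp
  qed
  have unique: "z = z'" if "z \<in> U_zero G" "x - z \<in> ?N" "z' \<in> U_zero G" "x - z' \<in> ?N" for z z'
  proof -
    have "z - z' = (x - z') - (x - z)" by simp
    then have "z - z' \<in> ?N" by (simp only: qs.span_diff that)
    then have "z - z' = 0"
      using that kill by (intro U_zero_separated) (auto simp: qs.subspace_diff[OF U_zero_subspace])
    then show ?thesis by simp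
  qed
  obtain z where z: "z \<in> U_zero G" "x - z \<in> ?N" using ex by blast
  then have "proj_zero G x = z"
    unfolding proj_zero_def using unique by (intro the_equality) blast+
  with z kill[OF z(2), of l] show ?thesis by (simp add: q_char_eq Lam_simps)
qed

lemma pi_form_eq: "pi_form G l x y = Lam l (antipode G x * y)"
  by (simp add: pi_form_def q_char_proj_zero)

lemma Lam_verma_ideal:
  assumes "z \<in> verma_ideal G l"
  shows "Lam l (x * z) = 0"
proof -
  have "Lam l (x * z) = (\<lambda>_. 0) z"
  proof (rule linear_span_eq[of "(*)" "\<lambda>z. Lam l (x * z)" "\<lambda>_. 0"])
    show "qfunctional (\<lambda>_. 0)" "qfunctional (\<lambda>z. Lam l (x * z))"
      by (intro qfunctionalI; simp add: Lam_simps distrib_left scaleq_mult_right)+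
    show "z \<in> qs.span ({x * e i | x i. True} \<union> {x * (t - q_char G l t *\<^sub>q 1) | x t. t \<in> torus G})"
      using assms by (simp add: verma_ideal_def)
  qed (auto simp: mult.assoc[symmetric] right_diff_distrib scaleq_mult_right Lam_simps Lam_tm_right elim!: torusE)
  then show ?thesis by simp
qed

text \<open>The antipode reverses the word and inserts torus elements, which q-commute with the e_i
  and can be collected on the left. Pairings through the antipode thus become values of
  \<open>Lam\<close> on ordinary words.\<close>

lemma antipode_ew: "\<exists>c n. c \<noteq> 0 \<and> antipode G (ew (rev v)) = c *\<^sub>q (tm n * ew v)"
proof (induction v)
  case Nil
  show ?case by (auto simp: antipode_1 tm_0 intro!: exI[of _ 1] exI[of _ "\<lambda>_. 0"])
next
  case (Cons i v)
  then obtain c n where cn: "c \<noteq> 0" "antipode G (ew (rev v)) = c *\<^sub>q (tm n * ew v)" by blast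
  obtain b where b: "e i * tm n = qpow b *\<^sub>q (tm n * e i)" using e_tm by blast
  have "antipode G (ew (rev (i # v))) = - (kk' i * e i) * (c *\<^sub>q (tm n * ew v))"
    by (simp add: ew_append antipode_mult antipode_e cn)
  also have "\<dots> = (- c) *\<^sub>q (kk' i * (e i * tm n) * ew v)"
    by (simp add: scaleq_mult_right mult.assoc)
  also have "\<dots> = (- c * qpow b) *\<^sub>q (kk' i * tm n * ew (i # v))"
    by (simp add: b scaleq_mult_left scaleq_mult_right scaleq_scaleq mult.assoc)
  finally have "antipode G (ew (rev (i # v))) = (- c * qpow b) *\<^sub>q (tm (\<lambda>j. - A $ j $ i + n j) * ew (i # v))"
    by (simp add: kk'_def tm_add)
  then show ?case
    using cn(1) by (intro exI[of _ "- c * qpow b"] exI[of _ "\<lambda>j. - A $ j $ i + n j"] conjI) (simp, assumption)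
qed

text \<open>A triangular monomial with a trailing e_i lies in the ideal; otherwise its torus part
  may be replaced by the value of the character.\<close>

lemma verma_ideal_complement: "\<exists>y\<in>U_minus G. z - y \<in> verma_ideal G l"
proof -
  have V: "qs.subspace (verma_ideal G l)" by (simp add: verma_ideal_def)
  have M: "qs.subspace (U_minus G)" by (simp add: U_minus_eq)
  have sub: "qs.subspace {z. \<exists>y\<in>U_minus G. z - y \<in> verma_ideal G l}"
    by (rule subspace_decomposable[OF M V])
  have "monomial w m v \<in> {z. \<exists>y\<in>U_minus G. z - y \<in> verma_ideal G l}" for w m v
  proof (cases v rule: rev_cases)
    case Nil
    have "monomial w m v - qpow (tv l m) *\<^sub>q fw w = fw w * (tm m - q_char G l (tm m) *\<^sub>q 1)"
      by (simp add: monomial_def Nil right_diff_distrib scaleq_mult_right)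
    also have "\<dots> \<in> verma_ideal G l"
      unfolding verma_ideal_def by (rule qs.span_base) (use tm_torus in blast)
    finally show ?thesis using qs.subspace_scale[OF M fw_U_minus] by blast
  next
    case (snoc v' i)
    then have "monomial w m v = (fw w * tm m * ew v') * e i"
      by (simp add: monomial_def ew_append mult.assoc)
    then have "monomial w m v \<in> verma_ideal G l"
      unfolding verma_ideal_def by (intro qs.span_base) blast
    then show ?thesis by (auto intro!: bexI[of _ 0] simp: qs.subspace_0[OF M])
  qed
  from subspace_monomialI[OF sub this] show ?thesis by blast
qed

text \<open>This exhibits the ideal of L(l) as the largest left ideal in the kernel of
  \<open>Lam l\<close>. For an element of \<open>K_minus\<close> it suffices to multiply by
  triangular monomials: the f-part and the torus act by scalars, and the e-part is a pairing by
  \<open>antipode_ew\<close>.\<close>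

lemma L_ideal_iff: "z \<in> L_ideal G l \<longleftrightarrow> (\<forall>x. Lam l (x * z) = 0)"
proof
  assume "z \<in> L_ideal G l"
  then obtain y v where z: "z = y + v" and y: "y \<in> K_minus G l" and v: "v \<in> verma_ideal G l"
    by (auto simp: L_ideal_def)
  have "Lam l (x * y) = (\<lambda>_. 0) x" for x
  proof (rule linear_eqI[of "(*)" "\<lambda>x. Lam l (x * y)" "\<lambda>_. 0"])
    show "qfunctional (\<lambda>x. Lam l (x * y))" "qfunctional (\<lambda>_. 0)"
      by (intro qfunctionalI; simp add: Lam_simps distrib_right scaleq_mult_left)+
    fix w m v
    obtain c n where cn: "c \<noteq> 0" "antipode G (ew (rev v)) = c *\<^sub>q (tm n * ew v)" using antipode_ew by blast
    have "pi_form G l (ew (rev v)) y = 0" using y by (simp add: K_minus_def)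
    then have "Lam l (ew v * y) = 0"
      using cn(1) by (simp add: pi_form_eq cn(2) scaleq_mult_left Lam_simps mult.assoc Lam_tm_left)
    then show "Lam l (monomial w m v * y) = 0"
      by (simp add: monomial_def mult.assoc Lam_U_minus Lam_tm_left)
  qed
  then show "\<forall>x. Lam l (x * z) = 0" by (simp add: z distrib_left Lam_simps Lam_verma_ideal[OF v])
next
  assume z: "\<forall>x. Lam l (x * z) = 0"
  obtain y where y: "y \<in> U_minus G" "z - y \<in> verma_ideal G l" using verma_ideal_complement by blast
  have "Lam l (x * y) = 0" for x
    using z[rule_format, of x] Lam_verma_ideal[OF y(2), of x] by (simp add: right_diff_distrib Lam_simps)
  then have "y \<in> K_minus G l" using y(1) by (simp add: K_minus_def pi_form_eq)
  with y(2) show "z \<in> L_ideal G l"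
    unfolding L_ideal_def by (intro CollectI exI[of _ y] exI[of _ "z - y"]) simp
qed

section \<open>The anti-involution omega and the symmetry of the Shapovalov form\<close>

definition om :: "'u \<Rightarrow> 'u" where "om x = antipode G (theta G x)"

lemma om_linear: "qlinear om"
  unfolding om_def by (rule qlinear_compose[OF antipode_linear theta_linear])

lemmas om_simps = lin_simps[OF om_linear]

lemma om_1 [simp]: "om 1 = 1" and om_mult: "om (x * y) = om y * om x"
  and om_t: "om (t i) = t i" and om_t': "om (t' i) = t' i"
  and om_f: "om (f i) = kk' i * e i" and om_e: "om (e i) = f i * kk i"
  by (simp_all add: om_def theta_1 theta_mult theta_t theta_t' theta_f theta_e antipode_1 antipode_mult
      antipode_t antipode_t' antipode_e antipode_f lin_neg[OF antipode_linear])

lemma om_tm: "om (tm m) = tm m"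
proof -
  have "om (tm m) = tm m \<and> tm m \<in> torus G"
  proof (rule torus_monomial_induct[of "\<lambda>x _. om x = x \<and> x \<in> torus G" _ "\<lambda>_. 0"])
    fix x y assume *: "om x = x \<and> x \<in> torus G" "om y = y \<and> y \<in> torus G"
    then have "x * y = y * x" by (metis torusE tm_tm)
    then show "om (x * y) = x * y \<and> x * y \<in> torus G" using * by (simp add: om_mult torus_mult)
  qed (simp_all add: om_t om_t' torus.one)
  then show ?thesis by blast
qed

lemma om_kk: "om (kk i) = kk i" and om_kk': "om (kk' i) = kk' i"
  by (simp_all add: kk_def kk'_def om_tm)

lemma om_om: "om (om x) = x"
proof -
  have "x \<in> {x. om (om x) = x}"
    by (rule left_closed)
      (simp_all add: subspace_equalizer[OF qlinear_compose[OF om_linear om_linear] qlinear_ident]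
        om_mult om_t om_t' om_e om_f om_kk om_kk' mult.assoc, simp add: mult.assoc[symmetric])
  then show ?thesis by simp
qed

text \<open>omega fixes the torus and exchanges the left multiples of f_i with the right multiples
  of e_i, all of which \<open>Lam\<close> annihilates. Symmetry of the Shapovalov form is a
  consequence.\<close>

lemma Lam_om: "Lam l (om x) = Lam l x"
proof (rule linear_eqI[of "(*)" "\<lambda>x. Lam l (om x)" "Lam l"])
  show "qfunctional (\<lambda>x. Lam l (om x))" by (intro qfunctionalI) (simp_all add: om_simps Lam_simps)
  show "qfunctional (Lam l)" by (rule Lam_linear)
  fix w v :: "'r list" and m
  consider "w = []" "v = []" | i w' where "w = i # w'" | i v' where "v = v' @ [i]"
    by (cases w; cases v rule: rev_cases) auto
  then show "Lam l (om (monomial w m v)) = Lam l (monomial w m v)"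
  proof cases
    case 1
    then show ?thesis by (simp add: monomial_def om_tm)
  next
    case 2
    then show ?thesis by (simp add: monomial_def om_mult om_f mult.assoc) (simp add: mult.assoc[symmetric])
  next
    case 3
    then show ?thesis by (simp add: monomial_def om_mult om_e mult.assoc ew_append) (simp add: mult.assoc[symmetric])
  qed
qed

lemma shapovalov_eq: "shapovalov G l x y = Lam l (om x * y)"
  by (simp add: shapovalov_def pi_form_eq om_def)

lemma Lam_om_commute: "Lam l (om x * y) = Lam l (om y * x)"
  using Lam_om[of l "om x * y"] by (simp add: om_mult om_om)

end

section \<open>Weight modules and tensor products\<close>

lemma is_module_bilinear: "is_module act \<Longrightarrow> qbilinear act"
  by (auto simp: is_module_def qbilinear_def)

lemmas module_simps = qbilinear_simps[OF is_module_bilinear]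

lemma is_moduleD: "is_module act \<Longrightarrow> act 1 v = v" "is_module act \<Longrightarrow> act (x * y) v = act x (act y v)"
  by (auto simp: is_module_def)

lemma is_moduleI:
  assumes "qbilinear act" "\<And>v. act 1 v = v" "\<And>x y v. act (x * y) v = act x (act y v)"
  shows "is_module act"
  using assms by (auto simp: is_module_def qbilinear_def)

text \<open>Expanding the second legs in a basis and collecting the first legs gives independent
  second legs. A tensor is then zero as soon as its collected first legs are.\<close>

lemma tensor_in_basis_form:
  fixes V :: "'a::qspace set" and n :: "('a, 'b::qspace) tensor"
  assumes V: "qs.subspace V" and n: "n \<in> qs.span {a \<otimes>\<^sub>q b | a b. a \<in> V}"
  shows "\<exists>Y v. finite Y \<and> qs.independent Y \<and> (\<forall>b\<in>Y. v b \<in> V) \<and> n = (\<Sum>b\<in>Y. v b \<otimes>\<^sub>q b)"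
proof -
  obtain X :: "'b set" where X: "qs.independent X" "UNIV \<subseteq> qs.span X"
    using qs.basis_exists[of UNIV] by metis
  have "n \<in> qs.span {a \<otimes>\<^sub>q b | a b. a \<in> V \<and> b \<in> X}"
  proof (rule linear_span_mem[OF qlinear_ident qs.subspace_span _ n])
    fix x :: "('a, 'b) tensor" assume "x \<in> {a \<otimes>\<^sub>q b | a b. a \<in> V}"
    then obtain a b where x: "x = a \<otimes>\<^sub>q b" "a \<in> V" by blast
    show "x \<in> qs.span {a \<otimes>\<^sub>q b | a b. a \<in> V \<and> b \<in> X}"
      unfolding x(1)
      by (rule linear_span_mem[OF qlinear_tensor_right qs.subspace_span, of X]) (use X x(2) in \<open>auto intro: qs.span_base\<close>)
  qed
  then have "\<exists>Y v. finite Y \<and> Y \<subseteq> X \<and> (\<forall>b\<in>Y. v b \<in> V) \<and> n = (\<Sum>b\<in>Y. v b \<otimes>\<^sub>q b)"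
  proof (induction rule: qs.span_induct_alt)
    case base
    show ?case by (rule exI[of _ "{}"]) simp
  next
    case (step c x n)
    then obtain Y v where Y: "finite Y" "Y \<subseteq> X" "\<forall>b\<in>Y. v b \<in> V" "n = (\<Sum>b\<in>Y. v b \<otimes>\<^sub>q b)" by blast
    obtain a b where x: "x = a \<otimes>\<^sub>q b" "a \<in> V" "b \<in> X" using step(1) by blast
    show ?case
    proof (cases "b \<in> Y")
      case True
      have "c *\<^sub>q x + n = (\<Sum>b'\<in>Y. (v(b := c *\<^sub>q a + v b)) b' \<otimes>\<^sub>q b')"
        using Y(1,4) True by (simp add: x(1) sum.remove[OF Y(1) True] tensor_simps)
      moreover have "\<forall>b'\<in>Y. (v(b := c *\<^sub>q a + v b)) b' \<in> V"
        using Y(3) x(2) True V by (simp add: qs.subspace_add qs.subspace_scale)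
      ultimately show ?thesis using Y(1,2) by blast
    next
      case False
      have "c *\<^sub>q x + n = (\<Sum>b'\<in>insert b Y. (v(b := c *\<^sub>q a)) b' \<otimes>\<^sub>q b')"
        using Y(1,4) False by (auto simp: x(1) tensor_simps intro!: sum.cong)
      moreover have "\<forall>b'\<in>insert b Y. (v(b := c *\<^sub>q a)) b' \<in> V"
        using Y(3) x(2) V by (simp add: qs.subspace_scale)
      ultimately show ?thesis using Y(1,2) x(3) by (meson finite_insert insert_subset)
    qed
  qed
  then obtain Y v where "finite Y" "Y \<subseteq> X" "\<forall>b\<in>Y. v b \<in> V" "n = (\<Sum>b\<in>Y. v b \<otimes>\<^sub>q b)" by blast
  then show ?thesis using qs.independent_mono[OF X(1)] by blast
qed

definition contract :: "('a::qspace \<Rightarrow> qfield) \<Rightarrow> ('a, 'b::qspace) tensor \<Rightarrow> 'b" where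
  "contract \<xi> = tensor_ext scaleq (\<lambda>v w. \<xi> v *\<^sub>q w)"

lemma contract:
  assumes "qfunctional \<xi>"
  shows contract_linear: "qlinear (contract \<xi>)" and contract_pure: "contract \<xi> (v \<otimes>\<^sub>q w) = \<xi> v *\<^sub>q w"
  unfolding contract_def
  by (rule tensor_ext; intro qlinearI; simp add: lin_simps[OF assms] scaleq_add_left qs.scale_right_distrib scaleq_scaleq mult.commute)+

text \<open>With independent second legs, contracting by a functional and getting zero means that it
  vanishes on every collected first leg; these legs lie in \<open>V\<close>, where the functionals
  separate.\<close>

lemma tensor_separated:
  fixes n :: "('a::qspace, 'b::qspace) tensor"
  assumes "qs.subspace V" "n \<in> qs.span {a \<otimes>\<^sub>q b | a b. a \<in> V}"
    and "\<And>k. qfunctional (\<xi> k)" "\<And>k. contract (\<xi> k) n = 0"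
    and "\<And>a. a \<in> V \<Longrightarrow> (\<And>k. \<xi> k a = 0) \<Longrightarrow> a = 0"
  shows "n = 0"
proof -
  obtain Y v where Y: "finite Y" "qs.independent Y" "\<forall>b\<in>Y. v b \<in> V" "n = (\<Sum>b\<in>Y. v b \<otimes>\<^sub>q b)"
    using tensor_in_basis_form[OF assms(1,2)] by blast
  have "v b = 0" if b: "b \<in> Y" for b
  proof (rule assms(5))
    show "v b \<in> V" using Y(3) b by blast
    fix k
    have "(\<Sum>b\<in>Y. \<xi> k (v b) *\<^sub>q b) = contract (\<xi> k) n"
      by (simp add: Y(4) lin_sum[OF contract_linear[OF assms(3)]] contract_pure[OF assms(3)])
    then have "(\<Sum>b\<in>Y. \<xi> k (v b) *\<^sub>q b) = 0" using assms(4) by simp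
    then show "\<xi> k (v b) = 0"
      using qs.independentD[OF Y(2) Y(1) subset_refl _ b, of "\<lambda>b. \<xi> k (v b)"] by blast
  qed
  then show ?thesis by (simp add: Y(4))
qed

lemma qlinear_eval_dual: "qfunctional (eval_dual f)"
  using eval_dual[of f] by simp

lemmas eval_dual_simps = lin_simps[OF qlinear_eval_dual]

lemma dual_eqI: "(\<And>x. eval_dual f x = eval_dual g x) \<Longrightarrow> f = g"
  by (metis eval_dual_inject ext)

lemmas dual_rep = zero_dual.rep_eq plus_dual.rep_eq minus_dual.rep_eq uminus_dual.rep_eq scaleq_dual.rep_eq

lemma eval_Dual: "qfunctional h \<Longrightarrow> eval_dual (Dual h) x = h x"
  by (simp add: Dual_inverse)

lemma eval_left_regular: "eval_dual (left_regular a f) x = eval_dual f (x * a)"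
proof -
  have "qfunctional (\<lambda>x. eval_dual f (x * a))"
    by (intro qfunctionalI) (simp_all add: eval_dual_simps distrib_right scaleq_mult_left)
  then show ?thesis by (simp add: left_regular_def eval_Dual)
qed

lemma left_regular_module: "is_module left_regular"
  by (intro is_moduleI) (auto intro!: qlinearI dual_eqI
      simp: qbilinear_def eval_left_regular dual_rep eval_dual_simps distrib_left scaleq_mult_right mult.assoc)

context qea
begin

lemma weight_space_iff:
  assumes "is_module act"
  shows "v \<in> weight_space G act m \<longleftrightarrow> (\<forall>i. act (t i) v = qpow (d i * m $ i) *\<^sub>q v)"
proof
  assume "v \<in> weight_space G act m"
  then show "\<forall>i. act (t i) v = qpow (d i * m $ i) *\<^sub>q v" by (simp add: weight_space_def)
next
  assume v: "\<forall>i. act (t i) v = qpow (d i * m $ i) *\<^sub>q v"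
  note simps = module_simps[OF assms]
  have "act (t' i) v = qpow (- (d i * m $ i)) *\<^sub>q v" for i
  proof -
    have "v = act (t' i * t i) v" using assms by (simp add: is_moduleD)
    also have "\<dots> = qpow (d i * m $ i) *\<^sub>q act (t' i) v" using assms v by (simp only: is_moduleD simps)
    finally show ?thesis by (metis qpow_minus_mult(1) qs.scale_one qs.scale_scale)
  qed
  with v have "act (tm n) v = qpow (tv m n) *\<^sub>q v" for n
    unfolding tv_def
    by - (rule torus_monomial_induct[of "\<lambda>x s. act x v = qpow s *\<^sub>q v"],
      use assms in \<open>simp_all add: is_moduleD simps qpow_add scaleq_scaleq mult.commute\<close>)
  then show "v \<in> weight_space G act m" by (auto simp: weight_space_def elim!: torusE)
qed

lemma weight_space_tm:
  "v \<in> weight_space G act m \<Longrightarrow> act (tm n) v = qpow (tv m n) *\<^sub>q v"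
  by (simp add: weight_space_def)

lemma kval_eq: "kval i m = B (simple_root i) m"
proof -
  have "B (simple_root i) (\<Sum>l\<in>L. m $ l *s simple_root l) = (\<Sum>l\<in>L. m $ l * B (simple_root i) (simple_root l))" for L
    by (induction L rule: infinite_finite_induct) (simp_all add: sform_right)
  moreover have "(\<Sum>l\<in>UNIV. m $ l *s simple_root l) = m"
    by (simp add: vec_eq_iff simple_root_nth if_distrib[of "\<lambda>x. _ * x"] sum.delta cong: if_cong)
  ultimately have "B (simple_root i) m = (\<Sum>l\<in>UNIV. m $ l * cc l i)"
    by (metis (no_types, lifting) cc_sform sform(3) sum.cong)
  then show ?thesis by (simp add: kval_def cc_def mult_ac)
qed

lemma weight_space_kk:
  assumes "v \<in> weight_space G act m"
  shows "act (kk i) v = qpow (B (simple_root i) m) *\<^sub>q v" "act (kk' i) v = qpow (- B (simple_root i) m) *\<^sub>q v"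
proof -
  have "tv m (\<lambda>j. A $ j $ i) = B (simple_root i) m" "tv m (\<lambda>j. - A $ j $ i) = - B (simple_root i) m"
    by (simp_all add: kval_eq[symmetric] kval_def tv_def sum_negf)
  then show "act (kk i) v = qpow (B (simple_root i) m) *\<^sub>q v" "act (kk' i) v = qpow (- B (simple_root i) m) *\<^sub>q v"
    using weight_space_tm[OF assms] by (simp_all add: kk_def kk'_def)
qed

lemma weight_space_subspace:
  assumes "is_module act"
  shows "qs.subspace (weight_space G act m)"
  unfolding qs.subspace_def
  by (simp add: weight_space_iff[OF assms] module_simps[OF assms]
      qs.scale_right_distrib scaleq_scaleq mult.commute)

lemma weight_space_e:
  assumes "is_module act" "v \<in> weight_space G act m"
  shows "act (e i) v \<in> weight_space G act (m + simple_root i)"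
  unfolding weight_space_iff[OF assms(1)]
proof
  fix j
  have "act (t j) (act (e i) v) = act (t j * e i) v" by (simp add: is_moduleD assms(1))
  also have "\<dots> = qpow (d j * (if j = i then 1 else 0)) *\<^sub>q act (e i) (act (t j) v)"
    unfolding t_e by (simp add: module_simps[OF assms(1)] is_moduleD assms(1))
  also have "act (t j) v = qpow (d j * m $ j) *\<^sub>q v"
    using assms(2) weight_space_iff[OF assms(1)] by blast
  finally show "act (t j) (act (e i) v) = qpow (d j * (m + simple_root i) $ j) *\<^sub>q act (e i) v"
    by (auto simp: module_simps[OF assms(1)] scaleq_scaleq simple_root_nth qpow_add[symmetric]
        algebra_simps)
qed

lemma weight_space_f:
  assumes "is_module act" "v \<in> weight_space G act m"
  shows "act (f i) v \<in> weight_space G act (m - simple_root i)"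
  unfolding weight_space_iff[OF assms(1)]
proof
  fix j
  have "act (t j) (act (f i) v) = act (t j * f i) v" by (simp add: is_moduleD assms(1))
  also have "\<dots> = qpow (- d j * (if j = i then 1 else 0)) *\<^sub>q act (f i) (act (t j) v)"
    unfolding t_f by (simp add: module_simps[OF assms(1)] is_moduleD assms(1))
  also have "act (t j) v = qpow (d j * m $ j) *\<^sub>q v"
    using assms(2) weight_space_iff[OF assms(1)] by blast
  finally show "act (t j) (act (f i) v) = qpow (d j * (m - simple_root i) $ j) *\<^sub>q act (f i) v"
    by (auto simp: module_simps[OF assms(1)] scaleq_scaleq simple_root_nth qpow_add[symmetric]
        algebra_simps)
qed

lemma weight_space_ew:
  assumes "is_module act" "v \<in> weight_space G act m"
  shows "act (ew w) v \<in> weight_space G act (m + wt w)"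
proof (induction w)
  case (Cons i w)
  from weight_space_e[OF assms(1) Cons, of i] show ?case
    by (simp add: is_moduleD assms(1) algebra_simps)
qed (simp add: assms is_moduleD)

lemma weight_space_fw:
  assumes "is_module act" "v \<in> weight_space G act m"
  shows "act (fw w) v \<in> weight_space G act (m - wt w)"
proof (induction w)
  case (Cons i w)
  from weight_space_f[OF assms(1) Cons, of i] show ?case
    by (simp add: is_moduleD assms(1) algebra_simps)
qed (simp add: assms is_moduleD)

text \<open>If t_i distinguishes m from n, then t_i minus its eigenvalue on weight n removes the
  component of weight n and multiplies that of weight m by a nonzero scalar. Induction on the number
  of weights isolates each component inside \<open>Y\<close>.\<close>

lemma weight_components:
  assumes act: "is_module act" and Y: "qs.subspace Y" "\<And>i y. y \<in> Y \<Longrightarrow> act (t i) y \<in> Y"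
    and "finite S" "\<And>m. m \<in> S \<Longrightarrow> x m \<in> weight_space G act m" "(\<Sum>m\<in>S. x m) \<in> Y" "m \<in> S"
  shows "x m \<in> Y"
  using assms(4-7)
proof (induction S arbitrary: x m rule: finite_induct)
  case (insert n S)
  note simps = module_simps[OF act]
  have S: "x m \<in> Y" if m: "m \<in> S" for m
  proof -
    have "m \<noteq> n" using m insert.hyps by blast
    then obtain i where i: "m $ i \<noteq> n $ i" by (auto simp: vec_eq_iff)
    define c where "c k = qpow (d i * k $ i) - qpow (d i * n $ i)" for k :: "'r weight"
    have cx: "c k *\<^sub>q x k = act (t i) (x k) - qpow (d i * n $ i) *\<^sub>q x k" if "k \<in> insert n S" for k
      using insert.prems(1)[OF that] by (simp add: weight_space_iff[OF act] c_def qs.scale_left_diff_distrib)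
    have "(\<Sum>k\<in>S. c k *\<^sub>q x k) = (\<Sum>k\<in>insert n S. c k *\<^sub>q x k)"
      using insert.hyps by (simp add: c_def)
    also have "\<dots> = (\<Sum>k\<in>insert n S. act (t i) (x k) - qpow (d i * n $ i) *\<^sub>q x k)"
      by (rule sum.cong) (simp_all only: cx)
    also have "\<dots> = act (t i) (\<Sum>k\<in>insert n S. x k) - qpow (d i * n $ i) *\<^sub>q (\<Sum>k\<in>insert n S. x k)"
      by (simp only: simps sum_subtractf qs.scale_sum_right)
    also have "\<dots> \<in> Y" using insert.prems(2) Y by (intro qs.subspace_diff qs.subspace_scale)
    finally have "c m *\<^sub>q x m \<in> Y"
      using m insert.prems(1) by (intro insert.IH[of "\<lambda>k. c k *\<^sub>q x k"])
        (auto intro: qs.subspace_scale weight_space_subspace act)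
    moreover have "c m \<noteq> 0" using i by (simp add: c_def)
    ultimately have "inverse (c m) *\<^sub>q (c m *\<^sub>q x m) \<in> Y" using qs.subspace_scale[OF Y(1)] by blast
    then show ?thesis using \<open>c m \<noteq> 0\<close> by simp
  qed
  have "(\<Sum>k\<in>insert n S. x k) - (\<Sum>k\<in>S. x k) \<in> Y"
    by (intro qs.subspace_diff[OF Y(1) insert.prems(2)] qs.subspace_sum[OF Y(1)] S)
  then have "x n \<in> Y" using insert.hyps by simp
  with S insert.prems(3) show ?case by blast
qed simp

section \<open>Tensor products of modules\<close>

definition tact :: "('u \<Rightarrow> 'v::qspace \<Rightarrow> 'v) \<Rightarrow> ('u \<Rightarrow> 'w::qspace \<Rightarrow> 'w) \<Rightarrow> 'u \<Rightarrow> ('v, 'w) tensor \<Rightarrow> ('v, 'w) tensor" where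
  "tact act1 act2 x = tensor_act act1 act2 (coproduct G x)"

context
  fixes act1 :: "'u \<Rightarrow> 'v::qspace \<Rightarrow> 'v" and act2 :: "'u \<Rightarrow> 'w::qspace \<Rightarrow> 'w"
  assumes act: "is_module act1" "is_module act2"
begin

lemma tact_module: "is_module (tact act1 act2)"
proof -
  note bil = is_module_bilinear[OF act(1)] is_module_bilinear[OF act(2)]
  note A = qbilinear_tensor_bilinear[OF bil]
  show ?thesis unfolding tact_def tensor_act_eq_bilinear
  proof (rule is_moduleI)
    show "qbilinear (\<lambda>x. tensor_bilinear act1 act2 (coproduct G x))"
      unfolding qbilinear_def
      by (auto intro: qbilinearD(1)[OF A] qlinear_compose[OF qbilinearD(2)[OF A] coproduct_linear])
    show "tensor_bilinear act1 act2 (coproduct G 1) v = v" for v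
      unfolding coproduct_1 one_tensor_def by (rule tensor_bilinear_1[OF bil]) (simp_all add: is_moduleD act)
    show "tensor_bilinear act1 act2 (coproduct G (x * y)) v
        = tensor_bilinear act1 act2 (coproduct G x) (tensor_bilinear act1 act2 (coproduct G y) v)" for x y v
      unfolding coproduct_mult times_tensor_def
      by (rule tensor_bilinear_mult[OF bil qbilinear_mult qbilinear_mult]) (simp_all add: is_moduleD act)
  qed
qed

lemma tact_pure:
  shows tact_t: "tact act1 act2 (t i) (v \<otimes>\<^sub>q w) = act1 (t i) v \<otimes>\<^sub>q act2 (t i) w"
    and tact_t': "tact act1 act2 (t' i) (v \<otimes>\<^sub>q w) = act1 (t' i) v \<otimes>\<^sub>q act2 (t' i) w"
    and tact_e: "tact act1 act2 (e i) (v \<otimes>\<^sub>q w) = act1 (e i) v \<otimes>\<^sub>q w + act1 (kk i) v \<otimes>\<^sub>q act2 (e i) w"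
    and tact_f: "tact act1 act2 (f i) (v \<otimes>\<^sub>q w) = act1 (f i) v \<otimes>\<^sub>q act2 (kk' i) w + v \<otimes>\<^sub>q act2 (f i) w"
    and tact_kk': "tact act1 act2 (kk' i) (v \<otimes>\<^sub>q w) = act1 (kk' i) v \<otimes>\<^sub>q act2 (kk' i) w"
proof -
  note bil = is_module_bilinear[OF act(1)] is_module_bilinear[OF act(2)]
  note A = qbilinear_tensor_bilinear[OF bil]
  show "tact act1 act2 (t i) (v \<otimes>\<^sub>q w) = act1 (t i) v \<otimes>\<^sub>q act2 (t i) w"
    "tact act1 act2 (t' i) (v \<otimes>\<^sub>q w) = act1 (t' i) v \<otimes>\<^sub>q act2 (t' i) w"
    "tact act1 act2 (e i) (v \<otimes>\<^sub>q w) = act1 (e i) v \<otimes>\<^sub>q w + act1 (kk i) v \<otimes>\<^sub>q act2 (e i) w"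
    "tact act1 act2 (f i) (v \<otimes>\<^sub>q w) = act1 (f i) v \<otimes>\<^sub>q act2 (kk' i) w + v \<otimes>\<^sub>q act2 (f i) w"
    "tact act1 act2 (kk' i) (v \<otimes>\<^sub>q w) = act1 (kk' i) v \<otimes>\<^sub>q act2 (kk' i) w"
    unfolding tact_def tensor_act_eq_bilinear coproduct_t coproduct_t' coproduct_e coproduct_f coproduct_kk'
      qbilinear_simps[OF A] tensor_bilinear_pure[OF bil]
    by (simp_all add: is_moduleD act)
qed

lemma tact_span:
  assumes "\<And>x v. v \<in> V \<Longrightarrow> act1 x v \<in> V" "\<And>x w. w \<in> W \<Longrightarrow> act2 x w \<in> W"
    and "n \<in> qs.span {v \<otimes>\<^sub>q w | v w. v \<in> V \<and> w \<in> W}"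
  shows "tact act1 act2 x n \<in> qs.span {v \<otimes>\<^sub>q w | v w. v \<in> V \<and> w \<in> W}"
proof -
  let ?S = "qs.span {v \<otimes>\<^sub>q w | v w. v \<in> V \<and> w \<in> W}"
  note bil = is_module_bilinear[OF act(1)] is_module_bilinear[OF act(2)]
  note A = qbilinear_tensor_bilinear[OF bil]
  have "tensor_bilinear act1 act2 s n \<in> ?S" for s
  proof (rule linear_span_mem[OF qbilinearD(2)[OF A] qs.subspace_span _ tensor_span])
    fix s :: "('u, 'u) tensor" assume "s \<in> {a \<otimes>\<^sub>q b | a b. True}"
    then obtain a b where s: "s = a \<otimes>\<^sub>q b" by blast
    show "tensor_bilinear act1 act2 s n \<in> ?S"
    proof (rule linear_span_mem[OF qbilinearD(1)[OF A] qs.subspace_span _ assms(3)])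
      fix x assume "x \<in> {v \<otimes>\<^sub>q w | v w. v \<in> V \<and> w \<in> W}"
      then obtain v w where x: "x = v \<otimes>\<^sub>q w" "v \<in> V" "w \<in> W" by blast
      show "tensor_bilinear act1 act2 s x \<in> ?S"
        unfolding s x(1) tensor_bilinear_pure[OF bil]
        by (rule qs.span_base) (use assms(1,2) x in blast)
    qed
  qed
  then show ?thesis by (simp add: tact_def tensor_act_eq_bilinear)
qed

end

lemma contract_linear_compose:
  assumes "is_module act" "qfunctional \<xi>"
  shows "qfunctional (\<lambda>v. \<xi> (act x v))"
  by (intro qfunctionalI) (simp_all add: lin_simps[OF assms(2)] module_simps[OF assms(1)])

end

text \<open>\<^term>\<open>vst\<close> reads off the coefficient of the highest weight vector.\<close>

locale highest_weight = qea G
  for G :: "('r::finite, 'u::qalgebra) qgroup" +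
  fixes lam :: "'r weight" and act :: "'u \<Rightarrow> 'l::qspace \<Rightarrow> 'l" and one :: 'l and vst :: "'l \<Rightarrow> qfield"
  assumes act: "is_module act" and vst_linear: "qfunctional vst"
    and vst_one: "vst (act x one) = Lam lam x"
    and nondegenerate: "(\<And>x. Lam lam (x * z) = 0) \<Longrightarrow> act z one = 0"
begin

lemmas act_simps = module_simps[OF act]
lemmas act_1 = is_moduleD(1)[OF act]
lemmas act_mult = is_moduleD(2)[OF act]

text \<open>The submodule generated by \<open>one\<close> need not be everything: the locale is
  interpreted in the given copy of L(lam) and also in the whole dual of \<open>'u\<close>.\<close>

definition V :: "'l set" where "V = range (\<lambda>x. act x one)"

lemma V_subspace: "qs.subspace V"
proof (rule qs.subspaceI)
  show "0 \<in> V" unfolding V_def by (rule range_eqI[of _ _ 0]) (simp add: act_simps)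
  show "x + y \<in> V" if "x \<in> V" "y \<in> V" for x y
    using that unfolding V_def by (auto simp: act_simps(1)[symmetric])
  show "c *\<^sub>q x \<in> V" if "x \<in> V" for c x
    using that unfolding V_def by (auto simp: act_simps(2)[symmetric])
qed

lemma one_V: "one \<in> V" and act_V: "v \<in> V \<Longrightarrow> act x v \<in> V"
  unfolding V_def using act_1[of one] by (metis rangeI, auto simp: act_mult[symmetric])

lemma vst_f: "v \<in> V \<Longrightarrow> vst (act (f i) v) = 0"
  unfolding V_def by (auto simp: act_mult[symmetric] vst_one)

lemma vst_tm: "v \<in> V \<Longrightarrow> vst (act (tm m) v) = qpow (tv lam m) * vst v"
  unfolding V_def by (auto simp: act_mult[symmetric] vst_one Lam_tm_left)

lemma one_e: "act (e i) one = 0"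
  by (rule nondegenerate) (simp flip: mult.assoc)

lemma one_tm: "act (tm m) one = qpow (tv lam m) *\<^sub>q one"
proof -
  have "act (tm m - qpow (tv lam m) *\<^sub>q 1) one = 0"
    by (rule nondegenerate) (simp add: right_diff_distrib Lam_simps Lam_tm_right scaleq_mult_right)
  then show ?thesis by (simp add: act_simps act_1)
qed

lemma one_weight: "one \<in> weight_space G act lam"
  using one_tm by (auto simp: weight_space_def elim!: torusE)

text \<open>The Shapovalov pairing with the vector \<open>act (fw w) one\<close>, written as a
  matrix coefficient of \<open>vst\<close>.\<close>

definition coef :: "'r list \<Rightarrow> 'l \<Rightarrow> qfield" where "coef w v = vst (act (om (fw w)) v)"

lemma coef_linear: "qfunctional (coef w)"
  using contract_linear_compose[OF act vst_linear, of "om (fw w)"] by (simp add: coef_def[abs_def])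

lemma coef_Nil: "coef [] = vst"
  by (rule ext) (simp add: coef_def act_1)

lemma om_fw_ew: "om (fw w * tm m * ew v) = om (ew v) * tm m * om (fw w)"
  by (simp add: om_mult om_tm mult.assoc)

text \<open>Nondegeneracy of the Shapovalov form. omega turns a triangular monomial into one whose
  first factor comes from e-letters and is a left multiple of some f_i unless empty, so only the
  pairings with the \<open>fw w\<close> remain.\<close>

lemma coef_separates:
  assumes "a \<in> V" "\<And>w. coef w a = 0"
  shows "a = 0"
proof -
  obtain z where z: "a = act z one" using assms(1) by (auto simp: V_def)
  have "Lam lam (om x * z) = (\<lambda>_. 0) x" for x
  proof (rule linear_eqI[of "(*)" "\<lambda>x. Lam lam (om x * z)" "\<lambda>_. 0"])
    show "qfunctional (\<lambda>x. Lam lam (om x * z))" "qfunctional (\<lambda>_. 0)"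
      by (intro qfunctionalI; simp add: om_simps Lam_simps distrib_right scaleq_mult_left)+
    fix w m v
    have "Lam lam (om (fw w) * z) = 0" using assms(2)[of w] by (simp add: z coef_def act_mult[symmetric] vst_one)
    then show "Lam lam (om (monomial w m v) * z) = 0"
      unfolding monomial_def om_fw_ew
      by (cases v rule: rev_cases) (simp_all add: Lam_tm_left mult.assoc ew_append om_mult om_e)
  qed
  then have "Lam lam (x * z) = 0" for x using om_om[of x] by metis
  then show ?thesis unfolding z by (rule nondegenerate)
qed

context
  fixes act2 :: "'u \<Rightarrow> 'w::qspace \<Rightarrow> 'w"
  assumes act2: "is_module act2"
begin

private abbreviation "TT \<equiv> tact act act2"

private lemmas act2_simps = module_simps[OF act2]
private lemmas T_simps = module_simps[OF tact_module[OF act act2]]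
private lemmas T_mult = is_moduleD(2)[OF tact_module[OF act act2]]
private lemmas pure = tact_pure[OF act act2]
private lemmas T_linear = qbilinearD(1)[OF is_module_bilinear[OF tact_module[OF act act2]]]
private lemmas act2_linear = qbilinearD(1)[OF is_module_bilinear[OF act2]]

text \<open>omega sends f_i to \<open>kk' i * e i\<close>, and the coproduct of this element is
  itself tensor \<open>kk' i\<close> plus 1 tensor itself. The identity computes the contraction
  with a longer word from contractions with a shorter one.\<close>

lemma contract_coef_e:
  "contract (coef w) (TT (kk' i * e i) n)
    = act2 (kk' i) (contract (coef (i # w)) n) + act2 (kk' i * e i) (contract (coef w) n)"
proof (rule linear_tensor_eq[of scaleq "\<lambda>n. contract (coef w) (TT (kk' i * e i) n)"])
  show "qlinear (\<lambda>n. contract (coef w) (TT (kk' i * e i) n))"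
    by (rule qlinear_compose[OF contract_linear[OF coef_linear] T_linear])
  show "qlinear (\<lambda>n. act2 (kk' i) (contract (coef (i # w)) n) + act2 (kk' i * e i) (contract (coef w) n))"
    by (intro qlinearI) (simp_all add: lin_simps[OF contract_linear[OF coef_linear]] act2_simps qs.scale_right_distrib)
  fix v :: 'l and u :: 'w
  have kk: "act (kk' i) (act (kk i) v) = v" by (simp add: act_mult[symmetric] act_1)
  show "contract (coef w) (TT (kk' i * e i) (v \<otimes>\<^sub>q u))
    = act2 (kk' i) (contract (coef (i # w)) (v \<otimes>\<^sub>q u)) + act2 (kk' i * e i) (contract (coef w) (v \<otimes>\<^sub>q u))"
    unfolding T_mult pure T_simps contract_pure[OF coef_linear] lin_simps[OF contract_linear[OF coef_linear]]
    by (simp add: coef_def kk act2_simps om_mult om_f act_mult is_moduleD[OF act2])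
qed

lemma contract_vst_f:
  assumes "n \<in> qs.span {v \<otimes>\<^sub>q u | v u. v \<in> V}"
  shows "contract vst (TT (f i) n) = act2 (f i) (contract vst n)"
proof (rule linear_span_eq[OF _ _ _ assms, of scaleq "\<lambda>n. contract vst (TT (f i) n)" "\<lambda>n. act2 (f i) (contract vst n)"])
  show "qlinear (\<lambda>n. contract vst (TT (f i) n))" "qlinear (\<lambda>n. act2 (f i) (contract vst n))"
    by (rule qlinear_compose[OF contract_linear[OF vst_linear] T_linear]
        qlinear_compose[OF act2_linear contract_linear[OF vst_linear]])+
  fix n assume "n \<in> {v \<otimes>\<^sub>q u | v u :: 'w. v \<in> V}"
  then obtain v u where n: "n = v \<otimes>\<^sub>q u" "v \<in> V" by blast
  show "contract vst (TT (f i) n) = act2 (f i) (contract vst n)"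
    unfolding n(1) pure lin_simps[OF contract_linear[OF vst_linear]] contract_pure[OF vst_linear]
    by (simp add: vst_f n(2) act2_simps)
qed

lemma tensor_coef_separated:
  assumes "n \<in> qs.span {v \<otimes>\<^sub>q u | v u. v \<in> V}" "\<And>w. contract (coef w) n = (0 :: 'w)"
  shows "n = 0"
  by (rule tensor_separated[OF V_subspace assms(1), of coef])
    (use coef_linear assms(2) coef_separates in blast)+

text \<open>Stability under \<open>kk' i * e i\<close> propagates the vanishing from
  \<open>vst\<close> to all \<open>coef w\<close> by the recursion \<open>contract_coef_e\<close>,
  and the \<open>coef w\<close> separate.\<close>

lemma tensor_submodule_zero:
  assumes "N \<subseteq> qs.span {v \<otimes>\<^sub>q u | v u. v \<in> V}" "\<And>i n. n \<in> N \<Longrightarrow> TT (kk' i * e i) n \<in> N"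
    and "\<And>n. n \<in> N \<Longrightarrow> contract vst n = 0" "n \<in> N"
  shows "n = 0"
proof -
  have "\<forall>n\<in>N. contract (coef w) n = 0" for w
  proof (induction w)
    case (Cons i w)
    show ?case
    proof
      fix n assume n: "n \<in> N"
      have "act2 (kk' i) (contract (coef (i # w)) n) = 0"
        using contract_coef_e[of w i n] Cons assms(2)[OF n] n by (simp add: act2_simps)
      then have "act2 (kk i * kk' i) (contract (coef (i # w)) n) = 0"
        by (simp only: is_moduleD[OF act2] act2_simps)
      then show "contract (coef (i # w)) n = 0" by (simp add: is_moduleD[OF act2])
    qed
  qed (simp add: assms(3) coef_Nil)
  then show ?thesis using assms(1,4) by (intro tensor_coef_separated) blast+
qed

text \<open>When \<open>z\<close> is annihilated by the e_i, the recursion says that adding a letter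
  i to the word applies - e_i, which is theta of f_i.\<close>

lemma contract_coef_singular:
  assumes "\<And>i. TT (e i) z = 0"
  shows "contract (coef w) z = act2 (theta G (fw w)) (contract vst z)"
proof (induction w)
  case (Cons i w)
  have "TT (kk' i * e i) z = 0" by (simp add: T_mult assms T_simps)
  then have "act2 (kk' i) (contract (coef (i # w)) z + act2 (e i) (contract (coef w) z)) = 0"
    using contract_coef_e[of w i z]
    by (simp add: lin_simps[OF contract_linear[OF coef_linear]] is_moduleD[OF act2] act2_simps)
  then have "act2 (kk i) (act2 (kk' i) (contract (coef (i # w)) z + act2 (e i) (contract (coef w) z))) = act2 (kk i) 0"
    by (simp only:)
  then have "contract (coef (i # w)) z = - act2 (e i) (contract (coef w) z)"
    unfolding is_moduleD(2)[OF act2, symmetric]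
    by (simp add: is_moduleD(1)[OF act2] act2_simps(8) eq_neg_iff_add_eq_0)
  then show ?case by (simp add: Cons.IH theta_mult theta_f is_moduleD[OF act2] act2_simps)
qed (simp add: coef_Nil theta_1 is_moduleD[OF act2])

end

end

section \<open>The bilinear form on words\<close>

text \<open>The relation g c g = g, by induction on the columns. A new column dependent on the old
  ones needs no change of c; an independent one is detected by a row functional, by which c is
  corrected. This replaces inversion of the Gram matrix of the form on words, which may be
  singular.\<close>

lemma generalized_inverse:
  fixes g :: "'a \<Rightarrow> 'b \<Rightarrow> 'c::field"
  assumes "finite I" "finite J"
  shows "\<exists>c. \<forall>i\<in>I. \<forall>j\<in>J. (\<Sum>k\<in>J. \<Sum>l\<in>I. g i k * c k l * g l j) = g i j"
  using assms(2)
proof (induction J rule: finite_induct)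
  case (insert p J)
  then obtain c where c: "\<forall>i\<in>I. \<forall>j\<in>J. (\<Sum>k\<in>J. \<Sum>l\<in>I. g i k * c k l * g l j) = g i j" by blast
  \<comment> \<open>The matrix 1 - g c, which annihilates the columns already treated.\<close>
  define h where "h i l = (if i = l then 1 else 0) - (\<Sum>k\<in>J. g i k * c k l)" for i l
  have h: "(\<Sum>l\<in>I. h i l * g l j) = g i j - (\<Sum>k\<in>J. \<Sum>l\<in>I. g i k * c k l * g l j)" if "i \<in> I" for i j
  proof -
    have "(\<Sum>l\<in>I. h i l * g l j) = (\<Sum>l\<in>I. (if i = l then g l j else 0)) - (\<Sum>l\<in>I. \<Sum>k\<in>J. g i k * c k l * g l j)"
      unfolding h_def left_diff_distrib sum_subtractf sum_distrib_right
      by (intro arg_cong2[of _ _ _ _ "(-)"] sum.cong) auto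
    then show ?thesis using that assms(1) sum.swap[of "\<lambda>l k. g i k * c k l * g l j" J I] by simp
  qed
  have hJ: "(\<Sum>l\<in>I. h i l * g l j) = 0" if "i \<in> I" "j \<in> J" for i j
    using h[OF that(1)] c that by simp
  show ?case
  proof (cases "\<forall>i\<in>I. (\<Sum>l\<in>I. h i l * g l p) = 0")
    case True
    define c' where "c' k l = (if k = p then 0 else c k l)" for k l
    have eq: "(\<Sum>k\<in>insert p J. \<Sum>l\<in>I. g i k * c' k l * g l j) = (\<Sum>k\<in>J. \<Sum>l\<in>I. g i k * c k l * g l j)" for i j
      using insert.hyps by (auto simp: c'_def intro!: sum.cong)
    have "(\<Sum>k\<in>J. \<Sum>l\<in>I. g i k * c k l * g l j) = g i j" if "i \<in> I" "j \<in> insert p J" for i j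
    proof (cases "j = p")
      case True
      then show ?thesis using h[OF that(1), of p] \<open>\<forall>i\<in>I. _ i = 0\<close> that(1) by simp
    qed (use c that in simp)
    then show ?thesis by (intro exI[of _ c'] ballI) (simp only: eq)
  next
    case False
    then obtain i0 where i0: "i0 \<in> I" and "(\<Sum>l\<in>I. h i0 l * g l p) \<noteq> 0" by blast
    define a where "a = (\<Sum>l\<in>I. h i0 l * g l p)"
    have a: "a \<noteq> 0" using \<open>_ \<noteq> 0\<close> by (simp add: a_def)
    \<comment> \<open>A row functional that vanishes on the old columns and is 1 on the new column
      p.\<close>
    define r where "r l = h i0 l / a" for l
    have r: "(\<Sum>l\<in>I. r l * g l j) = (if j = p then 1 else 0)" if "j \<in> insert p J" for j
    proof -
      have "(\<Sum>l\<in>I. r l * g l j) = (\<Sum>l\<in>I. h i0 l * g l j) / a"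
        by (simp add: r_def sum_divide_distrib)
      then show ?thesis using that hJ[OF i0] a insert.hyps by (auto simp: a_def)
    qed
    \<comment> \<open>The old c applied to the new column. Subtracting \<open>v\<close> times
      \<open>r\<close> from c leaves the old columns alone and removes the unwanted contribution at
      p.\<close>
    define v where "v k = (\<Sum>l\<in>I. c k l * g l p)" for k
    define c' where "c' k l = (if k = p then r l else c k l - v k * r l)" for k l
    have "(\<Sum>k\<in>insert p J. \<Sum>l\<in>I. g i k * c' k l * g l j) = g i j" if i: "i \<in> I" and j: "j \<in> insert p J" for i j
    proof -
      have "(\<Sum>k\<in>insert p J. \<Sum>l\<in>I. g i k * c' k l * g l j)
          = (\<Sum>l\<in>I. g i p * r l * g l j) + (\<Sum>k\<in>J. \<Sum>l\<in>I. g i k * (c k l - v k * r l) * g l j)"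
        using insert.hyps by (auto simp: c'_def intro!: sum.cong arg_cong2[of _ _ _ _ "(+)"])
      also have "(\<Sum>l\<in>I. g i p * r l * g l j) = g i p * (\<Sum>l\<in>I. r l * g l j)"
        by (simp add: sum_distrib_left mult.assoc)
      also have "(\<Sum>k\<in>J. \<Sum>l\<in>I. g i k * (c k l - v k * r l) * g l j)
          = (\<Sum>k\<in>J. \<Sum>l\<in>I. g i k * c k l * g l j) - (\<Sum>k\<in>J. g i k * v k) * (\<Sum>l\<in>I. r l * g l j)"
        unfolding sum_product sum_subtractf[symmetric]
        by (intro sum.cong refl) (simp add: algebra_simps)
      finally have *: "(\<Sum>k\<in>insert p J. \<Sum>l\<in>I. g i k * c' k l * g l j)
          = g i p * (\<Sum>l\<in>I. r l * g l j) + ((\<Sum>k\<in>J. \<Sum>l\<in>I. g i k * c k l * g l j) - (\<Sum>k\<in>J. g i k * v k) * (\<Sum>l\<in>I. r l * g l j))" .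
      have v: "(\<Sum>k\<in>J. g i k * v k) = (\<Sum>k\<in>J. \<Sum>l\<in>I. g i k * c k l * g l p)"
        by (simp add: v_def sum_distrib_left mult.assoc)
      show ?thesis
      proof (cases "j = p")
        case True
        then show ?thesis unfolding * r[OF j] v by simp
      next
        case False
        then show ?thesis unfolding * r[OF j] using c i j by simp
      qed
    qed
    then show ?thesis by blast
  qed
qed simp

text \<open>The sum over all occurrences of j in the word, with that letter deleted and weighted by
  the product of \<open>c\<close> over the letters before it. In \<open>rstrip\<close> the weight
  depends on the letters after it. For suitable weights these are Lusztig's left and right twisted
  derivations; \<open>s\<close> lets the values be scalars, algebra elements or vectors.\<close>

primrec strip :: "(qfield \<Rightarrow> 'v \<Rightarrow> 'v::ab_group_add) \<Rightarrow> ('r \<Rightarrow> qfield) \<Rightarrow> 'r \<Rightarrow> 'r list \<Rightarrow> ('r list \<Rightarrow> 'v) \<Rightarrow> 'v" where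
  "strip s c j [] g = 0"
| "strip s c j (i # w) g = (if i = j then g w else 0) + s (c i) (strip s c j w (\<lambda>u. g (i # u)))"

primrec rstrip :: "(qfield \<Rightarrow> 'v \<Rightarrow> 'v::ab_group_add) \<Rightarrow> ('r list \<Rightarrow> qfield) \<Rightarrow> 'r \<Rightarrow> 'r list \<Rightarrow> ('r list \<Rightarrow> 'v) \<Rightarrow> 'v" where
  "rstrip s c j [] g = 0"
| "rstrip s c j (i # w) g = (if i = j then s (c w) (g w) else 0) + rstrip s c j w (\<lambda>u. g (i # u))"

lemma
  assumes "vector_space s"
  shows strip_add: "strip s c j w (\<lambda>u. g u + g' u) = strip s c j w g + strip s c j w g'"
    and strip_scale: "strip s c j w (\<lambda>u. s a (g u)) = s a (strip s c j w g)"
    and rstrip_add: "rstrip s b j w (\<lambda>u. g u + g' u) = rstrip s b j w g + rstrip s b j w g'"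
    and rstrip_scale: "rstrip s b j w (\<lambda>u. s a (g u)) = s a (rstrip s b j w g)"
proof -
  interpret vector_space s by fact
  show "strip s c j w (\<lambda>u. g u + g' u) = strip s c j w g + strip s c j w g'"
    by (induction w arbitrary: g g') (simp_all add: scale_right_distrib)
  show "strip s c j w (\<lambda>u. s a (g u)) = s a (strip s c j w g)"
    by (induction w arbitrary: g) (simp_all add: scale_right_distrib mult.commute)
  show "rstrip s b j w (\<lambda>u. g u + g' u) = rstrip s b j w g + rstrip s b j w g'"
    by (induction w arbitrary: g g') (simp_all add: scale_right_distrib)
  show "rstrip s b j w (\<lambda>u. s a (g u)) = s a (rstrip s b j w g)"
    by (induction w arbitrary: g) (simp_all add: scale_right_distrib mult.commute)
qed

lemma strip_zero: "vector_space s \<Longrightarrow> strip s c j w (\<lambda>u. 0) = 0"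
proof -
  assume "vector_space s"
  then interpret vector_space s .
  show ?thesis by (induction w) simp_all
qed

lemma
  assumes "Vector_Spaces.linear s s' h"
  shows strip_linear: "h (strip s c j w g) = strip s' c j w (\<lambda>u. h (g u))"
    and rstrip_linear: "h (rstrip s b j w g) = rstrip s' b j w (\<lambda>u. h (g u))"
  by (induction w arbitrary: g) (simp_all add: lin_simps[OF assms])

lemma strip_swap:
  assumes "vector_space s"
  shows "strip s c j w (\<lambda>u. strip s c' i w' (g u)) = strip s c' i w' (\<lambda>u'. strip s c j w (\<lambda>u. g u u'))"
proof (induction w' arbitrary: g)
  case (Cons l w')
  interpret vector_space s by fact
  have "strip s c j w (\<lambda>u. strip s c' i (l # w') (g u))
      = strip s c j w (\<lambda>u. if l = i then g u w' else 0) + s (c' l) (strip s c j w (\<lambda>u. strip s c' i w' (\<lambda>v. g u (l # v))))"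
    by (simp add: strip_add[OF assms] strip_scale[OF assms])
  then show ?case by (simp add: Cons.IH strip_zero[OF assms])
qed (simp add: strip_zero assms)

lemma wt_eq_0_iff: "wt w = 0 \<longleftrightarrow> w = []"
proof (cases w)
  case (Cons i v)
  have "wt v $ i \<ge> 0" by (induction v) (auto simp: simple_root_nth)
  then have "wt w $ i > 0" by (simp add: Cons simple_root_nth)
  then have "wt w \<noteq> 0" by (metis less_irrefl zero_index)
  then show ?thesis using Cons by blast
qed simp

lemma length_wt: "rat_of_nat (length w) = (\<Sum>j\<in>UNIV. wt w $ j)"
proof (induction w)
  case (Cons i w)
  have "(\<Sum>j\<in>UNIV. simple_root i $ j) = (1 :: rat)"
    by (simp add: simple_root_nth)
  with Cons show ?case by (simp add: sum.distrib)
qed simp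

lemma wt_length: "wt v = wt w \<Longrightarrow> length v = length w"
  using length_wt[of v] length_wt[of w] by simp

definition words :: "('r::finite) weight \<Rightarrow> 'r list set" where "words \<beta> = {w. wt w = \<beta>}"

lemma finite_words: "finite (words \<beta>)"
proof (cases "words \<beta> = {}")
  case False
  then obtain w where w: "wt w = \<beta>" by (auto simp: words_def)
  have "words \<beta> \<subseteq> {v. set v \<subseteq> UNIV \<and> length v = length w}"
    using w wt_length by (auto simp: words_def)
  then show ?thesis by (rule finite_subset) (rule finite_lists_length_eq, simp)
qed simp

lemma Cons_words: "j # u \<in> words (\<beta> + simple_root j) \<longleftrightarrow> u \<in> words \<beta>"
  by (auto simp: words_def algebra_simps)

lemma snoc_words: "u @ [j] \<in> words (\<beta> + simple_root j) \<longleftrightarrow> u \<in> words \<beta>"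
  by (auto simp: words_def wt_append)

context qea
begin

abbreviation "lq j \<equiv> (\<lambda>i. qpow (B (simple_root j) (simple_root i)))"
abbreviation "lq' j \<equiv> (\<lambda>i. qpow (- B (simple_root j) (simple_root i)))"
abbreviation "rq j \<equiv> (\<lambda>w. qpow (B (simple_root j) (wt w)))"
abbreviation "rq' j \<equiv> (\<lambda>w. qpow (- B (simple_root j) (wt w)))"

lemmas sform_simps = sform(1,2) sform_right sform_minus

lemma sform_diag: "B (simple_root j) (simple_root j) = 2 * d j"
  using cc_sform[of j j] by simp

text \<open>The letters before and after the deleted one make up \<open>wt w\<close> minus alpha_j,
  so a weight on one side is the inverse weight on the other times a fixed power of q. The shift 2
  d_j is the norm of the deleted alpha_j.\<close>

lemma strip_rstrip:
  assumes "vector_space s"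
  shows "strip s (lq' j) j w g = s (qpow (- (B (simple_root j) (wt w) - 2 * d j))) (rstrip s (rq j) j w g)"
    and "strip s (lq j) j w g = s (qpow (B (simple_root j) (wt w) - 2 * d j)) (rstrip s (rq' j) j w g)"
proof -
  interpret vector_space s by fact
  show "strip s (lq' j) j w g = s (qpow (- (B (simple_root j) (wt w) - 2 * d j))) (rstrip s (rq j) j w g)"
    by (induction w arbitrary: g)
      (auto simp: sform_simps scale_right_distrib qpow_add[symmetric] sform_diag algebra_simps)
  show "strip s (lq j) j w g = s (qpow (B (simple_root j) (wt w) - 2 * d j)) (rstrip s (rq' j) j w g)"
    by (induction w arbitrary: g)
      (auto simp: sform_simps scale_right_distrib qpow_add[symmetric] sform_diag algebra_simps)
qed

lemma rstrip_strip:
  assumes "vector_space s"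
  shows "rstrip s (rq' j) j w g = s (qpow (- (B (simple_root j) (wt w) - 2 * d j))) (strip s (lq j) j w g)"
proof -
  interpret vector_space s by fact
  show ?thesis unfolding strip_rstrip(2)[OF assms] by (simp add: qpow_add[symmetric])
qed

lemma strip_weighted:
  assumes "vector_space s"
  shows "strip s (lq i) i w (\<lambda>u. s (qpow (B (simple_root j) (wt u))) (g u))
    = s (qpow (B (simple_root j) (wt w - simple_root i))) (strip s (lq i) i w g)"
proof (induction w arbitrary: g)
  case Nil
  interpret vector_space s by fact
  show ?case by simp
next
  case (Cons l w)
  interpret vector_space s by fact
  have "strip s (lq i) i w (\<lambda>u. s (qpow (B (simple_root j) (wt (l # u)))) (g (l # u)))
      = s (qpow (B (simple_root j) (simple_root l))) (strip s (lq i) i w (\<lambda>u. s (qpow (B (simple_root j) (wt u))) (g (l # u))))"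
    by (simp add: sform_simps qpow_add flip: strip_scale[OF assms])
  then show ?case
    by (auto simp: Cons.IH scale_right_distrib sform_simps qpow_add[symmetric] algebra_simps)
qed

text \<open>Deleting i and j in either order gives the same word. The weights agree because the
  factor lost when one letter is already gone is the symmetric number (alpha_i|alpha_j) in both
  cases.\<close>

lemma strip_rstrip_commute:
  assumes "vector_space s"
  shows "strip s (lq i) i w (\<lambda>u. rstrip s (rq j) j u g) = rstrip s (rq j) j w (\<lambda>u. strip s (lq i) i u g)"
proof (induction w arbitrary: g)
  case (Cons l w)
  interpret vector_space s by fact
  have 1: "strip s (lq i) i w (\<lambda>u. rstrip s (rq j) j (l # u) g)
      = (if l = j then s (qpow (B (simple_root j) (wt w - simple_root i))) (strip s (lq i) i w g) else 0)
        + rstrip s (rq j) j w (\<lambda>u. strip s (lq i) i u (\<lambda>v. g (l # v)))"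
    by (simp add: strip_add[OF assms] Cons.IH strip_weighted[OF assms] strip_zero[OF assms])
  have 2: "rstrip s (rq j) j w (\<lambda>u. strip s (lq i) i (l # u) g)
      = (if l = i then rstrip s (rq j) j w g else 0)
        + s (lq i l) (rstrip s (rq j) j w (\<lambda>u. strip s (lq i) i u (\<lambda>v. g (l # v))))"
    using rstrip_scale[OF assms, of "rq j" j w 0 g]
    by (simp add: rstrip_add[OF assms] rstrip_scale[OF assms])
  have 3: "lq i j * qpow (B (simple_root j) (wt w - simple_root i)) = rq j w"
    by (simp add: qpow_add[symmetric] sform_simps sform(3)[of "simple_root i"])
  have "strip s (lq i) i (l # w) (\<lambda>u. rstrip s (rq j) j u g)
      = (if l = i then rstrip s (rq j) j w g else 0) + s (lq i l) (strip s (lq i) i w (\<lambda>u. rstrip s (rq j) j (l # u) g))"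
    by simp
  also have "\<dots> = (if l = j then s (rq j w) (strip s (lq i) i w g) else 0)
      + rstrip s (rq j) j w (\<lambda>u. strip s (lq i) i (l # u) g)"
    unfolding 1 2 by (auto simp: scale_right_distrib 3)
  finally show ?case by simp
qed simp

text \<open>The commutator of e_j with one letter j leaves \<open>kk j\<close> and
  \<open>kk' j\<close> in its place; moving them to the front past the preceding letters produces
  the weights of the left derivation.\<close>

lemma strip_commutator:
  "e j * fw w = fw w * e j + nu j *\<^sub>q (kk j * strip scaleq (lq j) j w fw - kk' j * strip scaleq (lq' j) j w fw)"
proof (induction w)
  case (Cons i w)
  have fk: "f i * (kk j * x) = lq j i *\<^sub>q (kk j * (f i * x))" "f i * (kk' j * x) = lq' j i *\<^sub>q (kk' j * (f i * x))" for x
  proof -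
    have "f i * kk j = lq j i *\<^sub>q (kk j * f i)" "f i * kk' j = lq' j i *\<^sub>q (kk' j * f i)"
      by (simp_all add: kk_f kk'_f scaleq_scaleq cc_sform)
    then show "f i * (kk j * x) = lq j i *\<^sub>q (kk j * (f i * x))" "f i * (kk' j * x) = lq' j i *\<^sub>q (kk' j * (f i * x))"
      by (simp_all only: mult.assoc[symmetric] scaleq_mult_left)
  qed
  have strip: "f i * strip scaleq c j w fw = strip scaleq c j w (\<lambda>u. fw (i # u))" for c
    using strip_linear[OF qlinear_mult_left[of "f i"]] by simp
  have "e j * fw (i # w) = e j * f i * fw w" by (simp add: mult.assoc)
  also have "\<dots> = f i * (e j * fw w) + (if i = j then nu j *\<^sub>q (kk j * fw w - kk' j * fw w) else 0)"
    by (auto simp: ef_commutator distrib_right left_diff_distrib scaleq_mult_left mult.assoc)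
  also have "f i * (e j * fw w) = fw (i # w) * e j
      + nu j *\<^sub>q (lq j i *\<^sub>q (kk j * strip scaleq (lq j) j w (\<lambda>u. fw (i # u))) - lq' j i *\<^sub>q (kk' j * strip scaleq (lq' j) j w (\<lambda>u. fw (i # u))))"
    unfolding Cons.IH distrib_left scaleq_mult_right right_diff_distrib fk strip by (simp add: mult.assoc)
  finally show ?case
    by (auto simp: distrib_left scaleq_mult_right algebra_simps qs.scale_right_diff_distrib qs.scale_right_distrib)
qed simp

lemma rstrip_commutator:
  "ew w * f j = f j * ew w + nu j *\<^sub>q (rstrip scaleq (rq j) j w ew * kk j - rstrip scaleq (rq' j) j w ew * kk' j)"
proof (induction w)
  case (Cons i w)
  have ke: "kk j * ew w = rq j w *\<^sub>q (ew w * kk j)" "kk' j * ew w = rq' j w *\<^sub>q (ew w * kk' j)"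
  proof -
    show "kk j * ew w = rq j w *\<^sub>q (ew w * kk j)"
    proof (induction w)
      case (Cons i w)
      from qcomm_mult[OF kk_e Cons] show ?case by (simp add: sform_simps qpow_add cc_sform)
    qed simp
    show "kk' j * ew w = rq' j w *\<^sub>q (ew w * kk' j)"
    proof (induction w)
      case (Cons i w)
      from qcomm_mult[OF kk'_e Cons] show ?case by (simp add: sform_simps qpow_add[symmetric] cc_sform)
    qed simp
  qed
  have "e i * rstrip scaleq c j w ew = rstrip scaleq c j w (\<lambda>u. ew (i # u))" for c
    using rstrip_linear[OF qlinear_mult_left[of "e i"], of c j w ew] by simp
  then have strip: "e i * (rstrip scaleq c j w ew * k) = rstrip scaleq c j w (\<lambda>u. ew (i # u)) * k" for c k
    by (simp only: mult.assoc[symmetric])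
  have "ew (i # w) * f j = e i * (ew w * f j)" by (simp add: mult.assoc)
  also have "\<dots> = (e i * f j) * ew w
      + nu j *\<^sub>q (rstrip scaleq (rq j) j w (\<lambda>u. ew (i # u)) * kk j - rstrip scaleq (rq' j) j w (\<lambda>u. ew (i # u)) * kk' j)"
    unfolding Cons.IH distrib_left scaleq_mult_right right_diff_distrib strip by (simp add: mult.assoc)
  also have "(e i * f j) * ew w = f j * ew (i # w)
      + (if i = j then nu j *\<^sub>q (rq j w *\<^sub>q (ew w * kk j) - rq' j w *\<^sub>q (ew w * kk' j)) else 0)"
    by (auto simp: ef_commutator distrib_right left_diff_distrib scaleq_mult_left mult.assoc ke)
  finally show ?case
    by (auto simp: distrib_right scaleq_mult_left algebra_simps qs.scale_right_diff_distrib qs.scale_right_distrib)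
qed simp

text \<open>Lusztig's form on the free algebra, evaluated on words: multiplication by a letter is adjoint to the
  twisted derivation \<^term>\<open>strip (*) (lq j) j\<close>.\<close>

primrec gf :: "'r list \<Rightarrow> 'r list \<Rightarrow> qfield" where
  "gf [] = word_unit"
| "gf (j # w) = (\<lambda>w'. strip (*) (lq j) j w' (gf w))"

lemma gf_Cons_right: "gf w (j # w') = strip (*) (lq j) j w (\<lambda>u. gf u w')"
proof (induction w arbitrary: w')
  case (Cons i w)
  have "gf (i # w) (j # w') = (if j = i then gf w w' else 0) + lq i j * strip (*) (lq i) i w' (\<lambda>u. gf w (j # u))"
    by simp
  also have "strip (*) (lq i) i w' (\<lambda>u. gf w (j # u)) = strip (*) (lq i) i w' (\<lambda>u. strip (*) (lq j) j w (\<lambda>v. gf v u))"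
    by (simp add: Cons.IH)
  also have "\<dots> = strip (*) (lq j) j w (\<lambda>v. gf (i # v) w')"
    using strip_swap[OF vs_qfield, of "lq i" i w' "lq j" j w "\<lambda>u v. gf v u"] by simp
  finally show ?case by (simp add: sform(3)[of "simple_root i" "simple_root j"] strip_add strip_scale)
qed (simp add: word_unit_def)

lemma gf_commute: "gf w w' = gf w' w"
proof (induction w arbitrary: w')
  case Nil
  show ?case by (cases w') (simp_all add: gf_Cons_right word_unit_def)
next
  case (Cons j w)
  then have "gf w = (\<lambda>u. gf u w)" by blast
  then show ?case by (simp add: gf_Cons_right)
qed

text \<open>Multiplication on the right is adjoint to the right derivation, by induction on the
  word, because left and right derivations commute.\<close>

lemma gf_snoc: "gf (w @ [j]) w' = rstrip (*) (rq j) j w' (gf w)"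
proof (induction w arbitrary: w')
  case Nil
  have "strip (*) c j v (\<lambda>u. 0) = 0" "rstrip (*) b j v (\<lambda>u. 0) = 0" for c b v and j :: 'r
    by (induction v) simp_all
  then show ?case by (cases w') (auto simp: word_unit_def)
next
  case (Cons i w)
  then have "gf (w @ [j]) = (\<lambda>w'. rstrip (*) (rq j) j w' (gf w))" by blast
  then show ?case by (simp add: strip_rstrip_commute)
qed

lemma gf_snoc_right: "gf w (w' @ [j]) = rstrip (*) (rq j) j w (\<lambda>u. gf u w')"
  using gf_snoc[of w' j w] gf_commute by (metis (no_types, lifting) ext)

lemma gf_wt: "wt w \<noteq> wt w' \<Longrightarrow> gf w w' = 0"
proof (induction w arbitrary: w')
  case (Cons j w)
  have "strip (*) (lq j) j w' g = 0" if "\<And>u. simple_root j + wt u = wt w' \<Longrightarrow> g u = 0" for g :: "'r list \<Rightarrow> qfield" and w'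
    using that
  proof (induction w' arbitrary: g)
    case (Cons i w')
    have "strip (*) (lq j) j w' (\<lambda>u. g (i # u)) = 0"
      by (rule Cons.IH) (rule Cons.prems, simp add: add.left_commute)
    moreover have "i = j \<Longrightarrow> g w' = 0" by (rule Cons.prems) simp
    ultimately show ?case by simp
  qed simp
  moreover have "gf w u = 0" if "simple_root j + wt u = wt w'" for u
    by (rule Cons.IH) (use that Cons.prems in auto)
  ultimately show ?case by simp
qed (auto simp: word_unit_def)

text \<open>The coefficients of a canonical element for the form. Only a generalized inverse is
  available, since a combination of words may pair to zero with all words.\<close>

definition gf_inv :: "'r weight \<Rightarrow> 'r list \<Rightarrow> 'r list \<Rightarrow> qfield" where
  "gf_inv \<beta> = (SOME c. \<forall>u\<in>words \<beta>. \<forall>v\<in>words \<beta>. (\<Sum>w\<in>words \<beta>. \<Sum>w'\<in>words \<beta>. gf u w * c w w' * gf w' v) = gf u v)"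

lemma gf_inv:
  assumes "u \<in> words \<beta>" "v \<in> words \<beta>"
  shows "(\<Sum>w\<in>words \<beta>. \<Sum>w'\<in>words \<beta>. gf u w * gf_inv \<beta> w w' * gf w' v) = gf u v"
proof -
  have "\<exists>c. \<forall>u\<in>words \<beta>. \<forall>v\<in>words \<beta>. (\<Sum>w\<in>words \<beta>. \<Sum>w'\<in>words \<beta>. gf u w * c w w' * gf w' v) = gf u v"
    by (rule generalized_inverse[OF finite_words finite_words])
  from someI_ex[OF this] show ?thesis using assms unfolding gf_inv_def by blast
qed

lemma gf_inv_transpose:
  assumes "u \<in> words \<beta>" "v \<in> words \<beta>"
  shows "(\<Sum>w\<in>words \<beta>. \<Sum>w'\<in>words \<beta>. gf u w' * gf_inv \<beta> w w' * gf w v) = gf u v"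
  using gf_inv[OF assms(2,1)] by (simp add: gf_commute[of v] gf_commute[of _ u] mult_ac)

lemma gf_inv_0: "gf_inv 0 [] [] = 1"
  using gf_inv[of "[]" 0 "[]"] by (simp add: words_def wt_eq_0_iff word_unit_def)

text \<open>The coefficient of the word \<open>u\<close> in a stripped \<open>w\<close>, found by
  inserting the indicator function of \<open>u\<close>. In this matrix form a derivation can be
  exchanged with its adjoint under sums.\<close>

definition rc :: "('r list \<Rightarrow> ('r list \<Rightarrow> qfield) \<Rightarrow> qfield) \<Rightarrow> 'r list \<Rightarrow> 'r list \<Rightarrow> qfield" where
  "rc S w u = S w (\<lambda>v. if v = u then 1 else 0)"

abbreviation "lcoef j \<equiv> rc (strip (*) (lq j) j)"
abbreviation "rcoef j \<equiv> rc (rstrip (*) (rq j) j)"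

lemma
  assumes "vector_space s" "w \<in> words (\<gamma> + simple_root j)"
  shows strip_expand: "strip s c j w g = (\<Sum>u\<in>words \<gamma>. s (rc (strip (*) c j) w u) (g u))"
    and rstrip_expand: "rstrip s b j w g = (\<Sum>u\<in>words \<gamma>. s (rc (rstrip (*) b j) w u) (g u))"
proof -
  interpret vector_space s by fact
  have *: "(\<Sum>u\<in>words \<gamma>. s (F (\<lambda>v. if i # v = u then 1 else 0)) (g u))
      = (\<Sum>u\<in>words (\<gamma> - simple_root i). s (F (\<lambda>v. if v = u then 1 else 0)) (g (i # u)))"
    if F0: "F (\<lambda>v. 0) = 0" for i \<gamma> g and F :: "('r list \<Rightarrow> qfield) \<Rightarrow> qfield"
  proof -
    have "(\<Sum>u\<in>words \<gamma>. s (F (\<lambda>v. if i # v = u then 1 else 0)) (g u))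
        = (\<Sum>u\<in>(#) i ` words (\<gamma> - simple_root i). s (F (\<lambda>v. if i # v = u then 1 else 0)) (g u))"
    proof (rule sum.mono_neutral_right)
      show "\<forall>u\<in>words \<gamma> - (#) i ` words (\<gamma> - simple_root i). s (F (\<lambda>v. if i # v = u then 1 else 0)) (g u) = 0"
      proof
        fix u assume u: "u \<in> words \<gamma> - (#) i ` words (\<gamma> - simple_root i)"
        have "i # v \<noteq> u" for v
        proof
          assume "i # v = u"
          moreover from this u have "v \<in> words (\<gamma> - simple_root i)" by (auto simp: words_def)
          ultimately show False using u by blast
        qed
        then show "s (F (\<lambda>v. if i # v = u then 1 else 0)) (g u) = 0" by (simp add: F0)
      qed
    qed (rule finite_words, auto simp: words_def)
    also have "\<dots> = (\<Sum>u\<in>words (\<gamma> - simple_root i). s (F (\<lambda>v. if v = u then 1 else 0)) (g (i # u)))"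
      by (subst sum.reindex) (auto simp: inj_on_def)
    finally show ?thesis .
  qed
  have zero: "strip (*) c j v (\<lambda>u. 0) = (0::qfield)" "rstrip (*) b j v (\<lambda>u. 0) = (0::qfield)" for v
    by (induction v) simp_all
  have delta: "(\<Sum>u\<in>words \<gamma>. s (if i = j then a * (if w = u then 1 else 0) else 0) (g u)) = (if i = j then s a (g w) else 0)"
    if "i # w \<in> words (\<gamma> + simple_root j)" for a i w \<gamma> g
  proof (cases "i = j")
    case True
    then have "w \<in> words \<gamma>" using that Cons_words by blast
    moreover have "(\<Sum>u\<in>words \<gamma>. s (a * (if w = u then 1 else 0)) (g u)) = (\<Sum>u\<in>words \<gamma>. if w = u then s a (g u) else 0)"
      by (rule sum.cong) auto
    ultimately show ?thesis using True by (simp add: sum.delta' finite_words)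
  qed simp
  show "strip s c j w g = (\<Sum>u\<in>words \<gamma>. s (rc (strip (*) c j) w u) (g u))"
    using assms(2)
  proof (induction w arbitrary: g \<gamma>)
    case Nil
    then show ?case by (simp add: rc_def)
  next
    case (Cons i w)
    have w: "w \<in> words (\<gamma> - simple_root i + simple_root j)" using Cons.prems by (auto simp: words_def algebra_simps)
    have "(\<Sum>u\<in>words \<gamma>. s (rc (strip (*) c j) (i # w) u) (g u))
        = (\<Sum>u\<in>words \<gamma>. s (if i = j then 1 * (if w = u then 1 else 0) else 0) (g u))
          + s (c i) (\<Sum>u\<in>words \<gamma>. s (strip (*) c j w (\<lambda>v. if i # v = u then 1 else 0)) (g u))"
      unfolding rc_def strip.simps scale_left_distrib sum.distrib scale_sum_right scale_scale mult_1_left ..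
    also have "\<dots> = (if i = j then s 1 (g w) else 0) + s (c i) (strip s c j w (\<lambda>u. g (i # u)))"
      unfolding delta[OF Cons.prems] *[of "strip (*) c j w", OF zero(1)]
      using Cons.IH[OF w, of "\<lambda>u. g (i # u)"] by (simp add: rc_def)
    finally show ?case by simp
  qed
  show "rstrip s b j w g = (\<Sum>u\<in>words \<gamma>. s (rc (rstrip (*) b j) w u) (g u))"
    using assms(2)
  proof (induction w arbitrary: g \<gamma>)
    case Nil
    then show ?case by (simp add: rc_def)
  next
    case (Cons i w)
    have w: "w \<in> words (\<gamma> - simple_root i + simple_root j)" using Cons.prems by (auto simp: words_def algebra_simps)
    have "(\<Sum>u\<in>words \<gamma>. s (rc (rstrip (*) b j) (i # w) u) (g u))
        = (\<Sum>u\<in>words \<gamma>. s (if i = j then b w * (if w = u then 1 else 0) else 0) (g u))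
          + (\<Sum>u\<in>words \<gamma>. s (rstrip (*) b j w (\<lambda>v. if i # v = u then 1 else 0)) (g u))"
      unfolding rc_def rstrip.simps scale_left_distrib sum.distrib ..
    also have "\<dots> = (if i = j then s (b w) (g w) else 0) + rstrip s b j w (\<lambda>u. g (i # u))"
      unfolding delta[OF Cons.prems] *[of "rstrip (*) b j w", OF zero(2)]
      using Cons.IH[OF w, of "\<lambda>u. g (i # u)"] by (simp add: rc_def)
    finally show ?case by simp
  qed
qed

end

section \<open>The quantum Casimir operator\<close>

lemma sum_swap3: "(\<Sum>a\<in>A. \<Sum>b\<in>B. \<Sum>c\<in>C. h a b c) = (\<Sum>c\<in>C. \<Sum>a\<in>A. \<Sum>b\<in>B. h a b c)"
proof -
  have "(\<Sum>a\<in>A. \<Sum>b\<in>B. \<Sum>c\<in>C. h a b c) = (\<Sum>a\<in>A. \<Sum>c\<in>C. \<Sum>b\<in>B. h a b c)"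
    by (intro sum.cong refl sum.swap)
  also have "\<dots> = (\<Sum>c\<in>C. \<Sum>a\<in>A. \<Sum>b\<in>B. h a b c)" by (rule sum.swap)
  finally show ?thesis .
qed

lemma sum_swap4: "(\<Sum>a\<in>A. \<Sum>b\<in>B. \<Sum>c\<in>C. \<Sum>d\<in>D. h a b c d) = (\<Sum>c\<in>C. \<Sum>d\<in>D. \<Sum>a\<in>A. \<Sum>b\<in>B. h a b c d)"
  unfolding sum_swap3[of _ C] by (intro sum.cong refl sum_swap3)

context qea
begin

lemma strip_coefficients:
  assumes "w \<in> words (\<gamma> + simple_root j)"
  shows "(\<Sum>u\<in>words \<gamma>. lcoef j w u * gf u v) = gf w (j # v)"
    and "(\<Sum>u\<in>words \<gamma>. rcoef j w u * gf u v) = gf w (v @ [j])"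
  using strip_expand[OF vs_qfield assms, of "lq j" "\<lambda>u. gf u v"] rstrip_expand[OF vs_qfield assms, of "rq j" "\<lambda>u. gf u v"]
  by (simp_all add: gf_Cons_right gf_snoc_right)

definition radical :: "'r weight \<Rightarrow> ('r list \<Rightarrow> qfield) \<Rightarrow> bool" where
  "radical \<beta> a \<longleftrightarrow> (\<forall>v\<in>words \<beta>. (\<Sum>w\<in>words \<beta>. a w * gf w v) = 0)"

text \<open>The linear extension of \<open>\<phi>\<close> to the free algebra factors through the
  quotient by the radical.\<close>

definition kills_radical :: "('r list \<Rightarrow> 'w::qspace) \<Rightarrow> bool" where
  "kills_radical \<phi> \<longleftrightarrow> (\<forall>\<beta> a. radical \<beta> a \<longrightarrow> (\<Sum>w\<in>words \<beta>. a w *\<^sub>q \<phi> w) = 0)"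

lemma radicalD: "radical \<beta> a \<Longrightarrow> (\<Sum>w\<in>words \<beta>. a w * gf w x) = 0"
  by (cases "wt x = \<beta>") (auto simp: radical_def words_def gf_wt intro!: sum.neutral)

text \<open>Both coefficient families have the same pairings with all words, so their difference
  lies in the radical and \<open>\<phi>\<close> does not see it.\<close>

lemma radical_expand:
  assumes "kills_radical \<phi>"
    and c: "\<And>p v. p \<in> words \<gamma> \<Longrightarrow> v \<in> words \<gamma> \<Longrightarrow> (\<Sum>x\<in>words \<gamma>. \<Sum>y\<in>words \<gamma>. gf p y * c x y * gf x v) = gf p v"
    and r: "\<And>v. v \<in> words \<gamma> \<Longrightarrow> (\<Sum>u\<in>words \<gamma>. r u * gf u v) = h v"
  shows "(\<Sum>u\<in>words \<gamma>. r u *\<^sub>q \<phi> u) = (\<Sum>x\<in>words \<gamma>. \<Sum>y\<in>words \<gamma>. (h y * c x y) *\<^sub>q \<phi> x)"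
proof -
  let ?W = "words \<gamma>"
  have "radical \<gamma> (\<lambda>x. r x - (\<Sum>y\<in>?W. h y * c x y))"
    unfolding radical_def
  proof
    fix v assume v: "v \<in> ?W"
    have "(\<Sum>x\<in>?W. (\<Sum>y\<in>?W. h y * c x y) * gf x v) = (\<Sum>x\<in>?W. \<Sum>y\<in>?W. \<Sum>u\<in>?W. r u * (gf u y * c x y * gf x v))"
      by (intro sum.cong refl) (simp add: sum_distrib_right r[symmetric] mult.assoc)
    also have "\<dots> = (\<Sum>u\<in>?W. r u * (\<Sum>x\<in>?W. \<Sum>y\<in>?W. gf u y * c x y * gf x v))"
      unfolding sum_distrib_left by (rule sum_swap3)
    also have "\<dots> = h v" using v by (simp add: c r)
    finally show "(\<Sum>x\<in>?W. (r x - (\<Sum>y\<in>?W. h y * c x y)) * gf x v) = 0"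
      using r[OF v] by (simp add: left_diff_distrib sum_subtractf)
  qed
  then have "(\<Sum>x\<in>?W. (r x - (\<Sum>y\<in>?W. h y * c x y)) *\<^sub>q \<phi> x) = 0" using assms(1) by (simp add: kills_radical_def)
  then show ?thesis by (simp add: qs.scale_left_diff_distrib sum_subtractf qs.scale_sum_left)
qed

text \<open>The term with \<open>kk j\<close> is written by the left derivation, that with
  \<open>kk' j\<close> by the right one. In the latter the power of q from the change of side
  cancels the dependence on \<gamma>, which leaves the exponent - (alpha_j|m).\<close>

lemma e_fw_act:
  assumes act: "is_module act" and y: "y \<in> weight_space G act m" and w: "w \<in> words (\<gamma> + simple_root j)"
  shows "act (e j) (act (fw w) y) = act (fw w) (act (e j) y)
    + (nu j * qpow (B (simple_root j) (m - \<gamma>))) *\<^sub>q (\<Sum>u\<in>words \<gamma>. lcoef j w u *\<^sub>q act (fw u) y)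
    - (nu j * qpow (- B (simple_root j) m)) *\<^sub>q (\<Sum>u\<in>words \<gamma>. rcoef j w u *\<^sub>q act (fw u) y)"
proof -
  note act_simps = module_simps[OF act] and act_mult = is_moduleD(2)[OF act]
  have lin: "qlinear (\<lambda>x. act x y)" by (rule qbilinearD(2)[OF is_module_bilinear[OF act]])
  have kk: "act (kk j) (\<Sum>u\<in>words \<gamma>. r u *\<^sub>q act (fw u) y) = qpow (B (simple_root j) (m - \<gamma>)) *\<^sub>q (\<Sum>u\<in>words \<gamma>. r u *\<^sub>q act (fw u) y)"
    and kk': "act (kk' j) (\<Sum>u\<in>words \<gamma>. r u *\<^sub>q act (fw u) y) = qpow (- B (simple_root j) (m - \<gamma>)) *\<^sub>q (\<Sum>u\<in>words \<gamma>. r u *\<^sub>q act (fw u) y)" for r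
  proof -
    have w: "act (fw u) y \<in> weight_space G act (m - \<gamma>)" if "u \<in> words \<gamma>" for u
      using weight_space_fw[OF act y, of u] that by (simp add: words_def)
    have "(\<Sum>u\<in>words \<gamma>. r u *\<^sub>q act (fw u) y) \<in> weight_space G act (m - \<gamma>)"
      by (intro qs.subspace_sum qs.subspace_scale weight_space_subspace act w)
    then show "act (kk j) (\<Sum>u\<in>words \<gamma>. r u *\<^sub>q act (fw u) y) = qpow (B (simple_root j) (m - \<gamma>)) *\<^sub>q (\<Sum>u\<in>words \<gamma>. r u *\<^sub>q act (fw u) y)"
      "act (kk' j) (\<Sum>u\<in>words \<gamma>. r u *\<^sub>q act (fw u) y) = qpow (- B (simple_root j) (m - \<gamma>)) *\<^sub>q (\<Sum>u\<in>words \<gamma>. r u *\<^sub>q act (fw u) y)"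
      by (rule weight_space_kk)+
  qed
  have wt: "wt w = \<gamma> + simple_root j" using w by (simp add: words_def)
  have "act (e j) (act (fw w) y) = act (e j * fw w) y" by (simp add: act_mult)
  also have "\<dots> = act (fw w) (act (e j) y) + nu j *\<^sub>q (act (kk j) (act (strip scaleq (lq j) j w fw) y)
      - act (kk' j) (act (strip scaleq (lq' j) j w fw) y))"
    unfolding strip_commutator by (simp add: act_simps act_mult)
  also have "act (strip scaleq (lq j) j w fw) y = (\<Sum>u\<in>words \<gamma>. lcoef j w u *\<^sub>q act (fw u) y)"
    unfolding strip_linear[OF lin] by (rule strip_expand[OF vs_scaleq w])
  also have "act (strip scaleq (lq' j) j w fw) y
      = qpow (- (B (simple_root j) \<gamma>)) *\<^sub>q (\<Sum>u\<in>words \<gamma>. rcoef j w u *\<^sub>q act (fw u) y)"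
    unfolding strip_linear[OF lin] strip_rstrip(1)[OF vs_scaleq] rstrip_expand[OF vs_scaleq w]
    by (simp add: wt sform_simps sform_diag act_simps)
  finally show ?thesis
    unfolding act_simps(7) kk kk'
    by (simp add: scaleq_scaleq qs.scale_right_diff_distrib qpow_add[symmetric] sform_simps mult.assoc algebra_simps)
qed

lemma ew_f_act:
  assumes act: "is_module act" and y: "y \<in> weight_space G act m" and w: "w \<in> words (\<gamma> + simple_root j)"
  shows "act (ew w) (act (f j) y) = act (f j) (act (ew w) y)
    + (nu j * qpow (B (simple_root j) m)) *\<^sub>q (\<Sum>u\<in>words \<gamma>. rcoef j w u *\<^sub>q act (ew u) y)
    - (nu j * qpow (- B (simple_root j) (m + \<gamma>))) *\<^sub>q (\<Sum>u\<in>words \<gamma>. lcoef j w u *\<^sub>q act (ew u) y)"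
proof -
  note act_simps = module_simps[OF act] and act_mult = is_moduleD(2)[OF act]
  have lin: "qlinear (\<lambda>x. act x y)" by (rule qbilinearD(2)[OF is_module_bilinear[OF act]])
  have kk: "act (kk j) y = qpow (B (simple_root j) m) *\<^sub>q y" "act (kk' j) y = qpow (- B (simple_root j) m) *\<^sub>q y"
    using weight_space_kk[OF y] by blast+
  have wt: "wt w = \<gamma> + simple_root j" using w by (simp add: words_def)
  have "act (ew w) (act (f j) y) = act (ew w * f j) y" by (simp add: act_mult)
  also have "\<dots> = act (f j) (act (ew w) y) + nu j *\<^sub>q (qpow (B (simple_root j) m) *\<^sub>q act (rstrip scaleq (rq j) j w ew) y
      - qpow (- B (simple_root j) m) *\<^sub>q act (rstrip scaleq (rq' j) j w ew) y)"
    unfolding rstrip_commutator by (simp add: act_simps act_mult kk)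
  also have "act (rstrip scaleq (rq j) j w ew) y = (\<Sum>u\<in>words \<gamma>. rcoef j w u *\<^sub>q act (ew u) y)"
    unfolding rstrip_linear[OF lin] by (rule rstrip_expand[OF vs_scaleq w])
  also have "act (rstrip scaleq (rq' j) j w ew) y
      = qpow (- (B (simple_root j) \<gamma>)) *\<^sub>q (\<Sum>u\<in>words \<gamma>. lcoef j w u *\<^sub>q act (ew u) y)"
    unfolding rstrip_linear[OF lin] rstrip_strip[OF vs_scaleq] strip_expand[OF vs_scaleq w]
    by (simp add: wt sform_simps sform_diag act_simps)
  finally show ?thesis
    by (simp add: scaleq_scaleq qs.scale_right_diff_distrib qpow_add[symmetric] sform_simps mult.assoc algebra_simps)
qed

end

text \<open>By a theorem of Lusztig the Serre relations generate the radical of the form on words. Requiring that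
  the radical acts by zero makes that theorem unnecessary.\<close>

locale integrable = qea G
  for G :: "('r::finite, 'u::qalgebra) qgroup" +
  fixes act :: "'u \<Rightarrow> 'w::qspace \<Rightarrow> 'w" and X :: "'w set"
  assumes act: "is_module act" and X_subspace: "qs.subspace X"
    and X_closed: "x \<in> X \<Longrightarrow> act u x \<in> X"
    and X_weights: "X \<subseteq> qs.span (\<Union>m. X \<inter> weight_space G act m)"
    and e_nilpotent: "x \<in> X \<Longrightarrow> \<exists>N. \<forall>w. length w \<ge> N \<longrightarrow> act (ew w) x = 0"
    and f_nilpotent: "x \<in> X \<Longrightarrow> \<exists>N. act (f i ^ N) x = 0"
    and radical_f: "x \<in> X \<Longrightarrow> kills_radical (\<lambda>w. act (fw w) x)"
    and radical_e: "x \<in> X \<Longrightarrow> kills_radical (\<lambda>w. act (ew w) x)"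
begin

lemmas act_simps = module_simps[OF act]
lemmas act_1 = is_moduleD(1)[OF act]
lemmas act_mult = is_moduleD(2)[OF act]

lemma expand_f:
  assumes "y \<in> X" "\<And>v. v \<in> words \<gamma> \<Longrightarrow> (\<Sum>u\<in>words \<gamma>. r u * gf u v) = h v"
  shows "(\<Sum>u\<in>words \<gamma>. r u *\<^sub>q act (fw u) y) = (\<Sum>u\<in>words \<gamma>. \<Sum>u'\<in>words \<gamma>. (h u' * gf_inv \<gamma> u u') *\<^sub>q act (fw u) y)"
  by (rule radical_expand[OF radical_f[OF assms(1)] gf_inv_transpose assms(2)])

lemma expand_e:
  assumes "y \<in> X" "\<And>v. v \<in> words \<gamma> \<Longrightarrow> (\<Sum>u\<in>words \<gamma>. r u * gf u v) = h v"
  shows "(\<Sum>u\<in>words \<gamma>. r u *\<^sub>q act (ew u) y) = (\<Sum>u\<in>words \<gamma>. \<Sum>u'\<in>words \<gamma>. (h u * gf_inv \<gamma> u u') *\<^sub>q act (ew u') y)"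
proof -
  have "(\<Sum>x\<in>words \<gamma>. \<Sum>z\<in>words \<gamma>. gf p z * gf_inv \<gamma> z x * gf x v) = gf p v" if "p \<in> words \<gamma>" "v \<in> words \<gamma>" for p v
    using gf_inv[OF that] by (subst sum.swap)
  from radical_expand[OF radical_e[OF assms(1)] this assms(2)] show ?thesis by (subst sum.swap)
qed

text \<open>The reproducing property of the canonical element: expanding the indicator of
  \<open>p\<close> through the form returns the word \<open>p\<close>, up to a radical element that
  acts by zero.\<close>

lemma reproduce_e:
  assumes "x \<in> X" "p \<in> words \<beta>"
  shows "(\<Sum>w\<in>words \<beta>. \<Sum>w'\<in>words \<beta>. (gf w p * gf_inv \<beta> w w') *\<^sub>q act (ew w') x) = act (ew p) x"
proof -
  have "(\<Sum>u\<in>words \<beta>. (if u = p then 1 else 0) *\<^sub>q act (ew u) x)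
      = (\<Sum>w\<in>words \<beta>. \<Sum>w'\<in>words \<beta>. (gf w p * gf_inv \<beta> w w') *\<^sub>q act (ew w') x)"
    by (rule expand_e[OF assms(1)])
      (use assms(2) in \<open>simp add: finite_words if_distrib[of "\<lambda>x. x * _"] gf_commute[of _ p] cong: if_cong\<close>)
  then show ?thesis using assms(2) by (simp add: finite_words if_distrib[of "\<lambda>x. x *\<^sub>q _"] cong: if_cong)
qed

lemma reproduce_f:
  assumes "x \<in> X" "p \<in> words \<beta>"
  shows "(\<Sum>w\<in>words \<beta>. \<Sum>w'\<in>words \<beta>. (gf w' p * gf_inv \<beta> w w') *\<^sub>q act (fw w) x) = act (fw p) x"
proof -
  have "(\<Sum>u\<in>words \<beta>. (if u = p then 1 else 0) *\<^sub>q act (fw u) x)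
      = (\<Sum>w\<in>words \<beta>. \<Sum>w'\<in>words \<beta>. (gf w' p * gf_inv \<beta> w w') *\<^sub>q act (fw w) x)"
    by (rule expand_f[OF assms(1)])
      (use assms(2) in \<open>simp add: finite_words if_distrib[of "\<lambda>x. x * _"] gf_commute[of _ p] cong: if_cong\<close>)
  then show ?thesis using assms(2) by (simp add: finite_words if_distrib[of "\<lambda>x. x *\<^sub>q _"] cong: if_cong)
qed

text \<open>An operator on the F-leg of the canonical element may be replaced by its adjoint on the
  E-leg. It is applied to derivations, whose adjoints are multiplications by a letter on the left or
  right.\<close>

lemma canonical_f:
  assumes "x \<in> X" "\<And>w v. w \<in> words \<beta> \<Longrightarrow> v \<in> words \<gamma> \<Longrightarrow> (\<Sum>u\<in>words \<gamma>. r w u * gf u v) = gf w (\<phi> v)"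
    and "\<And>v. v \<in> words \<gamma> \<Longrightarrow> \<phi> v \<in> words \<beta>"
  shows "(\<Sum>w\<in>words \<beta>. \<Sum>w'\<in>words \<beta>. gf_inv \<beta> w w' *\<^sub>q (\<Sum>u\<in>words \<gamma>. r w u *\<^sub>q act (fw u) (act (ew w') x)))
    = (\<Sum>u\<in>words \<gamma>. \<Sum>u'\<in>words \<gamma>. gf_inv \<gamma> u u' *\<^sub>q act (fw u) (act (ew (\<phi> u')) x))"
proof -
  let ?W = "words \<beta>" and ?U = "words \<gamma>"
  have "(\<Sum>w\<in>?W. \<Sum>w'\<in>?W. gf_inv \<beta> w w' *\<^sub>q (\<Sum>u\<in>?U. r w u *\<^sub>q act (fw u) (act (ew w') x)))
      = (\<Sum>w\<in>?W. \<Sum>w'\<in>?W. gf_inv \<beta> w w' *\<^sub>q (\<Sum>u\<in>?U. \<Sum>u'\<in>?U. (gf w (\<phi> u') * gf_inv \<gamma> u u') *\<^sub>q act (fw u) (act (ew w') x)))"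
    using expand_f[OF X_closed[OF assms(1)] assms(2)] by (intro sum.cong refl) simp
  also have "\<dots> = (\<Sum>w\<in>?W. \<Sum>w'\<in>?W. \<Sum>u\<in>?U. \<Sum>u'\<in>?U. gf_inv \<gamma> u u' *\<^sub>q act (fw u) ((gf w (\<phi> u') * gf_inv \<beta> w w') *\<^sub>q act (ew w') x))"
    by (simp add: qs.scale_sum_right act_simps mult_ac)
  also have "\<dots> = (\<Sum>u\<in>?U. \<Sum>u'\<in>?U. \<Sum>w\<in>?W. \<Sum>w'\<in>?W. gf_inv \<gamma> u u' *\<^sub>q act (fw u) ((gf w (\<phi> u') * gf_inv \<beta> w w') *\<^sub>q act (ew w') x))"
    by (rule sum_swap4)
  also have "\<dots> = (\<Sum>u\<in>?U. \<Sum>u'\<in>?U. gf_inv \<gamma> u u' *\<^sub>q act (fw u) (\<Sum>w\<in>?W. \<Sum>w'\<in>?W. (gf w (\<phi> u') * gf_inv \<beta> w w') *\<^sub>q act (ew w') x))"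
    by (simp only: act_simps(12) qs.scale_sum_right)
  also have "\<dots> = (\<Sum>u\<in>?U. \<Sum>u'\<in>?U. gf_inv \<gamma> u u' *\<^sub>q act (fw u) (act (ew (\<phi> u')) x))"
    using assms(1,3) by (simp add: reproduce_e)
  finally show ?thesis .
qed

lemma canonical_e:
  assumes "x \<in> X" "\<And>w v. w \<in> words \<beta> \<Longrightarrow> v \<in> words \<gamma> \<Longrightarrow> (\<Sum>u\<in>words \<gamma>. r w u * gf u v) = gf w (\<phi> v)"
    and "\<And>v. v \<in> words \<gamma> \<Longrightarrow> \<phi> v \<in> words \<beta>"
  shows "(\<Sum>w\<in>words \<beta>. \<Sum>w'\<in>words \<beta>. gf_inv \<beta> w w' *\<^sub>q act (fw w) (\<Sum>u\<in>words \<gamma>. r w' u *\<^sub>q act (ew u) x))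
    = (\<Sum>u\<in>words \<gamma>. \<Sum>u'\<in>words \<gamma>. gf_inv \<gamma> u u' *\<^sub>q act (fw (\<phi> u)) (act (ew u') x))"
proof -
  let ?W = "words \<beta>" and ?U = "words \<gamma>"
  have "(\<Sum>w\<in>?W. \<Sum>w'\<in>?W. gf_inv \<beta> w w' *\<^sub>q act (fw w) (\<Sum>u\<in>?U. r w' u *\<^sub>q act (ew u) x))
      = (\<Sum>w\<in>?W. \<Sum>w'\<in>?W. gf_inv \<beta> w w' *\<^sub>q act (fw w) (\<Sum>u\<in>?U. \<Sum>u'\<in>?U. (gf w' (\<phi> u) * gf_inv \<gamma> u u') *\<^sub>q act (ew u') x))"
    using expand_e[OF assms(1) assms(2)] by (intro sum.cong refl) simp
  also have "\<dots> = (\<Sum>w\<in>?W. \<Sum>w'\<in>?W. \<Sum>u\<in>?U. \<Sum>u'\<in>?U. gf_inv \<gamma> u u' *\<^sub>q ((gf w' (\<phi> u) * gf_inv \<beta> w w') *\<^sub>q act (fw w) (act (ew u') x)))"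
    by (simp add: qs.scale_sum_right act_simps mult_ac)
  also have "\<dots> = (\<Sum>u\<in>?U. \<Sum>u'\<in>?U. \<Sum>w\<in>?W. \<Sum>w'\<in>?W. gf_inv \<gamma> u u' *\<^sub>q ((gf w' (\<phi> u) * gf_inv \<beta> w w') *\<^sub>q act (fw w) (act (ew u') x)))"
    by (rule sum_swap4)
  also have "\<dots> = (\<Sum>u\<in>?U. \<Sum>u'\<in>?U. gf_inv \<gamma> u u' *\<^sub>q (\<Sum>w\<in>?W. \<Sum>w'\<in>?W. (gf w' (\<phi> u) * gf_inv \<beta> w w') *\<^sub>q act (fw w) (act (ew u') x)))"
    by (simp only: qs.scale_sum_right)
  also have "\<dots> = (\<Sum>u\<in>?U. \<Sum>u'\<in>?U. gf_inv \<gamma> u u' *\<^sub>q act (fw (\<phi> u)) (act (ew u') x))"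
    using assms(1,3) by (simp add: reproduce_f X_closed)
  finally show ?thesis .
qed

abbreviation "Xw m \<equiv> X \<inter> weight_space G act m"

lemma Xw_subspace: "qs.subspace (Xw m)"
  by (intro qs.subspace_inter X_subspace weight_space_subspace act)

lemma Xw_e: "x \<in> Xw m \<Longrightarrow> act (e i) x \<in> Xw (m + simple_root i)"
  and Xw_f: "x \<in> Xw m \<Longrightarrow> act (f i) x \<in> Xw (m - simple_root i)"
  and Xw_ew: "x \<in> Xw m \<Longrightarrow> act (ew w) x \<in> Xw (m + wt w)"
  and Xw_fw: "x \<in> Xw m \<Longrightarrow> act (fw w) x \<in> Xw (m - wt w)"
  using X_closed weight_space_e[OF act] weight_space_f[OF act] weight_space_ew[OF act] weight_space_fw[OF act] by blast+

text \<open>The canonical element of weight \<beta> with F-leg and E-leg multiplied together and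
  applied to x. The maps \<open>\<phi>\<close> and \<open>\<psi>\<close> modify the words, to
  express what becomes of it when a generator moves through.\<close>

definition ZZ :: "('r list \<Rightarrow> 'r list) \<Rightarrow> ('r list \<Rightarrow> 'r list) \<Rightarrow> 'r weight \<Rightarrow> 'w \<Rightarrow> 'w" where
  "ZZ \<phi> \<psi> \<beta> x = (\<Sum>w\<in>words \<beta>. \<Sum>w'\<in>words \<beta>. gf_inv \<beta> w w' *\<^sub>q act (fw (\<phi> w)) (act (ew (\<psi> w')) x))"

abbreviation "Z \<equiv> ZZ id id"

text \<open>Moving \<open>e j\<close> through the F-leg leaves a left and a right derivation, and
  \<open>canonical_f\<close> turns them into a letter j put in front of or behind the E-leg of the
  canonical element of the smaller weight \<gamma>.\<close>

lemma e_Z: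
  assumes "x \<in> Xw m"
  shows "act (e j) (Z (\<gamma> + simple_root j) x) = ZZ id ((#) j) (\<gamma> + simple_root j) x
    + (nu j * qpow (B (simple_root j) (m + simple_root j))) *\<^sub>q ZZ id ((#) j) \<gamma> x
    - (nu j * qpow (- B (simple_root j) (m + simple_root j + \<gamma>))) *\<^sub>q Z \<gamma> (act (e j) x)"
proof -
  let ?\<beta> = "\<gamma> + simple_root j"
  have x: "x \<in> X" using assms by blast
  have 1: "act (e j) (act (fw w) (act (ew w') x)) = act (fw w) (act (ew (j # w')) x)
    + (nu j * qpow (B (simple_root j) (m + simple_root j))) *\<^sub>q (\<Sum>u\<in>words \<gamma>. lcoef j w u *\<^sub>q act (fw u) (act (ew w') x))
    - (nu j * qpow (- B (simple_root j) (m + simple_root j + \<gamma>))) *\<^sub>q (\<Sum>u\<in>words \<gamma>. rcoef j w u *\<^sub>q act (fw u) (act (ew w') x))"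
    if "w \<in> words ?\<beta>" "w' \<in> words ?\<beta>" for w w'
  proof -
    \<comment> \<open>The vector on which the F-leg acts has already been raised by the E-leg of
      weight \<gamma> + alpha_j.\<close>
    have "m + wt w' - \<gamma> = m + simple_root j" "m + wt w' = m + simple_root j + \<gamma>"
      using that(2) by (simp_all add: words_def)
    then show ?thesis
      using e_fw_act[OF act IntD2[OF Xw_ew[OF assms, of w']] that(1)] by (simp only: act_mult ew_simps)
  qed
  have "act (e j) (Z ?\<beta> x) = (\<Sum>w\<in>words ?\<beta>. \<Sum>w'\<in>words ?\<beta>. gf_inv ?\<beta> w w' *\<^sub>q act (e j) (act (fw w) (act (ew w') x)))"
    by (simp add: ZZ_def act_simps)
  also have "\<dots> = (\<Sum>w\<in>words ?\<beta>. \<Sum>w'\<in>words ?\<beta>. gf_inv ?\<beta> w w' *\<^sub>q act (fw w) (act (ew (j # w')) x)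
    + (nu j * qpow (B (simple_root j) (m + simple_root j))) *\<^sub>q (gf_inv ?\<beta> w w' *\<^sub>q (\<Sum>u\<in>words \<gamma>. lcoef j w u *\<^sub>q act (fw u) (act (ew w') x)))
    - (nu j * qpow (- B (simple_root j) (m + simple_root j + \<gamma>))) *\<^sub>q (gf_inv ?\<beta> w w' *\<^sub>q (\<Sum>u\<in>words \<gamma>. rcoef j w u *\<^sub>q act (fw u) (act (ew w') x))))"
    by (intro sum.cong refl)
      (simp only: 1 qs.scale_right_diff_distrib qs.scale_right_distrib qs.scale_left_commute[of "gf_inv _ _ _"])
  also have "\<dots> = ZZ id ((#) j) ?\<beta> x
    + (nu j * qpow (B (simple_root j) (m + simple_root j))) *\<^sub>q
      (\<Sum>w\<in>words ?\<beta>. \<Sum>w'\<in>words ?\<beta>. gf_inv ?\<beta> w w' *\<^sub>q (\<Sum>u\<in>words \<gamma>. lcoef j w u *\<^sub>q act (fw u) (act (ew w') x)))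
    - (nu j * qpow (- B (simple_root j) (m + simple_root j + \<gamma>))) *\<^sub>q
      (\<Sum>w\<in>words ?\<beta>. \<Sum>w'\<in>words ?\<beta>. gf_inv ?\<beta> w w' *\<^sub>q (\<Sum>u\<in>words \<gamma>. rcoef j w u *\<^sub>q act (fw u) (act (ew w') x)))"
    by (simp only: sum.distrib sum_subtractf qs.scale_sum_right[of "nu j * _"] ZZ_def id_apply)
  also have "(\<Sum>w\<in>words ?\<beta>. \<Sum>w'\<in>words ?\<beta>. gf_inv ?\<beta> w w' *\<^sub>q (\<Sum>u\<in>words \<gamma>. lcoef j w u *\<^sub>q act (fw u) (act (ew w') x)))
      = ZZ id ((#) j) \<gamma> x"
    unfolding ZZ_def id_apply
    by (rule canonical_f[OF x]) (simp_all add: strip_coefficients Cons_words)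
  also have "(\<Sum>w\<in>words ?\<beta>. \<Sum>w'\<in>words ?\<beta>. gf_inv ?\<beta> w w' *\<^sub>q (\<Sum>u\<in>words \<gamma>. rcoef j w u *\<^sub>q act (fw u) (act (ew w') x)))
      = ZZ id (\<lambda>u. u @ [j]) \<gamma> x"
    unfolding ZZ_def id_apply
    by (rule canonical_f[OF x]) (simp_all add: strip_coefficients snoc_words)
  also have "ZZ id (\<lambda>u. u @ [j]) \<gamma> x = Z \<gamma> (act (e j) x)"
    by (simp add: ZZ_def ew_append act_mult)
  finally show ?thesis .
qed

lemma Z_f:
  assumes "x \<in> Xw m"
  shows "Z (\<gamma> + simple_root j) (act (f j) x) = ZZ (\<lambda>u. u @ [j]) id (\<gamma> + simple_root j) x
    + (nu j * qpow (B (simple_root j) m)) *\<^sub>q ZZ (\<lambda>u. u @ [j]) id \<gamma> x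
    - (nu j * qpow (- B (simple_root j) (m + \<gamma>))) *\<^sub>q act (f j) (Z \<gamma> x)"
proof -
  let ?\<beta> = "\<gamma> + simple_root j"
  have x: "x \<in> X" using assms by blast
  have 1: "act (fw w) (act (ew w') (act (f j) x)) = act (fw (w @ [j])) (act (ew w') x)
    + (nu j * qpow (B (simple_root j) m)) *\<^sub>q act (fw w) (\<Sum>u\<in>words \<gamma>. rcoef j w' u *\<^sub>q act (ew u) x)
    - (nu j * qpow (- B (simple_root j) (m + \<gamma>))) *\<^sub>q act (fw w) (\<Sum>u\<in>words \<gamma>. lcoef j w' u *\<^sub>q act (ew u) x)"
    if "w' \<in> words ?\<beta>" for w w'
    unfolding ew_f_act[OF act IntD2[OF assms] that] by (simp add: act_simps act_mult fw_append)
  have "Z ?\<beta> (act (f j) x) = (\<Sum>w\<in>words ?\<beta>. \<Sum>w'\<in>words ?\<beta>. gf_inv ?\<beta> w w' *\<^sub>q act (fw (w @ [j])) (act (ew w') x)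
    + (nu j * qpow (B (simple_root j) m)) *\<^sub>q (gf_inv ?\<beta> w w' *\<^sub>q act (fw w) (\<Sum>u\<in>words \<gamma>. rcoef j w' u *\<^sub>q act (ew u) x))
    - (nu j * qpow (- B (simple_root j) (m + \<gamma>))) *\<^sub>q (gf_inv ?\<beta> w w' *\<^sub>q act (fw w) (\<Sum>u\<in>words \<gamma>. lcoef j w' u *\<^sub>q act (ew u) x)))"
    unfolding ZZ_def id_apply by (intro sum.cong refl)
      (simp only: 1 qs.scale_right_diff_distrib qs.scale_right_distrib qs.scale_left_commute[of "gf_inv _ _ _"])
  also have "\<dots> = ZZ (\<lambda>u. u @ [j]) id ?\<beta> x
    + (nu j * qpow (B (simple_root j) m)) *\<^sub>q
      (\<Sum>w\<in>words ?\<beta>. \<Sum>w'\<in>words ?\<beta>. gf_inv ?\<beta> w w' *\<^sub>q act (fw w) (\<Sum>u\<in>words \<gamma>. rcoef j w' u *\<^sub>q act (ew u) x))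
    - (nu j * qpow (- B (simple_root j) (m + \<gamma>))) *\<^sub>q
      (\<Sum>w\<in>words ?\<beta>. \<Sum>w'\<in>words ?\<beta>. gf_inv ?\<beta> w w' *\<^sub>q act (fw w) (\<Sum>u\<in>words \<gamma>. lcoef j w' u *\<^sub>q act (ew u) x))"
    by (simp only: sum.distrib sum_subtractf qs.scale_sum_right[of "nu j * _"] ZZ_def id_apply)
  also have "(\<Sum>w\<in>words ?\<beta>. \<Sum>w'\<in>words ?\<beta>. gf_inv ?\<beta> w w' *\<^sub>q act (fw w) (\<Sum>u\<in>words \<gamma>. rcoef j w' u *\<^sub>q act (ew u) x))
      = ZZ (\<lambda>u. u @ [j]) id \<gamma> x"
    unfolding ZZ_def id_apply
    by (rule canonical_e[OF x]) (simp_all add: strip_coefficients snoc_words)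
  also have "(\<Sum>w\<in>words ?\<beta>. \<Sum>w'\<in>words ?\<beta>. gf_inv ?\<beta> w w' *\<^sub>q act (fw w) (\<Sum>u\<in>words \<gamma>. lcoef j w' u *\<^sub>q act (ew u) x))
      = ZZ ((#) j) id \<gamma> x"
    unfolding ZZ_def id_apply
    by (rule canonical_e[OF x]) (simp_all add: strip_coefficients Cons_words)
  also have "ZZ ((#) j) id \<gamma> x = act (f j) (Z \<gamma> x)"
    by (simp add: ZZ_def act_mult act_simps)
  finally show ?thesis .
qed

text \<open>\<^term>\<open>two_rho m\<close> is the scalar product of \<^term>\<open>m\<close> with the sum of the positive roots.\<close>

definition two_rho :: "'r weight \<Rightarrow> rat" where "two_rho m = (\<Sum>j\<in>UNIV. 2 * d j * m $ j)"

text \<open>Each alpha_j contributes - 1 / nu_j, which undoes the commutator constant, and q^(- 2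
  d_j), which balances (alpha_j|alpha_j) in the recursion. Rounding down converts the rational
  coordinates of a weight in \<open>Q_plus\<close> to exponents.\<close>

definition casimir_factor :: "'r weight \<Rightarrow> qfield" where
  "casimir_factor \<beta> = (\<Prod>j\<in>UNIV. (- (qpow (d j) - qpow (- d j)) * qpow (- 2 * d j)) ^ nat \<lfloor>\<beta> $ j\<rfloor>)"

text \<open>\<^term>\<open>cas m \<beta>\<close> is the solution of the recursion in \<^term>\<open>\<beta>\<close> that makes the sum of the \<^term>\<open>cas m \<beta> *\<^sub>q Z \<beta> x\<close>
  commute with the \<^term>\<open>e j\<close> and \<^term>\<open>f j\<close>, normalized to be the eigenvalue \<^term>\<open>qpow (- (B m m + two_rho m))\<close>
  on a singular vector of weight \<^term>\<open>m\<close>.\<close>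

definition cas :: "'r weight \<Rightarrow> 'r weight \<Rightarrow> qfield" where
  "cas m \<beta> = qpow (- (B m m + two_rho m) - B \<beta> m) * casimir_factor \<beta>"

lemma two_rho_add: "two_rho (m + n) = two_rho m + two_rho n"
  by (simp add: two_rho_def sum.distrib algebra_simps)

lemma two_rho_simple: "two_rho (simple_root j) = 2 * d j"
  by (simp add: two_rho_def simple_root_nth if_distrib[of "\<lambda>x. _ * x"] cong: if_cong)

lemma wt_nonneg: "wt w $ i \<ge> 0"
  by (induction w) (auto simp: simple_root_nth)

lemma casimir_factor_add:
  "casimir_factor (wt w + simple_root j) = casimir_factor (wt w) * (- (qpow (d j) - qpow (- d j)) * qpow (- 2 * d j))"
proof -
  let ?a = "\<lambda>j. - (qpow (d j) - qpow (- d j)) * qpow (- 2 * d j)"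
  have "?a i ^ nat \<lfloor>(wt w + simple_root j) $ i\<rfloor> = ?a i ^ nat \<lfloor>wt w $ i\<rfloor> * (if i = j then ?a i else 1)" for i
    using wt_nonneg[of w i] by (simp add: simple_root_nth nat_add_distrib)
  then have "casimir_factor (wt w + simple_root j) = (\<Prod>i\<in>UNIV. ?a i ^ nat \<lfloor>wt w $ i\<rfloor> * (if i = j then ?a i else 1))"
    unfolding casimir_factor_def by (intro prod.cong refl) blast
  then show ?thesis unfolding prod.distrib by (simp add: casimir_factor_def)
qed

text \<open>The recursion between \<gamma> and \<gamma> + alpha_j that cancels the two kinds of
  terms with an extra letter j in \<open>e_Z\<close> and \<open>Z_f\<close>.\<close>

lemma cas_add:
  assumes "words \<gamma> \<noteq> {}"
  shows "cas m (\<gamma> + simple_root j) * (nu j * qpow (B (simple_root j) (m + simple_root j))) = - cas m \<gamma>"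
proof -
  obtain w where w: "\<gamma> = wt w" using assms by (auto simp: words_def)
  define K where "K = qpow (d j) - qpow (- d j)"
  have factor: "casimir_factor (\<gamma> + simple_root j) = casimir_factor \<gamma> * (- K * qpow (- 2 * d j))"
    unfolding w casimir_factor_add K_def by (rule refl)
  have "cas m (\<gamma> + simple_root j) * (nu j * qpow (B (simple_root j) (m + simple_root j)))
      = - ((nu j * K) * casimir_factor \<gamma> *
        (qpow (- (B m m + two_rho m) - B (\<gamma> + simple_root j) m) * qpow (- 2 * d j) * qpow (B (simple_root j) (m + simple_root j))))"
    unfolding cas_def factor by (simp add: mult_ac)
  also have "qpow (- (B m m + two_rho m) - B (\<gamma> + simple_root j) m) * qpow (- 2 * d j) * qpow (B (simple_root j) (m + simple_root j))
      = qpow (- (B m m + two_rho m) - B \<gamma> m)"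
    unfolding qpow_add[symmetric] by (simp add: sform_simps sform_diag algebra_simps)
  also have "nu j * K = 1" using nu_denominator[of j] by (simp add: nu_def K_def)
  finally show ?thesis by (simp add: cas_def mult.commute)
qed

lemma cas_shift:
  "cas (m + simple_root j) \<gamma> = qpow (- 2 * B (simple_root j) (m + simple_root j) - B (simple_root j) \<gamma>) * cas m \<gamma>"
proof -
  have "- (B (m + simple_root j) (m + simple_root j) + two_rho (m + simple_root j)) - B \<gamma> (m + simple_root j)
      = (- 2 * B (simple_root j) (m + simple_root j) - B (simple_root j) \<gamma>) + (- (B m m + two_rho m) - B \<gamma> m)"
    by (simp add: sform_simps two_rho_add two_rho_simple sform_diag sform(3)[of \<gamma> "simple_root j"] sform(3)[of m "simple_root j"])
  then show ?thesis by (simp only: cas_def qpow_add mult.assoc)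
qed

section \<open>Finite truncations of the Casimir operator\<close>

definition kills :: "nat \<Rightarrow> 'w \<Rightarrow> bool" where "kills N x \<longleftrightarrow> (\<forall>w. length w \<ge> N \<longrightarrow> act (ew w) x = 0)"

definition bound :: "nat \<Rightarrow> 'r weight set" where "bound N = wt ` {w. length w < N}"

lemma finite_bound: "finite (bound N)"
proof -
  have "{w :: 'r list. length w < N} \<subseteq> {w. set w \<subseteq> UNIV \<and> length w \<le> N}" by auto
  then have "finite {w :: 'r list. length w < N}"
    by (rule finite_subset) (rule finite_lists_length_le, simp)
  then show ?thesis by (simp add: bound_def)
qed

lemma bound_iff: "w \<in> words \<beta> \<Longrightarrow> \<beta> \<in> bound N \<longleftrightarrow> length w < N"
  by (auto simp: bound_def words_def dest: wt_length)

lemma ZZ_zero: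
  assumes "kills N x" "\<And>w. w \<in> words \<beta> \<Longrightarrow> length (\<psi> w) \<ge> N"
  shows "ZZ \<phi> \<psi> \<beta> x = 0"
  using assms by (simp add: ZZ_def kills_def act_simps)

lemma Z_outside:
  assumes "kills N x" "\<beta> \<notin> bound N"
  shows "Z \<beta> x = 0"
  by (rule ZZ_zero[OF assms(1)]) (use assms(2) bound_iff[of _ \<beta> N] in auto)

definition casimir_upto :: "nat \<Rightarrow> 'r weight \<Rightarrow> 'w \<Rightarrow> 'w" where
  "casimir_upto N m x = (\<Sum>\<beta>\<in>bound N. cas m \<beta> *\<^sub>q Z \<beta> x)"

lemma casimir_upto_mono:
  assumes "kills N x" "N \<le> N'"
  shows "casimir_upto N' m x = casimir_upto N m x"
  unfolding casimir_upto_def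
proof (rule sum.mono_neutral_right)
  show "bound N \<subseteq> bound N'" using assms(2) by (auto simp: bound_def)
  show "\<forall>\<beta>\<in>bound N' - bound N. cas m \<beta> *\<^sub>q Z \<beta> x = 0" using Z_outside[OF assms(1)] by simp
qed (rule finite_bound)

text \<open>Reindexing by \<beta> = \<gamma> + alpha_j moves the truncation range. The two
  hypotheses are the boundary conditions: weights leaving the range, and weights carried by no
  word.\<close>

lemma sum_shift:
  fixes h :: "'r weight \<Rightarrow> 'w"
  assumes "\<And>\<gamma>. \<gamma> \<in> bound N \<Longrightarrow> \<gamma> + simple_root j \<notin> bound N \<Longrightarrow> h \<gamma> = 0"
    and "\<And>\<gamma>. words \<gamma> = {} \<Longrightarrow> h \<gamma> = 0"
  shows "(\<Sum>\<beta>\<in>bound N. h (\<beta> - simple_root j)) = (\<Sum>\<gamma>\<in>bound N. h \<gamma>)"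
proof -
  have "(\<Sum>\<beta>\<in>bound N. h (\<beta> - simple_root j)) = (\<Sum>\<gamma>\<in>(\<lambda>\<beta>. \<beta> - simple_root j) ` bound N. h \<gamma>)"
    by (subst sum.reindex) (auto simp: inj_on_def)
  also have "\<dots> = (\<Sum>\<gamma>\<in>(\<lambda>\<beta>. \<beta> - simple_root j) ` bound N \<inter> bound N. h \<gamma>)"
  proof (rule sum.mono_neutral_right)
    show "\<forall>\<gamma>\<in>(\<lambda>\<beta>. \<beta> - simple_root j) ` bound N - (\<lambda>\<beta>. \<beta> - simple_root j) ` bound N \<inter> bound N. h \<gamma> = 0"
    proof
      fix \<gamma> assume \<gamma>: "\<gamma> \<in> (\<lambda>\<beta>. \<beta> - simple_root j) ` bound N - (\<lambda>\<beta>. \<beta> - simple_root j) ` bound N \<inter> bound N"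
      then have b: "\<gamma> + simple_root j \<in> bound N" by auto
      have "words \<gamma> = {}"
      proof (rule ccontr)
        assume "words \<gamma> \<noteq> {}"
        then obtain u where u: "u \<in> words \<gamma>" by blast
        then have "j # u \<in> words (\<gamma> + simple_root j)" by (simp add: Cons_words)
        with b have "length u < N" using bound_iff by fastforce
        with u \<gamma> show False using bound_iff by blast
      qed
      then show "h \<gamma> = 0" by (rule assms(2))
    qed
  qed (auto simp: finite_bound)
  also have "\<dots> = (\<Sum>\<gamma>\<in>bound N. h \<gamma>)"
  proof (rule sum.mono_neutral_left)
    show "\<forall>\<gamma>\<in>bound N - (\<lambda>\<beta>. \<beta> - simple_root j) ` bound N \<inter> bound N. h \<gamma> = 0"
    proof
      fix \<gamma> assume \<gamma>: "\<gamma> \<in> bound N - (\<lambda>\<beta>. \<beta> - simple_root j) ` bound N \<inter> bound N"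
      then have "\<gamma> + simple_root j \<notin> bound N" by (force simp: image_iff)
      with \<gamma> show "h \<gamma> = 0" using assms(1) by blast
    qed
  qed (auto simp: finite_bound)
  finally show ?thesis .
qed

text \<open>By \<open>e_Z\<close> the terms with j in front of the E-leg appear twice, from \<gamma>
  and from \<gamma> + alpha_j, and cancel by \<open>cas_add\<close>. What survives has the
  coefficients for the weight m + alpha_j, by \<open>cas_shift\<close>.\<close>

lemma casimir_upto_e:
  assumes "x \<in> Xw m" "kills N x"
  shows "act (e j) (casimir_upto N m x) = casimir_upto N (m + simple_root j) (act (e j) x)"
proof -
  let ?a = "simple_root j" and ?L = "\<lambda>\<gamma>. ZZ id ((#) j) \<gamma> x" and ?M = "\<lambda>\<gamma>. Z \<gamma> (act (e j) x)"
  define h where "h \<gamma> = cas m (\<gamma> + ?a) *\<^sub>q ((nu j * qpow (B ?a (m + ?a))) *\<^sub>q ?L \<gamma>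
      - (nu j * qpow (- B ?a (m + ?a + \<gamma>))) *\<^sub>q ?M \<gamma>)" for \<gamma>
  have M: "?M \<gamma> = ZZ id (\<lambda>u. u @ [j]) \<gamma> x" for \<gamma> by (simp add: ZZ_def ew_append act_mult)
  have "act (e j) (casimir_upto N m x) = (\<Sum>\<beta>\<in>bound N. cas m \<beta> *\<^sub>q act (e j) (Z (\<beta> - ?a + ?a) x))"
    by (simp add: casimir_upto_def act_simps)
  also have "\<dots> = (\<Sum>\<beta>\<in>bound N. cas m \<beta> *\<^sub>q ?L \<beta> + h (\<beta> - ?a))"
    unfolding e_Z[OF assms(1)] h_def by (simp add: qs.scale_right_distrib algebra_simps)
  also have "\<dots> = (\<Sum>\<beta>\<in>bound N. cas m \<beta> *\<^sub>q ?L \<beta>) + (\<Sum>\<gamma>\<in>bound N. h \<gamma>)"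
    unfolding sum.distrib
  proof (subst sum_shift[where h = h])
    fix \<gamma>
    show "h \<gamma> = 0" if "words \<gamma> = {}" using that by (simp add: h_def ZZ_def)
    assume \<gamma>: "\<gamma> \<in> bound N" "\<gamma> + ?a \<notin> bound N"
    \<comment> \<open>At the boundary the E-leg together with the extra letter j has at least N
      letters and therefore kills x.\<close>
    have "length w + 1 \<ge> N" if "w \<in> words \<gamma>" for w
      using \<gamma> that bound_iff[of "j # w" "\<gamma> + ?a" N] by (simp add: Cons_words)
    then have "?L \<gamma> = 0" "?M \<gamma> = 0" unfolding M by (auto intro!: ZZ_zero[OF assms(2)])
    then show "h \<gamma> = 0" by (simp add: h_def)
  qed simp
  also have "\<dots> = (\<Sum>\<gamma>\<in>bound N. cas m \<gamma> *\<^sub>q ?L \<gamma> + h \<gamma>)" by (simp add: sum.distrib)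
  also have "\<dots> = (\<Sum>\<gamma>\<in>bound N. cas (m + ?a) \<gamma> *\<^sub>q ?M \<gamma>)"
  proof (rule sum.cong[OF refl])
    fix \<gamma> assume "\<gamma> \<in> bound N"
    then have "words \<gamma> \<noteq> {}" by (auto simp: bound_def words_def)
    note c = cas_add[OF this, of m j]
    have "qpow (- B ?a (m + ?a + \<gamma>)) = qpow (B ?a (m + ?a)) * qpow (- 2 * B ?a (m + ?a) - B ?a \<gamma>)"
      unfolding qpow_add[symmetric] by (simp add: sform_simps)
    then have "cas m (\<gamma> + ?a) * (nu j * qpow (- B ?a (m + ?a + \<gamma>)))
        = (cas m (\<gamma> + ?a) * (nu j * qpow (B ?a (m + ?a)))) * qpow (- 2 * B ?a (m + ?a) - B ?a \<gamma>)"
      by (simp add: mult_ac)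
    then have "cas m (\<gamma> + ?a) * (nu j * qpow (- B ?a (m + ?a + \<gamma>))) = - cas (m + ?a) \<gamma>"
      unfolding c cas_shift by (simp add: mult.commute)
    with c show "cas m \<gamma> *\<^sub>q ?L \<gamma> + h \<gamma> = cas (m + ?a) \<gamma> *\<^sub>q ?M \<gamma>"
      by (simp add: h_def qs.scale_right_diff_distrib)
  qed
  finally show ?thesis by (simp add: casimir_upto_def)
qed

text \<open>The cancellation is that of \<open>casimir_upto_e\<close>, read off from
  \<open>Z_f\<close>. Here the boundary terms carry no extra letter on the E-leg, so words of length
  N - 1 must already kill x; hence M < N.\<close>

lemma casimir_upto_f:
  assumes "x \<in> Xw m" "kills M x" "M < N"
  shows "act (f j) (casimir_upto N m x) = casimir_upto N (m - simple_root j) (act (f j) x)"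
proof -
  let ?a = "simple_root j" and ?R = "\<lambda>\<gamma>. ZZ (\<lambda>u. u @ [j]) id \<gamma> x"
  define m' where "m' = m - ?a"
  have m: "m = m' + ?a" by (simp add: m'_def)
  define h where "h \<gamma> = cas m' (\<gamma> + ?a) *\<^sub>q ((nu j * qpow (B ?a m)) *\<^sub>q ?R \<gamma>
      - (nu j * qpow (- B ?a (m + \<gamma>))) *\<^sub>q act (f j) (Z \<gamma> x))" for \<gamma>
  have "casimir_upto N m' (act (f j) x) = (\<Sum>\<beta>\<in>bound N. cas m' \<beta> *\<^sub>q Z (\<beta> - ?a + ?a) (act (f j) x))"
    by (simp add: casimir_upto_def)
  also have "\<dots> = (\<Sum>\<beta>\<in>bound N. cas m' \<beta> *\<^sub>q ?R \<beta> + h (\<beta> - ?a))"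
    unfolding Z_f[OF assms(1)] h_def by (simp add: qs.scale_right_distrib algebra_simps)
  also have "\<dots> = (\<Sum>\<beta>\<in>bound N. cas m' \<beta> *\<^sub>q ?R \<beta>) + (\<Sum>\<gamma>\<in>bound N. h \<gamma>)"
    unfolding sum.distrib
  proof (subst sum_shift[where h = h])
    fix \<gamma>
    show "h \<gamma> = 0" if "words \<gamma> = {}" using that by (simp add: h_def ZZ_def act_simps)
    assume \<gamma>: "\<gamma> \<in> bound N" "\<gamma> + ?a \<notin> bound N"
    have "length w \<ge> M" if "w \<in> words \<gamma>" for w
      using \<gamma> that bound_iff[of "j # w" "\<gamma> + ?a" N] assms(3) by (simp add: Cons_words)
    then have "?R \<gamma> = 0" "Z \<gamma> x = 0" by (auto intro!: ZZ_zero[OF assms(2)])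
    then show "h \<gamma> = 0" by (simp add: h_def act_simps)
  qed simp
  also have "\<dots> = (\<Sum>\<gamma>\<in>bound N. cas m' \<gamma> *\<^sub>q ?R \<gamma> + h \<gamma>)" by (simp add: sum.distrib)
  also have "\<dots> = (\<Sum>\<gamma>\<in>bound N. cas m \<gamma> *\<^sub>q act (f j) (Z \<gamma> x))"
  proof (rule sum.cong[OF refl])
    fix \<gamma> assume "\<gamma> \<in> bound N"
    then have "words \<gamma> \<noteq> {}" by (auto simp: bound_def words_def)
    from cas_add[OF this, of m' j] have c: "cas m' (\<gamma> + ?a) * (nu j * qpow (B ?a m)) = - cas m' \<gamma>"
      by (simp add: m)
    have "qpow (- B ?a (m + \<gamma>)) = qpow (B ?a m) * qpow (- 2 * B ?a m - B ?a \<gamma>)"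
      unfolding qpow_add[symmetric] by (simp add: sform_simps)
    then have "cas m' (\<gamma> + ?a) * (nu j * qpow (- B ?a (m + \<gamma>)))
        = (cas m' (\<gamma> + ?a) * (nu j * qpow (B ?a m))) * qpow (- 2 * B ?a m - B ?a \<gamma>)"
      by (simp add: mult_ac)
    then have "cas m' (\<gamma> + ?a) * (nu j * qpow (- B ?a (m + \<gamma>))) = - cas m \<gamma>"
      unfolding c using cas_shift[of m' j \<gamma>] by (simp add: m mult.commute)
    with c show "cas m' \<gamma> *\<^sub>q ?R \<gamma> + h \<gamma> = cas m \<gamma> *\<^sub>q act (f j) (Z \<gamma> x)"
      by (simp add: h_def qs.scale_right_diff_distrib)
  qed
  finally show ?thesis by (simp add: casimir_upto_def act_simps m'_def)
qed

text \<open>The least truncation is merely a canonical choice; every sufficiently large one gives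
  the same value.\<close>

definition casimir :: "'r weight \<Rightarrow> 'w \<Rightarrow> 'w" where
  "casimir m x = casimir_upto (LEAST N. kills N x) m x"

lemma casimir_eq:
  assumes "kills N x"
  shows "casimir m x = casimir_upto N m x"
proof -
  have "kills (LEAST N. kills N x) x" using assms by (rule LeastI)
  from casimir_upto_mono[OF this Least_le[of "\<lambda>N. kills N x", OF assms]] show ?thesis
    by (simp add: casimir_def)
qed

lemma kills_mono: "kills N x \<Longrightarrow> N \<le> N' \<Longrightarrow> kills N' x"
  by (auto simp: kills_def)

lemma kills_ex: "x \<in> X \<Longrightarrow> \<exists>N. kills N x"
  using e_nilpotent by (auto simp: kills_def)

lemma kills_e:
  assumes "kills (Suc N) x"
  shows "kills N (act (e i) x)"
  unfolding kills_def
proof (intro allI impI)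
  fix w :: "'r list" assume "N \<le> length w"
  then have "Suc N \<le> length (w @ [i])" by simp
  then have "act (ew (w @ [i])) x = 0" using assms unfolding kills_def by blast
  then show "act (ew w) (act (e i) x) = 0" by (simp add: ew_append act_mult)
qed

lemma Z_linear: "qlinear (Z \<beta>)"
  by (intro qlinearI) (simp_all add: ZZ_def act_simps sum.distrib qs.scale_right_distrib qs.scale_sum_right mult.commute)

lemma casimir_add:
  assumes "x \<in> X" "y \<in> X"
  shows "casimir m (x + y) = casimir m x + casimir m y"
proof -
  obtain N N' where N: "kills N x" "kills N' y" using kills_ex assms by blast
  let ?N = "max N N'"
  have k: "kills ?N x" "kills ?N y" using N by (auto intro: kills_mono)
  then have "kills ?N (x + y)" by (simp add: kills_def act_simps)
  then show ?thesis
    using k by (simp add: casimir_eq casimir_upto_def lin_simps[OF Z_linear] qs.scale_right_distrib sum.distrib)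
qed

lemma casimir_scale:
  assumes "x \<in> X"
  shows "casimir m (c *\<^sub>q x) = c *\<^sub>q casimir m x"
proof -
  obtain N where N: "kills N x" using kills_ex assms by blast
  then have "kills N (c *\<^sub>q x)" by (simp add: kills_def act_simps)
  then show ?thesis
    using N by (simp add: casimir_eq casimir_upto_def lin_simps[OF Z_linear] mult.commute qs.scale_sum_right)
qed

lemma casimir_e:
  assumes "x \<in> Xw m"
  shows "act (e j) (casimir m x) = casimir (m + simple_root j) (act (e j) x)"
proof -
  obtain N where N: "kills N x" using kills_ex assms by blast
  have "kills (Suc N) x" using N by (rule kills_mono) simp
  then have "kills N (act (e j) x)" by (rule kills_e)
  then show ?thesis using casimir_upto_e[OF assms N, of j] by (simp add: casimir_eq[OF N] casimir_eq)
qed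

lemma casimir_f:
  assumes "x \<in> Xw m"
  shows "act (f j) (casimir m x) = casimir (m - simple_root j) (act (f j) x)"
proof -
  obtain M where M: "kills M x" using kills_ex assms by blast
  obtain M' where M': "kills M' (act (f j) x)" using kills_ex X_closed assms by blast
  let ?N = "Suc (max M M')"
  have "kills ?N x" "kills ?N (act (f j) x)" using M M' by (auto intro: kills_mono)
  then show ?thesis using casimir_upto_f[OF assms M, of ?N j] by (simp add: casimir_eq)
qed

lemma Z_weight:
  assumes "x \<in> Xw m"
  shows "Z \<beta> x \<in> Xw m"
proof -
  have "act (fw w) (act (ew w') x) \<in> Xw m" if "w \<in> words \<beta>" "w' \<in> words \<beta>" for w w'
    using Xw_fw[OF Xw_ew[OF assms, of w'], of w] that by (simp add: words_def)
  then show ?thesis unfolding ZZ_def id_apply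
    by (intro qs.subspace_sum qs.subspace_scale Xw_subspace)
qed

lemma casimir_weight: "x \<in> Xw m \<Longrightarrow> casimir m x \<in> Xw m"
  unfolding casimir_def casimir_upto_def
  by (intro qs.subspace_sum qs.subspace_scale Xw_subspace Z_weight)

definition chi :: "'r weight \<Rightarrow> qfield" where "chi m = qpow (- (B m m + two_rho m))"

lemma words_0: "words (0 :: 'r weight) = {[]}"
  by (auto simp: words_def wt_eq_0_iff)

lemma cas_0: "cas m 0 = chi m"
  by (simp add: cas_def chi_def casimir_factor_def)

lemma Z_0: "Z 0 x = x"
  by (simp add: ZZ_def words_0 gf_inv_0 act_1)

text \<open>Every component of nonzero weight ends, on the E-side, with some e_i applied to x, which
  is in \<open>Y\<close>. Only the component of weight 0 is left, and its coefficient is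
  \<open>chi m\<close>.\<close>

lemma casimir_mod:
  assumes "x \<in> X" "qs.subspace Y" "\<And>i. act (e i) x \<in> Y" "\<And>u y. y \<in> Y \<Longrightarrow> act u y \<in> Y"
  shows "casimir m x - chi m *\<^sub>q x \<in> Y"
proof -
  obtain N0 where "kills N0 x" using kills_ex assms by blast
  \<comment> \<open>The successor ensures that the weight 0 is in the range even when
    \<open>N0\<close> is 0.\<close>
  then have N: "kills (Suc N0) x" by (rule kills_mono) simp
  have 0: "0 \<in> bound (Suc N0)" unfolding bound_def by (rule image_eqI[of _ _ "[]"]) simp_all
  have "casimir m x = (\<Sum>\<beta>\<in>bound (Suc N0). cas m \<beta> *\<^sub>q Z \<beta> x)"
    by (simp add: casimir_eq[OF N] casimir_upto_def)
  also have "\<dots> = chi m *\<^sub>q x + (\<Sum>\<beta>\<in>bound (Suc N0) - {0}. cas m \<beta> *\<^sub>q Z \<beta> x)"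
    using 0 by (simp add: sum.remove[OF finite_bound 0] cas_0 Z_0)
  finally have "casimir m x - chi m *\<^sub>q x = (\<Sum>\<beta>\<in>bound (Suc N0) - {0}. cas m \<beta> *\<^sub>q Z \<beta> x)" by simp
  also have "\<dots> \<in> Y"
  proof (intro qs.subspace_sum qs.subspace_scale assms(2))
    fix \<beta> assume \<beta>: "\<beta> \<in> bound (Suc N0) - {0}"
    have "act (fw w) (act (ew w') x) \<in> Y" if w': "w' \<in> words \<beta>" for w w'
    proof -
      have "w' \<noteq> []" using w' \<beta> by (auto simp: words_def)
      then obtain v i where "w' = v @ [i]" by (cases w' rule: rev_cases) auto
      then have "act (ew w') x = act (ew v) (act (e i) x)" by (simp add: ew_append act_mult)
      then show ?thesis using assms(3,4) by simp
    qed
    then show "Z \<beta> x \<in> Y" unfolding ZZ_def id_apply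
      by (intro qs.subspace_sum qs.subspace_scale assms(2))
  qed
  finally show ?thesis .
qed

lemma casimir_singular:
  assumes "x \<in> X" "\<And>i. act (e i) x = 0"
  shows "casimir m x = chi m *\<^sub>q x"
  using casimir_mod[OF assms(1), of "{0}" m] assms(2) by (simp add: act_simps qs.subspace_def)

lemma casimir_fw:
  assumes "x \<in> Xw m" "casimir m x = c *\<^sub>q x"
  shows "casimir (m - wt w) (act (fw w) x) = c *\<^sub>q act (fw w) x"
proof (induction w)
  case (Cons i w)
  have "casimir (m - wt (i # w)) (act (fw (i # w)) x) = act (f i) (casimir (m - wt w) (act (fw w) x))"
    using casimir_f[OF Xw_fw[OF assms(1), of w], of i] by (simp add: act_mult algebra_simps)
  then show ?case by (simp add: Cons act_simps act_mult)
qed (simp add: assms act_1)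

end

section \<open>Complete reducibility\<close>

lemma subspace_scaleD:
  assumes "qs.subspace S" "c *\<^sub>q x \<in> S" "c \<noteq> 0"
  shows "x \<in> S"
  using qs.subspace_scale[OF assms(1,2), of "inverse c"] assms(3) by simp

context qea
begin

lemma weight_unique:
  assumes "is_module act" "v \<in> weight_space G act m" "v \<in> weight_space G act n" "v \<noteq> 0"
  shows "m = n"
proof (rule ccontr)
  assume "m \<noteq> n"
  then obtain i where "m $ i \<noteq> n $ i" by (auto simp: vec_eq_iff)
  moreover have "qpow (d i * m $ i) *\<^sub>q v = qpow (d i * n $ i) *\<^sub>q v"
    using assms(2,3) weight_space_iff[OF assms(1)] by metis
  ultimately show False using assms(4) by simp
qed

text \<open>Grouping a combination of homogeneous vectors by weight, all groups of a weight other
  than n cancel, since weight spaces are independent.\<close>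

lemma graded_span:
  assumes act: "is_module act" and S: "S \<subseteq> (\<Union>m. weight_space G act m)"
    and y: "y \<in> qs.span S" "y \<in> weight_space G act n"
  shows "y \<in> qs.span (S \<inter> weight_space G act n)"
proof -
  obtain X r where X: "finite X" "X \<subseteq> S" "y = (\<Sum>a\<in>X. r a *\<^sub>q a)"
    using y(1) unfolding qs.span_explicit by blast
  define om where "om a = (SOME m. a \<in> weight_space G act m)" for a
  have om: "a \<in> weight_space G act (om a)" if "a \<in> X" for a
  proof -
    have "\<exists>m. a \<in> weight_space G act m" using that X(2) S by blast
    then show ?thesis unfolding om_def by (rule someI_ex)
  qed
  define x where "x m = (\<Sum>a | a \<in> X \<and> om a = m. r a *\<^sub>q a)" for m
  have xw: "x m \<in> weight_space G act m" for m
    unfolding x_def by (intro qs.subspace_sum qs.subspace_scale weight_space_subspace act) (use om in blast)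
  have sum: "y = (\<Sum>m\<in>om ` X. x m)"
    unfolding X(3) x_def by (rule sum.image_gen[OF X(1)])
  let ?S = "insert n (om ` X)"
  have x0: "x m = 0" if "m \<notin> om ` X" for m
    using that unfolding x_def by (intro sum.neutral) blast
  have "(\<Sum>m\<in>?S. x m - (if m = n then y else 0)) = 0"
  proof -
    have "(\<Sum>m\<in>?S. x m) = y"
      unfolding sum by (rule sum.mono_neutral_right) (use X(1) x0 in auto)
    then show ?thesis using X(1) by (simp add: sum_subtractf sum.delta)
  qed
  moreover have "x m - (if m = n then y else 0) \<in> weight_space G act m" for m
    using xw y(2) qs.subspace_diff[OF weight_space_subspace[OF act]] by simp
  moreover have "act (t i) z \<in> {0}" if "z \<in> {0}" for i z
    using that by (simp add: module_simps[OF act])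
  ultimately have "x n - (if n = n then y else 0) \<in> {0}"
    by (intro weight_components[OF act, of "{0}" ?S "\<lambda>m. x m - (if m = n then y else 0)"])
      (use X(1) in \<open>auto simp: qs.subspace_def\<close>)
  then have "y = x n" by simp
  also have "\<dots> \<in> qs.span (S \<inter> weight_space G act n)"
    unfolding x_def using om X(2) by (intro qs.span_sum qs.span_scale qs.span_base) blast
  finally show ?thesis .
qed

lemma coroot_pairing_sform: "d i * coroot_pairing A m i = B (simple_root i) m"
proof -
  have "kval i m = (\<Sum>l\<in>UNIV. m $ l * (d i * of_int (A $ i $ l)))"
    unfolding kval_def by (rule sum.cong) (simp_all add: A_sym[of i] mult_ac)
  then show ?thesis by (simp add: kval_eq[symmetric] coroot_pairing_def sum_distrib_left mult_ac)
qed

lemma qpow_diff_eq_0_iff: "qpow x - qpow (- x) = 0 \<longleftrightarrow> x = 0"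
  by auto

lemma e_f_power:
  assumes act: "is_module act" and u: "u \<in> weight_space G act m"
  shows "act (e i) (act (f i ^ Suc n) u) = act (f i ^ Suc n) (act (e i) u)
    + (nu i * (\<Sum>s\<le>n. qpow (B (simple_root i) m - 2 * d i * of_nat s) - qpow (- (B (simple_root i) m - 2 * d i * of_nat s)))) *\<^sub>q act (f i ^ n) u"
proof (induction n)
  note act_simps = module_simps[OF act] and act_1 = is_moduleD(1)[OF act]
    and act_mult = is_moduleD(2)[OF act]
  {
  case 0
  have "act (e i) (act (f i) u) = act (e i * f i) u" by (simp add: act_mult)
  then show ?case
    using weight_space_kk[OF u]
    by (simp add: ef_commutator act_simps act_mult act_1 qs.scale_left_diff_distrib qs.scale_right_diff_distrib scaleq_scaleq right_diff_distrib)
  next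
  case (Suc n)
  let ?y = "act (f i ^ Suc n) u"
  have w: "act (f i ^ k) u \<in> weight_space G act (m - of_nat k *s simple_root i)" for k
  proof (induction k)
    case (Suc k)
    have eq: "m - of_nat (Suc k) *s simple_root i = m - of_nat k *s simple_root i - simple_root i"
      by (simp add: vec_eq_iff algebra_simps)
    from weight_space_f[OF act Suc, of i] show ?case by (simp only: power_Suc act_mult eq)
  qed (use u in \<open>simp add: act_1\<close>)
  have k: "act (kk i) ?y = qpow (B (simple_root i) m - 2 * d i * of_nat (Suc n)) *\<^sub>q ?y"
    "act (kk' i) ?y = qpow (- (B (simple_root i) m - 2 * d i * of_nat (Suc n))) *\<^sub>q ?y"
    using weight_space_kk[of ?y act "m - of_nat (Suc n) *s simple_root i" i] w[of "Suc n"]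
    by (simp_all add: sform_simps sform_diag algebra_simps)
  have "act (e i) (act (f i ^ Suc (Suc n)) u) = act (e i * f i) ?y" by (simp add: act_mult)
  also have "\<dots> = act (f i) (act (e i) ?y) + nu i *\<^sub>q (act (kk i) ?y - act (kk' i) ?y)"
    by (simp add: ef_commutator act_simps act_mult)
  also have "act (f i) (act (e i) ?y) = act (f i ^ Suc (Suc n)) (act (e i) u)
    + (nu i * (\<Sum>s\<le>n. qpow (B (simple_root i) m - 2 * d i * of_nat s) - qpow (- (B (simple_root i) m - 2 * d i * of_nat s)))) *\<^sub>q ?y"
    unfolding Suc.IH by (simp add: act_simps act_mult)
  finally show ?case unfolding k
    by (simp add: qs.scale_left_diff_distrib[symmetric] scaleq_add_left distrib_left scaleq_scaleq del: power_Suc)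
  }
qed

text \<open>Closes the sum in \<open>e_f_power\<close>. With x = d_i it shows that the coefficient
  vanishes exactly when (alpha_i|m) = d_i n.\<close>

lemma power_sum:
  "(qpow x - qpow (- x)) * (\<Sum>s\<le>n. qpow (b - 2 * x * of_nat s) - qpow (- (b - 2 * x * of_nat s)))
    = (qpow (x * of_nat (Suc n)) - qpow (- (x * of_nat (Suc n)))) * (qpow (b - x * of_nat n) - qpow (- (b - x * of_nat n)))"
proof (induction n)
  case (Suc n)
  show ?case
    unfolding sum.atMost_Suc distrib_left Suc.IH
    by (simp add: left_diff_distrib right_diff_distrib qpow_add[symmetric]) (simp add: algebra_simps)
qed simp

end

context integrable
begin

text \<open>The rank one argument modulo \<open>Y\<close>: take the last power f_i^k u outside
  \<open>Y\<close>. Applying e_i to f_i^(k+1) u gives a multiple of f_i^k u inside \<open>Y\<close>,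
  so the scalar is zero, and this says that the coroot pairing is k.\<close>

lemma singular_mod_dominant:
  assumes Y: "qs.subspace Y" "\<And>u y. y \<in> Y \<Longrightarrow> act u y \<in> Y"
    and u: "u \<in> Xw m" "u \<notin> Y" "\<And>i. act (e i) u \<in> Y"
  shows "dominant_integral A m"
  unfolding dominant_integral_def
proof
  fix i
  define n where "n = (LEAST n. act (f i ^ n) u \<in> Y)"
  obtain N where "act (f i ^ N) u = 0" using f_nilpotent u(1) by blast
  then have "act (f i ^ N) u \<in> Y" using qs.subspace_0[OF Y(1)] by simp
  then have n: "act (f i ^ n) u \<in> Y" unfolding n_def by (rule LeastI)
  have "n \<noteq> 0"
  proof
    assume "n = 0"
    then show False using n u(2) by (simp add: act_1)
  qed
  then obtain k where k: "n = Suc k" by (cases n) auto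
  have nk: "act (f i ^ k) u \<notin> Y"
    using not_less_Least[of k "\<lambda>n. act (f i ^ n) u \<in> Y"] k unfolding n_def[symmetric] by simp
  let ?b = "B (simple_root i) m"
  let ?c = "nu i * (\<Sum>s\<le>k. qpow (?b - 2 * d i * of_nat s) - qpow (- (?b - 2 * d i * of_nat s)))"
  have "?c *\<^sub>q act (f i ^ k) u = act (e i) (act (f i ^ Suc k) u) - act (f i ^ Suc k) (act (e i) u)"
    unfolding e_f_power[OF act IntD2[OF u(1)]] by simp
  also have "\<dots> \<in> Y" by (rule qs.subspace_diff[OF Y(1) Y(2)[OF n[unfolded k]] Y(2)[OF u(3)]])
  finally have c: "?c *\<^sub>q act (f i ^ k) u \<in> Y" .
  have "?c = 0"
  proof (rule ccontr)
    assume "?c \<noteq> 0"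
    then show False using nk subspace_scaleD[OF Y(1) c] by blast
  qed
  then have "(qpow (d i) - qpow (- d i)) * (\<Sum>s\<le>k. qpow (?b - 2 * d i * of_nat s) - qpow (- (?b - 2 * d i * of_nat s))) = 0"
    using mult_eq_0_iff[of "nu i"] by (simp del: minus_diff_eq)
  moreover have "qpow (d i * of_nat (Suc k)) - qpow (- (d i * of_nat (Suc k))) \<noteq> 0"
    unfolding qpow_diff_eq_0_iff by (simp del: of_nat_Suc)
  ultimately have "qpow (?b - d i * of_nat k) - qpow (- (?b - d i * of_nat k)) = 0"
    unfolding power_sum by (simp only: mult_eq_0_iff) blast
  then have "?b - d i * of_nat k = 0" unfolding qpow_diff_eq_0_iff .
  then have "d i * coroot_pairing A m i = d i * of_nat k" by (simp add: coroot_pairing_sform)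
  then show "coroot_pairing A m i \<in> \<nat>" by simp
qed

lemma zero_subspace: "qs.subspace {0 :: 'w}"
  by (simp add: qs.subspace_def)

lemma singular_dominant:
  assumes "s \<in> Xw m" "s \<noteq> 0" "\<And>i. act (e i) s = 0"
  shows "dominant_integral A m"
  by (rule singular_mod_dominant[OF zero_subspace]) (use assms in \<open>auto simp: act_simps\<close>)

lemma dominant_nonneg: "dominant_integral A m \<Longrightarrow> B (simple_root i) m \<ge> 0"
proof -
  assume "dominant_integral A m"
  then have "coroot_pairing A m i \<in> \<nat>" by (simp add: dominant_integral_def)
  then obtain k where "coroot_pairing A m i = of_nat k" by (rule Nats_cases)
  then show ?thesis using d_pos[of i] by (simp add: coroot_pairing_sform[symmetric])
qed

lemma dominant_wt_nonneg: "dominant_integral A m \<Longrightarrow> B (wt w) m \<ge> 0"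
  by (induction w) (simp_all add: sform_simps dominant_nonneg)

text \<open>For \<beta> = wt w the exponents differ by (\<beta>|m) + (\<beta>|m + \<beta>) + (2
  rho|\<beta>). Dominance makes the first two terms nonnegative, and the last is positive.\<close>

lemma chi_neq:
  assumes "dominant_integral A m" "dominant_integral A (m + wt w)" "w \<noteq> []"
  shows "chi (m + wt w) \<noteq> chi m"
proof -
  have "two_rho (wt w) > 0" using assms(3)
  proof (induction w)
    case (Cons i w)
    have "two_rho (wt w) \<ge> 0" unfolding two_rho_def
      by (intro sum_nonneg mult_nonneg_nonneg wt_nonneg) (simp_all add: less_imp_le[OF d_pos])
    then show ?case using d_pos[of i] by (simp add: two_rho_add two_rho_simple)
  qed simp
  moreover have "B (wt w) m \<ge> 0" "B (wt w) (m + wt w) \<ge> 0"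
    using assms dominant_wt_nonneg by blast+
  ultimately have "B (m + wt w) (m + wt w) + two_rho (m + wt w) \<noteq> B m m + two_rho m"
    by (simp add: sform_simps two_rho_add sform(3)[of m "wt w"])
  then show ?thesis by (simp add: chi_def)
qed

text \<open>A nonzero homogeneous component of an element of \<open>Y\<close> is again in
  \<open>Y\<close>; raising it by the e_i must stop by nilpotency, and the last nonzero vector is
  singular.\<close>

lemma singular_submodule:
  assumes Y: "qs.subspace Y" "\<And>u y. y \<in> Y \<Longrightarrow> act u y \<in> Y" "Y \<subseteq> X" "Y \<noteq> {0}"
  shows "\<exists>s m. s \<in> Y \<and> s \<noteq> 0 \<and> s \<in> Xw m \<and> (\<forall>i. act (e i) s = 0)"
proof -
  obtain y where y: "y \<in> Y" "y \<noteq> 0" using Y(1,4) qs.subspace_0 by blast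
  have "y \<in> qs.span (\<Union>m. Xw m)" using X_weights y Y(3) by blast
  then obtain S r where S: "finite S" "S \<subseteq> (\<Union>m. Xw m)" "y = (\<Sum>a\<in>S. r a *\<^sub>q a)"
    unfolding qs.span_explicit by blast
  define om where "om a = (SOME m. a \<in> Xw m)" for a
  have om: "a \<in> Xw (om a)" if "a \<in> S" for a
  proof -
    have "\<exists>m. a \<in> Xw m" using that S(2) by blast
    then show ?thesis unfolding om_def by (rule someI_ex)
  qed
  define x where "x m = (\<Sum>a | a \<in> S \<and> om a = m. r a *\<^sub>q a)" for m
  have xw: "x m \<in> Xw m" for m
    unfolding x_def by (intro qs.subspace_sum qs.subspace_scale Xw_subspace) (use om in blast)
  have sum: "y = (\<Sum>m\<in>om ` S. x m)"
    unfolding S(3) x_def by (rule sum.image_gen[OF S(1)])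
  then obtain m where m: "m \<in> om ` S" "x m \<noteq> 0" using y(2) by (metis sum.neutral)
  have xY: "x m \<in> Y"
    by (rule weight_components[OF act Y(1,2) _ _ _ m(1)]) (use S(1) xw sum y(1) in auto)
  have *: "\<exists>s m. s \<in> Y \<and> s \<noteq> 0 \<and> s \<in> Xw m \<and> (\<forall>i. act (e i) s = 0)"
    if v: "kills N v" "v \<in> Y" "v \<noteq> 0" "v \<in> Xw n" for N v n
    using v
  proof (induction N arbitrary: n v)
    case 0
    then have "act (ew []) v = 0" unfolding kills_def by blast
    then show ?case using 0 by (simp add: act_1)
  next
    case (Suc N)
    show ?case
    proof (cases "\<forall>i. act (e i) v = 0")
      case True
      then show ?thesis using Suc.prems by blast
    next
      case False
      then obtain i where i: "act (e i) v \<noteq> 0" by blast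
      show ?thesis
        by (rule Suc.IH[OF kills_e[OF Suc.prems(1)] Y(2)[OF Suc.prems(2)] i Xw_e[OF Suc.prems(4)]])
    qed
  qed
  obtain N where "kills N (x m)" using kills_ex xw by blast
  from *[OF this xY m(2) xw] show ?thesis .
qed

text \<open>Modulo the Verma ideal, which annihilates \<open>s\<close>, an element of
  \<open>U\<close> is a combination of words in the f_i, and \<open>Lam\<close> picks out the
  coefficient of the empty one.\<close>

lemma singular_span:
  assumes "\<And>i. act (e i) s = 0" "s \<in> Xw m"
  shows "act y s - Lam m y *\<^sub>q s \<in> qs.span {act (fw w) s | w. w \<noteq> []}"
proof -
  obtain z where z: "z \<in> U_minus G" "y - z \<in> verma_ideal G m" using verma_ideal_complement by blast
  have lin: "qlinear (\<lambda>x. act x s)" by (rule qbilinearD(2)[OF is_module_bilinear[OF act]])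
  have "act v s = (\<lambda>_. 0) v" if v: "v \<in> verma_ideal G m" for v
  proof (rule linear_span_eq[of scaleq "\<lambda>x. act x s" "\<lambda>_. 0"])
    show "qlinear (\<lambda>x. act x s)" by (rule lin)
    show "qlinear (\<lambda>_ :: 'u. 0 :: 'w)" by (intro qlinearI) simp_all
    show "v \<in> qs.span ({x * e i | x i. True} \<union> {x * (t - q_char G m t *\<^sub>q 1) | x t. t \<in> torus G})"
      using v by (simp add: verma_ideal_def)
  qed (use assms in \<open>auto simp: act_mult act_simps act_1 weight_space_def\<close>)
  from this[OF z(2)] have "act y s = act z s" by (simp add: act_simps)
  moreover have "Lam m y = Lam m z"
    using Lam_verma_ideal[OF z(2), of 1] by (simp add: Lam_simps)
  moreover have "act z s - Lam m z *\<^sub>q s \<in> qs.span {act (fw w) s | w. w \<noteq> []}"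
  proof (rule linear_span_mem[of "\<lambda>z. act z s - Lam m z *\<^sub>q s", OF _ qs.subspace_span])
    show "qlinear (\<lambda>z. act z s - Lam m z *\<^sub>q s)"
      by (intro qlinearI) (simp_all add: act_simps Lam_simps scaleq_add_left scaleq_scaleq qs.scale_right_diff_distrib)
    show "z \<in> qs.span (range fw)" using z(1) by (simp add: U_minus_eq)
    fix x assume "x \<in> range fw"
    then obtain w where w: "x = fw w" by blast
    show "act x s - Lam m x *\<^sub>q s \<in> qs.span {act (fw w) s | w. w \<noteq> []}"
    proof (cases w)
      case Nil
      then show ?thesis by (simp add: w act_1 qs.span_zero)
    next
      case (Cons i v)
      then have "Lam m x = 0" by (simp add: w)
      moreover have "act (fw w) s \<in> {act (fw w) s | w. w \<noteq> []}" using Cons by blast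
      ultimately show ?thesis by (simp only: w qs.scale_zero_left diff_zero qs.span_base)
    qed
  qed
  ultimately show ?thesis by simp
qed

text \<open>A singular vector generates an irreducible module. Otherwise the ideal of L(m) applied
  to \<open>s\<close> is a nonzero submodule and has a singular vector of a lower weight; the
  Casimir scalar is inherited from \<open>s\<close>, against \<open>chi_neq\<close>.\<close>

lemma singular_L_ideal:
  assumes s: "s \<in> Xw m" "\<And>i. act (e i) s = 0" and l: "l \<in> L_ideal G m"
  shows "act l s = 0"
proof (rule ccontr)
  assume ls: "act l s \<noteq> 0"
  then have s0: "s \<noteq> 0" by (auto simp: act_simps)
  let ?Y = "{act l s | l. l \<in> L_ideal G m}"
  have L0: "0 \<in> L_ideal G m" by (simp add: L_ideal_iff Lam_simps)
  have LA: "a + b \<in> L_ideal G m" if "a \<in> L_ideal G m" "b \<in> L_ideal G m" for a b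
    using that by (simp add: L_ideal_iff Lam_simps distrib_left)
  have LM: "u * a \<in> L_ideal G m" if "a \<in> L_ideal G m" for u a
    using that by (simp add: L_ideal_iff flip: mult.assoc)
  have LS: "c *\<^sub>q a \<in> L_ideal G m" if "a \<in> L_ideal G m" for c a
    using that by (simp add: L_ideal_iff Lam_simps scaleq_mult_right)
  have Y: "qs.subspace ?Y"
  proof (rule qs.subspaceI)
    show "0 \<in> ?Y" using L0 act_simps(3)[of s] by force
    fix x assume "x \<in> ?Y"
    then obtain l where l: "x = act l s" "l \<in> L_ideal G m" by blast
    show "c *\<^sub>q x \<in> ?Y" for c
      unfolding l(1) act_simps(2)[symmetric] using LS[OF l(2)] by blast
    fix y assume "y \<in> ?Y"
    then obtain k where k: "y = act k s" "k \<in> L_ideal G m" by blast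
    show "x + y \<in> ?Y"
      unfolding l(1) k(1) act_simps(1)[symmetric] using LA[OF l(2) k(2)] by blast
  qed
  have Y_closed: "act u y \<in> ?Y" if y: "y \<in> ?Y" for u y
  proof -
    obtain l where l: "y = act l s" "l \<in> L_ideal G m" using y by blast
    show ?thesis unfolding l(1) act_mult[symmetric] using LM[OF l(2)] by blast
  qed
  have Y_X: "?Y \<subseteq> X" using s(1) X_closed by blast
  have "?Y \<noteq> {0}" using ls l by blast
  from singular_submodule[OF Y Y_closed Y_X this] obtain s' m' where
    s': "s' \<in> ?Y" "s' \<noteq> 0" "s' \<in> Xw m'" "\<forall>i. act (e i) s' = 0" by blast
  then obtain l' where l': "s' = act l' s" "l' \<in> L_ideal G m" by blast
  let ?S = "{act (fw w) s | w. w \<noteq> []}"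
  \<comment> \<open>Hence \<open>s'\<close> has no component along \<open>s\<close> and comes from
    nonempty words only.\<close>
  have "Lam m l' = 0" using l'(2) unfolding L_ideal_iff by (metis mult_1_left)
  then have "s' \<in> qs.span ?S" using singular_span[OF s(2) s(1), of l'] by (simp add: l'(1))
  moreover have "?S \<subseteq> (\<Union>m. weight_space G act m)" using Xw_fw[OF s(1)] by blast
  ultimately have s'_span: "s' \<in> qs.span (?S \<inter> weight_space G act m')"
    using s'(3) by (intro graded_span act) auto
  have "casimir m' s' = chi m' *\<^sub>q s'" using s'(3,4) by (intro casimir_singular) auto
  have pt: "casimir m' a = chi m *\<^sub>q a" if a: "a \<in> ?S \<inter> weight_space G act m'" for a
  proof (cases "a = 0")
    case True
    then show ?thesis using casimir_scale[of 0 m' 0] qs.subspace_0[OF X_subspace] by simp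
  next
    case False
    obtain w where w: "a = act (fw w) s" using a by blast
    have "m - wt w = m'" using False a Xw_fw[OF s(1), of w] unfolding w by (auto intro: weight_unique[OF act])
    then show ?thesis
      using casimir_fw[OF s(1) casimir_singular, of w] s unfolding w by simp
  qed
  have sp: "casimir m' a = chi m *\<^sub>q a \<and> a \<in> X" if a: "a \<in> qs.span (?S \<inter> weight_space G act m')" for a
    using a
  proof (induction rule: qs.span_induct_alt)
    case base
    then show ?case using casimir_scale[of 0 m' 0] qs.subspace_0[OF X_subspace] by simp
  next
    case (step c x y)
    have "x \<in> X" using step(1) s(1) X_closed by blast
    then have "c *\<^sub>q x \<in> X" by (rule qs.subspace_scale[OF X_subspace])
    with step(2) \<open>x \<in> X\<close> pt[OF step(1)] show ?case
      by (simp add: casimir_add casimir_scale qs.subspace_add[OF X_subspace] qs.scale_right_distrib mult.commute)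
  qed
  from sp[OF s'_span] have "casimir m' s' = chi m *\<^sub>q s'" by blast
  with \<open>casimir m' s' = chi m' *\<^sub>q s'\<close> have "chi m' *\<^sub>q s' = chi m *\<^sub>q s'" by metis
  then have chi: "chi m = chi m'" using s'(2) by auto
  have dom: "dominant_integral A m" "dominant_integral A m'"
    using singular_dominant[OF s(1) s0 s(2)] singular_dominant[OF s'(3,2)] s'(4) by blast+
  \<comment> \<open>A nonzero vector here would make m equal to m' + wt w for a nonempty
    \<open>w\<close>, although the Casimir scalars of m and m' agree.\<close>
  have "?S \<inter> weight_space G act m' \<subseteq> {0}"
  proof
    fix a assume a: "a \<in> ?S \<inter> weight_space G act m'"
    then obtain w where w: "a = act (fw w) s" "w \<noteq> []" by blast
    show "a \<in> {0}"
    proof (rule ccontr)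
      assume "a \<notin> {0}"
      then have "m - wt w = m'" using a Xw_fw[OF s(1), of w] unfolding w by (auto intro: weight_unique[OF act])
      then show False using chi_neq[of m' w] dom chi w(2) by auto
    qed
  qed
  then have "s' \<in> qs.span {0}" using s'_span qs.span_mono by blast
  then show False using s'(2) by simp
qed

section \<open>The submodule generated by singular vectors\<close>

definition Sing :: "'w set" where
  "Sing = {s. \<exists>m. dominant_integral A m \<and> s \<in> Xw m \<and> (\<forall>i. act (e i) s = 0)}"

definition generated :: "'w set" where "generated = qs.span {act (fw w) s | w s. s \<in> Sing}"

lemma generated_subspace: "qs.subspace generated"
  by (simp add: generated_def)

lemma Sing_generated: "s \<in> Sing \<Longrightarrow> s \<in> generated"
  unfolding generated_def by (rule qs.span_base) (force simp: act_1 intro: exI[of _ "[]"])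

lemma generated_closed:
  assumes "y \<in> generated"
  shows "act u y \<in> generated"
proof -
  have base: "act u s \<in> generated" if s: "s \<in> Sing" for s u
  proof -
    obtain m where m: "s \<in> Xw m" "\<forall>i. act (e i) s = 0" using s unfolding Sing_def by blast
    have "act u s - Lam m u *\<^sub>q s \<in> generated"
    proof -
      have "act u s - Lam m u *\<^sub>q s \<in> qs.span {act (fw w) s | w. w \<noteq> []}"
        by (rule singular_span) (use m in auto)
      moreover have "{act (fw w) s | w. w \<noteq> []} \<subseteq> {act (fw w) s | w s. s \<in> Sing}" using s by blast
      ultimately show ?thesis unfolding generated_def using qs.span_mono by blast
    qed
    moreover have "Lam m u *\<^sub>q s \<in> generated"
      by (rule qs.subspace_scale[OF generated_subspace Sing_generated[OF s]])
    ultimately have "(act u s - Lam m u *\<^sub>q s) + Lam m u *\<^sub>q s \<in> generated"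
      by (rule qs.subspace_add[OF generated_subspace])
    then show ?thesis by simp
  qed
  show ?thesis
    by (rule linear_span_mem[OF qbilinearD(1)[OF is_module_bilinear[OF act]] generated_subspace _
          assms[unfolded generated_def]])
      (auto simp: act_mult[symmetric] base)
qed

primrec casimir_product :: "'r weight \<Rightarrow> qfield list \<Rightarrow> 'w \<Rightarrow> 'w" where
  "casimir_product m [] y = y"
| "casimir_product m (c # cs) y = casimir_product m cs (casimir m y - c *\<^sub>q y)"

lemma casimir_step:
  assumes "y \<in> Xw m"
  shows "casimir m y - c *\<^sub>q y \<in> Xw m"
  using assms casimir_weight[OF assms] by (intro qs.subspace_diff qs.subspace_scale Xw_subspace)

lemma casimir_product_weight: "y \<in> Xw m \<Longrightarrow> casimir_product m cs y \<in> Xw m"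
  by (induction cs arbitrary: y) (simp_all only: casimir_product.simps casimir_step)

lemma casimir_diff:
  assumes "x \<in> X" "y \<in> X"
  shows "casimir m (x - y) = casimir m x - casimir m y"
  using casimir_add[of x "(- 1) *\<^sub>q y" m] casimir_scale[of y m "- 1"] assms
    qs.subspace_scale[OF X_subspace assms(2), of "- 1"] by simp

lemma casimir_product_linear:
  assumes "x \<in> Xw m" "y \<in> Xw m"
  shows "casimir_product m cs (x + y) = casimir_product m cs x + casimir_product m cs y"
    and "casimir_product m cs (a *\<^sub>q x) = a *\<^sub>q casimir_product m cs x"
proof -
  show "casimir_product m cs (x + y) = casimir_product m cs x + casimir_product m cs y"
    using assms
  proof (induction cs arbitrary: x y)
    case (Cons c cs)
    have "casimir m (x + y) - c *\<^sub>q (x + y) = (casimir m x - c *\<^sub>q x) + (casimir m y - c *\<^sub>q y)"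
      using Cons.prems by (simp add: casimir_add qs.scale_right_distrib)
    then show ?case
      by (simp only: casimir_product.simps) (rule Cons.IH; rule casimir_step; rule Cons.prems)
  qed simp
  show "casimir_product m cs (a *\<^sub>q x) = a *\<^sub>q casimir_product m cs x"
    using assms(1)
  proof (induction cs arbitrary: x)
    case (Cons c cs)
    have "casimir m (a *\<^sub>q x) - c *\<^sub>q (a *\<^sub>q x) = a *\<^sub>q (casimir m x - c *\<^sub>q x)"
      using Cons.prems by (simp add: casimir_scale qs.scale_right_diff_distrib mult.commute)
    then show ?case
      by (simp only: casimir_product.simps) (rule Cons.IH; rule casimir_step; rule Cons.prems)
  qed simp
qed

lemma casimir_product_zero: "casimir_product m cs 0 = 0"
  using casimir_product_linear(2)[of 0 m 0 cs 0] qs.subspace_0[OF Xw_subspace] by simp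

lemma casimir_product_append:
  "casimir_product m (cs @ cs') y = casimir_product m cs' (casimir_product m cs y)"
  by (induction cs arbitrary: y) simp_all

lemma casimir_product_commute:
  assumes "y \<in> Xw m"
  shows "casimir_product m cs (casimir_product m cs' y) = casimir_product m cs' (casimir_product m cs y)"
proof -
  have 1: "casimir_product m cs (casimir m y - c *\<^sub>q y)
      = casimir m (casimir_product m cs y) - c *\<^sub>q casimir_product m cs y" if "y \<in> Xw m" for y c cs
    using that
  proof (induction cs arbitrary: y)
    case (Cons a cs)
    have y: "y \<in> X" "casimir m y \<in> X" using Cons.prems casimir_weight[OF Cons.prems] by blast+
    have "casimir m (casimir m y - c *\<^sub>q y) - a *\<^sub>q (casimir m y - c *\<^sub>q y)
        = casimir m (casimir m y - a *\<^sub>q y) - c *\<^sub>q (casimir m y - a *\<^sub>q y)"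
      using y by (simp add: casimir_diff casimir_scale qs.subspace_scale[OF X_subspace] qs.scale_right_diff_distrib mult.commute)
    then show ?case
      using Cons.IH[OF casimir_step[OF Cons.prems, of a]] by simp
  qed simp
  show ?thesis using assms
  proof (induction cs' arbitrary: y)
    case (Cons c cs')
    then show ?case using Cons.IH[OF casimir_step[OF Cons.prems, of c]] by (simp add: 1)
  qed simp
qed

lemma casimir_product_e:
  assumes "y \<in> Xw m"
  shows "act (e i) (casimir_product m cs y) = casimir_product (m + simple_root i) cs (act (e i) y)"
  using assms
proof (induction cs arbitrary: y)
  case (Cons c cs)
  have "act (e i) (casimir m y - c *\<^sub>q y) = casimir (m + simple_root i) (act (e i) y) - c *\<^sub>q act (e i) y"
    by (simp add: act_simps casimir_e[OF Cons.prems])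
  then show ?case using Cons.IH[OF casimir_step[OF Cons.prems, of c]] by simp
qed simp

text \<open>A vector obtained from a singular vector of weight m by lowering is a Casimir
  eigenvector with value \<open>chi m\<close>, and m is n + wt w. Finitely many such vectors are
  killed by the product of their factors, which commute.\<close>

lemma generated_annihilated:
  assumes "y \<in> generated" "y \<in> Xw n"
  shows "\<exists>cs. (\<forall>c\<in>set cs. \<exists>w. dominant_integral A (n + wt w) \<and> c = chi (n + wt w)) \<and> casimir_product n cs y = 0"
proof -
  let ?S = "{act (fw w) s | w s. s \<in> Sing}"
  have "?S \<subseteq> (\<Union>m. weight_space G act m)"
    using Xw_fw by (fastforce simp: Sing_def)
  then have "y \<in> qs.span (?S \<inter> weight_space G act n)"
    using assms unfolding generated_def by (intro graded_span act) auto
  then have "y \<in> Xw n \<and> (\<exists>cs. (\<forall>c\<in>set cs. \<exists>w. dominant_integral A (n + wt w) \<and> c = chi (n + wt w)) \<and> casimir_product n cs y = 0)"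
  proof (induction rule: qs.span_induct_alt)
    case base
    show ?case
      by (intro conjI exI[of _ "[]"] qs.subspace_0[OF Xw_subspace]) simp_all
  next
    case (step a x y)
    obtain w s where x: "x = act (fw w) s" "s \<in> Sing" using step(1) by blast
    obtain m where m: "dominant_integral A m" "s \<in> Xw m" "\<forall>i. act (e i) s = 0" using x(2) unfolding Sing_def by blast
    have "x \<in> X" unfolding x(1) using m(2) X_closed by blast
    with step(1) have xn: "x \<in> Xw n" by blast
    obtain cs where cs: "\<forall>c\<in>set cs. \<exists>w. dominant_integral A (n + wt w) \<and> c = chi (n + wt w)" "casimir_product n cs y = 0"
      and y: "y \<in> Xw n" using step(2) by blast
    have ax: "a *\<^sub>q x \<in> Xw n" by (rule qs.subspace_scale[OF Xw_subspace xn])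
    have "\<exists>cs'. (\<forall>c\<in>set cs'. \<exists>w. dominant_integral A (n + wt w) \<and> c = chi (n + wt w)) \<and> casimir_product n cs' x = 0"
    proof (cases "x = 0")
      case True
      then show ?thesis by (intro exI[of _ "[]"]) simp
    next
      case False
      have "m - wt w = n" using False xn Xw_fw[OF m(2), of w] unfolding x(1) by (auto intro: weight_unique[OF act])
      then have mn: "m = n + wt w" by auto
      have "casimir n x = chi m *\<^sub>q x"
        using casimir_fw[OF m(2) casimir_singular, of w] m \<open>m - wt w = n\<close> by (simp add: x(1))
      then show ?thesis using m(1) mn by (intro exI[of _ "[chi m]"]) auto
    qed
    then obtain cs' where cs': "\<forall>c\<in>set cs'. \<exists>w. dominant_integral A (n + wt w) \<and> c = chi (n + wt w)"
      "casimir_product n cs' x = 0" by blast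
    have "casimir_product n (cs' @ cs) (a *\<^sub>q x + y)
        = casimir_product n cs (casimir_product n cs' (a *\<^sub>q x)) + casimir_product n cs' (casimir_product n cs y)"
      unfolding casimir_product_append casimir_product_linear(1)[OF ax y]
        casimir_product_linear(1)[OF casimir_product_weight[OF ax] casimir_product_weight[OF y]]
      by (simp only: casimir_product_commute[OF y])
    also have "\<dots> = 0"
      using cs(2) cs'(2) by (simp add: casimir_product_linear(2)[OF xn xn] casimir_product_zero)
    finally have "casimir_product n (cs' @ cs) (a *\<^sub>q x + y) = 0" .
    moreover have "a *\<^sub>q x + y \<in> Xw n" by (rule qs.subspace_add[OF Xw_subspace ax y])
    ultimately show ?case using cs(1) cs'(1) by (intro conjI exI[of _ "cs' @ cs"]) auto
  qed
  then show ?thesis by blast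
qed

text \<open>Modulo \<open>generated\<close>, the vector y looks singular, so each factor acts by the
  scalar chi(m) - c.\<close>

lemma casimir_product_mod:
  assumes "y \<in> Xw m" "\<And>i. act (e i) y \<in> generated"
  shows "casimir_product m cs y - (\<Prod>c\<leftarrow>cs. chi m - c) *\<^sub>q y \<in> generated"
  using assms
proof (induction cs arbitrary: y)
  case Nil
  show ?case by (simp add: qs.subspace_0[OF generated_subspace])
next
  case (Cons c cs)
  let ?z = "casimir m y - c *\<^sub>q y" and ?p = "\<Prod>c\<leftarrow>cs. chi m - c"
  have mod: "casimir m y - chi m *\<^sub>q y \<in> generated"
    by (rule casimir_mod[OF IntD1[OF Cons.prems(1)] generated_subspace Cons.prems(2) generated_closed])
  have "act (e i) ?z \<in> generated" for i
  proof -
    have "?z = (casimir m y - chi m *\<^sub>q y) + (chi m - c) *\<^sub>q y" by (simp add: qs.scale_left_diff_distrib)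
    then have "act (e i) ?z = act (e i) (casimir m y - chi m *\<^sub>q y) + (chi m - c) *\<^sub>q act (e i) y"
      by (simp only: act_simps)
    then show ?thesis
      using generated_closed[OF mod] Cons.prems(2)
      by (simp only: qs.subspace_add[OF generated_subspace] qs.subspace_scale[OF generated_subspace])
  qed
  from Cons.IH[OF casimir_step[OF Cons.prems(1)] this]
  have 1: "casimir_product m cs ?z - ?p *\<^sub>q ?z \<in> generated" .
  have "?p *\<^sub>q (casimir m y - chi m *\<^sub>q y) \<in> generated" by (rule qs.subspace_scale[OF generated_subspace mod])
  from qs.subspace_add[OF generated_subspace 1 this] show ?case
    by (simp add: qs.scale_right_diff_distrib qs.scale_left_diff_distrib left_diff_distrib mult.commute algebra_simps)
qed

text \<open>Let u be outside with all e_i u inside. A product of Casimir factors kills every e_i u,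
  so it makes u singular. Modulo \<open>generated\<close> this product is a scalar multiple of u,
  and the scalar is nonzero because m is dominant and all factors belong to strictly higher dominant
  weights. So u is inside after all.\<close>

lemma X_generated: "X \<subseteq> generated"
proof -
  have "u \<in> generated" if "u \<in> Xw m" "kills N u" for u m N
    using that
  proof (induction N arbitrary: u m)
    case 0
    then have "act (ew []) u = 0" unfolding kills_def by blast
    then show ?case by (simp add: act_1 qs.subspace_0[OF generated_subspace])
  next
    case (Suc N)
    have eu: "act (e i) u \<in> generated" for i
      by (rule Suc.IH[OF Xw_e[OF Suc.prems(1)] kills_e[OF Suc.prems(2)]])
    show ?case
    proof (rule ccontr)
      assume u: "u \<notin> generated"
      have dom: "dominant_integral A m"
        by (rule singular_mod_dominant[OF generated_subspace generated_closed Suc.prems(1) u eu])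
      have "\<exists>cs. (\<forall>c\<in>set cs. \<exists>w. dominant_integral A (m + simple_root i + wt w) \<and> c = chi (m + simple_root i + wt w))
          \<and> casimir_product (m + simple_root i) cs (act (e i) u) = 0" for i
        by (rule generated_annihilated[OF eu Xw_e[OF Suc.prems(1)]])
      then obtain cs where cs: "\<And>i c. c \<in> set (cs i) \<Longrightarrow> \<exists>w. dominant_integral A (m + simple_root i + wt w) \<and> c = chi (m + simple_root i + wt w)"
        "\<And>i. casimir_product (m + simple_root i) (cs i) (act (e i) u) = 0" by metis
      \<comment> \<open>One list for all i at once. Since the factors commute, the block for a given
        i can be applied before the others.\<close>
      define ds where "ds = concat (map cs index_list)"
      have "casimir_product (m + simple_root i) ds (act (e i) u) = 0" for i
      proof -
        obtain xs ys where xs: "(index_list :: 'r list) = xs @ i # ys" using split_list[of i index_list] by (auto simp: index_list)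
        have ds: "ds = concat (map cs xs) @ cs i @ concat (map cs ys)" by (simp add: ds_def xs)
        show ?thesis
          unfolding ds casimir_product_append
          using casimir_product_commute[OF Xw_e[OF Suc.prems(1), of i], of "cs i" "concat (map cs xs)"]
          by (simp add: cs(2) casimir_product_zero)
      qed
      then have "act (e i) (casimir_product m ds u) = 0" for i
        by (simp add: casimir_product_e[OF Suc.prems(1)])
      then have "casimir_product m ds u \<in> Sing"
        using dom casimir_product_weight[OF Suc.prems(1)] unfolding Sing_def by blast
      then have 1: "casimir_product m ds u \<in> generated" by (rule Sing_generated)
      let ?p = "\<Prod>c\<leftarrow>ds. chi m - c"
      have "casimir_product m ds u - (casimir_product m ds u - ?p *\<^sub>q u) \<in> generated"
        by (rule qs.subspace_diff[OF generated_subspace 1 casimir_product_mod[OF Suc.prems(1) eu]])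
      then have p: "?p *\<^sub>q u \<in> generated" by simp
      have "chi m - c \<noteq> 0" if c: "c \<in> set ds" for c
      proof -
        \<comment> \<open>The weight behind c is m + alpha_i + wt w, strictly above m even when
          \<open>w\<close> is empty.\<close>
        obtain i where "c \<in> set (cs i)" using c by (auto simp: ds_def)
        then obtain w where "dominant_integral A (m + wt (i # w))" "c = chi (m + wt (i # w))"
          using cs(1) by (fastforce simp: add.assoc)
        then show ?thesis using chi_neq[OF dom, of "i # w"] by auto
      qed
      then have "?p \<noteq> 0" by (induction ds) auto
      then show False using u subspace_scaleD[OF generated_subspace p] by blast
    qed
  qed
  then have "(\<Union>m. Xw m) \<subseteq> generated" using kills_ex by blast
  then show ?thesis
    using X_weights qs.span_minimal[OF _ generated_subspace] by blast
qed

theorem completely_reducible: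
  assumes "x \<in> X"
  shows "x \<in> qs.span {act y s | y s. \<exists>m. dominant_integral A m \<and> s \<in> Xw m \<and> (\<forall>l\<in>L_ideal G m. act l s = 0)}"
proof -
  have "{act (fw w) s | w s. s \<in> Sing} \<subseteq> {act y s | y s. \<exists>m. dominant_integral A m \<and> s \<in> Xw m \<and> (\<forall>l\<in>L_ideal G m. act l s = 0)}"
    (is "_ \<subseteq> ?S")
  proof clarify
    fix w s assume "s \<in> Sing"
    then obtain m where m: "dominant_integral A m" "s \<in> Xw m" "\<forall>i. act (e i) s = 0" unfolding Sing_def by blast
    then have "\<forall>l\<in>L_ideal G m. act l s = 0" using singular_L_ideal by blast
    with m show "\<exists>y s'. act (fw w) s = act y s' \<and> (\<exists>m. dominant_integral A m \<and> s' \<in> Xw m \<and> (\<forall>l\<in>L_ideal G m. act l s' = 0))"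
      by blast
  qed
  then show ?thesis
    using assms X_generated qs.span_mono unfolding generated_def by blast
qed

end

section \<open>Words acting on products\<close>

text \<open>A word acts on a product by the sum of all ways of distributing its letters over the two factors,
  with the coefficient \<open>b i u\<close> whenever a letter \<open>i\<close> passes the subword \<open>u\<close> acting on the first factor.\<close>

primrec shuf :: "('i \<Rightarrow> 'i list \<Rightarrow> qfield) \<Rightarrow> 'i list \<Rightarrow> ('i list \<Rightarrow> 'i list \<Rightarrow> 'w::qspace) \<Rightarrow> 'w" where
  "shuf b [] h = h [] []"
| "shuf b (i # w) h = shuf b w (\<lambda>u v. h (i # u) v + b i u *\<^sub>q h u (i # v))"

lemma shuf_sum: "shuf b w (\<lambda>u v. \<Sum>k\<in>K. h k u v) = (\<Sum>k\<in>K. shuf b w (h k))"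
  by (induction w arbitrary: h) (simp_all add: sum.distrib[symmetric] qs.scale_sum_right)

lemma shuf_add: "shuf b w (\<lambda>u v. h u v + h' u v) = shuf b w h + shuf b w h'"
  by (induction w arbitrary: h h') (simp_all add: qs.scale_right_distrib algebra_simps)

lemma shuf_cong:
  assumes "\<And>u v. length u + length v = length w \<Longrightarrow> h u v = h' u v"
  shows "shuf b w h = shuf b w h'"
  using assms
proof (induction w arbitrary: h h')
  case (Cons i w)
  have "shuf b w (\<lambda>u v. h (i # u) v + b i u *\<^sub>q h u (i # v)) = shuf b w (\<lambda>u v. h' (i # u) v + b i u *\<^sub>q h' u (i # v))"
    by (rule Cons.IH) (simp add: Cons.prems)
  then show ?case by simp
qed simp

lemma shuf_linear:
  assumes "qlinear g"
  shows "g (shuf b w h) = shuf b w (\<lambda>u v. g (h u v))"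
  by (induction w arbitrary: h) (simp_all add: lin_simps[OF assms])

lemma shuf_span: "shuf b w h \<in> qs.span {h u v | u v. length u + length v = length w \<and> set u \<union> set v \<subseteq> set w}"
proof (induction w arbitrary: h)
  case Nil
  show ?case by (simp add: qs.span_base)
next
  case (Cons i w)
  let ?S = "{h u v | u v. length u + length v = length (i # w) \<and> set u \<union> set v \<subseteq> set (i # w)}"
  have "h (i # u) v + b i u *\<^sub>q h u (i # v) \<in> qs.span ?S"
    if "length u + length v = length w" "set u \<union> set v \<subseteq> set w" for u v
  proof (intro qs.span_add qs.span_scale qs.span_base CollectI)
    show "\<exists>u' v'. h (i # u) v = h u' v' \<and> length u' + length v' = length (i # w) \<and> set u' \<union> set v' \<subseteq> set (i # w)"
      by (intro exI[of _ "i # u"] exI[of _ v]) (use that in auto)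
    show "\<exists>u' v'. h u (i # v) = h u' v' \<and> length u' + length v' = length (i # w) \<and> set u' \<union> set v' \<subseteq> set (i # w)"
      by (intro exI[of _ u] exI[of _ "i # v"]) (use that in auto)
  qed
  then have "qs.span {h (i # u) v + b i u *\<^sub>q h u (i # v) | u v. length u + length v = length w \<and> set u \<union> set v \<subseteq> set w} \<subseteq> qs.span ?S"
    by (intro qs.span_minimal qs.subspace_span) blast
  with Cons[of "\<lambda>u v. h (i # u) v + b i u *\<^sub>q h u (i # v)"] show ?case by auto
qed

text \<open>The twisted Leibniz rule: a derivation reaching the second word has passed all letters
  of the first.\<close>

lemma strip_append:
  assumes "vector_space s"
  shows "strip s c j (u @ v) g = strip s c j u (\<lambda>x. g (x @ v)) + s (prod_list (map c u)) (strip s c j v (\<lambda>y. g (u @ y)))"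
proof (induction u arbitrary: g)
  case Nil
  interpret vector_space s by fact
  show ?case by simp
next
  case (Cons i u)
  interpret vector_space s by fact
  show ?case by (simp add: Cons.IH scale_right_distrib)
qed

context qea
begin

lemma prod_lq: "prod_list (map (lq j) u) = qpow (B (simple_root j) (wt u))"
  by (induction u) (simp_all add: sform_simps qpow_add)

text \<open>Distributing letters is adjoint to concatenation. The weight \<^term>\<open>n\<close> only contributes a global factor.\<close>

lemma shuf_gf:
  "shuf (\<lambda>i u. qpow (B (simple_root i) (n + wt u))) w (\<lambda>u v. (gf u u' * gf v v') *\<^sub>q x)
    = (qpow (B n (wt v')) * gf w (u' @ v')) *\<^sub>q x"
proof (induction w arbitrary: u' v' x)
  case Nil
  show ?case by (auto simp: word_unit_def)
next
  case (Cons i w)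
  let ?b = "\<lambda>i u. qpow (B (simple_root i) (n + wt u))"
  define U V where "U = words (wt u' - simple_root i)" and "V = words (wt v' - simple_root i)"
  define R where "R = lcoef i"
  have strip: "strip (*) (lq i) i u' g = (\<Sum>y\<in>U. R u' y * g y)" "strip (*) (lq i) i v' g = (\<Sum>y\<in>V. R v' y * g y)" for g
    unfolding U_def V_def R_def by (rule strip_expand[OF vs_qfield]; simp add: words_def)+
  have b: "?b i u * gf u u' = ?b i u' * gf u u'" for u
    using gf_wt[of u u'] by (cases "wt u = wt u'") simp_all
  have 1: "(gf (i # u) u' * gf v v') *\<^sub>q x = (\<Sum>y\<in>U. (gf u y * gf v v') *\<^sub>q (R u' y *\<^sub>q x))" for u v
    by (simp add: strip sum_distrib_left sum_distrib_right qs.scale_sum_left scaleq_scaleq mult_ac)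
  have 2: "?b i u *\<^sub>q ((gf u u' * gf (i # v) v') *\<^sub>q x) = (\<Sum>y\<in>V. (gf u u' * gf v y) *\<^sub>q ((?b i u' * R v' y) *\<^sub>q x))" for u v
  proof -
    have "?b i u *\<^sub>q ((gf u u' * gf (i # v) v') *\<^sub>q x) = ((?b i u * gf u u') * gf (i # v) v') *\<^sub>q x"
      by (simp add: scaleq_scaleq mult.assoc)
    also have "\<dots> = (\<Sum>y\<in>V. (gf u u' * gf v y) *\<^sub>q ((?b i u' * R v' y) *\<^sub>q x))"
      unfolding b by (simp add: strip sum_distrib_left qs.scale_sum_left scaleq_scaleq mult_ac)
    finally show ?thesis .
  qed
  have V: "(qpow (B n (wt y)) * g) *\<^sub>q ((?b i u' * r) *\<^sub>q x) = (qpow (B n (wt v')) * (rq i u' * (r * g))) *\<^sub>q x"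
    if "y \<in> V" for y g r
  proof -
    have "qpow (B n (wt y)) * ?b i u' = qpow (B n (wt v')) * rq i u'"
      using that by (simp add: V_def words_def sform_simps qpow_add[symmetric] sform(3)[of "simple_root i" n])
    then show ?thesis by (simp add: scaleq_scaleq)
  qed
  have "shuf ?b (i # w) (\<lambda>u v. (gf u u' * gf v v') *\<^sub>q x)
      = (\<Sum>y\<in>U. (qpow (B n (wt v')) * gf w (y @ v')) *\<^sub>q (R u' y *\<^sub>q x))
        + (\<Sum>y\<in>V. (qpow (B n (wt y)) * gf w (u' @ y)) *\<^sub>q ((?b i u' * R v' y) *\<^sub>q x))"
    by (simp only: shuf.simps 1 2 shuf_add shuf_sum Cons.IH)
  also have "\<dots> = (\<Sum>y\<in>U. (qpow (B n (wt v')) * gf w (y @ v')) *\<^sub>q (R u' y *\<^sub>q x))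
        + (\<Sum>y\<in>V. (qpow (B n (wt v')) * (rq i u' * (R v' y * gf w (u' @ y)))) *\<^sub>q x)"
    by (intro arg_cong2[of _ _ _ _ "(+)"] sum.cong refl V)
  also have "\<dots> = (qpow (B n (wt v')) * gf (i # w) (u' @ v')) *\<^sub>q x"
    by (simp add: strip_append[OF vs_qfield] strip prod_lq sum_distrib_left qs.scale_sum_left distrib_left scaleq_add_left scaleq_scaleq mult_ac)
  finally show ?case .
qed

text \<open>The vectors paired with the words when \<open>\<phi>\<close> is written through the
  form, as in an expansion by dual bases; the generalized inverse stands in for the inverse Gram
  matrix.\<close>

definition dual_word :: "('r list \<Rightarrow> 'w::qspace) \<Rightarrow> 'r list \<Rightarrow> 'w" where
  "dual_word \<phi> v = (\<Sum>x\<in>words (wt v). gf_inv (wt v) x v *\<^sub>q \<phi> x)"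

lemma kills_radical_expand:
  assumes "kills_radical \<phi>" "finite W" "words (wt u) \<subseteq> W"
  shows "\<phi> u = (\<Sum>v\<in>W. gf u v *\<^sub>q dual_word \<phi> v)"
proof -
  let ?U = "words (wt u)"
  have u: "u \<in> ?U" by (simp add: words_def)
  have "\<phi> u = (\<Sum>x\<in>?U. (if x = u then 1 else 0) *\<^sub>q \<phi> x)"
    using u by (simp add: finite_words if_distrib[of "\<lambda>x. x *\<^sub>q _"] cong: if_cong)
  also have "\<dots> = (\<Sum>x\<in>?U. \<Sum>v\<in>?U. (gf u v * gf_inv (wt u) x v) *\<^sub>q \<phi> x)"
    by (rule radical_expand[OF assms(1) gf_inv_transpose])
      (use u in \<open>simp_all add: finite_words if_distrib[of "\<lambda>x. x * _"] cong: if_cong\<close>)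
  also have "\<dots> = (\<Sum>v\<in>?U. \<Sum>x\<in>?U. (gf u v * gf_inv (wt u) x v) *\<^sub>q \<phi> x)" by (rule sum.swap)
  also have "\<dots> = (\<Sum>v\<in>?U. gf u v *\<^sub>q dual_word \<phi> v)"
    by (rule sum.cong) (simp_all add: dual_word_def words_def qs.scale_sum_right)
  also have "\<dots> = (\<Sum>v\<in>W. gf u v *\<^sub>q dual_word \<phi> v)"
    by (rule sum.mono_neutral_left[OF assms(2,3)]) (use gf_wt[of u] in \<open>auto simp: words_def\<close>)
  finally show ?thesis .
qed

text \<open>Writing both maps through the form turns a distributed word w into values of
  \<open>gf\<close> at w and concatenations u' @ v', by \<open>shuf_gf\<close>. Radical coefficients
  pair to zero with every word, in particular with these.\<close>

lemma kills_radical_shuf: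
  assumes "kills_radical \<phi>" "kills_radical \<psi>" "qbilinear D"
  shows "kills_radical (\<lambda>w. shuf (\<lambda>i u. qpow (B (simple_root i) (n + wt u))) w (\<lambda>u v. D (\<phi> u) (\<psi> v)))"
  unfolding kills_radical_def
proof (intro allI impI)
  fix \<beta> a assume rad: "radical \<beta> a"
  let ?shuf = "shuf (\<lambda>i u. qpow (B (simple_root i) (n + wt u)))"
  define L where "L = length (SOME w. w \<in> words \<beta>)"
  have L: "length w = L" if "w \<in> words \<beta>" for w
    unfolding L_def using that someI[of "\<lambda>w. w \<in> words \<beta>" w] by (intro wt_length) (simp add: words_def)
  \<comment> \<open>All words up to the common length in weight \<beta>: a finite set in which every
    subword produced by \<open>shuf\<close> can be expanded.\<close>
  define W :: "'r list set" where "W = {u. set u \<subseteq> UNIV \<and> length u \<le> L}"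
  have W: "finite W" unfolding W_def by (rule finite_lists_length_le) simp
  have sub: "words (wt u) \<subseteq> W" if "length u \<le> L" for u
  proof
    fix x assume "x \<in> words (wt u)"
    then have "length x = length u" by (intro wt_length) (simp add: words_def)
    then show "x \<in> W" using that by (simp add: W_def)
  qed
  define c where "c u v = D (dual_word \<phi> u) (dual_word \<psi> v)" for u v
  have "?shuf w (\<lambda>u v. D (\<phi> u) (\<psi> v)) = (\<Sum>u'\<in>W. \<Sum>v'\<in>W. (qpow (B n (wt v')) * gf w (u' @ v')) *\<^sub>q c u' v')"
    if w: "w \<in> words \<beta>" for w
  proof -
    have "?shuf w (\<lambda>u v. D (\<phi> u) (\<psi> v)) = ?shuf w (\<lambda>u v. \<Sum>u'\<in>W. \<Sum>v'\<in>W. (gf u u' * gf v v') *\<^sub>q c u' v')"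
    proof (rule shuf_cong)
      fix u v :: "'r list" assume "length u + length v = length w"
      then have "length u \<le> L" "length v \<le> L" using L[OF w] by auto
      then have "\<phi> u = (\<Sum>v\<in>W. gf u v *\<^sub>q dual_word \<phi> v)" "\<psi> v = (\<Sum>u\<in>W. gf v u *\<^sub>q dual_word \<psi> u)"
        using kills_radical_expand[OF assms(1) W sub] kills_radical_expand[OF assms(2) W sub] by blast+
      then have "D (\<phi> u) (\<psi> v) = D (\<Sum>v\<in>W. gf u v *\<^sub>q dual_word \<phi> v) (\<Sum>u\<in>W. gf v u *\<^sub>q dual_word \<psi> u)" by simp
      also have "\<dots> = (\<Sum>u'\<in>W. \<Sum>v'\<in>W. (gf u u' * gf v v') *\<^sub>q c u' v')"
        unfolding qbilinear_simps(11)[OF assms(3)] unfolding qbilinear_simps(12)[OF assms(3)]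
        by (simp add: qbilinear_simps(2,7)[OF assms(3)] c_def scaleq_scaleq mult.commute)
      finally show "D (\<phi> u) (\<psi> v) = (\<Sum>u'\<in>W. \<Sum>v'\<in>W. (gf u u' * gf v v') *\<^sub>q c u' v')" .
    qed
    then show ?thesis by (simp only: shuf_sum shuf_gf)
  qed
  then have "(\<Sum>w\<in>words \<beta>. a w *\<^sub>q ?shuf w (\<lambda>u v. D (\<phi> u) (\<psi> v)))
      = (\<Sum>w\<in>words \<beta>. \<Sum>u'\<in>W. \<Sum>v'\<in>W. (qpow (B n (wt v')) * (a w * gf w (u' @ v'))) *\<^sub>q c u' v')"
    by (intro sum.cong refl) (simp add: qs.scale_sum_right scaleq_scaleq mult_ac)
  also have "\<dots> = (\<Sum>u'\<in>W. \<Sum>v'\<in>W. \<Sum>w\<in>words \<beta>. (qpow (B n (wt v')) * (a w * gf w (u' @ v'))) *\<^sub>q c u' v')"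
    by (rule sum_swap3[symmetric])
  also have "\<dots> = 0"
    by (simp add: qs.scale_sum_left[symmetric] sum_distrib_left[symmetric] radicalD[OF rad])
  finally show "(\<Sum>w\<in>words \<beta>. a w *\<^sub>q ?shuf w (\<lambda>u v. D (\<phi> u) (\<psi> v))) = 0" .
qed

end

section \<open>Irreducible highest weight modules\<close>

context qea
begin

text \<open>Derivations are adjoint to multiplication by a letter, and the radical pairs to zero
  with all words, so it is stable under derivations.\<close>

lemma radical_strip:
  assumes "radical (\<gamma> + simple_root j) a"
  shows "radical \<gamma> (\<lambda>u. \<Sum>w\<in>words (\<gamma> + simple_root j). a w * lcoef j w u)"
    and "radical \<gamma> (\<lambda>u. \<Sum>w\<in>words (\<gamma> + simple_root j). a w * rcoef j w u)"
proof -
  have *: "radical \<gamma> (\<lambda>u. \<Sum>w\<in>words (\<gamma> + simple_root j). a w * r w u)"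
    if r: "\<And>w v. w \<in> words (\<gamma> + simple_root j) \<Longrightarrow> v \<in> words \<gamma> \<Longrightarrow> (\<Sum>u\<in>words \<gamma>. r w u * gf u v) = gf w (\<phi> v)" for r \<phi>
    unfolding radical_def
  proof
    fix v assume v: "v \<in> words \<gamma>"
    have "(\<Sum>u\<in>words \<gamma>. (\<Sum>w\<in>words (\<gamma> + simple_root j). a w * r w u) * gf u v)
        = (\<Sum>u\<in>words \<gamma>. \<Sum>w\<in>words (\<gamma> + simple_root j). a w * (r w u * gf u v))"
      by (simp add: sum_distrib_right mult.assoc)
    also have "\<dots> = (\<Sum>w\<in>words (\<gamma> + simple_root j). \<Sum>u\<in>words \<gamma>. a w * (r w u * gf u v))" by (rule sum.swap)
    also have "\<dots> = (\<Sum>w\<in>words (\<gamma> + simple_root j). a w * gf w (\<phi> v))"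
      using r v by (simp add: sum_distrib_left[symmetric])
    also have "\<dots> = 0" by (rule radicalD[OF assms])
    finally show "(\<Sum>u\<in>words \<gamma>. (\<Sum>w\<in>words (\<gamma> + simple_root j). a w * r w u) * gf u v) = 0" .
  qed
  show "radical \<gamma> (\<lambda>u. \<Sum>w\<in>words (\<gamma> + simple_root j). a w * lcoef j w u)"
    "radical \<gamma> (\<lambda>u. \<Sum>w\<in>words (\<gamma> + simple_root j). a w * rcoef j w u)"
    using *[of "lcoef j" "(#) j"] *[of "rcoef j" "\<lambda>v. v @ [j]"]
    by (simp_all add: strip_coefficients)
qed

lemma radical_0: "radical 0 a \<Longrightarrow> a [] = 0"
  by (simp add: radical_def words_def wt_eq_0_iff word_unit_def)

lemma radical_sum:
  "(\<Sum>w\<in>W. a w *\<^sub>q (\<Sum>u\<in>U. r w u *\<^sub>q x u)) = (\<Sum>u\<in>U. (\<Sum>w\<in>W. a w * r w u) *\<^sub>q x u)"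
  unfolding qs.scale_sum_right qs.scale_sum_left scaleq_scaleq by (rule sum.swap)

section \<open>Local nilpotency of the lowering operators\<close>

lemma serre_span:
  assumes "i \<noteq> j"
  defines "N \<equiv> nat (1 - A $ i $ j)"
  shows "f i ^ N * f j \<in> qs.span {f i ^ k * f j * f i ^ (N - k) | k. k < N}"
proof -
  let ?c = "\<lambda>m. (- 1) ^ m / (q_fact (d i) m * q_fact (d i) (N - m))"
  let ?X = "\<lambda>m. f i ^ m * f j * f i ^ (N - m)"
  let ?S = "qs.span {?X k | k. k < N}"
  have "(\<Sum>m = 0..N. ?c m *\<^sub>q ?X m) = 0"
    using serre_f[OF assms(1)] by (simp add: serre_in_def N_def Let_def)
  moreover have "{0..N} = insert N {..<N}" by auto
  ultimately have "?c N *\<^sub>q ?X N + (\<Sum>m<N. ?c m *\<^sub>q ?X m) = 0" by simp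
  then have "?c N *\<^sub>q ?X N = - (\<Sum>m<N. ?c m *\<^sub>q ?X m)" by (simp only: eq_neg_iff_add_eq_0)
  moreover have "(\<Sum>m<N. ?c m *\<^sub>q ?X m) \<in> ?S" by (intro qs.span_sum qs.span_scale qs.span_base) blast
  ultimately have "?c N *\<^sub>q ?X N \<in> ?S" by (simp only: qs.span_neg)
  moreover have "?c N \<noteq> 0" by (simp add: q_fact_nonzero)
  ultimately have "?X N \<in> ?S" using subspace_scaleD[OF qs.subspace_span] by blast
  then show ?thesis by simp
qed

text \<open>Whenever N letters f_i stand to the left of f_j, the Serre relation moves at least one
  of them to the right. Hence fewer than N remain on the left, however large M is.\<close>

lemma serre_span_power:
  assumes "i \<noteq> j" and N: "N = nat (1 - A $ i $ j)" and "N \<le> M"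
  shows "f i ^ M * f j \<in> qs.span {f i ^ k * f j * f i ^ (M - k) | k. k < N}"
  using assms(3)
proof (induction M rule: dec_induct)
  case base
  show ?case using serre_span[OF assms(1)] by (simp add: N)
next
  case (step M)
  let ?S = "qs.span {f i ^ k * f j * f i ^ (Suc M - k) | k. k < N}"
  have "f i * x \<in> ?S" if x: "x \<in> {f i ^ k * f j * f i ^ (M - k) | k. k < N}" for x
  proof -
    obtain k where k: "x = f i ^ k * f j * f i ^ (M - k)" "k < N" using x by blast
    have e: "f i * x = f i ^ Suc k * f j * f i ^ (Suc M - Suc k)" by (simp add: k(1) mult.assoc)
    show ?thesis
    proof (cases "Suc k < N")
      case True
      then show ?thesis unfolding e by (intro qs.span_base) blast
    next
      case False
      then have N': "N = Suc k" using k(2) by simp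
      have "f i ^ N * f j * f i ^ (Suc M - N) \<in> ?S"
      proof (rule linear_span_mem[OF qlinear_mult_right qs.subspace_span _ serre_span[OF assms(1), folded N]])
        fix y assume "y \<in> {f i ^ k * f j * f i ^ (N - k) | k. k < N}"
        then obtain l where l: "y = f i ^ l * f j * f i ^ (N - l)" "l < N" by blast
        have "y * f i ^ (Suc M - N) = f i ^ l * f j * f i ^ ((N - l) + (Suc M - N))"
          by (simp add: l(1) mult.assoc power_add)
        also have "(N - l) + (Suc M - N) = Suc M - l" using l(2) step(1) by simp
        finally show "y * f i ^ (Suc M - N) \<in> ?S" using l(2) by (auto intro: qs.span_base)
      qed
      then show ?thesis unfolding e by (simp add: N')
    qed
  qed
  then have "f i * (f i ^ M * f j) \<in> ?S"
    by (rule linear_span_mem[OF qlinear_mult_left qs.subspace_span _ step.IH])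
  then show ?case by (simp add: mult.assoc)
qed

text \<open>With r + N factors f_i in front of f_j, at least r of them end up on the right, where
  they annihilate x.\<close>

lemma f_nilpotent_f:
  assumes act: "is_module act" and x: "act (f i ^ r) x = 0"
  shows "\<exists>N. act (f i ^ N) (act (f j) x) = 0"
proof (cases "i = j")
  case True
  have "act (f i ^ r) (act (f j) x) = act (f i) (act (f i ^ r) x)"
    by (simp add: True is_moduleD(2)[OF act, symmetric] power_commutes)
  then have "act (f i ^ r) (act (f j) x) = 0"
    unfolding x by (simp add: module_simps[OF act])
  then show ?thesis by blast
next
  case False
  define N where "N = nat (1 - A $ i $ j)"
  have lin: "qlinear (\<lambda>u. act u x)" by (rule qbilinearD(2)[OF is_module_bilinear[OF act]])
  have "act (f i ^ (r + N) * f j) x \<in> {0}"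
  proof (rule linear_span_mem[OF lin _ _ serre_span_power[OF False N_def]])
    fix u assume "u \<in> {f i ^ k * f j * f i ^ (r + N - k) | k. k < N}"
    then obtain k where k: "u = f i ^ k * f j * f i ^ (r + N - k)" "k < N" by blast
    have "f i ^ (r + N - k) = f i ^ (N - k) * f i ^ r"
      using k(2) by (simp add: power_add[symmetric] add.commute)
    then show "act u x \<in> {0}"
      by (simp add: k(1) is_moduleD(2)[OF act] x module_simps[OF act])
  qed (simp_all add: qs.subspace_def)
  then show ?thesis by (auto simp: is_moduleD(2)[OF act])
qed

end

context highest_weight
begin

lemma verma_ideal_one: "x \<in> verma_ideal G lam \<Longrightarrow> act x one = 0"
  by (rule nondegenerate) (simp add: Lam_verma_ideal)

lemma V_span: "V = qs.span (range (\<lambda>w. act (fw w) one))"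
proof
  show "V \<subseteq> qs.span (range (\<lambda>w. act (fw w) one))"
  proof
    fix v assume "v \<in> V"
    then obtain x where x: "v = act x one" by (auto simp: V_def)
    obtain z where z: "z \<in> U_minus G" "x - z \<in> verma_ideal G lam" using verma_ideal_complement by blast
    have "v = act z one" using verma_ideal_one[OF z(2)] by (simp add: x act_simps)
    also have "\<dots> \<in> qs.span (range (\<lambda>w. act (fw w) one))"
      by (rule linear_span_mem[OF qbilinearD(2)[OF is_module_bilinear[OF act]] qs.subspace_span, of "range fw"])
        (use z(1) in \<open>auto simp: U_minus_eq intro: qs.span_base\<close>)
    finally show "v \<in> qs.span (range (\<lambda>w. act (fw w) one))" .
  qed
  show "qs.span (range (\<lambda>w. act (fw w) one)) \<subseteq> V"
    by (rule qs.span_minimal[OF _ V_subspace]) (auto simp: V_def)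
qed

lemma fw_one_weight: "act (fw w) one \<in> weight_space G act (lam - wt w)"
  by (rule weight_space_fw[OF act one_weight])

lemma V_weight:
  assumes "v \<in> V" "v \<in> weight_space G act m" "v \<noteq> 0"
  shows "\<exists>u. m = lam - wt u"
proof (rule ccontr)
  assume m: "\<nexists>u. m = lam - wt u"
  let ?S = "range (\<lambda>w. act (fw w) one)"
  have "v \<in> qs.span (?S \<inter> weight_space G act m)"
    using assms(1,2) fw_one_weight unfolding V_span by (intro graded_span[OF act]) blast+
  moreover have "?S \<inter> weight_space G act m \<subseteq> {0}"
    using m weight_unique[OF act fw_one_weight] by blast
  ultimately have "v \<in> qs.span {0}" using qs.span_mono by blast
  then show False using assms(3) by simp
qed

text \<open>A word longer than \<open>u\<close> would raise the weight lam - wt u to one that is not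
  of the form lam - wt u', as a comparison of lengths shows.\<close>

lemma e_nilpotent_V:
  assumes "v \<in> V"
  shows "\<exists>N. \<forall>w. length w \<ge> N \<longrightarrow> act (ew w) v = 0"
  using assms unfolding V_span
proof (induction rule: qs.span_induct_alt)
  case base
  show ?case by (simp add: act_simps)
next
  case (step c x y)
  then obtain N u where N: "\<forall>w. length w \<ge> N \<longrightarrow> act (ew w) y = 0" and u: "x = act (fw u) one" by blast
  have "act (ew w) x = 0" if "length w > length u" for w
  proof (rule ccontr)
    assume "act (ew w) x \<noteq> 0"
    moreover have "act (ew w) x \<in> V" "act (ew w) x \<in> weight_space G act (lam - wt u + wt w)"
      using act_V one_V weight_space_ew[OF act fw_one_weight] by (auto simp: u)
    ultimately obtain u' where "lam - wt u + wt w = lam - wt u'" using V_weight by blast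
    then have "wt (w @ u') = wt u" by (simp add: wt_append algebra_simps)
    then have "length (w @ u') = length u" by (rule wt_length)
    then show False using that by simp
  qed
  with N show ?case by (intro exI[of _ "max N (Suc (length u))"]) (simp add: act_simps)
qed

lemma singular_zero:
  assumes "v \<in> V" "\<And>i. act (e i) v = 0" "vst v = 0"
  shows "v = 0"
proof (rule coef_separates[OF assms(1)])
  fix w
  show "coef w v = 0"
    by (cases w) (simp_all add: coef_def act_1 assms om_mult om_f act_mult act_simps lin_simps[OF vst_linear])
qed

text \<open>If k is the coroot pairing of lam, then f_i^(k+1) applied to \<open>one\<close> is
  singular and invisible to \<open>vst\<close>, hence zero. The Serre relations carry nilpotency
  from \<open>one\<close> to all of \<open>V\<close>.\<close>

lemma f_nilpotent_V:
  assumes dom: "dominant_integral A lam" and "v \<in> V"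
  shows "\<exists>N. act (f i ^ N) v = 0"
proof -
  have "coroot_pairing A lam i \<in> \<nat>" using dom by (simp add: dominant_integral_def)
  then obtain k where k: "coroot_pairing A lam i = of_nat k" by (rule Nats_cases)
  have b: "B (simple_root i) lam = d i * of_nat k" by (simp add: coroot_pairing_sform[symmetric] k)
  \<comment> \<open>At n = k the second factor on the right of \<open>power_sum\<close> is the one
    for exponent 0.\<close>
  have "(qpow (d i) - qpow (- d i)) * (\<Sum>s\<le>k. qpow (B (simple_root i) lam - 2 * d i * of_nat s)
      - qpow (- (B (simple_root i) lam - 2 * d i * of_nat s))) = 0"
    unfolding power_sum b by simp
  then have s0: "(\<Sum>s\<le>k. qpow (B (simple_root i) lam - 2 * d i * of_nat s)
      - qpow (- (B (simple_root i) lam - 2 * d i * of_nat s))) = 0"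
    using mult_eq_0_iff nu_denominator[of i] by blast
  have "act (f i ^ Suc k) one = 0"
  proof (rule singular_zero)
    show "act (f i ^ Suc k) one \<in> V" by (rule act_V[OF one_V])
    show "vst (act (f i ^ Suc k) one) = 0" by (simp add: vst_one)
    show "act (e j) (act (f i ^ Suc k) one) = 0" for j
    proof (cases "i = j")
      case True
      then show ?thesis using e_f_power[OF act one_weight, of i k] unfolding s0 by (simp add: one_e act_simps)
    next
      case False
      then have "e j * f i = f i * e j" by (simp add: ef_commutator)
      then have "e j * f i ^ n = f i ^ n * e j" for n
        by (rule power_commuting_commutes[symmetric, OF sym])
      then have "act (e j) (act (f i ^ Suc k) one) = act (f i ^ Suc k) (act (e j) one)"
        by (simp only: act_mult[symmetric])
      then show ?thesis by (simp add: one_e act_simps)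
    qed
  qed
  then have one: "\<exists>N. act (f i ^ N) one = 0" by blast
  have base: "\<exists>N. act (f i ^ N) (act (fw w) one) = 0" for w
  proof (induction w)
    case (Cons j w)
    then obtain r where "act (f i ^ r) (act (fw w) one) = 0" by blast
    from f_nilpotent_f[OF act this, of j] show ?case by (simp add: act_mult)
  qed (use one in \<open>simp add: act_1\<close>)
  have mono: "act (f i ^ M) x = 0" if "act (f i ^ N) x = 0" "M \<ge> N" for M N x
  proof -
    have "f i ^ M = f i ^ (M - N) * f i ^ N" using that(2) by (simp add: power_add[symmetric])
    then show ?thesis using that(1) by (simp add: act_mult act_simps)
  qed
  have "v \<in> qs.span (range (\<lambda>w. act (fw w) one))" using assms(2) V_span by simp
  then show ?thesis
  proof (induction rule: qs.span_induct_alt)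
    case base
    show ?case by (simp add: act_simps)
  next
    case (step c x y)
    then obtain M N where "act (f i ^ M) x = 0" "act (f i ^ N) y = 0" using base by blast
    then have "act (f i ^ max M N) x = 0" "act (f i ^ max M N) y = 0" by (auto intro: mono)
    then show ?case by (intro exI[of _ "max M N"]) (simp add: act_simps)
  qed
qed

lemma coef_Cons: "coef (j # w) v = coef w (act (kk' j) (act (e j) v))"
  by (simp add: coef_def om_mult om_f act_mult)

text \<open>All coefficients \<open>coef w\<close> of the combination vanish, by induction on w:
  applying e_j gives combinations with coefficients again in the radical, by
  \<open>radical_strip\<close>, and \<open>vst\<close> sees only the coefficient of the empty word,
  which is 0 in the radical.\<close>

lemma radical_f_V:
  assumes "v \<in> V"
  shows "kills_radical (\<lambda>w. act (fw w) v)"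
proof -
  have *: "coef w (\<Sum>u\<in>words \<beta>. a u *\<^sub>q act (fw u) x) = 0"
    if "x \<in> V" "x \<in> weight_space G act m" "radical \<beta> a" for w x m \<beta> a
    using that
  proof (induction w arbitrary: x m \<beta> a)
    case Nil
    have "vst (act (fw u) x) = 0" if "u \<noteq> []" for u
      using that vst_f[OF act_V[OF Nil(1)]] by (cases u) (simp_all add: act_mult)
    then have "a u * vst (act (fw u) x) = 0" if "u \<in> words \<beta>" for u
      using that radical_0[of a] Nil(3) by (cases "u = []") (auto simp: words_def)
    then have "(\<Sum>u\<in>words \<beta>. a u * vst (act (fw u) x)) = 0" by (rule sum.neutral[OF ballI])
    then show ?case by (simp add: coef_def act_1 lin_simps[OF vst_linear])
  next
    case (Cons j w)
    define \<gamma> where "\<gamma> = \<beta> - simple_root j"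
    have \<beta>: "\<beta> = \<gamma> + simple_root j" by (simp add: \<gamma>_def)
    let ?W = "words (\<gamma> + simple_root j)" and ?U = "words \<gamma>"
    define R R' where "R = lcoef j" and "R' = rcoef j"
    define a1 a2 where "a1 u = (\<Sum>w\<in>?W. a w * R w u)" and "a2 u = (\<Sum>w\<in>?W. a w * R' w u)" for u
    define c1 c2 where "c1 = nu j * qpow (B (simple_root j) (m - \<gamma>))" and "c2 = nu j * qpow (- B (simple_root j) m)"
    let ?x = "act (e j) x"
    have x': "?x \<in> V" "?x \<in> weight_space G act (m + simple_root j)"
      using act_V[OF Cons.prems(1)] weight_space_e[OF act Cons.prems(2)] by auto
    have rad: "radical (\<gamma> + simple_root j) a" using Cons.prems(3) by (simp add: \<beta>)
    have rad': "radical \<gamma> a1" "radical \<gamma> a2" using radical_strip[OF rad] by (simp_all add: a1_def[abs_def] a2_def[abs_def] R_def R'_def)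
    let ?Z = "\<lambda>\<beta> a x. \<Sum>u\<in>words \<beta>. a u *\<^sub>q act (fw u) x"
    have "act (e j) (?Z (\<gamma> + simple_root j) a x) = (\<Sum>w\<in>?W. a w *\<^sub>q (act (fw w) ?x
        + c1 *\<^sub>q (\<Sum>u\<in>?U. R w u *\<^sub>q act (fw u) x) - c2 *\<^sub>q (\<Sum>u\<in>?U. R' w u *\<^sub>q act (fw u) x)))"
      unfolding act_simps using e_fw_act[OF act Cons.prems(2)]
      by (intro sum.cong refl) (simp add: c1_def c2_def R_def R'_def)
    also have "\<dots> = ?Z (\<gamma> + simple_root j) a ?x + c1 *\<^sub>q ?Z \<gamma> a1 x - c2 *\<^sub>q ?Z \<gamma> a2 x"
      unfolding a1_def a2_def radical_sum[symmetric] qs.scale_sum_right[of c1] qs.scale_sum_right[of c2]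
      by (simp add: qs.scale_right_distrib qs.scale_right_diff_distrib sum.distrib sum_subtractf qs.scale_left_commute qs.scale_sum_right mult_ac)
    finally have e: "act (e j) (?Z (\<gamma> + simple_root j) a x) = ?Z (\<gamma> + simple_root j) a ?x + c1 *\<^sub>q ?Z \<gamma> a1 x - c2 *\<^sub>q ?Z \<gamma> a2 x" .
    have "act (fw u) x \<in> weight_space G act (m - (\<gamma> + simple_root j))" if "u \<in> ?W" for u
      using weight_space_fw[OF act Cons.prems(2), of u] that by (simp add: words_def)
    then have "?Z (\<gamma> + simple_root j) a x \<in> weight_space G act (m - (\<gamma> + simple_root j))"
      by (intro qs.subspace_sum qs.subspace_scale weight_space_subspace act)
    from weight_space_e[OF act this, of j] have "act (kk' j) (act (e j) (?Z (\<gamma> + simple_root j) a x))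
        = qpow (- B (simple_root j) (m - \<gamma>)) *\<^sub>q act (e j) (?Z (\<gamma> + simple_root j) a x)"
      by (intro weight_space_kk) (simp add: algebra_simps)
    then have "coef (j # w) (?Z (\<gamma> + simple_root j) a x)
        = qpow (- B (simple_root j) (m - \<gamma>)) * coef w (act (e j) (?Z (\<gamma> + simple_root j) a x))"
      unfolding coef_Cons by (simp only: lin_simps[OF coef_linear])
    also have "\<dots> = 0"
      unfolding e
      using Cons.IH[OF x' rad] Cons.IH[OF Cons.prems(1,2) rad'(1)] Cons.IH[OF Cons.prems(1,2) rad'(2)]
      by (simp add: lin_simps[OF coef_linear])
    finally show ?case by (simp add: \<beta>)
  qed
  show ?thesis unfolding kills_radical_def
  proof (intro allI impI)
    fix \<beta> a assume rad: "radical \<beta> a"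
    have "(\<Sum>u\<in>words \<beta>. a u *\<^sub>q act (fw u) v) \<in> {0}"
    proof (rule linear_span_mem[of "\<lambda>v. \<Sum>u\<in>words \<beta>. a u *\<^sub>q act (fw u) v"])
      show "v \<in> qs.span (range (\<lambda>w. act (fw w) one))" using assms V_span by simp
      show "qlinear (\<lambda>v. \<Sum>u\<in>words \<beta>. a u *\<^sub>q act (fw u) v)"
        by (intro qlinearI) (simp_all add: act_simps qs.scale_right_distrib sum.distrib qs.scale_sum_right mult.commute)
      fix x assume "x \<in> range (\<lambda>w. act (fw w) one)"
      then obtain w where x: "x = act (fw w) one" by blast
      have xV: "x \<in> V" unfolding x by (rule act_V[OF one_V])
      have "(\<Sum>u\<in>words \<beta>. a u *\<^sub>q act (fw u) x) = 0"
      proof (rule coef_separates)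
        show "(\<Sum>u\<in>words \<beta>. a u *\<^sub>q act (fw u) x) \<in> V"
          by (intro qs.subspace_sum[OF V_subspace] qs.subspace_scale[OF V_subspace] act_V xV)
        show "coef w (\<Sum>u\<in>words \<beta>. a u *\<^sub>q act (fw u) x) = 0" for w
          by (rule *[OF xV _ rad]) (unfold x, rule fw_one_weight)
      qed
      then show "(\<Sum>u\<in>words \<beta>. a u *\<^sub>q act (fw u) x) \<in> {0}" by simp
    qed (simp add: qs.subspace_def)
    then show "(\<Sum>u\<in>words \<beta>. a u *\<^sub>q act (fw u) v) = 0" by simp
  qed
qed

text \<open>On \<open>one\<close> only the empty word acts, and its coefficient is 0. Moving a
  further f_j to the left changes the coefficients by derivations, which preserve the
  radical.\<close>

lemma radical_e_V:
  assumes "v \<in> V"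
  shows "kills_radical (\<lambda>w. act (ew w) v)"
proof -
  let ?Z = "\<lambda>\<beta> a x. \<Sum>u\<in>words \<beta>. a u *\<^sub>q act (ew u) x"
  have *: "?Z \<beta> a (act (fw w) one) = 0" if "radical \<beta> a" for w \<beta> a
    using that
  proof (induction w arbitrary: \<beta> a)
    case Nil
    have "act (ew u) one = 0" if "u \<noteq> []" for u
      using that by (cases u rule: rev_cases) (simp_all add: ew_append act_mult one_e act_simps)
    then have "a u *\<^sub>q act (ew u) one = 0" if "u \<in> words \<beta>" for u
      using that radical_0[of a] Nil by (cases "u = []") (auto simp: words_def)
    then have "?Z \<beta> a one = 0" by (rule sum.neutral[OF ballI])
    then show ?case by (simp add: act_1)
  next
    case (Cons j w)
    define \<gamma> where "\<gamma> = \<beta> - simple_root j"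
    have \<beta>: "\<beta> = \<gamma> + simple_root j" by (simp add: \<gamma>_def)
    let ?W = "words (\<gamma> + simple_root j)" and ?U = "words \<gamma>" and ?x = "act (fw w) one"
    define R R' where "R = lcoef j" and "R' = rcoef j"
    define a1 a2 where "a1 u = (\<Sum>w\<in>?W. a w * R w u)" and "a2 u = (\<Sum>w\<in>?W. a w * R' w u)" for u
    let ?m = "lam - wt w"
    define c1 c2 where "c1 = nu j * qpow (- B (simple_root j) (?m + \<gamma>))" and "c2 = nu j * qpow (B (simple_root j) ?m)"
    have rad: "radical (\<gamma> + simple_root j) a" using Cons.prems by (simp add: \<beta>)
    have rad': "radical \<gamma> a1" "radical \<gamma> a2" using radical_strip[OF rad] by (simp_all add: a1_def[abs_def] a2_def[abs_def] R_def R'_def)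
    have "?Z (\<gamma> + simple_root j) a (act (f j) ?x) = (\<Sum>w\<in>?W. a w *\<^sub>q (act (f j) (act (ew w) ?x)
        + c2 *\<^sub>q (\<Sum>u\<in>?U. R' w u *\<^sub>q act (ew u) ?x) - c1 *\<^sub>q (\<Sum>u\<in>?U. R w u *\<^sub>q act (ew u) ?x)))"
      using ew_f_act[OF act fw_one_weight]
      by (intro sum.cong refl) (simp add: c1_def c2_def R_def R'_def)
    also have "\<dots> = act (f j) (?Z (\<gamma> + simple_root j) a ?x) + c2 *\<^sub>q ?Z \<gamma> a2 ?x - c1 *\<^sub>q ?Z \<gamma> a1 ?x"
      unfolding a1_def a2_def radical_sum[symmetric] qs.scale_sum_right[of c1] qs.scale_sum_right[of c2]
      by (simp add: act_simps qs.scale_right_distrib qs.scale_right_diff_distrib sum.distrib sum_subtractf qs.scale_left_commute qs.scale_sum_right mult_ac)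
    finally show ?case
      using Cons.IH[OF rad] Cons.IH[OF rad'(1)] Cons.IH[OF rad'(2)] by (simp add: \<beta> act_mult act_simps)
  qed
  show ?thesis unfolding kills_radical_def
  proof (intro allI impI)
    fix \<beta> a assume rad: "radical \<beta> a"
    have "?Z \<beta> a v \<in> {0}"
    proof (rule linear_span_mem[of "?Z \<beta> a"])
      show "v \<in> qs.span (range (\<lambda>w. act (fw w) one))" using assms V_span by simp
      show "qlinear (?Z \<beta> a)"
        by (intro qlinearI) (simp_all add: act_simps qs.scale_right_distrib sum.distrib qs.scale_sum_right mult.commute)
    qed (use *[OF rad] in \<open>auto simp: qs.subspace_def\<close>)
    then show "?Z \<beta> a v = 0" by simp
  qed
qed

end

section \<open>The algebra of regular functions\<close>

context qea
begin

abbreviation "FF \<equiv> regular_functions G"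
abbreviation "hw m \<equiv> Dual (Lam m)"

lemma eval_hw: "eval_dual (hw m) x = Lam m x"
  by (simp add: eval_Dual Lam_linear)

text \<open>\<open>Lam m\<close>, as an element of the dual, generates a copy of L(m) under the left
  regular action, because its annihilator is the largest left ideal in its kernel; evaluation at 1
  reads off the highest weight coefficient. Every L(m) is thus present in a single type.\<close>

lemma highest_weight_dual: "highest_weight G m left_regular (hw m) (\<lambda>c. eval_dual c 1)"
  by unfold_locales
    (auto simp: left_regular_module eval_left_regular eval_hw dual_rep algebra_simps intro!: dual_eqI)

lemmas lr_simps = module_simps[OF left_regular_module]
lemmas lr_1 = is_moduleD(1)[OF left_regular_module]
lemmas lr_mult = is_moduleD(2)[OF left_regular_module]

lemma left_regular_hw_zero: "left_regular z (hw m) = 0 \<longleftrightarrow> z \<in> L_ideal G m"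
proof -
  have "Lam m (x * z) = eval_dual (left_regular z (hw m)) x" for x by (simp add: eval_left_regular eval_hw)
  then show ?thesis unfolding L_ideal_iff by (auto simp: dual_rep intro: dual_eqI)
qed

lemma L_ideal_mult: "z \<in> L_ideal G m \<Longrightarrow> x * z \<in> L_ideal G m"
  by (simp add: L_ideal_iff flip: mult.assoc)

lemma verma_ideal_L_ideal: "z \<in> verma_ideal G m \<Longrightarrow> z \<in> L_ideal G m"
  by (simp add: L_ideal_iff Lam_verma_ideal)

lemma matrix_elements_eq:
  "matrix_elements G m = {left_regular y g | y g. \<forall>z\<in>L_ideal G m. eval_dual g z = 0}"
proof -
  have "(\<forall>x. eval_dual c x = eval_dual g (x * y)) \<longleftrightarrow> c = left_regular y g" for c g :: "'u dual" and y
    by (auto simp: eval_left_regular intro: dual_eqI)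
  then show ?thesis unfolding matrix_elements_def by auto
qed

text \<open>A functional vanishing on the ideal of L(m) is annihilated by that ideal, which is the
  annihilator of \<open>hw m\<close>. Relations proved for \<open>hw m\<close> therefore hold for
  all matrix elements of L(m).\<close>

lemma left_regular_transfer:
  assumes "left_regular z (hw m) = 0" "\<forall>z\<in>L_ideal G m. eval_dual g z = 0"
  shows "left_regular z g = 0"
  by (rule dual_eqI)
    (use assms L_ideal_mult in \<open>auto simp: eval_left_regular dual_rep left_regular_hw_zero\<close>)

lemma FF_subspace: "qs.subspace FF"
  by (simp add: regular_functions_def)

lemma matrix_element_FF:
  assumes "dominant_integral A m" "\<forall>z\<in>L_ideal G m. eval_dual g z = 0"
  shows "left_regular y g \<in> FF"
  unfolding regular_functions_def matrix_elements_eq by (rule qs.span_base) (use assms in blast)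

lemma FF_induct [consumes 1, case_names zero add base]:
  assumes "p \<in> FF" "P 0" "\<And>c x y. P x \<Longrightarrow> P y \<Longrightarrow> P (c *\<^sub>q x + y)"
    and "\<And>m y g. dominant_integral A m \<Longrightarrow> \<forall>z\<in>L_ideal G m. eval_dual g z = 0 \<Longrightarrow> P (left_regular y g)"
  shows "P p"
  using assms(1) unfolding regular_functions_def matrix_elements_eq
  by (induction rule: qs.span_induct_alt) (use assms(2-4) in auto)

lemma FF_closed: "p \<in> FF \<Longrightarrow> left_regular x p \<in> FF"
proof (induction rule: FF_induct)
  case (base m y g)
  then show ?case using matrix_element_FF[of m g "x * y"] by (simp add: lr_mult)
qed (simp_all add: lr_simps qs.subspace_0[OF FF_subspace] qs.subspace_add[OF FF_subspace] qs.subspace_scale[OF FF_subspace])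

lemma FF_weights: "FF \<subseteq> qs.span (\<Union>m. FF \<inter> weight_space G left_regular m)"
proof
  fix p assume "p \<in> FF"
  then show "p \<in> qs.span (\<Union>m. FF \<inter> weight_space G left_regular m)" (is "_ \<in> ?S")
  proof (induction rule: FF_induct)
    case (base m y g)
    obtain z where z: "z \<in> U_minus G" "y - z \<in> verma_ideal G m" using verma_ideal_complement by blast
    have "left_regular (y - z) (hw m) = 0" using verma_ideal_L_ideal[OF z(2)] by (simp add: left_regular_hw_zero)
    from left_regular_transfer[OF this base(2)] have "left_regular y g = left_regular z g" by (simp add: lr_simps)
    also have "\<dots> \<in> ?S"
    proof (rule linear_span_mem[OF qbilinearD(2)[OF is_module_bilinear[OF left_regular_module]] qs.subspace_span])
      show "z \<in> qs.span (range fw)" using z(1) by (simp add: U_minus_eq)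
      have "left_regular (tm n - qpow (tv m n) *\<^sub>q 1) (hw m) = 0" for n
        using highest_weight.one_tm[OF highest_weight_dual[of m], of n] by (simp add: lr_simps lr_1)
      from left_regular_transfer[OF this base(2)] have "g \<in> weight_space G left_regular m"
        by (auto simp: weight_space_def lr_simps lr_1 elim!: torusE)
      then show "left_regular x g \<in> ?S" if "x \<in> range fw" for x
        using that weight_space_fw[OF left_regular_module] matrix_element_FF[OF base]
        by (intro qs.span_base) blast
    qed
    finally show ?case .
  qed (simp_all add: qs.span_zero qs.span_add qs.span_scale)
qed

lemma FF_e_nilpotent: "p \<in> FF \<Longrightarrow> \<exists>N. \<forall>w. length w \<ge> N \<longrightarrow> left_regular (ew w) p = 0"
proof (induction rule: FF_induct)
  case (add c x y)
  then obtain M N where "\<forall>w. length w \<ge> M \<longrightarrow> left_regular (ew w) x = 0" "\<forall>w. length w \<ge> N \<longrightarrow> left_regular (ew w) y = 0"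
    by blast
  then show ?case by (intro exI[of _ "max M N"]) (simp add: lr_simps)
next
  case (base m y g)
  interpret highest_weight G m left_regular "hw m" "\<lambda>c. eval_dual c 1" by (rule highest_weight_dual)
  obtain N where "\<forall>w. length w \<ge> N \<longrightarrow> left_regular (ew w) (left_regular y (hw m)) = 0"
    using e_nilpotent_V[OF act_V[OF one_V]] by blast
  then have "left_regular (ew w * y) g = 0" if "length w \<ge> N" for w
    using that by (intro left_regular_transfer[OF _ base(2)]) (simp add: lr_mult)
  then show ?case by (auto simp: lr_mult)
qed (simp add: lr_simps)

lemma power_kills_mono:
  assumes "is_module act" "act (x ^ N) v = 0" "N \<le> M"
  shows "act (x ^ M) v = 0"
proof -
  have "x ^ M = x ^ (M - N) * x ^ N" using assms(3) by (simp add: power_add[symmetric])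
  then show ?thesis
    using assms(2) by (simp add: is_moduleD(2)[OF assms(1)] module_simps[OF assms(1)])
qed

lemma FF_f_nilpotent: "p \<in> FF \<Longrightarrow> \<exists>N. left_regular (f_gen G i ^ N) p = 0"
proof (induction rule: FF_induct)
  case (add c x y)
  then obtain M N where "left_regular (f_gen G i ^ M) x = 0" "left_regular (f_gen G i ^ N) y = 0" by blast
  then have "left_regular (f_gen G i ^ max M N) x = 0" "left_regular (f_gen G i ^ max M N) y = 0"
    by (auto intro: power_kills_mono[OF left_regular_module])
  then show ?case by (intro exI[of _ "max M N"]) (simp add: lr_simps)
next
  case (base m y g)
  interpret highest_weight G m left_regular "hw m" "\<lambda>c. eval_dual c 1" by (rule highest_weight_dual)
  obtain N where "left_regular (f_gen G i ^ N) (left_regular y (hw m)) = 0"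
    using f_nilpotent_V[OF base(1) act_V[OF one_V]] by blast
  then have "left_regular (f_gen G i ^ N * y) g = 0"
    by (intro left_regular_transfer[OF _ base(2)]) (simp add: lr_mult)
  then show ?case by (auto simp: lr_mult)
qed (simp add: lr_simps)

lemma kills_radical_transfer:
  assumes "kills_radical (\<lambda>w. left_regular (x w) (left_regular y (hw m)))" "\<forall>z\<in>L_ideal G m. eval_dual g z = 0"
  shows "kills_radical (\<lambda>w. left_regular (x w) (left_regular y g))"
  unfolding kills_radical_def
proof (intro allI impI)
  fix \<beta> a assume "radical \<beta> a"
  then have "left_regular (\<Sum>w\<in>words \<beta>. a w *\<^sub>q (x w * y)) (hw m) = 0"
    using assms(1) by (simp add: kills_radical_def lr_simps lr_mult)
  from left_regular_transfer[OF this assms(2)] show "(\<Sum>w\<in>words \<beta>. a w *\<^sub>q left_regular (x w) (left_regular y g)) = 0"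
    by (simp add: lr_simps lr_mult)
qed

lemma kills_radical_add:
  assumes "kills_radical \<phi>" "kills_radical \<psi>"
  shows "kills_radical (\<lambda>w. c *\<^sub>q \<phi> w + \<psi> w)"
proof -
  have "(\<Sum>w\<in>words \<beta>. a w *\<^sub>q (c *\<^sub>q \<phi> w + \<psi> w)) = c *\<^sub>q (\<Sum>w\<in>words \<beta>. a w *\<^sub>q \<phi> w) + (\<Sum>w\<in>words \<beta>. a w *\<^sub>q \<psi> w)" for \<beta> a
    by (simp add: qs.scale_right_distrib sum.distrib qs.scale_sum_right mult.commute)
  then show ?thesis using assms unfolding kills_radical_def by simp
qed

lemma kills_radical_zero: "kills_radical (\<lambda>w. 0)"
  by (simp add: kills_radical_def)

lemma FF_radical:
  assumes "p \<in> FF"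
  shows "kills_radical (\<lambda>w. left_regular (fw w) p)" "kills_radical (\<lambda>w. left_regular (ew w) p)"
proof -
  have "kills_radical (\<lambda>w. left_regular (fw w) p) \<and> kills_radical (\<lambda>w. left_regular (ew w) p)"
    using assms
  proof (induction rule: FF_induct)
    case (base m y g)
    interpret highest_weight G m left_regular "hw m" "\<lambda>c. eval_dual c 1" by (rule highest_weight_dual)
    show ?case
      using kills_radical_transfer[OF radical_f_V[OF act_V[OF one_V]] base(2)]
        kills_radical_transfer[OF radical_e_V[OF act_V[OF one_V]] base(2)] by blast
  qed (simp_all add: lr_simps kills_radical_zero kills_radical_add)
  then show "kills_radical (\<lambda>w. left_regular (fw w) p)" "kills_radical (\<lambda>w. left_regular (ew w) p)" by blast+
qed

section \<open>Products of functions\<close>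

definition pairing :: "'u dual \<Rightarrow> 'u dual \<Rightarrow> ('u, 'u) tensor \<Rightarrow> qfield" where
  "pairing p g = tensor_ext (*) (\<lambda>a b. eval_dual p a * eval_dual g b)"

lemma pairing:
  shows pairing_linear: "qfunctional (pairing p g)" and pairing_pure: "pairing p g (a \<otimes>\<^sub>q b) = eval_dual p a * eval_dual g b"
  unfolding pairing_def by (rule tensor_ext; intro qfunctionalI; simp add: eval_dual_simps algebra_simps)+

lemma eval_dual_times: "eval_dual (dual_times G p g) x = pairing p g (coproduct G x)"
  unfolding dual_times_def pairing_def[symmetric]
  by (rule eval_Dual, intro qfunctionalI) (simp_all add: lin_simps[OF pairing_linear] lin_simps[OF coproduct_linear])

lemma dual_times_bilinear: "qbilinear (dual_times G)"
proof -
  have add: "pairing (p + p') g s = pairing p g s + pairing p' g s" "pairing p (g + g') s = pairing p g s + pairing p g' s"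
    and scale: "pairing (c *\<^sub>q p) g s = c * pairing p g s" "pairing p (c *\<^sub>q g) s = c * pairing p g s" for p p' g g' c s
  proof -
    have L: "qfunctional (\<lambda>s. pairing p g s + pairing p' g' s)" "qfunctional (\<lambda>s. c * pairing p g s)" for p g p' g' c
      by (intro qfunctionalI; simp add: lin_simps[OF pairing_linear] algebra_simps)+
    show "pairing (p + p') g s = pairing p g s + pairing p' g s"
      by (rule linear_tensor_eq[OF pairing_linear L(1)]) (simp add: pairing_pure dual_rep algebra_simps)
    show "pairing p (g + g') s = pairing p g s + pairing p g' s"
      by (rule linear_tensor_eq[OF pairing_linear L(1)]) (simp add: pairing_pure dual_rep algebra_simps)
    show "pairing (c *\<^sub>q p) g s = c * pairing p g s"
      by (rule linear_tensor_eq[OF pairing_linear L(2)]) (simp add: pairing_pure dual_rep algebra_simps)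
    show "pairing p (c *\<^sub>q g) s = c * pairing p g s"
      by (rule linear_tensor_eq[OF pairing_linear L(2)]) (simp add: pairing_pure dual_rep algebra_simps)
  qed
  show ?thesis unfolding qbilinear_def
    by (intro allI conjI qlinearI dual_eqI) (simp_all add: eval_dual_times dual_rep add scale)
qed

lemmas dual_times_simps = qbilinear_simps[OF dual_times_bilinear]

lemma pairing_mult: "pairing p g (s * (a \<otimes>\<^sub>q b)) = pairing (left_regular a p) (left_regular b g) s"
proof (rule linear_tensor_eq[of "(*)" "\<lambda>s. pairing p g (s * (a \<otimes>\<^sub>q b))"])
  show "qfunctional (\<lambda>s. pairing p g (s * (a \<otimes>\<^sub>q b)))"
    by (intro qfunctionalI) (simp_all add: distrib_right scaleq_mult_left lin_simps[OF pairing_linear])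
qed (simp_all add: pairing_linear pairing_pure eval_left_regular)

lemma
  shows lr_t_times: "left_regular (t i) (dual_times G p g) = dual_times G (left_regular (t i) p) (left_regular (t i) g)"
    and lr_t'_times: "left_regular (t' i) (dual_times G p g) = dual_times G (left_regular (t' i) p) (left_regular (t' i) g)"
    and lr_e_times: "left_regular (e i) (dual_times G p g)
      = dual_times G (left_regular (e i) p) g + dual_times G (left_regular (kk i) p) (left_regular (e i) g)"
    and lr_f_times: "left_regular (f_gen G i) (dual_times G p g)
      = dual_times G (left_regular (f_gen G i) p) (left_regular (kk' i) g) + dual_times G p (left_regular (f_gen G i) g)"
  by (intro dual_eqI; simp add: eval_left_regular eval_dual_times dual_rep coproduct_mult coproduct_t coproduct_t' coproduct_e
      coproduct_f distrib_left lin_simps[OF pairing_linear] pairing_mult lr_1)+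

text \<open>When a letter acts on the second factor, \<open>kk i\<close> acts on the first, where
  the subword u has already raised the weight n; this is the coefficient of
  \<open>shuf\<close>.\<close>

lemma ew_times:
  assumes "p \<in> weight_space G left_regular n"
  shows "left_regular (ew w) (dual_times G p g)
    = shuf (\<lambda>i u. qpow (B (simple_root i) (n + wt u))) w (\<lambda>u v. dual_times G (left_regular (ew u) p) (left_regular (ew v) g))"
proof (induction w)
  case (Cons i w)
  have lin: "qlinear (left_regular (e i))" by (rule qbilinearD(1)[OF is_module_bilinear[OF left_regular_module]])
  have k: "left_regular (kk i) (left_regular (ew u) p) = qpow (B (simple_root i) (n + wt u)) *\<^sub>q left_regular (ew u) p" for u
    by (rule weight_space_kk(1)[OF weight_space_ew[OF left_regular_module assms]])
  show ?case
    by (simp add: lr_mult Cons.IH shuf_linear[OF lin] lr_e_times k dual_times_simps)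
qed (simp add: lr_1)

text \<open>Here \<open>kk' i\<close> acts on the second factor when a letter goes to the first, so
  the subwords change roles and the weight enters as - n.\<close>

lemma fw_times:
  assumes "g \<in> weight_space G left_regular n"
  shows "left_regular (fw w) (dual_times G p g)
    = shuf (\<lambda>i u. qpow (B (simple_root i) (- n + wt u))) w (\<lambda>u v. dual_times G (left_regular (fw v) p) (left_regular (fw u) g))"
proof (induction w)
  case (Cons i w)
  have lin: "qlinear (left_regular (f_gen G i))" by (rule qbilinearD(1)[OF is_module_bilinear[OF left_regular_module]])
  have "left_regular (kk' i) (left_regular (fw u) g) = qpow (- B (simple_root i) (n - wt u)) *\<^sub>q left_regular (fw u) g" for u
    by (rule weight_space_kk(2)[OF weight_space_fw[OF left_regular_module assms]])
  then have k: "left_regular (kk' i) (left_regular (fw u) g) = qpow (B (simple_root i) (- n + wt u)) *\<^sub>q left_regular (fw u) g" for u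
    by (simp add: sform_simps)
  show ?case
    by (simp add: lr_mult Cons.IH shuf_linear[OF lin] lr_f_times k dual_times_simps add.commute)
qed (simp add: lr_1)

text \<open>The module to which complete reducibility is applied. Its generators are general
  products; the word formulas need homogeneous factors, and these span it as well.\<close>

definition products :: "'u dual set" where "products = qs.span {dual_times G p g | p g. p \<in> FF \<and> g \<in> FF}"

lemma products_span:
  "products = qs.span {dual_times G p g | p g m n. p \<in> FF \<inter> weight_space G left_regular m \<and> g \<in> FF \<inter> weight_space G left_regular n}"
  (is "_ = qs.span ?S")
proof
  have "dual_times G p g \<in> qs.span ?S" if "p \<in> FF" "g \<in> FF" for p g
  proof (rule linear_span_mem[OF qbilinearD(2)[OF dual_times_bilinear] qs.subspace_span _ subsetD[OF FF_weights that(1)]])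
    fix p assume p: "p \<in> (\<Union>m. FF \<inter> weight_space G left_regular m)"
    show "dual_times G p g \<in> qs.span ?S"
      by (rule linear_span_mem[OF qbilinearD(1)[OF dual_times_bilinear] qs.subspace_span _ subsetD[OF FF_weights that(2)]])
        (use p in \<open>blast intro: qs.span_base\<close>)
  qed
  then show "products \<subseteq> qs.span ?S" unfolding products_def by (intro qs.span_minimal qs.subspace_span) blast
  show "qs.span ?S \<subseteq> products" unfolding products_def by (rule qs.span_mono) blast
qed

lemma products_subspace: "qs.subspace products"
  by (simp add: products_def)

lemma products_induct [consumes 1, case_names zero add base]:
  assumes "x \<in> products" "P 0" "\<And>c x y. P x \<Longrightarrow> P y \<Longrightarrow> P (c *\<^sub>q x + y)"
    and "\<And>p g m n. p \<in> FF \<Longrightarrow> g \<in> FF \<Longrightarrow> p \<in> weight_space G left_regular m \<Longrightarrow> g \<in> weight_space G left_regular n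
      \<Longrightarrow> P (dual_times G p g)"
  shows "P x"
  using assms(1) unfolding products_span
  by (induction rule: qs.span_induct_alt) (use assms(2-4) in auto)

lemma products_closed:
  assumes "x \<in> products"
  shows "left_regular u x \<in> products"
proof -
  have lin: "qlinear (left_regular u)" for u :: 'u by (rule qbilinearD(1)[OF is_module_bilinear[OF left_regular_module]])
  have gen: "left_regular u x \<in> products" if "x \<in> products" "\<And>p g. p \<in> FF \<Longrightarrow> g \<in> FF \<Longrightarrow> left_regular u (dual_times G p g) \<in> products" for u x
    by (rule linear_span_mem[OF lin products_subspace _ that(1)[unfolded products_def]]) (use that(2) in blast)
  have base: "dual_times G p g \<in> products" if "p \<in> FF" "g \<in> FF" for p g
    unfolding products_def by (rule qs.span_base) (use that in blast)
  have gens: "left_regular (t i) x \<in> products" "left_regular (t' i) x \<in> products" "left_regular (e i) x \<in> products"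
    "left_regular (f_gen G i) x \<in> products" if "x \<in> products" for i x
    by (rule gen[OF that]; simp only: lr_t_times lr_t'_times lr_e_times lr_f_times;
      intro qs.subspace_add[OF products_subspace] base FF_closed; assumption)+
  have "u \<in> {u. \<forall>x\<in>products. left_regular u x \<in> products}"
  proof (rule left_closed)
    show "qs.subspace {u. \<forall>x\<in>products. left_regular u x \<in> products}"
      unfolding qs.subspace_def
      by (auto simp: lr_simps qs.subspace_0[OF products_subspace] qs.subspace_add[OF products_subspace] qs.subspace_scale[OF products_subspace])
  qed (simp_all add: lr_1 lr_mult gens)
  with assms show ?thesis by blast
qed

lemma shuf_zero:
  assumes "\<And>u v. length u + length v = length w \<Longrightarrow> set u \<union> set v \<subseteq> set w \<Longrightarrow> h u v = 0"
  shows "shuf b w h = 0"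
proof -
  have "{h u v | u v. length u + length v = length w \<and> set u \<union> set v \<subseteq> set w} \<subseteq> {0}" using assms by blast
  then have "shuf b w h \<in> qs.span {0}" using shuf_span[of b w h] qs.span_mono by blast
  then show ?thesis by simp
qed

lemma fw_replicate: "fw (replicate n i) = f_gen G i ^ n"
  by (induction n) simp_all

text \<open>Each condition is inherited from the factors through \<open>shuf\<close>: a long word
  places a long subword on one of the factors, and the condition on the radical passes by
  \<open>kills_radical_shuf\<close>.\<close>

lemma products_integrable: "integrable G left_regular products"
proof (unfold_locales)
  show "is_module left_regular" by (rule left_regular_module)
  show "qs.subspace products" by (rule products_subspace)
  show "left_regular u x \<in> products" if "x \<in> products" for x u using that by (rule products_closed)
  show "products \<subseteq> qs.span (\<Union>m. products \<inter> weight_space G left_regular m)"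
  proof -
    have *: "dual_times G p g \<in> (\<Union>m. products \<inter> weight_space G left_regular m)"
      if "p \<in> FF \<inter> weight_space G left_regular m" "g \<in> FF \<inter> weight_space G left_regular n" for p g m n
    proof -
      have "dual_times G p g \<in> products" unfolding products_def by (rule qs.span_base) (use that in blast)
      moreover have "dual_times G p g \<in> weight_space G left_regular (m + n)"
        using that by (auto simp: weight_space_iff[OF left_regular_module] lr_t_times dual_times_simps scaleq_scaleq
            qpow_add[symmetric] algebra_simps)
      ultimately show ?thesis by blast
    qed
    show ?thesis
    proof
      fix x assume "x \<in> products"
      then show "x \<in> qs.span (\<Union>m. products \<inter> weight_space G left_regular m)"
      proof (induction rule: products_induct)
        case (base p g m n)
        then show ?case by (intro qs.span_base *) blast+
      qed (simp_all add: qs.span_zero qs.span_add qs.span_scale)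
    qed
  qed
  show "\<exists>N. \<forall>w. N \<le> length w \<longrightarrow> left_regular (ew w) x = 0" if "x \<in> products" for x
    using that
  proof (induction rule: products_induct)
    case (add c x y)
    then obtain M N where "\<forall>w. length w \<ge> M \<longrightarrow> left_regular (ew w) x = 0" "\<forall>w. length w \<ge> N \<longrightarrow> left_regular (ew w) y = 0"
      by blast
    then show ?case by (intro exI[of _ "max M N"]) (simp add: lr_simps)
  next
    case (base p g m n)
    obtain M N where MN: "\<forall>w. length w \<ge> M \<longrightarrow> left_regular (ew w) p = 0" "\<forall>w. length w \<ge> N \<longrightarrow> left_regular (ew w) g = 0"
      using FF_e_nilpotent base by metis
    have "left_regular (ew w) (dual_times G p g) = 0" if "length w \<ge> M + N" for w
      unfolding ew_times[OF base(3)]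
    proof (rule shuf_zero)
      fix u v :: "'r list" assume "length u + length v = length w"
      then have "length u \<ge> M \<or> length v \<ge> N" using that by linarith
      then show "dual_times G (left_regular (ew u) p) (left_regular (ew v) g) = 0" using MN by (auto simp: dual_times_simps)
    qed
    then show ?case by blast
  qed (simp add: lr_simps)
  show "\<exists>N. left_regular (f_gen G i ^ N) x = 0" if "x \<in> products" for x i
    using that
  proof (induction rule: products_induct)
    case (add c x y)
    then obtain M N where "left_regular (f_gen G i ^ M) x = 0" "left_regular (f_gen G i ^ N) y = 0" by blast
    then have "left_regular (f_gen G i ^ max M N) x = 0" "left_regular (f_gen G i ^ max M N) y = 0"
      by (auto intro: power_kills_mono[OF left_regular_module])
    then show ?case by (intro exI[of _ "max M N"]) (simp add: lr_simps)
  next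
    case (base p g m n)
    obtain M N where MN: "left_regular (f_gen G i ^ M) p = 0" "left_regular (f_gen G i ^ N) g = 0"
      using FF_f_nilpotent base by metis
    \<comment> \<open>The power of f_i is a word with equal letters, so all subwords are powers of
      f_i too and nilpotency on one factor suffices.\<close>
    have "left_regular (fw (replicate (M + N) i)) (dual_times G p g) = 0"
      unfolding fw_times[OF base(4)]
    proof (rule shuf_zero)
      fix u v assume uv: "length u + length v = length (replicate (M + N) i)" "set u \<union> set v \<subseteq> set (replicate (M + N) i)"
      then have "set u \<subseteq> {i}" "set v \<subseteq> {i}" by (auto split: if_splits)
      then have "u = replicate (length u) i" "v = replicate (length v) i" by (simp_all add: replicate_length_same[symmetric] subset_iff)
      then have *: "fw u = f_gen G i ^ length u" "fw v = f_gen G i ^ length v" by (metis fw_replicate)+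
      have "length v \<ge> M \<or> length u \<ge> N" using uv(1) by simp linarith
      then show "dual_times G (left_regular (fw v) p) (left_regular (fw u) g) = 0"
        unfolding * using MN power_kills_mono[OF left_regular_module] by (metis dual_times_simps(3,8))
    qed
    then show ?case unfolding fw_replicate by blast
  qed (simp add: lr_simps)
  have rad: "kills_radical (\<lambda>w. left_regular (fw w) x) \<and> kills_radical (\<lambda>w. left_regular (ew w) x)" if "x \<in> products" for x
    using that
  proof (induction rule: products_induct)
    case (base p g m n)
    \<comment> \<open>The arguments are swapped because in \<open>fw_times\<close> the first subword
      acts on the second factor.\<close>
    have bil: "qbilinear (\<lambda>a b. dual_times G b a)"
      using dual_times_bilinear by (auto simp: qbilinear_def)
    show ?case
      unfolding fw_times[OF base(4)] ew_times[OF base(3)]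
      using kills_radical_shuf[OF FF_radical(1)[OF base(2)] FF_radical(1)[OF base(1)] bil]
        kills_radical_shuf[OF FF_radical(2)[OF base(1)] FF_radical(2)[OF base(2)] dual_times_bilinear] by blast
  qed (simp_all add: lr_simps kills_radical_zero kills_radical_add)
  then show "kills_radical (\<lambda>w. left_regular (fw w) x)" "kills_radical (\<lambda>w. left_regular (ew w) x)"
    if "x \<in> products" for x using that by blast+
qed

text \<open>Complete reducibility writes the product as a sum of y s with s annihilated by the ideal
  of some L(m), m dominant integral; such an s is itself a functional on L(m), so y s is a matrix
  element.\<close>

theorem FF_times:
  assumes "p \<in> FF" "g \<in> FF"
  shows "dual_times G p g \<in> FF"
proof -
  interpret integrable G left_regular products by (rule products_integrable)
  have "dual_times G p g \<in> products" unfolding products_def by (rule qs.span_base) (use assms in blast)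
  from completely_reducible[OF this] show ?thesis
  proof (rule subsetD[OF qs.span_minimal[OF _ FF_subspace], rotated])
    show "{left_regular y s | y s. \<exists>m. dominant_integral A m \<and> s \<in> Xw m \<and> (\<forall>l\<in>L_ideal G m. left_regular l s = 0)} \<subseteq> FF"
    proof clarify
      fix y s m assume m: "dominant_integral A m" and s: "\<forall>l\<in>L_ideal G m. left_regular l s = 0"
      have "\<forall>l\<in>L_ideal G m. eval_dual s l = 0"
      proof
        fix l assume "l \<in> L_ideal G m"
        \<comment> \<open>Evaluating l s at 1 gives the value of s at l.\<close>
        then have "eval_dual (left_regular l s) 1 = 0" using s by (simp add: dual_rep)
        then show "eval_dual s l = 0" by (simp add: eval_left_regular)
      qed
      then show "left_regular y s \<in> FF" by (rule matrix_element_FF[OF m])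
    qed
  qed
qed

end

section \<open>Intertwiners and invariant functions\<close>

text \<open>A generalized inverse c satisfies M c M = M. Nondegeneracy cancels M on the left to give
  c M = 1, and with symmetry also M c = 1, so c is the unique two-sided inverse.\<close>

lemma inverse_matrix:
  assumes sym: "\<And>i j. i < n \<Longrightarrow> j < n \<Longrightarrow> M i j = M j i"
    and nondeg: "\<And>r k. (\<And>i. i < n \<Longrightarrow> (\<Sum>k<n. M i k * r k) = 0) \<Longrightarrow> k < n \<Longrightarrow> r k = 0"
    and "i < n" "j < n"
  shows "(\<Sum>k<n. M i k * inverse_matrix n M k j) = (if i = j then 1 else 0)"
proof -
  obtain c where c: "\<forall>i<n. \<forall>j<n. (\<Sum>k<n. \<Sum>l<n. M i k * c k l * M l j) = M i j"
    using generalized_inverse[of "{..<n}" "{..<n}" M] by auto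
  have left: "(\<Sum>l<n. c k l * M l j) = (if k = j then 1 else 0)" if kj: "k < n" "j < n" for k j
  proof -
    have "(\<Sum>l<n. c k l * M l j) - (if k = j then 1 else 0) = 0"
    proof (rule nondeg[OF _ kj(1)])
      fix i assume i: "i < n"
      have "(\<Sum>k<n. M i k * ((\<Sum>l<n. c k l * M l j) - (if k = j then 1 else 0)))
          = (\<Sum>k<n. \<Sum>l<n. M i k * c k l * M l j) - M i j"
        using kj(2) by (simp add: right_diff_distrib sum_subtractf sum_distrib_left mult.assoc if_distrib[of "\<lambda>x. _ * x"] cong: if_cong)
      then show "(\<Sum>k<n. M i k * ((\<Sum>l<n. c k l * M l j) - (if k = j then 1 else 0))) = 0"
        using c i kj(2) by simp
    qed
    then show ?thesis by simp
  qed
  have right: "(\<Sum>k<n. M i k * c k l) = (if i = l then 1 else 0)" if il: "i < n" "l < n" for i l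
  proof -
    have "(\<Sum>k<n. M i k * c k l) - (if i = l then 1 else 0) = 0"
    proof (rule nondeg[OF _ il(2)])
      fix j assume j: "j < n"
      have "(\<Sum>l<n. M j l * ((\<Sum>k<n. M i k * c k l) - (if i = l then 1 else 0)))
          = (\<Sum>l<n. \<Sum>k<n. M i k * c k l * M l j) - M i j"
        using il j by (simp add: right_diff_distrib sum_subtractf sum_distrib_left sym[OF j] mult_ac if_distrib[of "\<lambda>x. _ * x"] cong: if_cong)
      also have "(\<Sum>l<n. \<Sum>k<n. M i k * c k l * M l j) = (\<Sum>k<n. \<Sum>l<n. M i k * c k l * M l j)" by (rule sum.swap)
      finally show "(\<Sum>l<n. M j l * ((\<Sum>k<n. M i k * c k l) - (if i = l then 1 else 0))) = 0"
        using c il(1) j by simp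
    qed
    then show ?thesis by simp
  qed
  let ?P = "\<lambda>C. (\<forall>i j. \<not> (i < n \<and> j < n) \<longrightarrow> C i j = 0) \<and> (\<forall>i<n. \<forall>j<n. (\<Sum>k<n. M i k * C k j) = (if i = j then 1 else 0) \<and>
                     (\<Sum>k<n. C i k * M k j) = (if i = j then 1 else 0))"
  let ?C = "\<lambda>i j. if i < n \<and> j < n then c i j else 0"
  have P: "?P ?C" by (auto simp: left right)
  have "C = ?C" if C: "?P C" for C
  proof (intro ext)
    fix i j
    show "C i j = ?C i j"
    proof (cases "i < n \<and> j < n")
      case True
      then have "C i j = (\<Sum>k<n. (if i = k then 1 else 0) * C k j)"
        by (simp add: if_distrib[of "\<lambda>x. x * _"] cong: if_cong)
      also have "\<dots> = (\<Sum>k<n. \<Sum>l<n. c i l * M l k * C k j)"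
        using True by (intro sum.cong refl) (simp add: left[symmetric] sum_distrib_right)
      also have "\<dots> = (\<Sum>l<n. c i l * (\<Sum>k<n. M l k * C k j))"
        unfolding sum_distrib_left mult.assoc by (rule sum.swap)
      also have "\<dots> = (\<Sum>l<n. c i l * (if l = j then 1 else 0))"
        using True C by (intro sum.cong refl) simp
      also have "\<dots> = c i j" using True by (simp add: if_distrib[of "\<lambda>x. _ * x"] cong: if_cong)
      finally show ?thesis using True by simp
    next
      case False
      moreover have "C i j = 0" using C False by blast
      ultimately show ?thesis by (simp only: if_False)
    qed
  qed
  with P have "inverse_matrix n M = ?C" unfolding inverse_matrix_def by (rule the_equality)
  then show ?thesis using assms(3,4) by (simp add: right)
qed

context qea
begin

lemma U_minus_weightE:
  assumes "y \<in> U_minus_weight G \<beta>"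
  shows "y \<in> U_minus G" "t i * y = qpow (- (d i * \<beta> $ i)) *\<^sub>q (y * t i)"
proof -
  let ?S = "{y \<in> U_minus G. \<forall>t\<in>torus G. \<forall>s\<in>torus G. t * s = 1 \<longrightarrow> t * y * s = q_char G (- \<beta>) t *\<^sub>q y}"
  have M: "qs.subspace (U_minus G)" by (simp add: U_minus_eq)
  have y: "y \<in> qs.span ?S" using assms by (simp add: U_minus_weight_def)
  then show "y \<in> U_minus G" using qs.span_minimal[OF _ M, of ?S] by blast
  show "t i * y = qpow (- (d i * \<beta> $ i)) *\<^sub>q (y * t i)"
  proof (rule linear_span_eq[of scaleq "\<lambda>y. t i * y" "\<lambda>y. qpow (- (d i * \<beta> $ i)) *\<^sub>q (y * t i)", OF _ _ _ y])
    show "qlinear (\<lambda>y. t i * y)" by (rule qlinear_mult_left)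
    show "qlinear (\<lambda>y. qpow (- (d i * \<beta> $ i)) *\<^sub>q (y * t i))"
      by (intro qlinearI) (simp_all add: distrib_right scaleq_mult_left qs.scale_right_distrib scaleq_scaleq mult.commute)
    fix y assume "y \<in> ?S"
    then have "t i * y * t' i = qpow (- (d i * \<beta> $ i)) *\<^sub>q y" by simp
    then have "t i * y * t' i * t i = (qpow (- (d i * \<beta> $ i)) *\<^sub>q y) * t i" by simp
    then show "t i * y = qpow (- (d i * \<beta> $ i)) *\<^sub>q (y * t i)" by (simp add: mult.assoc scaleq_mult_left)
  qed
qed

lemma U_minus_weight_act:
  assumes "is_module a" "y \<in> U_minus_weight G \<beta>" "v \<in> weight_space G a m"
  shows "a y v \<in> weight_space G a (m - \<beta>)" "a (theta G y) v \<in> weight_space G a (m + \<beta>)"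
proof -
  note simps = is_moduleD(2)[OF assms(1), symmetric] module_simps[OF assms(1)]
  have v: "a (t i) v = qpow (d i * m $ i) *\<^sub>q v" for i using assms(3) weight_space_iff[OF assms(1)] by blast
  have y: "t i * y = qpow (- (d i * \<beta> $ i)) *\<^sub>q (y * t i)" for i by (rule U_minus_weightE[OF assms(2)])
  have "a (t i) (a y v) = qpow (d i * (m - \<beta>) $ i) *\<^sub>q a y v" for i
  proof -
    have "a (t i) (a y v) = qpow (- (d i * \<beta> $ i)) *\<^sub>q a y (a (t i) v)" by (simp only: simps y)
    then show ?thesis by (simp add: v simps scaleq_scaleq qpow_add[symmetric] algebra_simps)
  qed
  then show "a y v \<in> weight_space G a (m - \<beta>)" by (simp add: weight_space_iff[OF assms(1)])
  have ty: "t i * theta G y = qpow (d i * \<beta> $ i) *\<^sub>q (theta G y * t i)" for i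
  proof -
    have "t' i * theta G y = qpow (- (d i * \<beta> $ i)) *\<^sub>q (theta G y * t' i)"
      using arg_cong[OF y[of i], of "theta G"] by (simp add: theta_mult theta_t lin_simps[OF theta_linear])
    then have "t i * (t' i * theta G y) * t i = qpow (- (d i * \<beta> $ i)) *\<^sub>q (t i * (theta G y * t' i) * t i)"
      by (simp add: scaleq_mult_left scaleq_mult_right)
    then have "theta G y * t i = qpow (- (d i * \<beta> $ i)) *\<^sub>q (t i * theta G y)"
      by (simp only: mult.assoc t't mult_1_right) (simp only: mult.assoc[symmetric] tt' mult_1_left)
    then have "qpow (d i * \<beta> $ i) *\<^sub>q (theta G y * t i) = (qpow (d i * \<beta> $ i) * qpow (- (d i * \<beta> $ i))) *\<^sub>q (t i * theta G y)"
      by (simp add: scaleq_scaleq)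
    then show ?thesis by simp
  qed
  have "a (t i) (a (theta G y) v) = qpow (d i * (m + \<beta>) $ i) *\<^sub>q a (theta G y) v" for i
  proof -
    have "a (t i) (a (theta G y) v) = qpow (d i * \<beta> $ i) *\<^sub>q a (theta G y) (a (t i) v)" by (simp only: simps ty)
    then show ?thesis by (simp add: v simps scaleq_scaleq qpow_add[symmetric] algebra_simps)
  qed
  then show "a (theta G y) v \<in> weight_space G a (m + \<beta>)" by (simp add: weight_space_iff[OF assms(1)])
qed

lemma theta_fw: "theta G (fw w) = (- 1) ^ length w *\<^sub>q ew w"
  by (induction w) (simp_all add: theta_1 theta_mult theta_f scaleq_mult_right scaleq_scaleq)

lemma theta_U_minus: "y \<in> U_minus G \<Longrightarrow> theta G y \<in> qs.span (range ew)"
  unfolding U_minus_eq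
  by (rule linear_span_mem[OF theta_linear qs.subspace_span, of "range fw"])
    (auto simp: theta_fw intro!: qs.span_scale[OF qs.span_base])

text \<open>An element of \<open>U_minus_weight\<close> is a combination of words, but they are not
  known to have weight \<beta>. The grading of the module does the sorting: the contributions of
  other weights must cancel.\<close>

lemma theta_U_minus_weight:
  assumes "is_module a" "y \<in> U_minus_weight G \<beta>" "v \<in> weight_space G a 0"
    and "\<And>w. wt w = \<beta> \<Longrightarrow> a (ew w) v = 0"
  shows "a (theta G y) v = 0"
proof -
  let ?S = "range (\<lambda>w. a (ew w) v)"
  have "a (theta G y) v \<in> qs.span ?S"
    by (rule linear_span_mem[OF qbilinearD(2)[OF is_module_bilinear[OF assms(1)]] qs.subspace_span _
        theta_U_minus[OF U_minus_weightE(1)[OF assms(2)]]]) (auto intro: qs.span_base)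
  moreover have w: "a (ew w) v \<in> weight_space G a (wt w)" for w
    using weight_space_ew[OF assms(1,3), of w] by simp
  moreover have "a (theta G y) v \<in> weight_space G a \<beta>"
    using U_minus_weight_act(2)[OF assms(1-3)] by simp
  ultimately have "a (theta G y) v \<in> qs.span (?S \<inter> weight_space G a \<beta>)"
    by (intro graded_span[OF assms(1)]) auto
  moreover have "?S \<inter> weight_space G a \<beta> \<subseteq> {0}"
    using assms(4) weight_unique[OF assms(1) w] by blast
  ultimately have "a (theta G y) v \<in> qs.span {0}" using qs.span_mono by blast
  then show ?thesis by simp
qed

lemma K_minus_L_ideal: "y \<in> K_minus G l \<longleftrightarrow> y \<in> U_minus G \<and> y \<in> L_ideal G l"
proof
  assume y: "y \<in> K_minus G l"
  have "0 \<in> verma_ideal G l" by (simp add: verma_ideal_def qs.span_zero)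
  then have "y \<in> L_ideal G l" using y unfolding L_ideal_def by force
  then show "y \<in> U_minus G \<and> y \<in> L_ideal G l" using y by (simp add: K_minus_def)
qed (simp add: K_minus_def pi_form_eq L_ideal_iff)

text \<open>Symmetry of the Shapovalov form: its left and right kernels agree, and theta carries one
  argument of it to that of \<open>pi_form\<close>.\<close>

lemma theta_K_minus:
  assumes "y \<in> K_minus G l"
  shows "theta G y \<in> K_plus G l"
proof -
  have "Lam l (om y * y') = 0" for y'
    using assms by (subst Lam_om_commute) (simp add: K_minus_L_ideal L_ideal_iff)
  then show ?thesis
    using theta_U_minus[of y] assms by (simp add: K_plus_def K_minus_L_ideal U_plus_eq pi_form_eq om_def)
qed

lemma wt_Q_plus: "wt w \<in> Q_plus"
proof -
  have "wt w $ i \<in> \<nat>" for i by (induction w) (auto simp: simple_root_nth)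
  then show ?thesis by (simp add: Q_plus_def)
qed

lemma dual_times_mu: "qlinear (mu G)" "mu G (p \<otimes>\<^sub>q g) = dual_times G p g"
  unfolding mu_def
  by (rule tensor_ext; rule qbilinearD[OF dual_times_bilinear])+

end

section \<open>Intertwiners out of L(lam)\<close>

locale irreducible_module = highest_weight G lam act one vst
  for G :: "('r::finite, 'u::qalgebra) qgroup" and lam :: "'r weight" and act :: "'u \<Rightarrow> 'l::qspace \<Rightarrow> 'l"
    and one :: 'l and vst :: "'l \<Rightarrow> qfield" +
  assumes V_UNIV: "V = UNIV"
begin

abbreviation "TL \<equiv> tact act left_regular"
abbreviation "TF \<equiv> tensor_F G (UNIV :: 'l set)"

lemma TL_module: "is_module TL"
  by (rule tact_module[OF act left_regular_module])

lemmas TL_simps = module_simps[OF TL_module]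
lemmas TL_1 = is_moduleD(1)[OF TL_module]
lemmas TL_mult = is_moduleD(2)[OF TL_module]
lemmas TL_pure = tact_pure[OF act left_regular_module]

lemma V_tensor: "n \<in> qs.span {v \<otimes>\<^sub>q u | v u. v \<in> V}"
  using tensor_span[of n] by (simp add: V_UNIV)

lemma obtain_act:
  obtains x where "v = act x one"
  using V_UNIV by (auto simp: V_def)

lemma vst_one_1: "vst one = 1"
  using vst_one[of 1] by (simp add: act_1)

lemma vst_weight:
  assumes "v \<in> weight_space G act m" "m \<noteq> lam"
  shows "vst v = 0"
proof -
  obtain i where i: "m $ i \<noteq> lam $ i" using assms(2) by (auto simp: vec_eq_iff)
  define n :: "'r \<Rightarrow> int" where "n = (\<lambda>j. if j = i then 1 else 0)"
  have tv: "tv l n = d i * l $ i" for l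
    by (simp add: tv_def n_def if_distrib[of "\<lambda>x. x * _"] if_distrib[of of_int] cong: if_cong)
  have "qpow (tv m n) * vst v = vst (act (tm n) v)"
    by (simp add: weight_space_tm[OF assms(1)] lin_simps[OF vst_linear])
  also have "\<dots> = qpow (tv lam n) * vst v" by (rule vst_tm) (simp add: V_UNIV)
  finally show ?thesis using i by (simp add: tv)
qed

lemma coef_weight: "v \<in> weight_space G act m \<Longrightarrow> m \<noteq> lam - wt w \<Longrightarrow> coef w v = 0"
proof (induction w arbitrary: m v)
  case Nil
  then show ?case by (simp add: coef_def act_1 vst_weight)
next
  case (Cons j w)
  have e: "act (e j) v \<in> weight_space G act (m + simple_root j)" by (rule weight_space_e[OF act Cons.prems(1)])
  have "coef (j # w) v = qpow (- B (simple_root j) (m + simple_root j)) * coef w (act (e j) v)"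
    unfolding coef_Cons weight_space_kk(2)[OF e] by (rule lin_simps[OF coef_linear])
  also have "coef w (act (e j) v) = 0"
    by (rule Cons.IH[OF e]) (use Cons.prems(2) in \<open>auto simp: algebra_simps\<close>)
  finally show ?case by simp
qed

lemma TF_subspace: "qs.subspace TF"
  by (simp add: tensor_F_def)

lemma TF_base: "p \<in> FF \<Longrightarrow> v \<otimes>\<^sub>q p \<in> TF"
  unfolding tensor_F_def by (rule qs.span_base) blast

lemma TF_closed: "n \<in> TF \<Longrightarrow> TL x n \<in> TF"
  using tact_span[OF act left_regular_module, of UNIV FF n x] FF_closed by (simp add: tensor_F_def)

lemma contract_FF:
  assumes "n \<in> TF"
  shows "contract vst n \<in> FF"
  by (rule linear_span_mem[OF contract_linear[OF vst_linear] FF_subspace _ assms[unfolded tensor_F_def]])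
    (auto simp: contract_pure[OF vst_linear] qs.subspace_scale[OF FF_subspace])

definition lower :: "'l set" where "lower = (\<Union>m\<in>{m. weight_less m lam}. weight_space G act m)"

lemma lower_vst: "v \<in> lower \<Longrightarrow> vst v = 0"
  unfolding lower_def using vst_weight by (auto simp: weight_less_def)

lemma one_complement: "v - vst v *\<^sub>q one \<in> qs.span lower"
proof -
  have v: "v \<in> qs.span (range (\<lambda>w. act (fw w) one))" using V_span V_UNIV by simp
  show ?thesis
  proof (rule linear_span_mem[of "\<lambda>v. v - vst v *\<^sub>q one", OF _ qs.subspace_span _ v])
    show "qlinear (\<lambda>v. v - vst v *\<^sub>q one)"
      by (intro qlinearI) (simp_all add: lin_simps[OF vst_linear] scaleq_add_left scaleq_scaleq qs.scale_right_diff_distrib)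
    fix v assume "v \<in> range (\<lambda>w. act (fw w) one)"
    then obtain w where v: "v = act (fw w) one" by blast
    show "v - vst v *\<^sub>q one \<in> qs.span lower"
    proof (cases w)
      case Nil
      then show ?thesis by (simp add: v act_1 vst_one_1 qs.span_zero)
    next
      case (Cons i w')
      then have "wt w \<noteq> 0" using wt_eq_0_iff by blast
      then have "weight_less (lam - wt w) lam" using wt_Q_plus[of w] by (simp add: weight_less_def)
      then have "v \<in> lower" using fw_one_weight[of w] by (auto simp: v lower_def)
      then show ?thesis by (simp add: lower_vst qs.span_base)
    qed
  qed
qed

text \<open>The module is spanned by \<open>one\<close> and the lower weight spaces, and
  \<open>vst\<close> is 1 on the former and 0 on the latter. Contraction with \<open>vst\<close>
  therefore computes the leading coefficient and shows that it is unique.\<close>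

lemma Theta_eq:
  assumes "\<phi> one \<in> TF"
  shows "Theta G lam act one \<phi> = contract vst (\<phi> one)"
  unfolding Theta_def lower_def[symmetric]
proof (rule the_equality)
  have "\<phi> one - one \<otimes>\<^sub>q contract vst (\<phi> one) \<in> tensor_F G lower"
  proof (rule linear_span_mem[of "\<lambda>n. n - one \<otimes>\<^sub>q contract vst n", OF _ _ _ assms[unfolded tensor_F_def]])
    show "qlinear (\<lambda>n. n - one \<otimes>\<^sub>q contract vst n)"
      by (intro qlinearI) (simp_all add: lin_simps[OF contract_linear[OF vst_linear]] tensor_simps qs.scale_right_diff_distrib)
    show "qs.subspace (tensor_F G lower)" by (simp add: tensor_F_def)
    fix n assume "n \<in> {v \<otimes>\<^sub>q p | v p. v \<in> (UNIV :: 'l set) \<and> p \<in> FF}"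
    then obtain v p where n: "n = v \<otimes>\<^sub>q p" "p \<in> FF" by blast
    have "n - one \<otimes>\<^sub>q contract vst n = (v - vst v *\<^sub>q one) \<otimes>\<^sub>q p"
      by (simp add: n(1) contract_pure[OF vst_linear] tensor_simps)
    also have "\<dots> \<in> tensor_F G lower"
      unfolding tensor_F_def
      by (rule linear_span_mem[OF qlinear_tensor_left qs.subspace_span _ one_complement])
        (use n(2) in \<open>auto intro: qs.span_base\<close>)
    finally show "n - one \<otimes>\<^sub>q contract vst n \<in> tensor_F G lower" .
  qed
  with contract_FF[OF assms]
  show "contract vst (\<phi> one) \<in> FF \<and> \<phi> one - one \<otimes>\<^sub>q contract vst (\<phi> one) \<in> tensor_F G lower" by blast
next
  fix p assume p: "p \<in> FF \<and> \<phi> one - one \<otimes>\<^sub>q p \<in> tensor_F G lower"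
  have "contract vst (\<phi> one - one \<otimes>\<^sub>q p) \<in> {0}"
    by (rule linear_span_mem[OF contract_linear[OF vst_linear] _ _ conjunct2[OF p, unfolded tensor_F_def]])
      (auto simp: contract_pure[OF vst_linear] lower_vst qs.subspace_def)
  then show "p = contract vst (\<phi> one)"
    by (simp add: lin_simps[OF contract_linear[OF vst_linear]] contract_pure[OF vst_linear] vst_one_1)
qed

lemma contract_vst_U_minus:
  assumes "y \<in> U_minus G"
  shows "contract vst (TL y n) = left_regular y (contract vst n)"
proof (rule linear_span_eq[of scaleq "\<lambda>y. contract vst (TL y n)" "\<lambda>y. left_regular y (contract vst n)"])
  show "qlinear (\<lambda>y. contract vst (TL y n))"
    by (rule qlinear_compose[OF contract_linear[OF vst_linear] qbilinearD(2)[OF is_module_bilinear[OF TL_module]]])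
  show "qlinear (\<lambda>y. left_regular y (contract vst n))" by (rule qbilinearD(2)[OF is_module_bilinear[OF left_regular_module]])
  show "y \<in> qs.span (range fw)" using assms by (simp add: U_minus_eq)
  fix y assume "y \<in> range fw"
  then obtain w where y: "y = fw w" by blast
  show "contract vst (TL y n) = left_regular y (contract vst n)"
    unfolding y
    by (induction w) (simp_all add: TL_1 lr_1 TL_mult lr_mult contract_vst_f[OF left_regular_module V_tensor])
qed

text \<open>The vectors l z, for l in the ideal, form a set stable under the e_i and the torus.
  Splitting l into a part in \<open>K_minus\<close> and a part in the Verma ideal shows that
  \<open>vst\<close> contracts all of them to 0, so they vanish.\<close>

lemma singular_L_ideal:
  assumes e: "\<And>i. TL (e i) z = 0" and wt: "z \<in> weight_space G TL lam"
    and K: "\<And>y. y \<in> K_minus G lam \<Longrightarrow> left_regular y (contract vst z) = 0" and l: "l \<in> L_ideal G lam"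
  shows "TL l z = 0"
proof (rule tensor_submodule_zero[OF left_regular_module, of "{TL l z | l. l \<in> L_ideal G lam}"])
  show "{TL l z | l. l \<in> L_ideal G lam} \<subseteq> qs.span {v \<otimes>\<^sub>q u | v u. v \<in> V}" using V_tensor by blast
  show "TL (kk' i * e i) n \<in> {TL l z | l. l \<in> L_ideal G lam}" if n: "n \<in> {TL l z | l. l \<in> L_ideal G lam}" for i n
  proof -
    obtain l where "n = TL l z" "l \<in> L_ideal G lam" using n by blast
    then have "TL (kk' i * e i) n = TL (kk' i * e i * l) z" "kk' i * e i * l \<in> L_ideal G lam"
      by (simp_all add: TL_mult L_ideal_mult)
    then show ?thesis by blast
  qed
  show "contract vst n = 0" if n: "n \<in> {TL l z | l. l \<in> L_ideal G lam}" for n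
  proof -
    obtain l where l: "n = TL l z" "l \<in> L_ideal G lam" using n by blast
    then obtain y v where yv: "l = y + v" "y \<in> K_minus G lam" "v \<in> verma_ideal G lam" by (auto simp: L_ideal_def)
    have "TL v z \<in> {0}"
      by (rule linear_span_mem[OF qbilinearD(2)[OF is_module_bilinear[OF TL_module]] _ _ yv(3)[unfolded verma_ideal_def]])
        (use e wt in \<open>auto simp: qs.subspace_def TL_mult TL_simps TL_1 weight_space_def\<close>)
    then have "n = TL y z" by (simp add: l(1) yv(1) TL_simps)
    then have "contract vst n = left_regular y (contract vst z)"
      using yv(2) by (simp add: contract_vst_U_minus K_minus_L_ideal)
    then show ?thesis using K[OF yv(2)] by simp
  qed
qed (use l in blast)

lemma intertwiner_exists:
  assumes "z \<in> TF" "\<And>l. l \<in> L_ideal G lam \<Longrightarrow> TL l z = 0"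
    and kernel: "\<And>x. act x one = 0 \<Longrightarrow> x \<in> L_ideal G lam"
  shows "\<exists>\<phi>\<in>intertwiners G act. \<phi> one = z"
proof -
  define rep where "rep v = (SOME x. v = act x one)" for v
  have rep: "v = act (rep v) one" for v
    unfolding rep_def by (rule someI_ex) (use obtain_act in blast)
  define \<phi> where "\<phi> v = TL (rep v) z" for v
  have \<phi>: "\<phi> (act x one) = TL x z" for x
  proof -
    have "act (rep (act x one) - x) one = 0" using rep[of "act x one"] by (simp add: act_simps)
    from assms(2)[OF kernel[OF this]] show ?thesis by (simp add: \<phi>_def TL_simps)
  qed
  have "qlinear \<phi>"
  proof (rule qlinearI)
    show "\<phi> (v + w) = \<phi> v + \<phi> w" for v w
      using \<phi>[of "rep v + rep w"] rep[of v] rep[of w] by (simp add: act_simps TL_simps \<phi>_def)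
    show "\<phi> (c *\<^sub>q v) = c *\<^sub>q \<phi> v" for c v
      using \<phi>[of "c *\<^sub>q rep v"] rep[of v] by (simp add: act_simps TL_simps \<phi>_def)
  qed
  moreover have "range \<phi> \<subseteq> TF" using TF_closed[OF assms(1)] by (auto simp: \<phi>_def)
  moreover have "\<phi> (act x v) = tensor_act act left_regular (coproduct G x) (\<phi> v)" for x v
    using \<phi>[of "x * rep v"] rep[of v] by (simp add: act_mult TL_mult \<phi>_def tact_def[symmetric])
  moreover have "\<phi> one = z" using \<phi>[of 1] by (simp add: act_1 TL_1)
  ultimately show ?thesis unfolding intertwiners_def by blast
qed

lemma intertwinerD:
  assumes "\<phi> \<in> intertwiners G act"
  shows "qlinear \<phi>" "\<phi> v \<in> TF" "\<phi> (act x v) = TL x (\<phi> v)"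
  using assms by (auto simp: intertwiners_def tact_def)

lemma intertwiner_coef:
  assumes "\<phi> \<in> intertwiners G act"
  shows "contract (coef w) (\<phi> one) = left_regular (theta G (fw w)) (contract vst (\<phi> one))"
proof (rule contract_coef_singular[OF left_regular_module])
  show "TL (e i) (\<phi> one) = 0" for i
    using intertwinerD(3)[OF assms, of "e i" one] by (simp add: one_e lin_simps[OF intertwinerD(1)[OF assms]])
qed

text \<open>Multiplying second legs does not touch the leg that is contracted. The last claim is
  where closure of F under products enters.\<close>

lemma id_tensor_mu:
  defines "h \<equiv> \<lambda>(s :: ('l, 'u dual) tensor) g. tensor_ext scaleq (\<lambda>v p. v \<otimes>\<^sub>q dual_times G p g) s"
  shows "qlinear (id_tensor_mu G :: (('l, 'u dual) tensor, 'u dual) tensor \<Rightarrow> _)"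
    and "contract vst (id_tensor_mu G (s \<otimes>\<^sub>q g)) = dual_times G (contract vst s) g"
    and "s \<in> TF \<Longrightarrow> g \<in> FF \<Longrightarrow> id_tensor_mu G (s \<otimes>\<^sub>q g) \<in> TF"
proof -
  have h: "qlinear (\<lambda>s. h s g)" "h (v \<otimes>\<^sub>q p) g = v \<otimes>\<^sub>q dual_times G p g" for v p g
    unfolding h_def by (rule tensor_ext; intro qlinearI; simp add: tensor_simps dual_times_simps)+
  have h_right: "qlinear (h s)" for s
  proof (rule qlinearI)
    have L: "qlinear (\<lambda>s. h s g + h s g')" "qlinear (\<lambda>s. c *\<^sub>q h s g)" for g g' c
      by (intro qlinearI; simp add: lin_simps[OF h(1)] qs.scale_right_distrib qs.scale_left_commute)+
    show "h s (g + g') = h s g + h s g'" for g g'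
      by (rule linear_tensor_eq[OF h(1) L(1)]) (simp add: h(2) tensor_simps dual_times_simps)
    show "h s (c *\<^sub>q g) = c *\<^sub>q h s g" for c g
      by (rule linear_tensor_eq[OF h(1) L(2)]) (simp add: h(2) tensor_simps dual_times_simps)
  qed
  have M: "qlinear (id_tensor_mu G :: (('l, 'u dual) tensor, 'u dual) tensor \<Rightarrow> _)" "id_tensor_mu G (s \<otimes>\<^sub>q g) = h s g" for s g
    unfolding id_tensor_mu_def h_def[symmetric] by (rule tensor_ext[OF h(1) h_right])+
  show "qlinear (id_tensor_mu G :: (('l, 'u dual) tensor, 'u dual) tensor \<Rightarrow> _)" by (rule M(1))
  show "contract vst (id_tensor_mu G (s \<otimes>\<^sub>q g)) = dual_times G (contract vst s) g"
    unfolding M(2)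
  proof (rule linear_tensor_eq[of scaleq "\<lambda>s. contract vst (h s g)" "\<lambda>s. dual_times G (contract vst s) g"])
    show "qlinear (\<lambda>s. contract vst (h s g))" by (rule qlinear_compose[OF contract_linear[OF vst_linear] h(1)])
    show "qlinear (\<lambda>s. dual_times G (contract vst s) g)"
      by (rule qlinear_compose[OF qbilinearD(2)[OF dual_times_bilinear] contract_linear[OF vst_linear]])
  qed (simp add: h(2) contract_pure[OF vst_linear] dual_times_simps)
  show "id_tensor_mu G (s \<otimes>\<^sub>q g) \<in> TF" if "s \<in> TF" "g \<in> FF"
    unfolding M(2)
    by (rule linear_span_mem[OF h(1) TF_subspace _ that(1)[unfolded tensor_F_def]])
      (use that(2) in \<open>auto simp: h(2) intro!: TF_base FF_times\<close>)
qed

end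

section \<open>The reduced fusion element\<close>

context irreducible_module
begin

lemma act_one_zero_iff: "act x one = 0 \<longleftrightarrow> x \<in> L_ideal G lam"
  unfolding L_ideal_iff
  using nondegenerate[of x] by (auto simp: act_mult vst_one[symmetric] act_simps lin_simps[OF vst_linear])

lemma invariantD:
  assumes "p \<in> invariant_functions G lam"
  shows "p \<in> FF" "p \<in> weight_space G left_regular 0"
    and "z \<in> K_minus G lam \<Longrightarrow> left_regular z p = 0" "z \<in> K_plus G lam \<Longrightarrow> left_regular z p = 0"
  using assms by (auto simp: invariant_functions_def)

lemma vst_om: "vst (act (om x) (act z one)) = vst (act (om z) (act x one))"
  unfolding act_mult[symmetric] vst_one by (rule Lam_om_commute)

lemma intertwiner_eq:
  assumes "\<phi> \<in> intertwiners G act" "\<And>w. contract (coef w) z = left_regular (theta G (fw w)) (contract vst (\<phi> one))"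
  shows "\<phi> one = z"
proof -
  have "\<phi> one - z = 0"
    by (rule tensor_coef_separated[OF left_regular_module V_tensor])
      (simp add: lin_simps[OF contract_linear[OF coef_linear]] intertwiner_coef[OF assms(1)] assms(2))
  then show ?thesis by simp
qed

section \<open>Dual bases for the Shapovalov form\<close>

context
  fixes n :: "'r weight \<Rightarrow> nat" and y :: "'r weight \<Rightarrow> nat \<Rightarrow> 'u"
  assumes adapted: "adapted_basis G lam act one n y"
begin

abbreviation "bb \<beta> i \<equiv> act (y \<beta> i) one"
abbreviation "SS \<beta> i j \<equiv> vst (act (om (y \<beta> i)) (bb \<beta> j))"
abbreviation "CC \<beta> \<equiv> inverse_matrix (n \<beta>) (\<lambda>i j. induced_form G lam act one (bb \<beta> i) (bb \<beta> j))"

lemma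
  assumes "\<beta> \<in> Q_plus"
  shows y_weight: "i < n \<beta> \<Longrightarrow> y \<beta> i \<in> U_minus_weight G \<beta>" and b_inj: "inj_on (bb \<beta>) {..<n \<beta>}"
    and b_independent: "qs.independent (bb \<beta> ` {..<n \<beta>})"
    and b_span: "qs.span (bb \<beta> ` {..<n \<beta>}) = weight_space G act (lam - \<beta>)"
  using adapted assms by (auto simp: adapted_basis_def Let_def)

lemma y_U_minus: "\<beta> \<in> Q_plus \<Longrightarrow> i < n \<beta> \<Longrightarrow> y \<beta> i \<in> U_minus G"
  by (rule U_minus_weightE(1)[OF y_weight])

lemma b_weight: "\<beta> \<in> Q_plus \<Longrightarrow> i < n \<beta> \<Longrightarrow> bb \<beta> i \<in> weight_space G act (lam - \<beta>)"
  by (rule U_minus_weight_act(1)[OF act y_weight one_weight])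

lemma b_expand:
  assumes "\<beta> \<in> Q_plus" "v \<in> weight_space G act (lam - \<beta>)"
  shows "\<exists>r. v = (\<Sum>k<n \<beta>. r k *\<^sub>q bb \<beta> k)"
proof -
  have "v \<in> qs.span (bb \<beta> ` {..<n \<beta>})" using assms b_span by simp
  then obtain u where "v = (\<Sum>x\<in>bb \<beta> ` {..<n \<beta>}. u x *\<^sub>q x)" by (auto simp: qs.span_finite)
  also have "\<dots> = (\<Sum>k<n \<beta>. u (bb \<beta> k) *\<^sub>q bb \<beta> k)" by (rule sum.reindex[OF b_inj[OF assms(1)], simplified comp_def])
  finally show ?thesis by (intro exI[of _ "\<lambda>k. u (bb \<beta> k)"])
qed

text \<open>By symmetry of the form each argument can be replaced by any other element of
  \<open>U\<close> representing the same vector, so the value depends on the two vectors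
  only.\<close>

lemma induced_form_eq:
  assumes "\<beta> \<in> Q_plus" "i < n \<beta>" "j < n \<beta>"
  shows "induced_form G lam act one (bb \<beta> i) (bb \<beta> j) = SS \<beta> i j"
  unfolding induced_form_def
proof (rule the_equality)
  show "\<exists>x\<in>U_minus G. \<exists>z\<in>U_minus G. bb \<beta> i = act x one \<and> bb \<beta> j = act z one \<and> SS \<beta> i j = shapovalov G lam x z"
    using y_U_minus assms by (intro bexI[of _ "y \<beta> i"] bexI[of _ "y \<beta> j"]) (simp_all add: shapovalov_eq act_mult[symmetric] vst_one)
next
  fix c assume "\<exists>x\<in>U_minus G. \<exists>z\<in>U_minus G. bb \<beta> i = act x one \<and> bb \<beta> j = act z one \<and> c = shapovalov G lam x z"
  then obtain x z where xz: "bb \<beta> i = act x one" "bb \<beta> j = act z one" "c = shapovalov G lam x z" by blast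
  have "c = vst (act (om x) (act z one))" by (simp add: xz(3) shapovalov_eq act_mult[symmetric] vst_one)
  also have "\<dots> = vst (act (om (y \<beta> j)) (act x one))" by (simp add: xz(2)[symmetric] vst_om[of x])
  also have "\<dots> = SS \<beta> i j" by (simp add: xz(1)[symmetric] vst_om[of "y \<beta> j"])
  finally show "c = SS \<beta> i j" .
qed

text \<open>The combination with coefficients r pairs to zero with its own weight space by
  assumption and with all other weight spaces by weight. So every \<open>coef w\<close> of it
  vanishes, and the basis is independent.\<close>

lemma S_nondegenerate:
  assumes \<beta>: "\<beta> \<in> Q_plus" and r: "\<And>i. i < n \<beta> \<Longrightarrow> (\<Sum>k<n \<beta>. SS \<beta> i k * r k) = 0" and k: "k < n \<beta>"
  shows "r k = 0"
proof -
  define Y where "Y = (\<Sum>k<n \<beta>. r k *\<^sub>q y \<beta> k)"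
  have Y: "act Y one = (\<Sum>k<n \<beta>. r k *\<^sub>q bb \<beta> k)" by (simp add: Y_def act_simps)
  have Y_weight: "act Y one \<in> weight_space G act (lam - \<beta>)"
    unfolding Y using b_weight[OF \<beta>] by (intro qs.subspace_sum qs.subspace_scale weight_space_subspace act) auto
  have zero: "vst (act (om Y) v) = (\<lambda>_. 0) v" if v: "v \<in> weight_space G act (lam - \<beta>)" for v
  proof (rule linear_span_eq[of "(*)" "\<lambda>v. vst (act (om Y) v)" "\<lambda>_. 0"])
    show "qfunctional (\<lambda>v. vst (act (om Y) v))" by (rule contract_linear_compose[OF act vst_linear])
    show "qfunctional (\<lambda>_ :: 'l. 0)" by (intro qfunctionalI) simp_all
    show "v \<in> qs.span (bb \<beta> ` {..<n \<beta>})" using v b_span[OF \<beta>] by simp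
    fix v assume "v \<in> bb \<beta> ` {..<n \<beta>}"
    then obtain i where i: "v = bb \<beta> i" "i < n \<beta>" by blast
    have "vst (act (om Y) v) = vst (act (om (y \<beta> i)) (act Y one))" unfolding i(1) by (rule vst_om)
    also have "\<dots> = (\<Sum>k<n \<beta>. SS \<beta> i k * r k)" by (simp add: Y act_simps lin_simps[OF vst_linear] mult.commute)
    finally show "vst (act (om Y) v) = 0" using r[OF i(2)] by simp
  qed
  have "act Y one = 0"
  proof (rule coef_separates)
    show "act Y one \<in> V" by (simp add: V_UNIV)
    fix w
    show "coef w (act Y one) = 0"
    proof (cases "wt w = \<beta>")
      case True
      have "coef w (act Y one) = vst (act (om Y) (act (fw w) one))" unfolding coef_def by (rule vst_om)
      then show ?thesis using zero[of "act (fw w) one"] fw_one_weight[of w] True by simp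
    next
      case False
      then show ?thesis by (intro coef_weight[OF Y_weight]) auto
    qed
  qed
  then have "(\<Sum>x\<in>bb \<beta> ` {..<n \<beta>}. r (the_inv_into {..<n \<beta>} (bb \<beta>) x) *\<^sub>q x) = 0"
    by (simp add: Y sum.reindex[OF b_inj[OF \<beta>]] the_inv_into_f_f[OF b_inj[OF \<beta>]])
  from qs.independentD[OF b_independent[OF \<beta>] _ subset_refl this, of "bb \<beta> k"]
  show ?thesis using k by (simp add: the_inv_into_f_f[OF b_inj[OF \<beta>]])
qed

lemma S_inverse:
  assumes "\<beta> \<in> Q_plus" "k < n \<beta>" "j < n \<beta>"
  shows "(\<Sum>i<n \<beta>. SS \<beta> k i * CC \<beta> i j) = (if k = j then 1 else 0)"
proof -
  note eq = induced_form_eq[OF assms(1)]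
  have "(\<Sum>i<n \<beta>. induced_form G lam act one (bb \<beta> k) (bb \<beta> i) * CC \<beta> i j) = (if k = j then 1 else 0)"
  proof (rule inverse_matrix[OF _ _ assms(2,3)])
    show "induced_form G lam act one (bb \<beta> i) (bb \<beta> j) = induced_form G lam act one (bb \<beta> j) (bb \<beta> i)" if "i < n \<beta>" "j < n \<beta>" for i j
      using that by (simp add: eq vst_om[of "y \<beta> i"])
    show "r k = 0" if r: "\<And>i. i < n \<beta> \<Longrightarrow> (\<Sum>k<n \<beta>. induced_form G lam act one (bb \<beta> i) (bb \<beta> k) * r k) = 0" and k: "k < n \<beta>" for r k
    proof (rule S_nondegenerate[OF assms(1) _ k])
      fix i assume i: "i < n \<beta>"
      have "(\<Sum>k<n \<beta>. SS \<beta> i k * r k) = (\<Sum>k<n \<beta>. induced_form G lam act one (bb \<beta> i) (bb \<beta> k) * r k)"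
        using eq[OF i] by (intro sum.cong refl) simp
      then show "(\<Sum>k<n \<beta>. SS \<beta> i k * r k) = 0" using r[OF i] by simp
    qed
  qed
  then show ?thesis using assms(2) by (simp add: eq)
qed

text \<open>A finite range outside of which theta of the chosen elements annihilates a given
  invariant function, once all words of length at least N do.\<close>

definition short_weights :: "nat \<Rightarrow> 'r weight set" where "short_weights N = wt ` {w. length w < N}"

lemma finite_short_weights: "finite (short_weights N)"
proof -
  have "{w :: 'r list. length w < N} \<subseteq> {w. set w \<subseteq> UNIV \<and> length w \<le> N}" by auto
  then have "finite {w :: 'r list. length w < N}" by (rule finite_subset) (rule finite_lists_length_le, simp)
  then show ?thesis by (simp add: short_weights_def)
qed

lemma short_weights_Q_plus: "short_weights N \<subseteq> Q_plus"
  using wt_Q_plus by (auto simp: short_weights_def)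

lemma theta_y_zero:
  assumes "\<forall>w. length w \<ge> N \<longrightarrow> left_regular (ew w) p = 0" "p \<in> weight_space G left_regular 0"
    and "\<beta> \<in> Q_plus" "\<beta> \<notin> short_weights N" "i < n \<beta>"
  shows "left_regular (theta G (y \<beta> i)) p = 0"
proof (rule theta_U_minus_weight[OF left_regular_module y_weight[OF assms(3,5)] assms(2)])
  fix w assume "wt w = \<beta>"
  then have "\<not> length w < N" using assms(4) by (auto simp: short_weights_def)
  then show "left_regular (ew w) p = 0" using assms(1) by simp
qed

text \<open>The reduced fusion element applied to \<open>one\<close> tensor \<open>p\<close>,
  truncated to finitely many weights.\<close>

definition singular_vector :: "'u dual \<Rightarrow> nat \<Rightarrow> ('l, 'u dual) tensor" where
  "singular_vector p N = (\<Sum>\<beta>\<in>short_weights N. \<Sum>i<n \<beta>. \<Sum>j<n \<beta>. CC \<beta> i j *\<^sub>q (bb \<beta> i \<otimes>\<^sub>q left_regular (theta G (y \<beta> j)) p))"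

context
  fixes p :: "'u dual" and N :: nat
  assumes p: "p \<in> invariant_functions G lam" and N: "\<forall>w. length w \<ge> N \<longrightarrow> left_regular (ew w) p = 0"
begin

text \<open>Pairing with \<open>fw w\<close> is pairing with its expansion in the basis, and the
  inverse Gram matrix recovers the coefficients.\<close>

lemma coef_expand:
  assumes "wt w = \<beta>" "act (fw w) one = (\<Sum>k<n \<beta>. r k *\<^sub>q bb \<beta> k)" "j < n \<beta>"
  shows "(\<Sum>i<n \<beta>. CC \<beta> i j * coef w (bb \<beta> i)) = r j"
proof -
  have \<beta>: "\<beta> \<in> Q_plus" using wt_Q_plus[of w] assms(1) by simp
  have "coef w (bb \<beta> i) = (\<Sum>k<n \<beta>. r k * SS \<beta> k i)" if i: "i < n \<beta>" for i
  proof -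
    have "coef w (bb \<beta> i) = vst (act (om (y \<beta> i)) (act (fw w) one))" unfolding coef_def by (rule vst_om)
    also have "\<dots> = (\<Sum>k<n \<beta>. r k * SS \<beta> i k)" by (simp add: assms(2) act_simps lin_simps[OF vst_linear])
    also have "\<dots> = (\<Sum>k<n \<beta>. r k * SS \<beta> k i)" by (simp add: vst_om[of "y \<beta> i"])
    finally show ?thesis .
  qed
  then have "(\<Sum>i<n \<beta>. CC \<beta> i j * coef w (bb \<beta> i)) = (\<Sum>i<n \<beta>. \<Sum>k<n \<beta>. r k * (SS \<beta> k i * CC \<beta> i j))"
    by (simp add: sum_distrib_left sum_distrib_right mult_ac)
  also have "\<dots> = (\<Sum>k<n \<beta>. \<Sum>i<n \<beta>. r k * (SS \<beta> k i * CC \<beta> i j))" by (rule sum.swap)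
  also have "\<dots> = (\<Sum>k<n \<beta>. r k * (if k = j then 1 else 0))"
    unfolding sum_distrib_left[symmetric] using S_inverse[OF \<beta>] assms(3) by (intro sum.cong refl) simp
  also have "\<dots> = r j" using assms(3) by (simp add: if_distrib[of "\<lambda>x. _ * x"] cong: if_cong)
  finally show ?thesis .
qed

text \<open>Only the weight of w contributes. There \<open>fw w\<close> and its expansion in the
  chosen elements differ by an element of \<open>K_minus\<close>, and theta of it kills
  \<open>p\<close>: this is where invariance under \<open>K_plus\<close> is used. Outside the range
  both sides are zero.\<close>

lemma contract_singular_vector:
  "contract (coef w) (singular_vector p N) = left_regular (theta G (fw w)) p"
proof -
  let ?g = "\<lambda>\<beta>. \<Sum>i<n \<beta>. \<Sum>j<n \<beta>. (CC \<beta> i j * coef w (bb \<beta> i)) *\<^sub>q left_regular (theta G (y \<beta> j)) p"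
  have 0: "?g \<beta> = 0" if "\<beta> \<in> short_weights N" "\<beta> \<noteq> wt w" for \<beta>
  proof -
    have \<beta>: "\<beta> \<in> Q_plus" using that(1) short_weights_Q_plus by blast
    have "coef w (bb \<beta> i) = 0" if "i < n \<beta>" for i
      using coef_weight[OF b_weight[OF \<beta> that]] \<open>\<beta> \<noteq> wt w\<close> by auto
    then show ?thesis by simp
  qed
  have 1: "contract (coef w) (singular_vector p N) = (\<Sum>\<beta>\<in>short_weights N. ?g \<beta>)"
    by (simp add: singular_vector_def lin_simps[OF contract_linear[OF coef_linear]] contract_pure[OF coef_linear] scaleq_scaleq)
  show ?thesis
  proof (cases "wt w \<in> short_weights N")
    case True
    let ?\<beta> = "wt w"
    have "(\<Sum>\<beta>\<in>short_weights N. ?g \<beta>) = (\<Sum>\<beta>\<in>{?\<beta>}. ?g \<beta>)"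
      by (rule sum.mono_neutral_right[OF finite_short_weights]) (use True 0 in auto)
    then have 2: "contract (coef w) (singular_vector p N) = ?g ?\<beta>" by (simp only: 1 sum.insert sum.empty) simp
    obtain r where r: "act (fw w) one = (\<Sum>k<n ?\<beta>. r k *\<^sub>q bb ?\<beta> k)"
      using b_expand[OF wt_Q_plus fw_one_weight] by blast
    define d where "d = fw w - (\<Sum>k<n ?\<beta>. r k *\<^sub>q y ?\<beta> k)"
    have "act d one = 0" by (simp add: d_def act_simps r)
    moreover have M: "qs.subspace (U_minus G)" by (simp add: U_minus_eq)
    have "d \<in> U_minus G" unfolding d_def
      using y_U_minus[OF wt_Q_plus] by (intro qs.subspace_diff[OF M] qs.subspace_sum[OF M] qs.subspace_scale[OF M] fw_U_minus) auto
    ultimately have "d \<in> K_minus G lam" by (simp add: K_minus_L_ideal act_one_zero_iff)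
    from invariantD(4)[OF p theta_K_minus[OF this]]
    have "left_regular (theta G (fw w)) p = (\<Sum>j<n ?\<beta>. r j *\<^sub>q left_regular (theta G (y ?\<beta> j)) p)"
      by (simp add: d_def lin_simps[OF theta_linear] lr_simps)
    also have "\<dots> = (\<Sum>j<n ?\<beta>. (\<Sum>i<n ?\<beta>. CC ?\<beta> i j * coef w (bb ?\<beta> i)) *\<^sub>q left_regular (theta G (y ?\<beta> j)) p)"
      using coef_expand[OF refl r] by (intro sum.cong refl) simp
    also have "\<dots> = ?g ?\<beta>" unfolding qs.scale_sum_left by (rule sum.swap)
    finally show ?thesis by (simp only: 2)
  next
    case False
    then have "length w \<ge> N" by (auto simp: short_weights_def not_less[symmetric])
    then have "left_regular (theta G (fw w)) p = 0" using N by (simp add: theta_fw lr_simps)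
    moreover have "(\<Sum>\<beta>\<in>short_weights N. ?g \<beta>) = 0" by (rule sum.neutral) (use 0 False in auto)
    ultimately show ?thesis by (simp only: 1)
  qed
qed

lemma singular_vector_TF: "singular_vector p N \<in> TF"
  unfolding singular_vector_def
  by (intro qs.subspace_sum[OF TF_subspace] qs.subspace_scale[OF TF_subspace] TF_base FF_closed invariantD(1)[OF p])

lemma contract_vst_singular_vector: "contract vst (singular_vector p N) = p"
  using contract_singular_vector[of "[]"] by (simp add: coef_Nil theta_1 lr_1)

lemma intertwiner_singular_vector: "\<exists>\<phi>\<in>intertwiners G act. \<phi> one = singular_vector p N"
proof (rule intertwiner_exists[OF singular_vector_TF])
  show "act x one = 0 \<Longrightarrow> x \<in> L_ideal G lam" for x by (simp add: act_one_zero_iff)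
  let ?z = "singular_vector p N"
  have e: "TL (e i) ?z = 0" for i
  proof -
    \<comment> \<open>Multiplying by the invertible \<open>kk' i\<close> matches the recursion
      \<open>contract_coef_e\<close>; its two terms cancel because theta of f_i is - e_i.\<close>
    have "TL (kk' i * e i) ?z = 0"
    proof (rule tensor_coef_separated[OF left_regular_module V_tensor])
      fix w
      show "contract (coef w) (TL (kk' i * e i) ?z) = 0"
        unfolding contract_coef_e[OF left_regular_module] contract_singular_vector
        by (simp add: theta_mult theta_f lr_mult lr_simps)
    qed
    then have "TL (kk i) (TL (kk' i * e i) ?z) = TL (kk i) 0" by (simp only:)
    then show ?thesis by (simp add: TL_mult[symmetric] TL_simps mult.assoc[symmetric])
  qed
  have wt: "?z \<in> weight_space G TL lam"
    unfolding singular_vector_def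
  proof (intro qs.subspace_sum qs.subspace_scale weight_space_subspace TL_module)
    fix \<beta> i j assume "\<beta> \<in> short_weights N" "i \<in> {..<n \<beta>}" "j \<in> {..<n \<beta>}"
    then have \<beta>: "\<beta> \<in> Q_plus" "i < n \<beta>" "j < n \<beta>" using short_weights_Q_plus by auto
    have "bb \<beta> i \<in> weight_space G act (lam - \<beta>)" "left_regular (theta G (y \<beta> j)) p \<in> weight_space G left_regular \<beta>"
      using b_weight[OF \<beta>(1,2)] U_minus_weight_act(2)[OF left_regular_module y_weight[OF \<beta>(1,3)] invariantD(2)[OF p]] by simp_all
    then show "bb \<beta> i \<otimes>\<^sub>q left_regular (theta G (y \<beta> j)) p \<in> weight_space G TL lam"
      by (simp add: weight_space_iff[OF act] weight_space_iff[OF left_regular_module] weight_space_iff[OF TL_module]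
          TL_pure tensor_simps scaleq_scaleq qpow_add[symmetric] algebra_simps)
  qed
  show "TL l ?z = 0" if "l \<in> L_ideal G lam" for l
    by (rule singular_L_ideal[OF e wt _ that]) (simp add: contract_vst_singular_vector invariantD(3)[OF p])
qed

text \<open>\<open>inv_into\<close> selects some preimage, but the value of an intertwiner at
  \<open>one\<close> is determined by its leading coefficient, so it must be the singular
  vector.\<close>

lemma Theta_inverse:
  defines "\<phi> \<equiv> inv_into (intertwiners G act) (Theta G lam act one) p"
  shows "\<phi> \<in> intertwiners G act" "\<phi> one = singular_vector p N"
proof -
  obtain \<psi> where \<psi>: "\<psi> \<in> intertwiners G act" "\<psi> one = singular_vector p N" using intertwiner_singular_vector by blast
  have "Theta G lam act one \<psi> = p"
    using Theta_eq[of \<psi>, OF intertwinerD(2)[OF \<psi>(1)]] by (simp add: \<psi>(2) contract_vst_singular_vector)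
  then have im: "p \<in> Theta G lam act one ` intertwiners G act" using \<psi>(1) by blast
  then show *: "\<phi> \<in> intertwiners G act" unfolding \<phi>_def by (rule inv_into_into)
  have "Theta G lam act one \<phi> = p" unfolding \<phi>_def by (rule f_inv_into_f[OF im])
  then have "contract vst (\<phi> one) = p" using Theta_eq[of \<phi>, OF intertwinerD(2)[OF *]] by simp
  then show "\<phi> one = singular_vector p N"
    by (intro intertwiner_eq[OF *]) (simp add: contract_singular_vector)
qed

end

lemma star_eq:
  assumes p1: "p1 \<in> invariant_functions G lam" and p2: "p2 \<in> invariant_functions G lam"
    and N2: "\<forall>w. length w \<ge> N \<longrightarrow> left_regular (ew w) p2 = 0"
  shows "star G lam act one p1 p2 = (\<Sum>\<beta>\<in>short_weights N. \<Sum>i<n \<beta>. \<Sum>j<n \<beta>.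
    CC \<beta> i j *\<^sub>q dual_times G (left_regular (y \<beta> i) p1) (left_regular (theta G (y \<beta> j)) p2))"
proof -
  let ?inv = "inv_into (intertwiners G act) (Theta G lam act one)"
  obtain N1 where N1: "\<forall>w. length w \<ge> N1 \<longrightarrow> left_regular (ew w) p1 = 0" using FF_e_nilpotent[OF invariantD(1)[OF p1]] by blast
  define \<phi>1 \<phi>2 where "\<phi>1 = ?inv p1" and "\<phi>2 = ?inv p2"
  have \<phi>1: "\<phi>1 \<in> intertwiners G act" "contract vst (\<phi>1 one) = p1"
    using Theta_inverse[OF p1 N1] contract_vst_singular_vector[OF p1 N1] by (simp_all add: \<phi>1_def)
  have \<phi>2: "\<phi>2 one = singular_vector p2 N" using Theta_inverse(2)[OF p2 N2] by (simp add: \<phi>2_def)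
  note map = tensor_map_linear[OF intertwinerD(1)[OF \<phi>1(1)], of id, unfolded id_def, OF qlinear_ident]
  let ?z = "intertwiner_times G \<phi>1 \<phi>2 one"
  have z: "?z = (\<Sum>\<beta>\<in>short_weights N. \<Sum>i<n \<beta>. \<Sum>j<n \<beta>.
      CC \<beta> i j *\<^sub>q id_tensor_mu G (\<phi>1 (bb \<beta> i) \<otimes>\<^sub>q left_regular (theta G (y \<beta> j)) p2))"
    unfolding intertwiner_times_def comp_def \<phi>2 singular_vector_def id_def
    by (simp add: lin_simps[OF map(1)] lin_simps[OF id_tensor_mu(1)] map(2))
  have "?z \<in> TF"
    unfolding z
    by (intro qs.subspace_sum[OF TF_subspace] qs.subspace_scale[OF TF_subspace] id_tensor_mu(3) FF_closed
        intertwinerD(2)[OF \<phi>1(1)] invariantD(1)[OF p2])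
  then have "star G lam act one p1 p2 = contract vst ?z"
    unfolding star_def Let_def \<phi>1_def[symmetric] \<phi>2_def[symmetric] by (rule Theta_eq)
  also have "\<dots> = (\<Sum>\<beta>\<in>short_weights N. \<Sum>i<n \<beta>. \<Sum>j<n \<beta>.
      CC \<beta> i j *\<^sub>q dual_times G (contract vst (\<phi>1 (bb \<beta> i))) (left_regular (theta G (y \<beta> j)) p2))"
    unfolding z by (simp add: lin_simps[OF contract_linear[OF vst_linear]] id_tensor_mu(2))
  also have "\<dots> = (\<Sum>\<beta>\<in>short_weights N. \<Sum>i<n \<beta>. \<Sum>j<n \<beta>.
      CC \<beta> i j *\<^sub>q dual_times G (left_regular (y \<beta> i) p1) (left_regular (theta G (y \<beta> j)) p2))"
  proof (intro sum.cong refl)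
    fix \<beta> i j assume "\<beta> \<in> short_weights N" "i \<in> {..<n \<beta>}"
    then have "y \<beta> i \<in> U_minus G" using short_weights_Q_plus y_U_minus by blast
    then have "contract vst (\<phi>1 (bb \<beta> i)) = left_regular (y \<beta> i) p1"
      by (simp add: intertwinerD(3)[OF \<phi>1(1)] contract_vst_U_minus \<phi>1(2))
    then show "CC \<beta> i j *\<^sub>q dual_times G (contract vst (\<phi>1 (bb \<beta> i))) (left_regular (theta G (y \<beta> j)) p2)
        = CC \<beta> i j *\<^sub>q dual_times G (left_regular (y \<beta> i) p1) (left_regular (theta G (y \<beta> j)) p2)" by simp
  qed
  finally show ?thesis .
qed

lemma completed_act_eq:
  assumes p2: "p2 \<in> invariant_functions G lam" and N2: "\<forall>w. length w \<ge> N \<longrightarrow> left_regular (ew w) p2 = 0"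
  shows "completed_act (J_red G lam act one n y) (p1 \<otimes>\<^sub>q p2) = (\<Sum>\<beta>\<in>short_weights N. \<Sum>i<n \<beta>. \<Sum>j<n \<beta>.
    CC \<beta> i j *\<^sub>q (left_regular (y \<beta> i) p1 \<otimes>\<^sub>q left_regular (theta G (y \<beta> j)) p2))"
proof -
  let ?A = "\<lambda>\<beta>. tensor_act left_regular left_regular (J_red G lam act one n y \<beta>) (p1 \<otimes>\<^sub>q p2)"
  note bil = is_module_bilinear[OF left_regular_module]
  have A: "?A \<beta> = (\<Sum>i<n \<beta>. \<Sum>j<n \<beta>. CC \<beta> i j *\<^sub>q (left_regular (y \<beta> i) p1 \<otimes>\<^sub>q left_regular (theta G (y \<beta> j)) p2))" for \<beta>
    unfolding tensor_act_eq_bilinear J_red_def Let_def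
    by (simp add: qbilinear_simps[OF qbilinear_tensor_bilinear[OF bil bil]] tensor_bilinear_pure[OF bil bil])
  have 0: "?A \<beta> = 0" if "\<beta> \<in> Q_plus" "\<beta> \<notin> short_weights N" for \<beta>
    unfolding A using theta_y_zero[OF N2 invariantD(2)[OF p2] that] by simp
  have "completed_act (J_red G lam act one n y) (p1 \<otimes>\<^sub>q p2) = (\<Sum>\<beta> | \<beta> \<in> Q_plus \<and> ?A \<beta> \<noteq> 0. ?A \<beta>)"
    by (simp only: completed_act_def Let_def)
  \<comment> \<open>The completed action sums over the weights with a nonzero term; this support
    lies in the finite range, where the additional terms are zero.\<close>
  also have "\<dots> = (\<Sum>\<beta>\<in>short_weights N. ?A \<beta>)"
    by (rule sum.mono_neutral_left[OF finite_short_weights]) (use 0 short_weights_Q_plus in auto)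
  finally show ?thesis by (simp only: A)
qed

lemma star_fusion:
  assumes p1: "p1 \<in> invariant_functions G lam" and p2: "p2 \<in> invariant_functions G lam"
  shows "star G lam act one p1 p2 = mu G (completed_act (J_red G lam act one n y) (p1 \<otimes>\<^sub>q p2))"
proof -
  have "p2 \<in> FF" using p2 by (simp add: invariant_functions_def)
  then obtain N where N: "\<forall>w. length w \<ge> N \<longrightarrow> left_regular (ew w) p2 = 0" using FF_e_nilpotent by blast
  show ?thesis
    unfolding star_eq[OF p1 p2 N] completed_act_eq[OF p2 N]
    by (simp add: lin_simps[OF dual_times_mu(1)] dual_times_mu(2))
qed

end

end

text \<open>What remains is to provide \<open>vst\<close> on the given copy of L(lam):
  \<open>Lam lam\<close> factors through x |-> \<open>act x one\<close>, because the kernel of this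
  map is \<open>L_ideal G lam\<close>, on which \<open>Lam lam\<close> vanishes.\<close>

theorem theorem14:
  fixes G :: "('r::finite, 'u::qalgebra) qgroup"
    and lam :: "'r weight"
    and act :: "'u \<Rightarrow> 'l::qspace \<Rightarrow> 'l"
    and one :: 'l
    and n :: "'r weight \<Rightarrow> nat"
    and y :: "'r weight \<Rightarrow> nat \<Rightarrow> 'u"
    and f1 f2 :: "'u dual"
  assumes "quantized_enveloping_algebra G"
    and "irreducible_highest_weight_module G lam act one"
    and "adapted_basis G lam act one n y"
    and "f1 \<in> invariant_functions G lam"
    and "f2 \<in> invariant_functions G lam"
  shows "star G lam act one f1 f2 =
    mu G (completed_act (J_red G lam act one n y) (f1 \<otimes>\<^sub>q f2))"
proof -
  interpret qea G by unfold_locales (rule assms(1))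
  have act: "is_module act" and surj: "surj (\<lambda>x. act x one)" and kernel: "\<And>x. act x one = 0 \<longleftrightarrow> x \<in> L_ideal G lam"
    using assms(2) by (auto simp: irreducible_highest_weight_module_def)
  note act_simps = module_simps[OF act]
  define rep where "rep v = (SOME x. v = act x one)" for v
  have rep: "v = act (rep v) one" for v
    unfolding rep_def by (rule someI_ex) (use surj in \<open>auto simp: surj_def\<close>)
  define vst where "vst v = Lam lam (rep v)" for v
  have vst: "vst (act x one) = Lam lam x" for x
  proof -
    have "act (rep (act x one) - x) one = 0" using rep[of "act x one"] by (simp add: act_simps)
    then have "Lam lam (1 * (rep (act x one) - x)) = 0" unfolding kernel L_ideal_iff by blast
    then show ?thesis by (simp add: vst_def Lam_simps)
  qed
  have "qfunctional vst"
  proof (rule qfunctionalI)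
    show "vst (v + w) = vst v + vst w" for v w
      using vst[of "rep v + rep w"] rep[of v] rep[of w] by (simp add: act_simps Lam_simps vst_def)
    show "vst (c *\<^sub>q v) = c * vst v" for c v
      using vst[of "c *\<^sub>q rep v"] rep[of v] by (simp add: act_simps Lam_simps vst_def)
  qed
  then interpret highest_weight G lam act one vst
    by (intro highest_weight.intro highest_weight_axioms.intro qea_axioms) (simp_all add: act vst kernel L_ideal_iff)
  interpret irreducible_module G lam act one vst
    by unfold_locales (use surj in \<open>simp add: V_def\<close>)
  show ?thesis by (rule star_fusion[OF assms(3-5)])
qed

end
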